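(* Let $Q$ be a ring of finite Krull dimension, and let $\mathbf{f} = f_1,\ldots,f_c$ be a $Q$-regular sequence. Set $A := Q/(\mathbf{f})$. Let $M$ and $N$ be finitely generated $A$-modules such that the projective dimension of $M$ as a $Q$-module is finite, and let $I$ be an ideal of $A$. Then there exist two non-negative integers $n_0, i_0$ such that for all $n \ge n_0$ and $i \ge i_0$, $$\mathrm{Ass}_A\left(\mathrm{Ext}_A^{2i}(M,N/I^nN)\right) = \mathrm{Ass}_A\left(\mathrm{Ext}_A^{2 i_0}(M,N/I^{n_0}N)\right),$$ $$\mathrm{Ass}_A\left(\mathrm{Ext}_A^{2i+1}(M,N/I^nN)\right) = \mathrm{Ass}_A\left(\mathrm{Ext}_A^{2 i_0 + 1}(M,N/I^{n_0}N)\right).$$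
   Context: All rings are commutative Noetherian with identity. $\mathrm{Ass}_A(E)$ denotes the set of associated prime ideals of an $A$-module $E$. *)

theory Defs
  imports "HOL-Algebra.Module" "HOL-Algebra.Ideal_Product" "HOL-Algebra.Ring_Divisibility"
    "HOL-Library.Extended_Nat"
begin

definition krull_dim :: "('a, 'b) ring_scheme \<Rightarrow> enat" where
  "krull_dim R = Sup {enat n | n. \<exists>p :: nat \<Rightarrow> 'a set.
     (\<forall>i\<le>n. primeideal (p i) R) \<and> (\<forall>i<n. p i \<subset> p (Suc i))}"

definition regular_sequence :: "('a, 'b) ring_scheme \<Rightarrow> 'a list \<Rightarrow> bool" where
  "regular_sequence R fs \<longleftrightarrow>
     set fs \<subseteq> carrier R \<and>
     (\<forall>i<length fs. let J = genideal R (set (take i fs)) in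
        \<forall>x\<in>carrier (R Quot J).
          (J +>\<^bsub>R\<^esub> fs ! i) \<otimes>\<^bsub>R Quot J\<^esub> x = \<zero>\<^bsub>R Quot J\<^esub> \<longrightarrow> x = \<zero>\<^bsub>R Quot J\<^esub>) \<and>
     genideal R (set fs) \<noteq> carrier R"

text \<open>The record type of modules extends that of rings. The locale \<^locale>\<open>module\<close> places no
  condition on its multiplication and unit fields, and they are left undefined in the
  constructions below.\<close>

definition span_module :: "('a, 'b) ring_scheme \<Rightarrow> ('a, 'm, 'c) module_scheme \<Rightarrow> 'm set \<Rightarrow> 'm set"
  where "span_module R M S = \<Inter> {K. submodule K R M \<and> S \<subseteq> K}"

definition fin_gen_module :: "('a, 'b) ring_scheme \<Rightarrow> ('a, 'm, 'c) module_scheme \<Rightarrow> bool" where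
  "fin_gen_module R M \<longleftrightarrow>
     (\<exists>S. finite S \<and> S \<subseteq> carrier M \<and> span_module R M S = carrier M)"

definition ideal_times_module ::
  "('a, 'b) ring_scheme \<Rightarrow> 'a set \<Rightarrow> ('a, 'm, 'c) module_scheme \<Rightarrow> 'm set" where
  "ideal_times_module R J M = span_module R M {a \<odot>\<^bsub>M\<^esub> x | a x. a \<in> J \<and> x \<in> carrier M}"

definition quot_module :: "('a, 'm, 'c) module_scheme \<Rightarrow> 'm set \<Rightarrow> ('a, 'm set) module" where
  "quot_module M K =
    \<lparr>carrier = a_rcosets\<^bsub>M\<^esub> K, monoid.mult = undefined, one = undefined, zero = K, add = set_add M,
     smult = (\<lambda>a C. (\<Union>x\<in>C. K +>\<^bsub>M\<^esub> (a \<odot>\<^bsub>M\<^esub> x)))\<rparr>"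

definition restrict_scalars ::
  "('a \<Rightarrow> 'b) \<Rightarrow> ('b, 'm, 'c) module_scheme \<Rightarrow> ('a, 'm) module" where
  "restrict_scalars \<phi> M =
    \<lparr>carrier = carrier M, monoid.mult = undefined, one = undefined, zero = \<zero>\<^bsub>M\<^esub>, add = add M,
     smult = (\<lambda>a x. \<phi> a \<odot>\<^bsub>M\<^esub> x)\<rparr>"

text \<open>Homomorphisms are extensional, so that equality of functions is equality of homomorphisms.\<close>

definition module_hom ::
  "('a, 'b) ring_scheme \<Rightarrow> ('a, 'm, 'c) module_scheme \<Rightarrow> ('a, 'n, 'd) module_scheme \<Rightarrow> ('m \<Rightarrow> 'n) set"
  where
  "module_hom R M N = {f \<in> carrier M \<rightarrow>\<^sub>E carrier N.
     (\<forall>x\<in>carrier M. \<forall>y\<in>carrier M. f (x \<oplus>\<^bsub>M\<^esub> y) = f x \<oplus>\<^bsub>N\<^esub> f y) \<and>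
     (\<forall>a\<in>carrier R. \<forall>x\<in>carrier M. f (a \<odot>\<^bsub>M\<^esub> x) = a \<odot>\<^bsub>N\<^esub> f x)}"

definition Hom_module ::
  "('a, 'b) ring_scheme \<Rightarrow> ('a, 'm, 'c) module_scheme \<Rightarrow> ('a, 'n, 'd) module_scheme
    \<Rightarrow> ('a, 'm \<Rightarrow> 'n) module" where
  "Hom_module R M N =
    \<lparr>carrier = module_hom R M N, monoid.mult = undefined, one = undefined,
     zero = (\<lambda>x\<in>carrier M. \<zero>\<^bsub>N\<^esub>),
     add = (\<lambda>f g. \<lambda>x\<in>carrier M. f x \<oplus>\<^bsub>N\<^esub> g x),
     smult = (\<lambda>a f. \<lambda>x\<in>carrier M. a \<odot>\<^bsub>N\<^esub> f x)\<rparr>"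

definition associated_primes ::
  "('a, 'b) ring_scheme \<Rightarrow> ('a, 'm, 'c) module_scheme \<Rightarrow> 'a set set" where
  "associated_primes R M =
    {p. primeideal p R \<and> (\<exists>x\<in>carrier M. p = {a \<in> carrier R. a \<odot>\<^bsub>M\<^esub> x = \<zero>\<^bsub>M\<^esub>})}"

text \<open>The lifting property. HOL cannot quantify over all types of modules in a definition, so the
  epimorphisms $g : E \to F$ range over modules on fixed types. These suffice: the free
  module on the set \<^term>\<open>carrier P\<close> (finitely supported functions) and $P$ itself
  are available as $E$ and $F$, so the property makes $P$ a direct summand of a free module,
  and it then holds for modules on all types.\<close>

definition projective_module :: "('a, 'b) ring_scheme \<Rightarrow> ('a, 'p) module \<Rightarrow> bool" where
  "projective_module R P \<longleftrightarrow> module R P \<and>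
     (\<forall>(E :: ('a, 'p \<Rightarrow> 'a) module) (F :: ('a, 'p) module) g f.
        module R E \<and> module R F \<and>
        g \<in> module_hom R E F \<and> g ` carrier E = carrier F \<and> f \<in> module_hom R P F
        \<longrightarrow> (\<exists>h\<in>module_hom R P E. compose (carrier P) g h = f))"

text \<open>The sequence is $\cdots \to P_2 \to P_1 \to P_0 \to M \to 0$ with
  $d_i : P_{i+1} \to P_i$ and augmentation $\varepsilon : P_0 \to M$.\<close>

definition projective_resolution ::
  "('a, 'b) ring_scheme \<Rightarrow> ('a, 'm, 'c) module_scheme
    \<Rightarrow> (nat \<Rightarrow> ('a, 'p) module) \<Rightarrow> (nat \<Rightarrow> 'p \<Rightarrow> 'p) \<Rightarrow> ('p \<Rightarrow> 'm) \<Rightarrow> bool" where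
  "projective_resolution R M P d \<epsilon> \<longleftrightarrow>
     (\<forall>i. projective_module R (P i)) \<and>
     (\<forall>i. d i \<in> module_hom R (P (Suc i)) (P i)) \<and>
     \<epsilon> \<in> module_hom R (P 0) M \<and>
     \<epsilon> ` carrier (P 0) = carrier M \<and>
     d 0 ` carrier (P (Suc 0)) = a_kernel (P 0) M \<epsilon> \<and>
     (\<forall>i. d (Suc i) ` carrier (P (Suc (Suc i))) = a_kernel (P (Suc i)) (P i) (d i))"

text \<open>In \<open>proj_dim\<close> and \<open>Ext\<close> the modules of a resolution have carriers in the type
  \<^typ>\<open>nat \<Rightarrow> 'a\<close>, which contains a copy of every submodule of $R^k$ for each finite $k$. These
  two definitions are meant for a finitely generated module $M$ over a Noetherian ring $R$.
  Such an $M$ has a resolution by modules $R^k$. If its projective dimension is $n$, then the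
  $n$-th syzygy in that resolution is projective and a submodule of some $R^k$, so
  resolutions on this type attain the projective dimension.\<close>

definition proj_dim :: "('a, 'b) ring_scheme \<Rightarrow> ('a, 'm, 'c) module_scheme \<Rightarrow> enat" where
  "proj_dim R M = Inf {enat n | n.
     \<exists>(P :: nat \<Rightarrow> ('a, nat \<Rightarrow> 'a) module) d \<epsilon>. projective_resolution R M P d \<epsilon> \<and>
       (\<forall>i>n. carrier (P i) = {\<zero>\<^bsub>P i\<^esub>})}"

definition Hom_cocycles ::
  "('a, 'b) ring_scheme \<Rightarrow> (nat \<Rightarrow> ('a, 'p) module) \<Rightarrow> (nat \<Rightarrow> 'p \<Rightarrow> 'p)
    \<Rightarrow> ('a, 'n, 'd) module_scheme \<Rightarrow> nat \<Rightarrow> ('p \<Rightarrow> 'n) set" where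
  "Hom_cocycles R P d N i = {f \<in> module_hom R (P i) N.
     compose (carrier (P (Suc i))) f (d i) = (\<lambda>x\<in>carrier (P (Suc i)). \<zero>\<^bsub>N\<^esub>)}"

fun Hom_coboundaries ::
  "('a, 'b) ring_scheme \<Rightarrow> (nat \<Rightarrow> ('a, 'p) module) \<Rightarrow> (nat \<Rightarrow> 'p \<Rightarrow> 'p)
    \<Rightarrow> ('a, 'n, 'd) module_scheme \<Rightarrow> nat \<Rightarrow> ('p \<Rightarrow> 'n) set" where
  "Hom_coboundaries R P d N 0 = {\<lambda>x\<in>carrier (P 0). \<zero>\<^bsub>N\<^esub>}"
| "Hom_coboundaries R P d N (Suc i) =
     (\<lambda>f. compose (carrier (P (Suc i))) f (d i)) ` module_hom R (P i) N"

definition Hom_cohomology ::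
  "('a, 'b) ring_scheme \<Rightarrow> (nat \<Rightarrow> ('a, 'p) module) \<Rightarrow> (nat \<Rightarrow> 'p \<Rightarrow> 'p)
    \<Rightarrow> ('a, 'n, 'd) module_scheme \<Rightarrow> nat \<Rightarrow> ('a, ('p \<Rightarrow> 'n) set) module" where
  "Hom_cohomology R P d N i =
     quot_module ((Hom_module R (P i) N)\<lparr>carrier := Hom_cocycles R P d N i\<rparr>)
       (Hom_coboundaries R P d N i)"

text \<open>The chosen resolution depends only on $R$ and $M$. Another choice gives an isomorphic
  module.\<close>

definition Ext ::
  "('a, 'b) ring_scheme \<Rightarrow> nat \<Rightarrow> ('a, 'm, 'c) module_scheme \<Rightarrow> ('a, 'n, 'd) module_scheme
    \<Rightarrow> ('a, ((nat \<Rightarrow> 'a) \<Rightarrow> 'n) set) module" where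
  "Ext R i M N =
     (let (P, d) = (SOME (P :: nat \<Rightarrow> ('a, nat \<Rightarrow> 'a) module, d).
                      \<exists>\<epsilon>. projective_resolution R M P d \<epsilon>)
      in Hom_cohomology R P d N i)"

end

(*
The matrices of a free resolution F of M over A = Q/(f), lifted to Q, satisfy
D D = sum_j f_j S_j. The S_j induce commuting operators of degree 2 (Eisenbud operators) on the
cohomology of Hom(F, -). The cone of S_c on F is a resolution over Q/(f_1,...,f_(c-1)), and the
cokernel of S_c on the cohomology of F embeds into the cohomology of the cone. So Hilbert's basis
argument reduces by induction on c to c = 0, where the cohomology vanishes in degrees above the
projective dimension (Gulliksen). This makes the cohomology with coefficients in the Rees module
and in the associated graded module of the I-adic filtration of N Noetherian over operators of
bidegree (1,0) and (0,2). In Noetherian systems of this kind the set of associated primes is finite and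
eventually constant. An associated prime of Ext^i(M, N/I^nN) either comes from the graded pieces or,
by Artin-Rees, is decided by a condition independent of n, which is again eventually periodic in i.

Modules are handled as subquotients of the abelian groups of a type: a pair B <= Z of subgroups
stands for Z/B. Q and N are quotients of products over all ring and module structures on their
types, and these products are instances of the type classes.
*)
theory Submission
  imports Defs "HOL-Library.Function_Algebras"
begin

section \<open>Noetherian systems of subquotients\<close>

text \<open>In general the sum of all N/I^nN is not Noetherian over the Rees algebra: its part of
  degree n+1 is not generated by I times the part of degree n. The modules Ext^i(M, N/I^nN)
  therefore do not form a Noetherian system themselves and have to be compared with two systems that
  do. The graded pieces decide which primes can occur; the Rees module supplies Artin-Rees bounds
  that are uniform in i.

  A second obstacle is that the Eisenbud operators commute with the differential only modulo the
  f_j, and with one another only up to homotopy. They act on representatives, and no polynomial ring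
  acts before passing to cohomology. For this reason the chain condition is formulated for families
  of subgroups stable under a set of operators, with commutation required only modulo the smaller
  family \<open>B\<close>. Hilbert's theorem then adjoins one operator at a time, in step with the
  removal of one equation at a time.

  The operators have degree 2, so even and odd degrees never interact; this is the origin of the two
  separate equalities.\<close>

definition subgrp :: "'x::ab_group_add set \<Rightarrow> bool" where
  "subgrp W \<longleftrightarrow> 0 \<in> W \<and> (\<forall>x\<in>W. \<forall>y\<in>W. x - y \<in> W)"

lemma subgrp_0: "subgrp W \<Longrightarrow> 0 \<in> W"
  and subgrp_diff: "subgrp W \<Longrightarrow> x \<in> W \<Longrightarrow> y \<in> W \<Longrightarrow> x - y \<in> W"
  by (simp_all add: subgrp_def)

lemma subgrp_minus: "subgrp W \<Longrightarrow> x \<in> W \<Longrightarrow> - x \<in> W"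
  using subgrp_diff[of W 0 x] subgrp_0[of W] by simp

lemma subgrp_add: "subgrp W \<Longrightarrow> x \<in> W \<Longrightarrow> y \<in> W \<Longrightarrow> x + y \<in> W"
  using subgrp_diff[of W x "- y"] subgrp_minus[of W y] by simp

lemma subgrp_sum: "subgrp W \<Longrightarrow> (\<And>i. i \<in> A \<Longrightarrow> f i \<in> W) \<Longrightarrow> sum f A \<in> W"
  by (induction A rule: infinite_finite_induct) (auto simp: subgrp_0 subgrp_add)

lemma subgrp_Inter: "(\<And>W. W \<in> \<W> \<Longrightarrow> subgrp W) \<Longrightarrow> subgrp (\<Inter>\<W>)"
  by (auto simp: subgrp_def)

lemma subgrp_Int: "subgrp V \<Longrightarrow> subgrp W \<Longrightarrow> subgrp (V \<inter> W)"
  by (auto simp: subgrp_def)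

definition ssum :: "'x::ab_group_add set \<Rightarrow> 'x set \<Rightarrow> 'x set" where
  "ssum V W = {x. \<exists>v\<in>V. \<exists>w\<in>W. x = v + w}"

lemma ssumI: "v \<in> V \<Longrightarrow> w \<in> W \<Longrightarrow> v + w \<in> ssum V W"
  by (auto simp: ssum_def)

lemma subgrp_ssum:
  assumes "subgrp V" "subgrp W" shows "subgrp (ssum V W)"
  unfolding subgrp_def
proof (intro conjI ballI)
  show "0 \<in> ssum V W" using ssumI[of 0 V 0 W] assms by (simp add: subgrp_0)
  fix x y assume "x \<in> ssum V W" "y \<in> ssum V W"
  then obtain a b c e where *: "a \<in> V" "b \<in> W" "c \<in> V" "e \<in> W" "x = a + b" "y = c + e"
    by (auto simp: ssum_def)
  have "(a - c) + (b - e) \<in> ssum V W"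
    using * assms by (intro ssumI subgrp_diff) auto
  moreover have "x - y = (a - c) + (b - e)" using * by simp
  ultimately show "x - y \<in> ssum V W" by simp
qed

lemma ssum_superset1: "subgrp W \<Longrightarrow> V \<subseteq> ssum V W"
  by (force simp: ssum_def subgrp_def)

lemma ssum_superset2: "subgrp V \<Longrightarrow> W \<subseteq> ssum V W"
  by (force simp: ssum_def subgrp_def)

lemma ssum_least: "subgrp U \<Longrightarrow> V \<subseteq> U \<Longrightarrow> W \<subseteq> U \<Longrightarrow> ssum V W \<subseteq> U"
  by (auto simp: ssum_def intro!: subgrp_add)

definition gspan :: "'x::ab_group_add set \<Rightarrow> 'x set" where
  "gspan A = \<Inter>{W. subgrp W \<and> A \<subseteq> W}"

lemma subgrp_gspan: "subgrp (gspan A)"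
  unfolding gspan_def by (rule subgrp_Inter) auto

lemma gspan_superset: "A \<subseteq> gspan A"
  by (auto simp: gspan_def)

lemma gspan_least: "subgrp W \<Longrightarrow> A \<subseteq> W \<Longrightarrow> gspan A \<subseteq> W"
  by (auto simp: gspan_def)

lemma gspan_mono: "A \<subseteq> B \<Longrightarrow> gspan A \<subseteq> gspan B"
  by (meson gspan_least gspan_superset subgrp_gspan subset_trans)

lemma subgrp_vimage:
  assumes "subgrp W" "\<And>x y. h (x - y) = h x - h y"
  shows "subgrp {x. h x \<in> W}"
proof -
  have "h 0 = 0" using assms(2)[of 0 0] by simp
  then show ?thesis using assms by (auto simp: subgrp_def)
qed

lemma subgrp_image:
  assumes "subgrp W" "\<And>x y. h (x - y) = h x - h y"
  shows "subgrp (h ` W)"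
proof -
  have "h 0 = 0" using assms(2)[of 0 0] by simp
  then show ?thesis using assms
    unfolding subgrp_def by (smt (verit) image_iff)
qed

text \<open>An operator is a pair of a shift of the degree and an additive map in every degree.\<close>

type_synonym ('d, 'x) oper = "('d \<Rightarrow> 'd) \<times> ('d \<Rightarrow> 'x \<Rightarrow> 'x)"

text \<open>The quotients \<open>W / B\<close> are the graded submodules of \<open>Z / B\<close>.
  The operators are the only structure, so scalars also enter as operators, of degree zero.\<close>

definition fam :: "('d, 'x::ab_group_add) oper set \<Rightarrow> ('d \<Rightarrow> 'x set) \<Rightarrow> ('d \<Rightarrow> 'x set) \<Rightarrow> ('d \<Rightarrow> 'x set) \<Rightarrow> bool"
  where "fam \<Omega> Z B W \<longleftrightarrow> (\<forall>d. subgrp (W d) \<and> B d \<subseteq> W d \<and> W d \<subseteq> Z d \<and>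
     (\<forall>(\<sigma>, \<tau>)\<in>\<Omega>. \<forall>x\<in>W d. \<tau> d x \<in> W (\<sigma> d)))"

text \<open>One index \<open>K\<close> serves all degrees at once: this is the chain condition on
  the graded module, not on its components one by one.\<close>

definition noeth :: "('d, 'x::ab_group_add) oper set \<Rightarrow> ('d \<Rightarrow> 'x set) \<Rightarrow> ('d \<Rightarrow> 'x set) \<Rightarrow> bool"
  where "noeth \<Omega> Z B \<longleftrightarrow> (\<forall>c::nat \<Rightarrow> 'd \<Rightarrow> 'x set. mono c \<longrightarrow> (\<forall>k. fam \<Omega> Z B (c k)) \<longrightarrow>
     (\<exists>K. \<forall>k\<ge>K. c k = c K))"

text \<open>Additivity is asked on the whole type because the operators act on representatives.
  Commutation is not part of a system; it holds only modulo \<open>B\<close> and is assumed where it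
  enters.\<close>

definition sys :: "('d, 'x::ab_group_add) oper set \<Rightarrow> ('d \<Rightarrow> 'x set) \<Rightarrow> ('d \<Rightarrow> 'x set) \<Rightarrow> bool"
  where "sys \<Omega> Z B \<longleftrightarrow> fam \<Omega> Z B Z \<and> fam \<Omega> Z B B \<and>
     (\<forall>(\<sigma>, \<tau>)\<in>\<Omega>. \<forall>d x y. \<tau> d (x - y) = \<tau> d x - \<tau> d y)"

lemma famI:
  assumes "\<And>d. subgrp (W d)" "\<And>d. B d \<subseteq> W d" "\<And>d. W d \<subseteq> Z d"
    "\<And>\<sigma> \<tau> d x. (\<sigma>, \<tau>) \<in> \<Omega> \<Longrightarrow> x \<in> W d \<Longrightarrow> \<tau> d x \<in> W (\<sigma> d)"
  shows "fam \<Omega> Z B W"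
  using assms unfolding fam_def by blast

lemma famD:
  assumes "fam \<Omega> Z B W"
  shows "subgrp (W d)" "B d \<subseteq> W d" "W d \<subseteq> Z d"
    "(\<sigma>, \<tau>) \<in> \<Omega> \<Longrightarrow> x \<in> W d \<Longrightarrow> \<tau> d x \<in> W (\<sigma> d)"
  using assms unfolding fam_def by blast+

lemma noethD:
  assumes "noeth \<Omega> Z B" "mono c" "\<And>k. fam \<Omega> Z B (c k)"
  obtains K where "\<And>k. k \<ge> K \<Longrightarrow> c k = c (K::nat)"
  using assms unfolding noeth_def by blast

lemma sysD:
  assumes "sys \<Omega> Z B"
  shows "fam \<Omega> Z B Z" "fam \<Omega> Z B B" "subgrp (Z d)" "subgrp (B d)" "B d \<subseteq> Z d"
    "(\<sigma>, \<tau>) \<in> \<Omega> \<Longrightarrow> x \<in> Z d \<Longrightarrow> \<tau> d x \<in> Z (\<sigma> d)"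
    "(\<sigma>, \<tau>) \<in> \<Omega> \<Longrightarrow> x \<in> B d \<Longrightarrow> \<tau> d x \<in> B (\<sigma> d)"
    "(\<sigma>, \<tau>) \<in> \<Omega> \<Longrightarrow> \<tau> d (x - y) = \<tau> d x - \<tau> d y"
  using assms unfolding sys_def fam_def by blast+

lemma sys_subset: "sys \<Omega>' Z B \<Longrightarrow> \<Omega> \<subseteq> \<Omega>' \<Longrightarrow> sys \<Omega> Z B"
  unfolding sys_def fam_def by blast

lemma oper_add:
  assumes "sys \<Omega> Z B" "(\<sigma>, \<tau>) \<in> \<Omega>" shows "\<tau> d (x + y) = \<tau> d x + \<tau> d y" "\<tau> d 0 = 0"
proof -
  note * = sysD(8)[OF assms]
  show "\<tau> d 0 = 0" using *[of d 0 0] by simp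
  then have "\<tau> d (- y) = - \<tau> d y" using *[of d 0 y] by simp
  then show "\<tau> d (x + y) = \<tau> d x + \<tau> d y" using *[of d x "- y"] by simp
qed

text \<open>More operators leave fewer stable families, and a family between \<open>B'\<close> and
  \<open>Z'\<close> also lies between \<open>B\<close> and \<open>Z\<close>.\<close>

lemma noeth_mono:
  assumes "noeth \<Omega> Z B" "\<Omega> \<subseteq> \<Omega>'" "\<And>d. B d \<subseteq> B' d" "\<And>d. Z' d \<subseteq> Z d"
  shows "noeth \<Omega>' Z' B'"
  unfolding noeth_def
proof (intro allI impI)
  fix c :: "nat \<Rightarrow> 'a \<Rightarrow> 'b set"
  assume c: "mono c" "\<forall>k. fam \<Omega>' Z' B' (c k)"
  have "fam \<Omega> Z B (c k)" for k
  proof (rule famI)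
    note W = famD[OF c(2)[rule_format, of k]]
    show "subgrp (c k d)" for d by (rule W)
    show "B d \<subseteq> c k d" for d using W(2) assms(3) by blast
    show "c k d \<subseteq> Z d" for d using W(3) assms(4) by blast
    show "\<tau> d x \<in> c k (\<sigma> d)" if "(\<sigma>, \<tau>) \<in> \<Omega>" "x \<in> c k d" for \<sigma> \<tau> d x
      using W(4) assms(2) that by blast
  qed
  then show "\<exists>K. \<forall>k\<ge>K. c k = c K" using assms(1) c(1) unfolding noeth_def by blast
qed

text \<open>Once the finitely many image chains are stationary, joint injectivity stops the chain
  itself. Only comparable families have to be separated, which is what arguments with differences of
  elements can deliver.\<close>

lemma noeth_embed_fin:
  fixes \<Phi> :: "'i \<Rightarrow> ('d \<Rightarrow> 'x::ab_group_add set) \<Rightarrow> ('e \<Rightarrow> 'y::ab_group_add set)"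
  assumes "finite I" and noe: "\<And>i. i \<in> I \<Longrightarrow> noeth (\<Omega>' i) (Z' i) (B' i)"
    and fam: "\<And>i W. i \<in> I \<Longrightarrow> fam \<Omega> Z B W \<Longrightarrow> fam (\<Omega>' i) (Z' i) (B' i) (\<Phi> i W)"
    and mono: "\<And>i W W'. i \<in> I \<Longrightarrow> fam \<Omega> Z B W \<Longrightarrow> fam \<Omega> Z B W' \<Longrightarrow> W \<le> W' \<Longrightarrow> \<Phi> i W \<le> \<Phi> i W'"
    and inj: "\<And>W W'. fam \<Omega> Z B W \<Longrightarrow> fam \<Omega> Z B W' \<Longrightarrow> W \<le> W' \<Longrightarrow>
      (\<And>i. i \<in> I \<Longrightarrow> \<Phi> i W = \<Phi> i W') \<Longrightarrow> W = W'"
  shows "noeth \<Omega> Z B"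
  unfolding noeth_def
proof (intro allI impI)
  fix c :: "nat \<Rightarrow> 'd \<Rightarrow> 'x set"
  assume c: "mono c" "\<forall>k. fam \<Omega> Z B (c k)"
  have "\<exists>K. \<forall>k\<ge>K. \<Phi> i (c k) = \<Phi> i (c K)" if "i \<in> I" for i
  proof (rule noethD[OF noe[OF that], of "\<lambda>k. \<Phi> i (c k)"])
    show "mono (\<lambda>k. \<Phi> i (c k))"
      using mono[OF that] c unfolding mono_def by blast
    show "fam (\<Omega>' i) (Z' i) (B' i) (\<Phi> i (c k))" for k
      using fam that c by blast
  qed blast
  then obtain K where K: "\<And>i k. i \<in> I \<Longrightarrow> k \<ge> K i \<Longrightarrow> \<Phi> i (c k) = \<Phi> i (c (K i))"
    by metis
  define L where "L = Max (insert 0 (K ` I))"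
  have L: "L \<ge> K i" if "i \<in> I" for i
    unfolding L_def using that \<open>finite I\<close> by (intro Max_ge) auto
  have "c k = c L" if "k \<ge> L" for k
  proof (rule inj[symmetric])
    show "c L \<le> c k" using c(1) that by (simp add: monoD)
    show "\<Phi> i (c L) = \<Phi> i (c k)" if "i \<in> I" for i
      using K[OF that] L[OF that] \<open>k \<ge> L\<close> by (metis order_trans)
  qed (use c in auto)
  then show "\<exists>K. \<forall>k\<ge>K. c k = c K" by blast
qed

lemma noeth_embed:
  assumes "noeth \<Omega>' Z' B'"
    and "\<And>W. fam \<Omega> Z B W \<Longrightarrow> fam \<Omega>' Z' B' (\<Phi> W)"
    and "\<And>W W'. fam \<Omega> Z B W \<Longrightarrow> fam \<Omega> Z B W' \<Longrightarrow> W \<le> W' \<Longrightarrow> \<Phi> W \<le> \<Phi> W'"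
    and "\<And>W W'. fam \<Omega> Z B W \<Longrightarrow> fam \<Omega> Z B W' \<Longrightarrow> W \<le> W' \<Longrightarrow> \<Phi> W = \<Phi> W' \<Longrightarrow> W = W'"
  shows "noeth \<Omega> Z B"
  using noeth_embed_fin[of "{()}" "\<lambda>_. \<Omega>'" "\<lambda>_. Z'" "\<lambda>_. B'" \<Omega> Z B "\<lambda>_. \<Phi>"] assms by auto

text \<open>Modular law: comparable families with the same sum with \<open>Y\<close> and the same
  intersection with \<open>Y\<close> are equal.\<close>

lemma noeth_ext:
  assumes Y: "fam \<Omega> Z B Y" and Z: "sys \<Omega> Z B"
    and n1: "noeth \<Omega> Z Y" and n2: "noeth \<Omega> Y B"
  shows "noeth \<Omega> Z B"
\<comment> \<open>\<open>True\<close> indexes the image in the quotient by \<open>Y\<close>,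
  \<open>False\<close> the trace on \<open>Y\<close>.\<close>
proof (rule noeth_embed_fin[of "UNIV :: bool set" "\<lambda>_. \<Omega>" "\<lambda>b. if b then Z else Y" "\<lambda>b. if b then Y else B"
      _ _ _ "\<lambda>b W d. if b then ssum (W d) (Y d) else W d \<inter> Y d"])
  note Yd = famD[OF Y] and Zd = sysD[OF Z]
  fix b W assume W: "fam \<Omega> Z B W"
  note Wd = famD[OF W]
  show "fam \<Omega> (if b then Z else Y) (if b then Y else B)
          (\<lambda>d. if b then ssum (W d) (Y d) else W d \<inter> Y d)"
  proof (cases b)
    case True
    have "fam \<Omega> Z Y (\<lambda>d. ssum (W d) (Y d))"
    proof (rule famI)
      fix d show "subgrp (ssum (W d) (Y d))" using Wd(1) Yd(1) by (rule subgrp_ssum)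
      show "Y d \<subseteq> ssum (W d) (Y d)" by (rule ssum_superset2[OF Wd(1)])
      show "ssum (W d) (Y d) \<subseteq> Z d" by (rule ssum_least[OF Zd(3) Wd(3) Yd(3)])
      fix \<sigma> \<tau> x assume st: "(\<sigma>, \<tau>) \<in> \<Omega>" and "x \<in> ssum (W d) (Y d)"
      then obtain w y where *: "w \<in> W d" "y \<in> Y d" "x = w + y" by (auto simp: ssum_def)
      show "\<tau> d x \<in> ssum (W (\<sigma> d)) (Y (\<sigma> d))"
        using * Wd(4)[OF st] Yd(4)[OF st] oper_add(1)[OF Z st] by (auto intro!: ssumI)
    qed
    then show ?thesis using True by simp
  next
    case False
    have "fam \<Omega> Y B (\<lambda>d. W d \<inter> Y d)"
      using Wd Yd by (intro famI subgrp_Int) blast+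
    then show ?thesis using False by simp
  qed
next
  fix b and W W' :: "'a \<Rightarrow> 'b set" assume "W \<le> W'"
  then have *: "W d \<subseteq> W' d" for d by (auto simp: le_fun_def)
  show "(\<lambda>d. if b then ssum (W d) (Y d) else W d \<inter> Y d) \<le> (\<lambda>d. if b then ssum (W' d) (Y d) else W' d \<inter> Y d)"
    using * by (fastforce simp: le_fun_def ssum_def)
next
  fix W W' assume W: "fam \<Omega> Z B W" and W': "fam \<Omega> Z B W'" and le: "W \<le> W'"
    and eq: "\<And>b. b \<in> UNIV \<Longrightarrow> (\<lambda>d. if b then ssum (W d) (Y d) else W d \<inter> Y d) =
           (\<lambda>d. if b then ssum (W' d) (Y d) else W' d \<inter> Y d)"
  have 1: "ssum (W d) (Y d) = ssum (W' d) (Y d)" for d using fun_cong[OF eq[of True], of d] by simp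
  have 2: "W d \<inter> Y d = W' d \<inter> Y d" for d using fun_cong[OF eq[of False], of d] by simp
  show "W = W'"
  proof (rule antisym[OF le], rule le_funI, rule subsetI)
    fix d x assume x: "x \<in> W' d"
    then have "x \<in> ssum (W d) (Y d)" using ssum_superset1[OF famD(1)[OF Y], of "W' d" d] 1 by auto
    then obtain w y where *: "w \<in> W d" "y \<in> Y d" "x = w + y" by (auto simp: ssum_def)
    have "x - w \<in> W' d" using x *(1) le by (intro subgrp_diff[OF famD(1)[OF W']]) (auto simp: le_fun_def)
    then have "y \<in> W d" using * 2[of d] by auto
    then show "x \<in> W d" using * subgrp_add[OF famD(1)[OF W]] by auto
  qed
next
  show "noeth \<Omega> (if b then Z else Y) (if b then Y else B)" if "b \<in> UNIV" for b :: bool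
    using n1 n2 by (cases b) simp_all
qed simp

lemma noeth_max:
  assumes noe: "noeth \<Omega> Z B" and W0: "fam \<Omega> Z B W0" "P W0"
  obtains W where "fam \<Omega> Z B W" "P W" "\<And>W'. fam \<Omega> Z B W' \<Longrightarrow> P W' \<Longrightarrow> W \<le> W' \<Longrightarrow> W' = W"
proof -
  have "\<exists>W. fam \<Omega> Z B W \<and> P W \<and> (\<forall>W'. fam \<Omega> Z B W' \<longrightarrow> P W' \<longrightarrow> W \<le> W' \<longrightarrow> W' = W)"
  proof (rule ccontr)
    assume "\<not> ?thesis"
    then have "\<And>W. fam \<Omega> Z B W \<Longrightarrow> P W \<Longrightarrow> \<exists>W'. fam \<Omega> Z B W' \<and> P W' \<and> W < W'"
      by (metis order_le_less)
    then have "\<exists>c. \<forall>n::nat. (fam \<Omega> Z B (c n) \<and> P (c n)) \<and> c n < c (Suc n)"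
      using W0 by (intro dependent_nat_choice) auto
    then obtain c where c: "\<And>n::nat. fam \<Omega> Z B (c n)" "\<And>n. c n < c (Suc n)" by blast
    obtain K where "\<And>k. k \<ge> K \<Longrightarrow> c k = c (K::nat)"
      using noethD[OF noe, of c] c by (auto simp: mono_iff_le_Suc less_imp_le)
    from this[of "Suc K"] have "c (Suc K) = c K" by simp
    then show False using c(2)[of K] by (metis less_irrefl)
  qed
  then show ?thesis using that by blast
qed

text \<open>\<open>Z / imgadd\<close> is the cokernel of the operator on \<open>Z / B\<close>. The
  span runs over all degrees sent to \<open>d\<close>, so no inverse of \<open>\<sigma>\<close> is
  required here; injectivity enters in \<open>imgaddE\<close>.\<close>

definition imgadd :: "('d \<Rightarrow> 'd) \<Rightarrow> ('d \<Rightarrow> 'x \<Rightarrow> 'x) \<Rightarrow> ('d \<Rightarrow> 'x::ab_group_add set) \<Rightarrow> ('d \<Rightarrow> 'x set) \<Rightarrow> 'd \<Rightarrow> 'x set"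
  where "imgadd \<sigma> \<tau> Z B d = gspan (B d \<union> {\<tau> e z | e z. \<sigma> e = d \<and> z \<in> Z e})"

lemma imgadd_least:
  "subgrp U \<Longrightarrow> B d \<subseteq> U \<Longrightarrow> (\<And>e z. \<sigma> e = d \<Longrightarrow> z \<in> Z e \<Longrightarrow> \<tau> e z \<in> U) \<Longrightarrow> imgadd \<sigma> \<tau> Z B d \<subseteq> U"
  unfolding imgadd_def by (rule gspan_least) auto

lemma imgadd_superset: "B d \<subseteq> imgadd \<sigma> \<tau> Z B d" "z \<in> Z e \<Longrightarrow> \<tau> e z \<in> imgadd \<sigma> \<tau> Z B (\<sigma> e)"
  unfolding imgadd_def by (auto intro!: subsetD[OF gspan_superset])

lemma subgrp_imgadd: "subgrp (imgadd \<sigma> \<tau> Z B d)"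
  by (simp add: imgadd_def subgrp_gspan)

text \<open>An injective shift has at most one source degree for \<open>d\<close>, so a single
  preimage \<open>z\<close> suffices and no sums over several sources occur.\<close>

lemma imgaddE:
  assumes sys: "sys \<Omega> Z B" and op: "(\<sigma>, \<tau>) \<in> \<Omega>" and "inj \<sigma>" and x: "x \<in> imgadd \<sigma> \<tau> Z B d"
  obtains "x \<in> B d" | e z where "\<sigma> e = d" "z \<in> Z e" "x - \<tau> e z \<in> B d"
proof -
  note S = sysD[OF sys]
  have "x \<in> {x. x \<in> B d \<or> (\<exists>e z. \<sigma> e = d \<and> z \<in> Z e \<and> x - \<tau> e z \<in> B d)}"
  proof (rule subsetD[OF _ x], cases "\<exists>e. \<sigma> e = d")
    case False
    then have "imgadd \<sigma> \<tau> Z B d \<subseteq> B d" by (intro imgadd_least S(4)) auto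
    then show "imgadd \<sigma> \<tau> Z B d \<subseteq> {x. x \<in> B d \<or> (\<exists>e z. \<sigma> e = d \<and> z \<in> Z e \<and> x - \<tau> e z \<in> B d)}"
      by auto
  next
    case True
    then obtain e where e: "\<sigma> e = d" by blast
    let ?U = "{x. \<exists>z\<in>Z e. x - \<tau> e z \<in> B d}"
    have "imgadd \<sigma> \<tau> Z B d \<subseteq> ?U"
    proof (rule imgadd_least)
      show "subgrp ?U"
        unfolding subgrp_def
      proof (intro conjI ballI)
        have "0 - \<tau> e 0 \<in> B d" using oper_add(2)[OF sys op] subgrp_0[OF S(4)] by simp
        then show "0 \<in> ?U" using subgrp_0[OF S(3)] by blast
        fix x y assume "x \<in> ?U" "y \<in> ?U"
        then obtain a b where *: "a \<in> Z e" "b \<in> Z e" "x - \<tau> e a \<in> B d" "y - \<tau> e b \<in> B d" by blast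
        have "x - y - \<tau> e (a - b) \<in> B d"
          using subgrp_diff[OF S(4) *(3,4)] unfolding S(8)[OF op, of e a b] by (simp add: algebra_simps)
        then show "x - y \<in> ?U" using subgrp_diff[OF S(3) *(1,2)] by blast
      qed
      show "B d \<subseteq> ?U" using subgrp_0[OF S(3)] oper_add(2)[OF sys op] by (auto intro!: bexI[of _ 0])
      show "\<tau> e' z \<in> ?U" if "\<sigma> e' = d" "z \<in> Z e'" for e' z
      proof -
        have "e' = e" using \<open>inj \<sigma>\<close> e that by (auto dest: injD)
        then show ?thesis using that subgrp_0[OF S(4)] by (auto intro!: bexI[of _ z])
      qed
    qed
    then show "imgadd \<sigma> \<tau> Z B d \<subseteq> {x. x \<in> B d \<or> (\<exists>e z. \<sigma> e = d \<and> z \<in> Z e \<and> x - \<tau> e z \<in> B d)}"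
      using e by blast
  qed
  then show ?thesis using that by blast
qed

text \<open>The remaining operators descend to the cokernel because they commute with the
  distinguished one modulo \<open>B\<close>.\<close>

lemma sys_imgadd:
  assumes sys: "sys (insert (\<sigma>0, \<tau>0) \<Omega>) Z B"
    and c1: "\<And>\<sigma> \<tau> d. (\<sigma>, \<tau>) \<in> \<Omega> \<Longrightarrow> \<sigma> (\<sigma>0 d) = \<sigma>0 (\<sigma> d)"
    and c2: "\<And>\<sigma> \<tau> d x. (\<sigma>, \<tau>) \<in> \<Omega> \<Longrightarrow> x \<in> Z d \<Longrightarrow> \<tau>0 (\<sigma> d) (\<tau> d x) - \<tau> (\<sigma>0 d) (\<tau>0 d x) \<in> B (\<sigma>0 (\<sigma> d))"
  shows "sys \<Omega> Z (imgadd \<sigma>0 \<tau>0 Z B)"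
proof -
  note S = sysD[OF sys]
  have S': "sys \<Omega> Z B" by (rule sys_subset[OF sys]) auto
  let ?B = "imgadd \<sigma>0 \<tau>0 Z B"
  have BZ: "?B d \<subseteq> Z d" for d
    using S by (intro imgadd_least) auto
  have st: "\<tau> d x \<in> ?B (\<sigma> d)" if op: "(\<sigma>, \<tau>) \<in> \<Omega>" and x: "x \<in> ?B d" for \<sigma> \<tau> d x
  proof -
    have "?B d \<subseteq> {x. \<tau> d x \<in> ?B (\<sigma> d)}"
    proof (rule imgadd_least)
      show "subgrp {x. \<tau> d x \<in> ?B (\<sigma> d)}"
        using sysD(8)[OF S' op] by (intro subgrp_vimage subgrp_imgadd)
      show "B d \<subseteq> {x. \<tau> d x \<in> ?B (\<sigma> d)}"
        using sysD(7)[OF S' op] by (auto intro: subsetD[OF imgadd_superset(1)])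
      fix e z assume e: "\<sigma>0 e = d" "z \<in> Z e"
      have "\<tau>0 (\<sigma> e) (\<tau> e z) \<in> ?B (\<sigma>0 (\<sigma> e))"
        using sysD(6)[OF S' op e(2)] by (rule imgadd_superset(2))
      moreover have "\<tau>0 (\<sigma> e) (\<tau> e z) - \<tau> (\<sigma>0 e) (\<tau>0 e z) \<in> ?B (\<sigma>0 (\<sigma> e))"
        using c2[OF op e(2)] by (rule subsetD[OF imgadd_superset(1)])
      ultimately have "\<tau> (\<sigma>0 e) (\<tau>0 e z) \<in> ?B (\<sigma>0 (\<sigma> e))"
        using subgrp_diff[OF subgrp_imgadd[of \<sigma>0 \<tau>0 Z B "\<sigma>0 (\<sigma> e)"]] by fastforce
      then show "\<tau>0 e z \<in> {x. \<tau> d x \<in> ?B (\<sigma> d)}" using e c1[OF op, of e] by auto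
    qed
    then show ?thesis using x by blast
  qed
  show ?thesis
    unfolding sys_def
  proof (intro conjI)
    show "fam \<Omega> Z ?B Z" using BZ S S' by (intro famI) (auto intro: sysD(6))
    show "fam \<Omega> Z ?B ?B" using BZ st subgrp_imgadd by (intro famI) auto
    show "\<forall>(\<sigma>, \<tau>)\<in>\<Omega>. \<forall>d x y. \<tau> d (x - y) = \<tau> d x - \<tau> d y" using S'[unfolded sys_def] by blast
  qed
qed

primrec opow :: "('d \<Rightarrow> 'd) \<Rightarrow> ('d \<Rightarrow> 'x \<Rightarrow> 'x) \<Rightarrow> nat \<Rightarrow> 'd \<Rightarrow> 'x \<Rightarrow> 'x" where
  "opow \<sigma> \<tau> 0 d x = x"
| "opow \<sigma> \<tau> (Suc m) d x = opow \<sigma> \<tau> m (\<sigma> d) (\<tau> d x)"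

lemma opow_Suc': "opow \<sigma> \<tau> (Suc m) d x = \<tau> ((\<sigma> ^^ m) d) (opow \<sigma> \<tau> m d x)"
proof (induction m arbitrary: d x)
  case (Suc m)
  have "opow \<sigma> \<tau> (Suc (Suc m)) d x = opow \<sigma> \<tau> (Suc m) (\<sigma> d) (\<tau> d x)"
    by (rule opow.simps(2))
  also have "\<dots> = \<tau> ((\<sigma> ^^ m) (\<sigma> d)) (opow \<sigma> \<tau> m (\<sigma> d) (\<tau> d x))"
    by (rule Suc.IH)
  also have "(\<sigma> ^^ m) (\<sigma> d) = (\<sigma> ^^ Suc m) d"
    by (simp add: funpow_swap1)
  finally show ?case by (simp only: opow.simps(2))
qed simp

text \<open>Hilbert's basis theorem: a family $W$ is determined by the families
  $(W : t^m) + tZ$, the role of the modules of leading coefficients.\<close>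

lemma noeth_hilbert:
  assumes sys: "sys (insert (\<sigma>0, \<tau>0) \<Omega>) Z B"
    and c1: "\<And>\<sigma> \<tau> d. (\<sigma>, \<tau>) \<in> \<Omega> \<Longrightarrow> \<sigma> (\<sigma>0 d) = \<sigma>0 (\<sigma> d)"
    and c2: "\<And>\<sigma> \<tau> d x. (\<sigma>, \<tau>) \<in> \<Omega> \<Longrightarrow> x \<in> Z d \<Longrightarrow> \<tau>0 (\<sigma> d) (\<tau> d x) - \<tau> (\<sigma>0 d) (\<tau>0 d x) \<in> B (\<sigma>0 (\<sigma> d))"
    and inj: "inj \<sigma>0"
    and ht: "\<And>d. \<not> Z d \<subseteq> B d \<Longrightarrow> h d < (h (\<sigma>0 d) :: nat)"
    and noe: "noeth \<Omega> Z (imgadd \<sigma>0 \<tau>0 Z B)"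
  shows "noeth (insert (\<sigma>0, \<tau>0) \<Omega>) Z B"
  unfolding noeth_def
proof (intro allI impI)
  let ?\<Omega> = "insert (\<sigma>0, \<tau>0) \<Omega>" and ?T = "imgadd \<sigma>0 \<tau>0 Z B" and ?p = "opow \<sigma>0 \<tau>0"
  note S = sysD[OF sys]
  have S': "sys \<Omega> Z ?T" 
  proof (rule sys_imgadd[OF sys])
    fix \<sigma> \<tau> d assume op: "(\<sigma>, \<tau>) \<in> \<Omega>"
    show "\<sigma> (\<sigma>0 d) = \<sigma>0 (\<sigma> d)" by (rule c1[OF op])
    fix x assume "x \<in> Z d"
    then show "\<tau>0 (\<sigma> d) (\<tau> d x) - \<tau> (\<sigma>0 d) (\<tau>0 d x) \<in> B (\<sigma>0 (\<sigma> d))" by (rule c2[OF op])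
  qed
  have ad: "\<tau>0 d (x - y) = \<tau>0 d x - \<tau>0 d y" for d x y using S(8)[of \<sigma>0 \<tau>0] by simp
  have pad: "?p m d (x - y) = ?p m d x - ?p m d y" for m d x y
    by (induction m arbitrary: d x y) (simp_all add: ad)
  have pst: "?p m d x \<in> W ((\<sigma>0 ^^ m) d)" if "fam ?\<Omega> Z B W" "x \<in> W d" for m d x W
    using that(2)
  proof (induction m arbitrary: d x)
    case (Suc m)
    then show ?case using famD(4)[OF that(1), of \<sigma>0 \<tau>0 x d] by (simp add: funpow_swap1)
  qed simp
  have pB: "?p m d x \<in> B ((\<sigma>0 ^^ m) d)" if "x \<in> B d" for m d x
    using pst[of B x d m] that S(2) by blast
  have scom: "(\<sigma>0 ^^ m) (\<sigma> d) = \<sigma> ((\<sigma>0 ^^ m) d)" if "(\<sigma>, \<tau>) \<in> \<Omega>" for m d \<sigma> \<tau>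
    by (induction m) (simp_all add: c1[OF that])
  \<comment> \<open>Commutation modulo \<open>B\<close> survives \<open>m\<close> steps because each
    further application of \<open>\<tau>0\<close> maps \<open>B\<close> into
    \<open>B\<close>.\<close>
  have pcom: "?p m (\<sigma> d) (\<tau> d x) - \<tau> ((\<sigma>0 ^^ m) d) (?p m d x) \<in> B ((\<sigma>0 ^^ m) (\<sigma> d))"
    if op: "(\<sigma>, \<tau>) \<in> \<Omega>" and "x \<in> Z d" for m d x \<sigma> \<tau>
    using that(2)
  proof (induction m)
    case 0
    then show ?case using subgrp_0[OF S(4)] by simp
  next
    case (Suc m)
    let ?e = "(\<sigma>0 ^^ m) d"
    have "?p m d x \<in> Z ?e" using pst[OF S(1) Suc.prems] .
    then have "\<tau>0 (\<sigma> ?e) (\<tau> ?e (?p m d x)) - \<tau> (\<sigma>0 ?e) (\<tau>0 ?e (?p m d x)) \<in> B (\<sigma>0 (\<sigma> ?e))"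
      by (rule c2[OF op])
    moreover have "\<tau>0 (\<sigma> ?e) (?p m (\<sigma> d) (\<tau> d x) - \<tau> ?e (?p m d x)) \<in> B (\<sigma>0 (\<sigma> ?e))"
      using S(7)[of \<sigma>0 \<tau>0, OF _ Suc.IH[OF Suc.prems]] scom[OF op, of m d] by simp
    ultimately have "\<tau>0 (\<sigma> ?e) (?p m (\<sigma> d) (\<tau> d x)) - \<tau> (\<sigma>0 ?e) (\<tau>0 ?e (?p m d x)) \<in> B (\<sigma>0 (\<sigma> ?e))"
      using subgrp_add[OF S(4)] by (fastforce simp: ad)
    then show ?case unfolding opow_Suc' using scom[OF op, of m d] by simp
  qed
  define V where "V m W d = ssum {x \<in> Z d. ?p m d x \<in> W ((\<sigma>0 ^^ m) d)} (?T d)" for m and W :: "'a \<Rightarrow> 'b set" and d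
  have Vfam: "fam \<Omega> Z ?T (V m W)" if W: "fam ?\<Omega> Z B W" for m W
  proof (rule famI)
    note Wd = famD[OF W]
    have sub: "subgrp {x \<in> Z d. ?p m d x \<in> W ((\<sigma>0 ^^ m) d)}" for d
      using subgrp_Int[OF S(3)[of d] subgrp_vimage[OF Wd(1), of "?p m d" "(\<sigma>0 ^^ m) d"]] pad
      by (simp add: Int_def)
    fix d
    show "subgrp (V m W d)" unfolding V_def by (intro subgrp_ssum sub subgrp_imgadd)
    show "?T d \<subseteq> V m W d" unfolding V_def by (rule ssum_superset2[OF sub])
    show "V m W d \<subseteq> Z d" unfolding V_def by (rule ssum_least) (use S(3) sysD(5)[OF S'] in auto)
    fix \<sigma> \<tau> x assume op: "(\<sigma>, \<tau>) \<in> \<Omega>" and x: "x \<in> V m W d"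
    then obtain y t where y: "y \<in> Z d" "?p m d y \<in> W ((\<sigma>0 ^^ m) d)" and t: "t \<in> ?T d" and xy: "x = y + t"
      by (auto simp: V_def ssum_def)
    have "\<tau> ((\<sigma>0 ^^ m) d) (?p m d y) \<in> W ((\<sigma>0 ^^ m) (\<sigma> d))"
      using Wd(4)[of \<sigma> \<tau>, OF _ y(2)] op scom[OF op] by simp
    then have "?p m (\<sigma> d) (\<tau> d y) \<in> W ((\<sigma>0 ^^ m) (\<sigma> d))"
      using subgrp_add[OF Wd(1) subsetD[OF Wd(2) pcom[OF op y(1), of m]]] by fastforce
    moreover have "\<tau> d y \<in> Z (\<sigma> d)" using sysD(6)[OF S' op y(1)] .
    ultimately show "\<tau> d x \<in> V m W (\<sigma> d)"
      unfolding V_def xy oper_add(1)[OF S' op] using sysD(7)[OF S' op t] by (auto intro: ssumI)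
  qed
  have Vmono: "V m W \<le> V m W'" if "W \<le> W'" for m W W'
    using that unfolding V_def le_fun_def ssum_def by blast
  have Vmono': "V m W \<le> V n W" if W: "fam ?\<Omega> Z B W" and "m \<le> n" for m n W
    using \<open>m \<le> n\<close>
  proof (induction n rule: dec_induct)
    case (step n)
    have "V n W \<le> V (Suc n) W"
    proof (rule le_funI)
      fix d
      have "?p (Suc n) d x \<in> W ((\<sigma>0 ^^ Suc n) d)" if "?p n d x \<in> W ((\<sigma>0 ^^ n) d)" for x
        using famD(4)[OF W, of \<sigma>0 \<tau>0, OF _ that] unfolding opow_Suc' by simp
      then show "V n W d \<subseteq> V (Suc n) W d" unfolding V_def ssum_def by blast
    qed
    with step show ?case by (metis order_trans)
  qed simp
  fix c :: "nat \<Rightarrow> 'a \<Rightarrow> 'b set"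
  assume c: "mono c" "\<forall>k. fam ?\<Omega> Z B (c k)"
  have cle: "c k \<le> c l" if "k \<le> l" for k l using c(1) that by (simp add: monoD)
  \<comment> \<open>\<open>V\<close> grows in both arguments, so the diagonal is a chain. Once it is
    stationary from \<open>K0\<close> on, only the finitely many \<open>m < K0\<close> need bounds
    of their own.\<close>
  have "mono (\<lambda>k. V k (c k))"
  proof (rule monoI)
    fix k l :: nat assume "k \<le> l"
    then have "V k (c k) \<le> V k (c l)" "V k (c l) \<le> V l (c l)" using Vmono cle Vmono' c(2) by blast+
    then show "V k (c k) \<le> V l (c l)" by (rule order_trans)
  qed
  then obtain K0 where K0: "\<And>k. k \<ge> K0 \<Longrightarrow> V k (c k) = V K0 (c K0)"
    using noethD[OF noe, of "\<lambda>k. V k (c k)"] Vfam c(2) by blast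
  have "\<exists>K. \<forall>k\<ge>K. V m (c k) = V m (c K)" for m
  proof -
    have "mono (\<lambda>k. V m (c k))" by (rule monoI) (intro Vmono cle)
    then show ?thesis using noe[unfolded noeth_def, rule_format, of "\<lambda>k. V m (c k)"] Vfam c(2) by simp
  qed
  then obtain K1 where K1: "\<And>m k. k \<ge> K1 m \<Longrightarrow> V m (c k) = V m (c (K1 m))" by metis
  define L where "L = Max (insert K0 (K1 ` {..<K0}))"
  have L: "L \<ge> K0" "\<And>m. m < K0 \<Longrightarrow> L \<ge> K1 m" unfolding L_def by (auto intro: Max_ge)
  have VL: "V m (c k) = V m (c L)" if "k \<ge> L" for m k
  proof (cases "m < K0")
    case True
    then show ?thesis using K1[of m k] K1[of m L] L(2)[OF True] that by simp
  next
    case False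
    \<comment> \<open>For \<open>m \<ge> K0\<close> the value is squeezed between two entries of the
      stationary diagonal.\<close>
    have "V K0 (c K0) \<le> V m (c j) \<and> V m (c j) \<le> V K0 (c K0)" if "j \<ge> L" for j
    proof
      have "V K0 (c K0) \<le> V K0 (c j)" using Vmono cle L(1) that by (meson order_trans)
      also have "\<dots> \<le> V m (c j)" using Vmono' c(2) False by simp
      finally show "V K0 (c K0) \<le> V m (c j)" .
      have "V m (c j) \<le> V (max m j) (c j)" using Vmono' c(2) by simp
      also have "\<dots> \<le> V (max m j) (c (max m j))" by (intro Vmono cle) simp
      also have "\<dots> = V K0 (c K0)" by (rule K0) (use False in auto)
      finally show "V m (c j) \<le> V K0 (c K0)" .
    qed
    then show ?thesis using that by (metis antisym order_refl)
  qed
  \<comment> \<open>The exponent \<open>m\<close> is generalised: writing an element of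
    \<open>tZ\<close> as the image of \<open>z\<close> one shift lower raises the exponent and
    lowers the height \<open>h\<close>, so the descent ends.\<close>
  have key: "?p m e x \<in> c L ((\<sigma>0 ^^ m) e)" if k: "k \<ge> L" and "x \<in> Z e" "?p m e x \<in> c k ((\<sigma>0 ^^ m) e)" for k m e x
    using that(2,3)
  proof (induction "h e" arbitrary: e m x rule: less_induct)
    case less
    note Wk = famD[OF c(2)[rule_format, of k]] and WL = famD[OF c(2)[rule_format, of L]]
    have "x \<in> V m (c k) e"
      unfolding V_def by (rule subsetD[OF ssum_superset1[OF subgrp_imgadd]]) (use less.prems in simp)
    then have "x \<in> V m (c L) e" using VL[OF k] by simp
    then obtain y t where y: "y \<in> Z e" "?p m e y \<in> c L ((\<sigma>0 ^^ m) e)" and t: "t \<in> ?T e" and xy: "x = y + t"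
      by (auto simp: V_def ssum_def)
    have tk: "?p m e t \<in> c k ((\<sigma>0 ^^ m) e)"
    proof -
      have "?p m e t = ?p m e x - ?p m e y" using pad[of m e x y] xy by simp
      then show ?thesis using subgrp_diff[OF Wk(1) less.prems(2)] y(2) cle[OF k] by (auto simp: le_fun_def)
    qed
    have "?p m e t \<in> c L ((\<sigma>0 ^^ m) e)"
    proof (rule imgaddE[OF sys insertI1 inj t])
      assume "t \<in> B e"
      then show ?thesis using pB WL(2) by blast
    next
      fix e' z assume B: "\<sigma>0 e' = e" "z \<in> Z e'" "t - \<tau>0 e' z \<in> B e"
      have tz: "?p m e t - ?p (Suc m) e' z \<in> B ((\<sigma>0 ^^ m) e)"
        using pB[OF B(3), of m] B(1) by (simp add: pad)
      have "?p (Suc m) e' z \<in> c L ((\<sigma>0 ^^ Suc m) e')"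
      \<comment> \<open>Where \<open>Z e'\<close> lies in \<open>B e'\<close> the height need not
        drop, but then \<open>z\<close> is already in \<open>B\<close>.\<close>
      proof (cases "Z e' \<subseteq> B e'")
        case True
        then show ?thesis using pB[of z e' "Suc m"] B(2) WL(2) by blast
      next
        case False
        then have "h e' < h e" using ht B(1) by blast
        then show ?thesis
        proof (rule less.hyps[OF _ B(2)])
          have "?p m e t - (?p m e t - ?p (Suc m) e' z) \<in> c k ((\<sigma>0 ^^ m) e)"
            by (rule subgrp_diff[OF Wk(1) tk subsetD[OF Wk(2) tz]])
          then show "?p (Suc m) e' z \<in> c k ((\<sigma>0 ^^ Suc m) e')"
            using B(1) by (simp add: funpow_swap1)
        qed
      qed
      then have "?p (Suc m) e' z \<in> c L ((\<sigma>0 ^^ m) e)" using B(1) by (simp add: funpow_swap1)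
      then have "(?p m e t - ?p (Suc m) e' z) + ?p (Suc m) e' z \<in> c L ((\<sigma>0 ^^ m) e)"
        using tz WL(2) by (intro subgrp_add[OF WL(1)]) auto
      then show ?thesis by simp
    qed
    moreover have "?p m e x = ?p m e t - ?p m e (- y)" using pad[of m e t "- y"] xy by (simp add: add.commute)
    moreover have "?p m e (- y) = - ?p m e y" using pad[of m e 0 0] pad[of m e 0 y] by simp
    ultimately show ?case using y(2) subgrp_add[OF WL(1)] by simp
  qed
  have "c k = c L" if "k \<ge> L" for k
  proof (rule antisym[OF _ cle[OF that]], rule le_funI, rule subsetI)
    fix d x assume "x \<in> c k d"
    then show "x \<in> c L d" using key[OF that, of x d 0] famD(3)[OF c(2)[rule_format, of k]] by auto
  qed
  then show "\<exists>K. \<forall>k\<ge>K. c k = c K" by blast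
qed

text \<open>Level \<open>k\<close> is what \<open>k\<close> successive applications of
  \<open>\<Theta>\<close> produce from \<open>W\<close> in the degree \<open>k\<close> shifts lower;
  \<open>\<pi>\<close> undoes one shift. Adding \<open>B d\<close> at each level keeps the result a
  subquotient of \<open>Z / B\<close>.\<close>

primrec gen_from :: "('d \<Rightarrow> 'd) \<Rightarrow> ('d \<Rightarrow> 'x \<Rightarrow> 'x) set \<Rightarrow> ('d \<Rightarrow> 'x::ab_group_add set) \<Rightarrow> ('d \<Rightarrow> 'x set) \<Rightarrow> nat \<Rightarrow> 'd \<Rightarrow> 'x set" where
  "gen_from \<pi> \<Theta> B W 0 d = W d"
| "gen_from \<pi> \<Theta> B W (Suc k) d = gspan (B d \<union> {\<theta> (\<pi> d) x | \<theta> x. \<theta> \<in> \<Theta> \<and> x \<in> gen_from \<pi> \<Theta> B W k (\<pi> d)})"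

text \<open>In a Noetherian system every family is generated in bounded levels: compare it with the
  families that agree with it up to level $m$ and are generated from there on.\<close>

lemma noeth_generated:
  assumes noe: "noeth (\<Omega> \<union> Pair \<sigma>0 ` \<Theta>) Z B" and sys: "sys (\<Omega> \<union> Pair \<sigma>0 ` \<Theta>) Z B"
    and W: "fam (\<Omega> \<union> Pair \<sigma>0 ` \<Theta>) Z B W"
    and lv: "\<And>d. lv (\<sigma>0 d) = lv d + (1::int)"
    and pi1: "\<And>d. \<pi> (\<sigma>0 d) = d" and pi2: "\<And>d. lv d > 0 \<Longrightarrow> \<sigma>0 (\<pi> d) = d"
    and c0: "\<And>\<sigma> \<tau> d. (\<sigma>, \<tau>) \<in> \<Omega> \<Longrightarrow> lv (\<sigma> d) = lv d"
    and c1: "\<And>\<sigma> \<tau> d. (\<sigma>, \<tau>) \<in> \<Omega> \<Longrightarrow> \<sigma> (\<sigma>0 d) = \<sigma>0 (\<sigma> d)"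
    and c2: "\<And>\<sigma> \<tau> \<theta> d x. (\<sigma>, \<tau>) \<in> \<Omega> \<Longrightarrow> \<theta> \<in> \<Theta> \<Longrightarrow> x \<in> Z d \<Longrightarrow>
      \<tau> (\<sigma>0 d) (\<theta> d x) - \<theta> (\<sigma> d) (\<tau> d x) \<in> B (\<sigma>0 (\<sigma> d))"
  shows "\<exists>K::nat. \<forall>d. int K \<le> lv d \<longrightarrow>
    W (\<sigma>0 d) \<subseteq> gspan (B (\<sigma>0 d) \<union> {\<theta> d x | \<theta> x. \<theta> \<in> \<Theta> \<and> x \<in> W d})"
proof -
  let ?\<Omega> = "\<Omega> \<union> Pair \<sigma>0 ` \<Theta>" and ?G = "gen_from \<pi> \<Theta> B W"
  note S = sysD[OF sys] and Wd = famD[OF W]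
  have th: "(\<sigma>0, \<theta>) \<in> ?\<Omega>" if "\<theta> \<in> \<Theta>" for \<theta> using that by blast
  have lvpi: "lv (\<pi> d) = lv d - 1" if "lv d > 0" for d using lv[of "\<pi> d"] pi2[OF that] by simp
  have GW: "?G k d \<subseteq> W d" if "k = 0 \<or> int k \<le> lv d" for k d
    using that
  proof (induction k arbitrary: d)
    case (Suc k)
    then have l: "lv d > 0" by simp
    have IH: "?G k (\<pi> d) \<subseteq> W (\<pi> d)" using Suc by (simp add: lvpi[OF l])
    have "\<theta> (\<pi> d) x \<in> W d" if "\<theta> \<in> \<Theta>" "x \<in> ?G k (\<pi> d)" for \<theta> x
      using Wd(4)[OF th[OF that(1)], of x "\<pi> d"] that(2) IH pi2[OF l] by auto
    then show ?case unfolding gen_from.simps using Wd(2) by (intro gspan_least Wd(1)) blast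
  qed simp
  have Gdec: "?G (Suc k) d \<subseteq> ?G k d" if "int (Suc k) \<le> lv d" for k d
    using that
  proof (induction k arbitrary: d)
    case 0
    show ?case using GW[of "Suc 0" d] 0 by simp
  next
    case (Suc k)
    then have l: "lv d > 0" by simp
    have "?G (Suc k) (\<pi> d) \<subseteq> ?G k (\<pi> d)" using Suc.prems by (intro Suc.IH) (simp add: lvpi[OF l])
    then show ?case unfolding gen_from.simps(2)[of \<pi> \<Theta> B W _ d] by (intro gspan_mono) blast
  qed
  have Gsub: "subgrp (?G k d)" for k d by (cases k) (auto simp: Wd(1) subgrp_gspan)
  have GB: "B d \<subseteq> ?G k d" for k d
  proof (cases k)
    case (Suc j)
    have "B d \<subseteq> gspan (B d \<union> X)" for X using gspan_superset[of "B d \<union> X"] by blast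
    then show ?thesis using Suc by simp
  qed (simp add: Wd(2))
  have Gth: "\<theta> d x \<in> ?G (Suc k) (\<sigma>0 d)" if "\<theta> \<in> \<Theta>" "x \<in> ?G k d" for \<theta> x k d
    unfolding gen_from.simps pi1 using that by (intro subsetD[OF gspan_superset]) blast
  have Gst: "\<tau> d x \<in> ?G k (\<sigma> d)" if op: "(\<sigma>, \<tau>) \<in> \<Omega>" and "k = 0 \<or> int k \<le> lv d" "x \<in> ?G k d" for \<sigma> \<tau> k d x
    using that(2,3)
  proof (induction k arbitrary: d x)
    case 0
    then show ?case using Wd(4)[of \<sigma> \<tau>] op by simp
  next
    case (Suc k)
    then have l: "lv d > 0" by simp
    have op': "(\<sigma>, \<tau>) \<in> ?\<Omega>" using op by blast
    have "?G (Suc k) d \<subseteq> {x. \<tau> d x \<in> ?G (Suc k) (\<sigma> d)}"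
      unfolding gen_from.simps(2)[of \<pi> \<Theta> B W _ d]
    proof (rule gspan_least)
      show "subgrp {x. \<tau> d x \<in> ?G (Suc k) (\<sigma> d)}" by (intro subgrp_vimage Gsub S(8)[OF op'])
      have "\<tau> d x \<in> ?G (Suc k) (\<sigma> d)" if "x \<in> B d" for x
        by (rule subsetD[OF GB S(7)[OF op' that]])
      moreover have "\<tau> d (\<theta> (\<pi> d) y) \<in> ?G (Suc k) (\<sigma> d)" if t: "\<theta> \<in> \<Theta>" and y: "y \<in> ?G k (\<pi> d)" for \<theta> y
      proof -
        have e: "\<sigma> d = \<sigma>0 (\<sigma> (\<pi> d))" using c1[OF op, of "\<pi> d"] pi2[OF l] by simp
        have k: "k = 0 \<or> int k \<le> lv (\<pi> d)" using Suc.prems(1) lvpi[OF l] by simp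
        have "y \<in> Z (\<pi> d)" using GW[OF k] y Wd(3) by blast
        from c2[OF op t this] have "\<tau> d (\<theta> (\<pi> d) y) - \<theta> (\<sigma> (\<pi> d)) (\<tau> (\<pi> d) y) \<in> B (\<sigma> d)"
          unfolding e pi2[OF l] .
        moreover have "\<theta> (\<sigma> (\<pi> d)) (\<tau> (\<pi> d) y) \<in> ?G (Suc k) (\<sigma> d)"
          unfolding e by (intro Gth t Suc.IH k y)
        ultimately show ?thesis using subgrp_add[OF Gsub subsetD[OF GB]] by fastforce
      qed
      ultimately show "B d \<union> {\<theta> (\<pi> d) x | \<theta> x. \<theta> \<in> \<Theta> \<and> x \<in> ?G k (\<pi> d)} \<subseteq> {x. \<tau> d x \<in> ?G (Suc k) (\<sigma> d)}"
        by blast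
    qed
    then show ?case using Suc.prems(2) by blast
  qed
  \<comment> \<open>\<open>nat\<close> truncates at zero, so one formula gives \<open>W\<close>
    itself up to level \<open>m\<close> and the part generated from level \<open>m\<close> above it.
    The chain increases because generating from a lower level gives less.\<close>
  define c where "c m d = ?G (nat (lv d - int m)) d" for m :: nat and d
  have "fam ?\<Omega> Z B (c m)" for m
  proof (rule famI)
    fix d
    show "subgrp (c m d)" "B d \<subseteq> c m d" unfolding c_def by (rule Gsub GB)+
    have "c m d \<subseteq> W d" unfolding c_def by (rule GW) linarith
    then show "c m d \<subseteq> Z d" using Wd(3) by blast
    fix \<sigma> \<tau> x assume op: "(\<sigma>, \<tau>) \<in> ?\<Omega>" and x: "x \<in> c m d"
    from op consider "(\<sigma>, \<tau>) \<in> \<Omega>" | "\<sigma> = \<sigma>0" "\<tau> \<in> \<Theta>" by blast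
    then show "\<tau> d x \<in> c m (\<sigma> d)"
    proof cases
      case 1
      have "\<tau> d x \<in> ?G (nat (lv d - int m)) (\<sigma> d)"
        using x unfolding c_def by (intro Gst[OF 1]) linarith+
      then show ?thesis by (simp add: c_def c0[OF 1])
    next
      case 2
      show ?thesis
      proof (cases "int m \<le> lv d")
        case True
        then have "nat (lv (\<sigma>0 d) - int m) = Suc (nat (lv d - int m))" using lv[of d] by linarith
        then show ?thesis using Gth[OF 2(2), of x "nat (lv d - int m)" d] x by (simp only: c_def 2(1))
      next
        case False
        then have "nat (lv (\<sigma>0 d) - int m) = 0" "nat (lv d - int m) = 0" using lv[of d] by linarith+
        then show ?thesis using x Wd(4)[OF op] 2(1) by (simp add: c_def)
      qed
    qed
  qed
  moreover have "mono c"
    unfolding mono_iff_le_Suc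
  proof (intro allI le_funI)
    fix m d
    show "c m d \<subseteq> c (Suc m) d"
    proof (cases "int m < lv d")
      case True
      then have "nat (lv d - int m) = Suc (nat (lv d - int (Suc m)))" by linarith
      then show ?thesis unfolding c_def using Gdec[of "nat (lv d - int (Suc m))" d] True by simp
    qed (simp add: c_def)
  qed
  ultimately obtain K where K: "\<And>k. k \<ge> K \<Longrightarrow> c k = c K" using noethD[OF noe] by metis
  \<comment> \<open>In a fixed degree the chain equals \<open>W\<close> as soon as \<open>m\<close>
    reaches the level of that degree; being stationary from \<open>K\<close> on, it equals
    \<open>W\<close> already at \<open>K\<close>.\<close>
  have cW: "c K d = W d" for d
  proof -
    have "c (max K (nat (lv d))) d = W d" by (simp add: c_def)
    then show ?thesis using K[of "max K (nat (lv d))"] by simp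
  qed
  show ?thesis
  proof (intro exI[of _ K] allI impI)
    fix d assume d: "int K \<le> lv d"
    then have "nat (lv (\<sigma>0 d) - int K) = Suc (nat (lv d - int K))" using lv[of d] by linarith
    then have "W (\<sigma>0 d) = ?G (Suc (nat (lv d - int K))) (\<sigma>0 d)" using cW[of "\<sigma>0 d"] by (simp only: c_def)
    moreover have "?G (nat (lv d - int K)) d = W d" using cW[of d] by (simp only: c_def)
    ultimately show "W (\<sigma>0 d) \<subseteq> gspan (B (\<sigma>0 d) \<union> {\<theta> d x | \<theta> x. \<theta> \<in> \<Theta> \<and> x \<in> W d})"
      by (simp add: pi1)
  qed
qed

section \<open>Modules over a commutative ring and their associated primes\<close>

locale scal =
  fixes sc :: "'t::comm_ring_1 \<Rightarrow> 'p::ab_group_add \<Rightarrow> 'p" (infixr "\<bullet>" 75)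
  assumes sc_add: "t \<bullet> (x + y) = t \<bullet> x + t \<bullet> y"
    and sc_plus: "(s + t) \<bullet> x = s \<bullet> x + t \<bullet> x"
    and sc_mult: "(s * t) \<bullet> x = s \<bullet> t \<bullet> x"
    and sc_one [simp]: "1 \<bullet> x = x"

lemma scal_times: "scal ((*) :: 't::comm_ring_1 \<Rightarrow> 't \<Rightarrow> 't)"
  by unfold_locales (auto simp: algebra_simps)

definition prime_id :: "'t::comm_ring_1 set \<Rightarrow> bool" where
  "prime_id p \<longleftrightarrow> subgrp p \<and> (\<forall>s. \<forall>t\<in>p. s * t \<in> p) \<and> 1 \<notin> p \<and> (\<forall>s t. s * t \<in> p \<longrightarrow> s \<in> p \<or> t \<in> p)"

lemma prime_idD:
  assumes "prime_id p"
  shows "subgrp p" "t \<in> p \<Longrightarrow> s * t \<in> p" "1 \<notin> p" "s * t \<in> p \<Longrightarrow> s \<notin> p \<Longrightarrow> t \<in> p" "0 \<in> p"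
  using assms by (auto simp: prime_id_def subgrp_def)

context scal
begin

lemma sc_0 [simp]: "t \<bullet> 0 = 0" using sc_add[of t 0 0] by simp
lemma sc_0' [simp]: "0 \<bullet> x = 0" using sc_plus[of 0 0 x] by simp
lemma sc_minus: "t \<bullet> (- x) = - (t \<bullet> x)" using sc_add[of t x "- x"] by (simp add: eq_neg_iff_add_eq_0 add.commute)
lemma sc_minus': "(- t) \<bullet> x = - (t \<bullet> x)" using sc_plus[of t "- t" x] by (simp add: eq_neg_iff_add_eq_0 add.commute)
lemma sc_diff: "t \<bullet> (x - y) = t \<bullet> x - t \<bullet> y" using sc_add[of t x "- y"] by (simp add: sc_minus)
lemma sc_diff': "(s - t) \<bullet> x = s \<bullet> x - t \<bullet> x" using sc_plus[of s "- t" x] by (simp add: sc_minus')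
lemma sc_sum: "t \<bullet> sum f A = (\<Sum>i\<in>A. t \<bullet> f i)" by (induction A rule: infinite_finite_induct) (auto simp: sc_add)
lemma sc_sum': "sum f A \<bullet> x = (\<Sum>i\<in>A. f i \<bullet> x)" by (induction A rule: infinite_finite_induct) (auto simp: sc_plus)
lemma sc_left_commute: "s \<bullet> t \<bullet> x = t \<bullet> s \<bullet> x" by (metis mult.commute sc_mult)

definition "subm W \<longleftrightarrow> subgrp W \<and> (\<forall>t. \<forall>x\<in>W. t \<bullet> x \<in> W)"

lemma submD: "subm W \<Longrightarrow> subgrp W" "subm W \<Longrightarrow> x \<in> W \<Longrightarrow> t \<bullet> x \<in> W"
  by (auto simp: subm_def)

definition scops :: "('d, 'p) oper set" where
  "scops = range (\<lambda>t. (\<lambda>d. d, \<lambda>d x. t \<bullet> x))"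

lemma scopsI: "(\<lambda>d. d, \<lambda>d x. t \<bullet> x) \<in> scops" by (auto simp: scops_def)

lemma subm_fam:
  assumes "fam \<Omega> Z B W" "scops \<subseteq> \<Omega>" shows "subm (W d)"
  unfolding subm_def
proof (intro conjI allI ballI)
  show "subgrp (W d)" by (rule famD(1)[OF assms(1)])
  show "t \<bullet> x \<in> W d" if "x \<in> W d" for t x
    using famD(4)[OF assms(1) subsetD[OF assms(2) scopsI] that] .
qed

text \<open>An \<open>x\<close> in \<open>B\<close> has the unit in its annihilator, so
  \<open>prime_id\<close> already forces \<open>x\<close> to be nonzero in
  \<open>Z / B\<close>.\<close>

definition assp :: "'p set \<Rightarrow> 'p set \<Rightarrow> 't set \<Rightarrow> bool" where
  "assp Z B p \<longleftrightarrow> prime_id p \<and> (\<exists>x\<in>Z. {t. t \<bullet> x \<in> B} = p)"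

text \<open>An element outside $H$ with maximal annihilator modulo $H$ generates a submodule all of whose
  nonzero elements modulo $H$ have that annihilator.\<close>

lemma finite_assp:
  assumes noe: "noeth \<Omega> Z B" and sys: "sys \<Omega> Z B" and sub: "scops \<subseteq> \<Omega>"
    and com: "\<And>\<sigma> \<tau> d t x. (\<sigma>, \<tau>) \<in> \<Omega> \<Longrightarrow> \<tau> d (t \<bullet> x) = t \<bullet> \<tau> d x"
    and kill: "\<And>d t x. t \<in> J \<Longrightarrow> x \<in> Z d \<Longrightarrow> t \<bullet> x \<in> B d"
    and noeT: "noeth (range (\<lambda>t. (\<lambda>d::unit. d, \<lambda>d x. t * x))) (\<lambda>_. UNIV) (\<lambda>_. J)"
  shows "finite {p. \<exists>d. assp (Z d) (B d) p}"
proof -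
  note S = sysD[OF sys]
  have "fam \<Omega> Z B B" by (rule S)
  moreover have "finite {p. \<exists>d. assp (B d) (B d) p}"
  proof -
    have "\<not> assp (B d) (B d) p" for d p
    proof
      assume "assp (B d) (B d) p"
      then obtain x where x: "x \<in> B d" "{t. t \<bullet> x \<in> B d} = p" "prime_id p" by (auto simp: assp_def)
      then show False using prime_idD(3)[of p] by force
    qed
    then show ?thesis by simp
  qed
  \<comment> \<open>Noetherian induction: \<open>H\<close> is maximal among the families with
    finitely many associated primes, and it remains to see that it exhausts
    \<open>Z\<close>.\<close>
  ultimately obtain H where H: "fam \<Omega> Z B H" "finite {p. \<exists>d. assp (H d) (B d) p}"
    and Hmax: "\<And>W. fam \<Omega> Z B W \<Longrightarrow> finite {p. \<exists>d. assp (W d) (B d) p} \<Longrightarrow> H \<le> W \<Longrightarrow> W = H"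
    using noeth_max[OF noe, of B "\<lambda>W. finite {p. \<exists>d. assp (W d) (B d) p}"] by blast
  note Hd = famD[OF H(1)] and Hs = subm_fam[OF H(1) sub]
  note Zs = subm_fam[OF S(1) sub]
  have "H = Z"
  proof (rule ccontr)
    assume "H \<noteq> Z"
    then obtain d0 x0 where x0: "x0 \<in> Z d0" "x0 \<notin> H d0" using Hd(3) by (metis ext subsetI subset_antisym)
    define an where "an d x = {t. t \<bullet> x \<in> H d}" for d x
    \<comment> \<open>Annihilators modulo \<open>H\<close> contain \<open>J\<close>, so the chain
      condition on the scalar ring modulo \<open>J\<close>, viewed as a system with a single degree,
      provides a maximal one.\<close>
    let ?O = "range (\<lambda>t. (\<lambda>d::unit. d, \<lambda>d x. t * x))"
    have anf: "fam ?O (\<lambda>_. UNIV) (\<lambda>_. J) (\<lambda>_. an d x)" if "x \<in> Z d" for d x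
    proof (rule famI)
      show "subgrp (an d x)" unfolding an_def
        by (rule subgrp_vimage[OF Hd(1)]) (rule sc_diff')
      show "J \<subseteq> an d x" unfolding an_def using kill[OF _ that] Hd(2) by blast
      show "\<And>\<sigma> \<tau> da xa. (\<sigma>, \<tau>) \<in> ?O \<Longrightarrow> xa \<in> an d x \<Longrightarrow> \<tau> da xa \<in> an d x"
        unfolding an_def using submD(2)[OF Hs] by (auto simp: sc_mult)
    qed auto
    let ?Q = "\<lambda>P. \<exists>d x. P = (\<lambda>_. an d x) \<and> x \<in> Z d \<and> x \<notin> H d"
    have "?Q (\<lambda>_. an d0 x0)" using x0 by blast
    then obtain P where "fam ?O (\<lambda>_. UNIV) (\<lambda>_. J) P" and P: "?Q P"
      and Pmax: "\<And>P'. fam ?O (\<lambda>_. UNIV) (\<lambda>_. J) P' \<Longrightarrow> ?Q P' \<Longrightarrow> P \<le> P' \<Longrightarrow> P' = P"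
    proof (rule noeth_max[where P = ?Q, OF noeT anf[OF x0(1)]])
      fix W assume W: "fam ?O (\<lambda>_. UNIV) (\<lambda>_. J) W" "?Q W"
        "\<And>P'. fam ?O (\<lambda>_. UNIV) (\<lambda>_. J) P' \<Longrightarrow> ?Q P' \<Longrightarrow> W \<le> P' \<Longrightarrow> P' = W"
      show thesis by (rule that[OF W])
    qed
    from P obtain d1 x1 where x1: "P = (\<lambda>_. an d1 x1)" "x1 \<in> Z d1" "x1 \<notin> H d1" by blast
    define p where "p = an d1 x1"
    have max: "an d x = p" if "x \<in> Z d" "x \<notin> H d" "p \<subseteq> an d x" for d x
      using Pmax[OF anf[OF that(1)]] that x1 unfolding p_def le_fun_def by metis
    have "prime_id p"
      unfolding prime_id_def
    proof (intro conjI allI ballI impI)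
      show "subgrp p" using famD(1)[OF anf[OF x1(2)]] by (simp add: p_def)
      show "1 \<notin> p" using x1(3) by (simp add: p_def an_def)
      fix s t
      show "s * t \<in> p" if "t \<in> p" using that submD(2)[OF Hs] by (auto simp: p_def an_def sc_mult)
      assume st: "s * t \<in> p"
      show "s \<in> p \<or> t \<in> p"
      proof (cases "t \<in> p")
        case False
        have "an d1 (t \<bullet> x1) = p"
        proof (rule max)
          show "t \<bullet> x1 \<in> Z d1" using submD(2)[OF Zs x1(2)] .
          show "t \<bullet> x1 \<notin> H d1" using False by (simp add: p_def an_def)
          show "p \<subseteq> an d1 (t \<bullet> x1)"
            using submD(2)[OF Hs] by (auto simp: p_def an_def sc_left_commute[of _ t])
        qed
        then show ?thesis using st by (auto simp: p_def an_def sc_mult)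
      qed simp
    qed
    \<comment> \<open>Everything that \<open>p\<close> kills modulo \<open>H\<close>. Unlike the
      submodule generated by \<open>x1\<close> this is stable under all operators, and it still
      contains \<open>x1\<close>.\<close>
    define H' where "H' d = {y \<in> Z d. \<forall>t\<in>p. t \<bullet> y \<in> H d}" for d
    have HH': "H \<le> H'"
      unfolding H'_def le_fun_def using Hd(3) submD(2)[OF Hs] by blast
    have "fam \<Omega> Z B H'"
    proof (rule famI)
      fix d
      show "subgrp (H' d)"
        using Hd(1)[of d] S(3)[of d] by (auto simp: subgrp_def sc_diff H'_def)
      show "B d \<subseteq> H' d" using HH' Hd(2)[of d] by (auto simp: le_fun_def)
      show "H' d \<subseteq> Z d" by (auto simp: H'_def)
      fix \<sigma> \<tau> x assume op: "(\<sigma>, \<tau>) \<in> \<Omega>" and x: "x \<in> H' d"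
      from x have x': "x \<in> Z d" "\<And>t. t \<in> p \<Longrightarrow> t \<bullet> x \<in> H d" by (auto simp: H'_def)
      have "t \<bullet> \<tau> d x \<in> H (\<sigma> d)" if "t \<in> p" for t
        using Hd(4)[OF op x'(2)[OF that]] by (simp add: com[OF op])
      then show "\<tau> d x \<in> H' (\<sigma> d)" using S(6)[OF op x'(1)] by (simp add: H'_def)
    qed
    moreover have "finite {q. \<exists>d. assp (H' d) (B d) q}"
    proof (rule finite_subset)
      show "finite (insert p {q. \<exists>d. assp (H d) (B d) q})" using H(2) by simp
      show "{q. \<exists>d. assp (H' d) (B d) q} \<subseteq> insert p {q. \<exists>d. assp (H d) (B d) q}"
      proof (rule subsetI, rule ccontr)
        fix q assume "q \<in> {q. \<exists>d. assp (H' d) (B d) q}"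
        then obtain d where q: "assp (H' d) (B d) q" by blast
        assume "q \<notin> insert p {q. \<exists>d. assp (H d) (B d) q}"
        then have nex: "\<not> assp (H d) (B d) q" and qp: "q \<noteq> p" by auto
        from q have pq: "prime_id q" and "\<exists>y\<in>H' d. {t. t \<bullet> y \<in> B d} = q" by (simp_all only: assp_def)
        then obtain y where y: "y \<in> H' d" "{t. t \<bullet> y \<in> B d} = q" by blast
        \<comment> \<open>Multiplying \<open>y\<close> by \<open>s\<close> outside \<open>q\<close>
          does not change its annihilator, so \<open>s \<bullet> y\<close> in \<open>H d\<close>
          would make \<open>q\<close> an associated prime of \<open>H d\<close> modulo
          \<open>B d\<close>, contrary to the choice of \<open>q\<close>.\<close>
        have "s \<bullet> y \<notin> H d" if "s \<notin> q" for s
        proof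
          assume sy: "s \<bullet> y \<in> H d"
          have "t \<bullet> s \<bullet> y \<in> B d \<longleftrightarrow> t \<in> q" for t
          proof -
            have "t \<bullet> s \<bullet> y \<in> B d \<longleftrightarrow> s * t \<in> q"
              unfolding y(2)[symmetric] by (simp add: sc_mult mult.commute[of s t])
            then show ?thesis using prime_idD(2)[OF pq] prime_idD(4)[OF pq _ that] by blast
          qed
          then have "{t. t \<bullet> s \<bullet> y \<in> B d} = q" by blast
          then have "assp (H d) (B d) q" unfolding assp_def using sy pq by blast
          with nex show False ..
        qed
        then have 1: "an d y \<subseteq> q" by (auto simp: an_def)
        have 2: "q \<subseteq> an d y" using y(2) Hd(2) by (auto simp: an_def)
        have "1 \<notin> an d y" using 1 prime_idD(3)[OF pq] by blast
        then have "y \<notin> H d" by (simp add: an_def)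
        moreover have "p \<subseteq> an d y" using y(1) by (auto simp: H'_def an_def)
        ultimately have "an d y = p" using y(1) by (intro max) (auto simp: H'_def)
        with 1 2 qp show False by simp
      qed
    qed
    ultimately have "H' = H" using Hmax HH' by blast
    moreover have "x1 \<in> H' d1" using x1(2) by (simp add: H'_def p_def an_def)
    ultimately show False using x1(3) by simp
  qed
  then show ?thesis using H(2) by simp
qed

end

section \<open>Complexes of free modules over a complete intersection\<close>

definition idl :: "'t::comm_ring_1 set \<Rightarrow> bool" where
  "idl I \<longleftrightarrow> subgrp I \<and> (\<forall>s. \<forall>t\<in>I. s * t \<in> I)"

lemma idlD: "idl I \<Longrightarrow> subgrp I" "idl I \<Longrightarrow> t \<in> I \<Longrightarrow> s * t \<in> I" "idl I \<Longrightarrow> t \<in> I \<Longrightarrow> t * s \<in> I"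
  by (auto simp: idl_def mult.commute)

text \<open>The recursion exposes a multiple of the last element, which suits arguments that remove
  one equation; \<open>Jk_iff\<close> gives the form as a sum.\<close>

primrec Jk :: "'t::comm_ring_1 set \<Rightarrow> (nat \<Rightarrow> 't) \<Rightarrow> nat \<Rightarrow> 't set" where
  "Jk T0 f 0 = T0"
| "Jk T0 f (Suc c) = {x. \<exists>y. x - f c * y \<in> Jk T0 f c}"

definition reg :: "'t::comm_ring_1 set \<Rightarrow> (nat \<Rightarrow> 't) \<Rightarrow> nat \<Rightarrow> bool" where
  "reg T0 f c \<longleftrightarrow> (\<forall>k<c. \<forall>x. f k * x \<in> Jk T0 f k \<longrightarrow> x \<in> Jk T0 f k)"

lemma idl_Jk: "idl T0 \<Longrightarrow> idl (Jk T0 f c)"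
proof (induction c)
  case (Suc c)
  then have I: "idl (Jk T0 f c)" by simp
  show ?case unfolding idl_def subgrp_def
  proof (intro conjI ballI allI)
    show "0 \<in> Jk T0 f (Suc c)" using subgrp_0[OF idlD(1)[OF I]] by (auto intro!: exI[of _ 0])
    fix s t assume "t \<in> Jk T0 f (Suc c)"
    then obtain y where y: "t - f c * y \<in> Jk T0 f c" by auto
    then have "s * (t - f c * y) \<in> Jk T0 f c" by (rule idlD(2)[OF I])
    then show "s * t \<in> Jk T0 f (Suc c)" by (auto intro!: exI[of _ "s * y"] simp: algebra_simps)
    fix s' assume "s' \<in> Jk T0 f (Suc c)"
    then obtain y' where y': "s' - f c * y' \<in> Jk T0 f c" by auto
    from subgrp_diff[OF idlD(1)[OF I] y y'] show "t - s' \<in> Jk T0 f (Suc c)"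
      by (auto intro!: exI[of _ "y - y'"] simp: algebra_simps)
  qed
qed simp

lemma Jk_mono:
  assumes "idl T0" "c \<le> c'" shows "Jk T0 f c \<subseteq> Jk T0 f c'"
  using assms(2)
proof (induction c' rule: dec_induct)
  case (step n)
  have "Jk T0 f n \<subseteq> Jk T0 f (Suc n)" by (fastforce intro: exI[of _ 0])
  with step show ?case by blast
qed simp

lemma Jk_gen: "idl T0 \<Longrightarrow> j < c \<Longrightarrow> f j \<in> Jk T0 f c"
proof -
  assume *: "idl T0" "j < c"
  have "f j \<in> Jk T0 f (Suc j)"
    using subgrp_0[OF idlD(1)[OF idl_Jk[OF *(1)]]] by (auto intro!: exI[of _ 1])
  then show ?thesis using Jk_mono[OF *(1), of "Suc j" c f] * by auto
qed

lemma Jk_iff: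
  assumes "idl T0"
  shows "x \<in> Jk T0 f c \<longleftrightarrow> (\<exists>s. x - (\<Sum>j<c. f j * s j) \<in> T0)"
proof
  assume "x \<in> Jk T0 f c"
  then show "\<exists>s. x - (\<Sum>j<c. f j * s j) \<in> T0"
  proof (induction c arbitrary: x)
    case (Suc c)
    then obtain y s where "x - f c * y - (\<Sum>j<c. f j * s j) \<in> T0" by fastforce
    then show ?case by (intro exI[of _ "s(c := y)"]) (simp add: algebra_simps)
  qed simp
next
  note I = idl_Jk[OF assms, of f c]
  assume "\<exists>s. x - (\<Sum>j<c. f j * s j) \<in> T0"
  then obtain s where s: "x - (\<Sum>j<c. f j * s j) \<in> T0" by blast
  have "(\<Sum>j<c. f j * s j) \<in> Jk T0 f c"
    using Jk_gen[OF assms] by (intro subgrp_sum idlD(3)[OF I] idlD(1)[OF I]) auto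
  moreover have "x - (\<Sum>j<c. f j * s j) \<in> Jk T0 f c" using Jk_mono[OF assms, of 0 c f] s by auto
  ultimately show "x \<in> Jk T0 f c" using subgrp_add[OF idlD(1)[OF I]] by fastforce
qed

text \<open>For the last coefficient the preceding elements suffice. This sharper bound yields the
  homotopies over one equation less in \<open>cohomology_noeth\<close>.\<close>

lemma reg_relation_last:
  assumes "idl T0" "reg T0 f c" "(\<Sum>j<Suc k. f j * B j) \<in> T0" "k < c"
  shows "B k \<in> Jk T0 f k"
proof -
  have "f k * B k - (\<Sum>j<k. f j * (- B j)) \<in> T0" using assms(3) by (simp add: sum_negf add.commute)
  then have "f k * B k \<in> Jk T0 f k" using Jk_iff[OF assms(1), of "f k * B k" f k] by (auto intro!: exI[of _ "\<lambda>j. - B j"])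
  then show ?thesis using assms(2,4) by (auto simp: reg_def)
qed

text \<open>Write the last coefficient as a combination of the earlier elements and subtract the
  corresponding trivial relations. The result is a relation of the shorter sequence whose
  coefficients differ from the old ones by multiples of the last element.\<close>

lemma reg_relation:
  assumes "idl T0" "reg T0 f c" "(\<Sum>j<c. f j * B j) \<in> T0" "j < c"
  shows "B j \<in> Jk T0 f c"
  using assms(2-4)
proof (induction c arbitrary: B j)
  case (Suc c)
  have r: "reg T0 f c" using Suc.prems(1) by (auto simp: reg_def)
  have Bc: "B c \<in> Jk T0 f c" by (rule reg_relation_last[OF assms(1) Suc.prems(1,2)]) simp
  then obtain h where h: "B c - (\<Sum>j<c. f j * h j) \<in> T0" using Jk_iff[OF assms(1)] by blast
  have "(\<Sum>j<Suc c. f j * B j) - f c * (B c - (\<Sum>j<c. f j * h j)) \<in> T0"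
    by (intro subgrp_diff idlD(2)[OF assms(1)] h Suc.prems(2) idlD(1)[OF assms(1)])
  also have "(\<Sum>j<Suc c. f j * B j) - f c * (B c - (\<Sum>j<c. f j * h j)) = (\<Sum>j<c. f j * (B j + f c * h j))"
    by (simp add: algebra_simps sum.distrib sum_distrib_left)
  finally have IH: "j < c \<Longrightarrow> B j + f c * h j \<in> Jk T0 f c" for j by (intro Suc.IH[OF r])
  show ?case
  proof (cases "j = c")
    case True
    then show ?thesis using Bc Jk_mono[OF assms(1), of c "Suc c" f] by auto
  next
    case False
    then have "j < c" using Suc.prems(3) by simp
    from IH[OF this] show ?thesis by (auto intro!: exI[of _ "- h j"])
  qed
qed simp

definition mm :: "nat set \<Rightarrow> (nat \<Rightarrow> nat \<Rightarrow> 't::comm_ring_1) \<Rightarrow> (nat \<Rightarrow> nat \<Rightarrow> 't) \<Rightarrow> nat \<Rightarrow> nat \<Rightarrow> 't" where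
  "mm \<beta> m m' b k = (\<Sum>l\<in>\<beta>. m b l * m' l k)"

text \<open>A complex of free modules modulo $T_0 + (f_0, \ldots, f_{c-1})$: \<open>\<beta> i\<close> is a basis in degree $i$, the
  matrix \<open>D i\<close> maps degree $i + 1$ to degree $i$, and the lifted differentials satisfy
  $D_i D_{i+1} = \sum_{j<c} f_j S_{j,i}$ modulo $T_0$. In \<open>exact\<close> the set \<open>\<K>\<close> holds the relations between
  the generators of the resolved module, and \<open>\<rho>\<close> matches these generators with \<open>\<beta> 0\<close>.\<close>

definition cdata :: "'t::comm_ring_1 set \<Rightarrow> (nat \<Rightarrow> 't) \<Rightarrow> nat \<Rightarrow> (int \<Rightarrow> nat set) \<Rightarrow> (int \<Rightarrow> nat \<Rightarrow> nat \<Rightarrow> 't) \<Rightarrow>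
    (nat \<Rightarrow> int \<Rightarrow> nat \<Rightarrow> nat \<Rightarrow> 't) \<Rightarrow> bool" where
  "cdata T0 f c \<beta> D S \<longleftrightarrow> (\<forall>i. finite (\<beta> i)) \<and> (\<forall>i<0. \<beta> i = {}) \<and>
     (\<forall>i. \<forall>b\<in>\<beta> i. \<forall>k\<in>\<beta> (i + 2). mm (\<beta> (i + 1)) (D i) (D (i + 1)) b k - (\<Sum>j<c. f j * S j i b k) \<in> T0)"

definition exact :: "'t::comm_ring_1 set \<Rightarrow> (nat \<Rightarrow> 't) set \<Rightarrow> (int \<Rightarrow> nat set) \<Rightarrow> (int \<Rightarrow> nat \<Rightarrow> nat \<Rightarrow> 't) \<Rightarrow> (nat \<Rightarrow> nat) \<Rightarrow> bool" where
  "exact J \<K> \<beta> D \<rho> \<longleftrightarrow>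
    (\<forall>i>0. \<forall>v. (\<forall>b\<in>\<beta> (i - 1). (\<Sum>k\<in>\<beta> i. D (i - 1) b k * v k) \<in> J) \<longrightarrow>
       (\<exists>w. \<forall>k\<in>\<beta> i. v k - (\<Sum>l\<in>\<beta> (i + 1). D i k l * w l) \<in> J)) \<and>
    (\<forall>v. (\<lambda>b. v (\<rho> b)) \<in> \<K> \<longleftrightarrow> (\<exists>w. \<forall>k\<in>\<beta> 0. v k - (\<Sum>l\<in>\<beta> 1. D 0 k l * w l) \<in> J))"

lemma cdataD:
  assumes "cdata T0 f c \<beta> D S"
  shows "finite (\<beta> i)" "i < 0 \<Longrightarrow> \<beta> i = {}"
    "b \<in> \<beta> i \<Longrightarrow> k \<in> \<beta> (i + 2) \<Longrightarrow> mm (\<beta> (i + 1)) (D i) (D (i + 1)) b k - (\<Sum>j<c. f j * S j i b k) \<in> T0"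
  using assms by (auto simp: cdata_def)

lemma mm_assoc: "mm \<beta>' (mm \<beta> m m') m'' = mm \<beta> m (mm \<beta>' m' m'')"
proof (intro ext)
  fix b k
  have "mm \<beta>' (mm \<beta> m m') m'' b k = (\<Sum>l\<in>\<beta>'. \<Sum>l'\<in>\<beta>. m b l' * m' l' l * m'' l k)"
    by (simp add: mm_def sum_distrib_right)
  also have "\<dots> = (\<Sum>l'\<in>\<beta>. \<Sum>l\<in>\<beta>'. m b l' * m' l' l * m'' l k)" by (rule sum.swap)
  also have "\<dots> = mm \<beta> m (mm \<beta>' m' m'') b k"
    by (simp add: mm_def sum_distrib_left mult.assoc)
  finally show "mm \<beta>' (mm \<beta> m m') m'' b k = mm \<beta> m (mm \<beta>' m' m'') b k" .
qed

text \<open>Bracket the product of three consecutive lifted differentials in both ways and compare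
  the two expressions in the \<open>S j\<close>.\<close>

lemma commutator_sum:
  assumes T0: "idl T0" and cd: "cdata T0 f c \<beta> D S" and b: "b \<in> \<beta> i" and k: "k \<in> \<beta> (i + 3)"
  shows "(\<Sum>j<c. f j * (mm (\<beta> (i + 1)) (D i) (S j (i + 1)) b k - mm (\<beta> (i + 2)) (S j i) (D (i + 2)) b k)) \<in> T0"
proof -
  note C = cdataD[OF cd]
  let ?b1 = "\<beta> (i + 1)" and ?b2 = "\<beta> (i + 2)"
  have e: "i + 1 + 1 = i + 2" "i + 1 + 2 = i + 3" by simp_all
  have 1: "mm ?b2 (mm ?b1 (D i) (D (i + 1))) (D (i + 2)) b k - (\<Sum>l\<in>?b2. (\<Sum>j<c. f j * S j i b l) * D (i + 2) l k) \<in> T0"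
  proof -
    have "(\<Sum>l\<in>?b2. (mm ?b1 (D i) (D (i + 1)) b l - (\<Sum>j<c. f j * S j i b l)) * D (i + 2) l k) \<in> T0"
      using C(3)[OF b] by (intro subgrp_sum idlD(1)[OF T0] idlD(3)[OF T0])
    then show ?thesis by (simp add: mm_def[of ?b2] left_diff_distrib sum_subtractf)
  qed
  have 2: "mm ?b1 (D i) (mm ?b2 (D (i + 1)) (D (i + 2))) b k - (\<Sum>l\<in>?b1. D i b l * (\<Sum>j<c. f j * S j (i + 1) l k)) \<in> T0"
  proof -
    have "(\<Sum>l\<in>?b1. D i b l * (mm ?b2 (D (i + 1)) (D (i + 2)) l k - (\<Sum>j<c. f j * S j (i + 1) l k))) \<in> T0"
      using C(3)[of _ "i + 1" k] k unfolding e
      by (intro subgrp_sum idlD(1)[OF T0] idlD(2)[OF T0]) (simp add: add.commute)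
    then show ?thesis by (simp add: mm_def[of ?b1] right_diff_distrib sum_subtractf)
  qed
  have 3: "(\<Sum>l\<in>?b2. (\<Sum>j<c. f j * S j i b l) * D (i + 2) l k) = (\<Sum>j<c. f j * mm ?b2 (S j i) (D (i + 2)) b k)"
    unfolding mm_def sum_distrib_left sum_distrib_right by (subst sum.swap) (simp add: mult.assoc)
  have 4: "(\<Sum>l\<in>?b1. D i b l * (\<Sum>j<c. f j * S j (i + 1) l k)) = (\<Sum>j<c. f j * mm ?b1 (D i) (S j (i + 1)) b k)"
    unfolding mm_def sum_distrib_left sum_distrib_right by (subst sum.swap) (simp add: mult.left_commute)
  show ?thesis
    using subgrp_diff[OF idlD(1)[OF T0] 1 2] unfolding mm_assoc 3 4
    by (simp add: right_diff_distrib sum_subtractf)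
qed

text \<open>The operators are chain maps modulo the sequence, since a relation among its elements
  has coefficients in the ideal they generate.\<close>

lemma commutator:
  assumes "idl T0" "reg T0 f c" "cdata T0 f c \<beta> D S" "b \<in> \<beta> i" "k \<in> \<beta> (i + 3)" "j < c"
  shows "mm (\<beta> (i + 1)) (D i) (S j (i + 1)) b k - mm (\<beta> (i + 2)) (S j i) (D (i + 2)) b k \<in> Jk T0 f c"
  by (rule reg_relation[OF assms(1,2) commutator_sum[OF assms(1,3-5)] assms(6)])

subsection \<open>Passing to one equation less\<close>

text \<open>The cone of $S_c$ is a complex for the remaining equations: even basis elements belong to $F$,
  odd ones to $F$ shifted by one.\<close>

definition bE :: "(int \<Rightarrow> nat set) \<Rightarrow> int \<Rightarrow> nat set" where
  "bE \<beta> i = (\<lambda>b. 2 * b) ` \<beta> i \<union> (\<lambda>b. 2 * b + 1) ` \<beta> (i - 1)"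

text \<open>As a block matrix this is [[D, g], [-Sc, -D]]. With \<open>g = f c\<close> the term
  \<open>f c * S c\<close> of \<open>D D\<close> cancels in both diagonal blocks, which is how one
  equation disappears.\<close>

definition DE :: "'t::comm_ring_1 \<Rightarrow> (int \<Rightarrow> nat \<Rightarrow> nat \<Rightarrow> 't) \<Rightarrow> (int \<Rightarrow> nat \<Rightarrow> nat \<Rightarrow> 't) \<Rightarrow> int \<Rightarrow> nat \<Rightarrow> nat \<Rightarrow> 't" where
  "DE g D Sc i b k = (if even b
     then (if even k then D i (b div 2) (k div 2) else if b div 2 = k div 2 then g else 0)
     else (if even k then - Sc (i - 1) (b div 2) (k div 2) else - D (i - 1) (b div 2) (k div 2)))"

text \<open>Each remaining operator acts by \<open>S j\<close> on both copies of F. The corner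
  \<open>U j\<close> is the coefficient of \<open>f j\<close> in the commutator of the differential
  with \<open>S c\<close>.\<close>

definition SE :: "(nat \<Rightarrow> int \<Rightarrow> nat \<Rightarrow> nat \<Rightarrow> 't::comm_ring_1) \<Rightarrow> (nat \<Rightarrow> int \<Rightarrow> nat \<Rightarrow> nat \<Rightarrow> 't) \<Rightarrow> nat \<Rightarrow> int \<Rightarrow> nat \<Rightarrow> nat \<Rightarrow> 't" where
  "SE S U j i b k = (if even b then (if even k then S j i (b div 2) (k div 2) else 0)
     else (if even k then U j i (b div 2) (k div 2) else S j (i - 1) (b div 2) (k div 2)))"

lemma sum_bE:
  assumes "\<And>i. finite (\<beta> i)"
  shows "sum h (bE \<beta> i) = (\<Sum>l\<in>\<beta> i. h (2 * l)) + (\<Sum>l\<in>\<beta> (i - 1). h (2 * l + 1))"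
proof -
  have "(\<lambda>b. 2 * b) ` \<beta> i \<inter> (\<lambda>b. 2 * b + 1) ` \<beta> (i - 1) = {}"
    by (auto dest: arg_cong[where f = even])
  then have "sum h (bE \<beta> i) = sum h ((\<lambda>b. 2 * b) ` \<beta> i) + sum h ((\<lambda>b. 2 * b + 1) ` \<beta> (i - 1))"
    unfolding bE_def using assms by (intro sum.union_disjoint) auto
  also have "sum h ((\<lambda>b. 2 * b) ` \<beta> i) = (\<Sum>l\<in>\<beta> i. h (2 * l))"
    by (subst sum.reindex) (auto simp: inj_on_def)
  also have "sum h ((\<lambda>b. 2 * b + 1) ` \<beta> (i - 1)) = (\<Sum>l\<in>\<beta> (i - 1). h (2 * l + 1))"
    by (subst sum.reindex) (auto simp: inj_on_def)
  finally show ?thesis .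
qed

lemma finite_bE: "(\<And>i. finite (\<beta> i)) \<Longrightarrow> finite (bE \<beta> i)"
  by (simp add: bE_def)

lemma bE_iff: "2 * b \<in> bE \<beta> i \<longleftrightarrow> b \<in> \<beta> i" "2 * b + 1 \<in> bE \<beta> i \<longleftrightarrow> b \<in> \<beta> (i - 1)"
  "Suc (2 * b) \<in> bE \<beta> i \<longleftrightarrow> b \<in> \<beta> (i - 1)"
  unfolding bE_def by (auto simp: image_iff dest: arg_cong[where f = even])

lemma bE_cases:
  assumes "b \<in> bE \<beta> i"
  obtains b' where "b = 2 * b'" "b' \<in> \<beta> i" | b' where "b = 2 * b' + 1" "b' \<in> \<beta> (i - 1)"
  using assms unfolding bE_def by blast

lemma DE_simps:
  "DE g D Sc i (2 * b) (2 * k) = D i b k"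
  "DE g D Sc i (2 * b) (Suc (2 * k)) = (if b = k then g else 0)"
  "DE g D Sc i (Suc (2 * b)) (2 * k) = - Sc (i - 1) b k"
  "DE g D Sc i (Suc (2 * b)) (Suc (2 * k)) = - D (i - 1) b k"
  by (simp_all add: DE_def)

lemma SE_simps:
  "SE S U j i (2 * b) (2 * k) = S j i b k"
  "SE S U j i (2 * b) (Suc (2 * k)) = 0"
  "SE S U j i (Suc (2 * b)) (2 * k) = U j i b k"
  "SE S U j i (Suc (2 * b)) (Suc (2 * k)) = S j (i - 1) b k"
  by (simp_all add: SE_def)

lemma sum_delta_mult:
  fixes h :: "nat \<Rightarrow> 't::comm_ring_1"
  assumes "finite A"
  shows "(\<Sum>l\<in>A. (if b = l then g else 0) * h l) = (if b \<in> A then g * h b else 0)"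
    "(\<Sum>l\<in>A. h l * (if l = b then g else 0)) = (if b \<in> A then h b * g else 0)"
proof -
  have "(\<Sum>l\<in>A. (if b = l then g else 0) * h l) = (\<Sum>l\<in>A. if b = l then g * h l else 0)"
    by (intro sum.cong) auto
  then show "(\<Sum>l\<in>A. (if b = l then g else 0) * h l) = (if b \<in> A then g * h b else 0)"
    using assms by simp
  have "(\<Sum>l\<in>A. h l * (if l = b then g else 0)) = (\<Sum>l\<in>A. if l = b then h l * g else 0)"
    by (intro sum.cong) auto
  then show "(\<Sum>l\<in>A. h l * (if l = b then g else 0)) = (if b \<in> A then h b * g else 0)"
    using assms by simp
qed

lemma cdata_E:
  assumes T0: "idl T0" and cd: "cdata T0 f (Suc c) \<beta> D S"
    and U: "\<And>i b k. b \<in> \<beta> (i - 1) \<Longrightarrow> k \<in> \<beta> (i + 2) \<Longrightarrow>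
      mm (\<beta> i) (D (i - 1)) (S c i) b k - mm (\<beta> (i + 1)) (S c (i - 1)) (D (i + 1)) b k
        - (\<Sum>j<c. f j * U j i b k) \<in> T0"
  shows "cdata T0 f c (bE \<beta>) (DE (f c) D (S c)) (SE S U)"
  unfolding cdata_def
proof (intro conjI allI impI ballI)
  note C = cdataD[OF cd]
  show "finite (bE \<beta> i)" for i using C(1) by (rule finite_bE)
  show "bE \<beta> i = {}" if "i < 0" for i using C(2) that by (simp add: bE_def)
  fix i b k assume b: "b \<in> bE \<beta> i" and k: "k \<in> bE \<beta> (i + 2)"
  show "mm (bE \<beta> (i + 1)) (DE (f c) D (S c) i) (DE (f c) D (S c) (i + 1)) b k - (\<Sum>j<c. f j * SE S U j i b k) \<in> T0"
    using b
  proof (cases rule: bE_cases)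
    case b: (1 b')
    show ?thesis using k
    proof (cases rule: bE_cases)
      case k: (1 k')
      show ?thesis using C(3)[OF b(2) k(2)] b k
        by (simp add: mm_def sum_bE[OF C(1)] DE_simps SE_simps sum_delta_mult C(1) sum_negf; simp add: algebra_simps)
    next
      case k: (2 k')
      show ?thesis using b k subgrp_0[OF idlD(1)[OF T0]]
        by (simp add: mm_def sum_bE[OF C(1)] DE_simps SE_simps sum_delta_mult C(1) sum_negf; simp add: algebra_simps)
    qed
  next
    case b: (2 b')
    show ?thesis using k
    proof (cases rule: bE_cases)
      case k: (1 k')
      show ?thesis using U[OF b(2) k(2)] b k
        by (simp add: mm_def sum_bE[OF C(1)] DE_simps SE_simps sum_negf; simp add: algebra_simps)
    next
      case k: (2 k')
      show ?thesis using C(3)[of b' "i - 1" k'] b k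
        by (simp add: mm_def sum_bE[OF C(1)] DE_simps SE_simps sum_delta_mult C(1) sum_negf; simp add: algebra_simps)
    qed
  qed
qed

text \<open>Modulo \<open>f c\<close> the even part of a cycle bounds by exactness of the old
  complex, and the error \<open>f c * w'\<close> supplies the odd part of a preimage. Cancelling the
  nonzerodivisor \<open>f c\<close> shows that this choice also matches the odd part of the
  cycle.\<close>

lemma exact_E:
  assumes T0: "idl T0" and rg: "reg T0 f (Suc c)" and cd: "cdata T0 f (Suc c) \<beta> D S"
    and ex: "exact (Jk T0 f (Suc c)) \<K> \<beta> D \<rho>"
  shows "exact (Jk T0 f c) \<K> (bE \<beta>) (DE (f c) D (S c)) (\<lambda>b. 2 * \<rho> b)"
  unfolding exact_def
proof (intro conjI allI impI)
  note C = cdataD[OF cd]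
  note I = idl_Jk[OF T0, of f c]
  note Ig = idlD(1)[OF I]
  fix i :: int and v assume i: "i > 0"
    and v: "\<forall>b\<in>bE \<beta> (i - 1). (\<Sum>k\<in>bE \<beta> i. DE (f c) D (S c) (i - 1) b k * v k) \<in> Jk T0 f c"
  define x y where "x l = v (2 * l)" and "y l = v (Suc (2 * l))" for l
  have 1: "(\<Sum>l\<in>\<beta> i. D (i - 1) b l * x l) + f c * y b \<in> Jk T0 f c" if "b \<in> \<beta> (i - 1)" for b
    using v[rule_format, of "2 * b"] that unfolding bE_iff
    by (simp add: sum_bE[OF C(1)] DE_simps sum_delta_mult C(1) x_def y_def)
  then have "(\<Sum>l\<in>\<beta> i. D (i - 1) b l * x l) \<in> Jk T0 f (Suc c)" if "b \<in> \<beta> (i - 1)" for b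
    using that by (auto intro!: exI[of _ "- y b"])
  then obtain w where "\<forall>k\<in>\<beta> i. x k - (\<Sum>l\<in>\<beta> (i + 1). D i k l * w l) \<in> Jk T0 f (Suc c)"
    using ex[unfolded exact_def] i by blast
  then have "\<forall>k. \<exists>y. k \<in> \<beta> i \<longrightarrow> x k - (\<Sum>l\<in>\<beta> (i + 1). D i k l * w l) - f c * y \<in> Jk T0 f c" by auto
  then obtain w' where w': "\<And>k. k \<in> \<beta> i \<Longrightarrow> x k - (\<Sum>l\<in>\<beta> (i + 1). D i k l * w l) - f c * w' k \<in> Jk T0 f c"
    by metis
  have y': "y b + (\<Sum>l\<in>\<beta> (i + 1). S c (i - 1) b l * w l) + (\<Sum>l\<in>\<beta> i. D (i - 1) b l * w' l) \<in> Jk T0 f c"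
    if b: "b \<in> \<beta> (i - 1)" for b
  proof -
    have "(\<Sum>k\<in>\<beta> i. D (i - 1) b k * (x k - (\<Sum>l\<in>\<beta> (i + 1). D i k l * w l) - f c * w' k)) \<in> Jk T0 f c"
      by (intro subgrp_sum Ig idlD(2)[OF I] w')
    also have "(\<Sum>k\<in>\<beta> i. D (i - 1) b k * (x k - (\<Sum>l\<in>\<beta> (i + 1). D i k l * w l) - f c * w' k))
      = (\<Sum>l\<in>\<beta> i. D (i - 1) b l * x l) - (\<Sum>l\<in>\<beta> (i + 1). mm (\<beta> i) (D (i - 1)) (D i) b l * w l)
        - f c * (\<Sum>l\<in>\<beta> i. D (i - 1) b l * w' l)"
    proof -
      have "(\<Sum>k\<in>\<beta> i. D (i - 1) b k * (\<Sum>l\<in>\<beta> (i + 1). D i k l * w l))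
         = (\<Sum>l\<in>\<beta> (i + 1). mm (\<beta> i) (D (i - 1)) (D i) b l * w l)"
        unfolding mm_def sum_distrib_left sum_distrib_right by (subst sum.swap) (simp add: mult.assoc)
      then show ?thesis
        by (simp add: right_diff_distrib sum_subtractf sum_distrib_left mult.left_commute)
    qed
    finally have 2: "(\<Sum>l\<in>\<beta> i. D (i - 1) b l * x l) - (\<Sum>l\<in>\<beta> (i + 1). mm (\<beta> i) (D (i - 1)) (D i) b l * w l)
        - f c * (\<Sum>l\<in>\<beta> i. D (i - 1) b l * w' l) \<in> Jk T0 f c" .
    have "(\<Sum>l\<in>\<beta> (i + 1). (mm (\<beta> i) (D (i - 1)) (D i) b l - f c * S c (i - 1) b l) * w l) \<in> Jk T0 f c"
    proof (intro subgrp_sum Ig idlD(3)[OF I])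
      fix l assume l: "l \<in> \<beta> (i + 1)"
      have "mm (\<beta> i) (D (i - 1)) (D i) b l - (\<Sum>j<Suc c. f j * S j (i - 1) b l) \<in> T0"
        using C(3)[OF b, of l] l by (simp add: add.commute)
      then show "mm (\<beta> i) (D (i - 1)) (D i) b l - f c * S c (i - 1) b l \<in> Jk T0 f c"
        using Jk_iff[OF T0] by (auto intro!: exI[of _ "\<lambda>j. S j (i - 1) b l"] simp: algebra_simps)
    qed
    then have 3: "(\<Sum>l\<in>\<beta> (i + 1). mm (\<beta> i) (D (i - 1)) (D i) b l * w l)
        - f c * (\<Sum>l\<in>\<beta> (i + 1). S c (i - 1) b l * w l) \<in> Jk T0 f c"
      by (simp add: left_diff_distrib sum_subtractf sum_distrib_left mult.assoc)
    \<comment> \<open>The relations \<open>1\<close>, \<open>2\<close> and \<open>3\<close> combine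
      to a multiple of \<open>f c\<close>; regularity then cancels this factor.\<close>
    have "f c * (y b + (\<Sum>l\<in>\<beta> (i + 1). S c (i - 1) b l * w l) + (\<Sum>l\<in>\<beta> i. D (i - 1) b l * w' l)) \<in> Jk T0 f c"
      using subgrp_diff[OF Ig subgrp_diff[OF Ig 1[OF b] 2] 3] by (simp add: algebra_simps)
    then show ?thesis using rg by (auto simp: reg_def)
  qed
  define u where "u k = (if even k then w (k div 2) else w' (k div 2))" for k
  have u: "u (2 * l) = w l" "u (Suc (2 * l)) = w' l" for l by (simp_all add: u_def)
  show "\<exists>w. \<forall>k\<in>bE \<beta> i. v k - (\<Sum>l\<in>bE \<beta> (i + 1). DE (f c) D (S c) i k l * w l) \<in> Jk T0 f c"
  proof (intro exI[of _ u] ballI)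
    fix k assume "k \<in> bE \<beta> i"
    then show "v k - (\<Sum>l\<in>bE \<beta> (i + 1). DE (f c) D (S c) i k l * u l) \<in> Jk T0 f c"
    proof (cases rule: bE_cases)
      case (1 b')
      then show ?thesis using w'[of b']
        by (simp add: sum_bE[OF C(1)] DE_simps sum_delta_mult C(1) u x_def; simp add: algebra_simps)
    next
      case (2 b')
      then show ?thesis using y'[of b']
        by (simp add: sum_bE[OF C(1)] DE_simps u y_def sum_negf; simp add: algebra_simps)
    qed
  qed
next
  note C = cdataD[OF cd]
  have m1: "\<beta> (- 1) = {}" using C(2) by simp
  fix v
  have "(\<lambda>b. v (2 * \<rho> b)) \<in> \<K> \<longleftrightarrow> (\<exists>w. \<forall>k\<in>\<beta> 0. v (2 * k) - (\<Sum>l\<in>\<beta> 1. D 0 k l * w l) \<in> Jk T0 f (Suc c))"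
    using ex[unfolded exact_def] by (auto dest!: spec[of _ "\<lambda>b. v (2 * b)"])
  also have "\<dots> \<longleftrightarrow> (\<exists>w. \<forall>k\<in>\<beta> 0. \<exists>y. v (2 * k) - (\<Sum>l\<in>\<beta> 1. D 0 k l * w l) - f c * y \<in> Jk T0 f c)" by simp
  \<comment> \<open>The multiples of \<open>f c\<close> that witness membership in
    \<open>Jk T0 f (Suc c)\<close> are chosen for each \<open>k\<close> and become the odd part of
    the preimage.\<close>
  also have "\<dots> \<longleftrightarrow> (\<exists>w w'. \<forall>k\<in>\<beta> 0. v (2 * k) - (\<Sum>l\<in>\<beta> 1. D 0 k l * w l) - f c * w' k \<in> Jk T0 f c)"
    by (simp only: bchoice_iff)
  also have "\<dots> \<longleftrightarrow> (\<exists>w. \<forall>k\<in>bE \<beta> 0. v k - (\<Sum>l\<in>bE \<beta> 1. DE (f c) D (S c) 0 k l * w l) \<in> Jk T0 f c)"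
    (is "_ \<longleftrightarrow> ?R")
  proof
    assume "\<exists>w w'. \<forall>k\<in>\<beta> 0. v (2 * k) - (\<Sum>l\<in>\<beta> 1. D 0 k l * w l) - f c * w' k \<in> Jk T0 f c"
    then obtain w w' where w: "\<forall>k\<in>\<beta> 0. v (2 * k) - (\<Sum>l\<in>\<beta> 1. D 0 k l * w l) - f c * w' k \<in> Jk T0 f c" by blast
    define u where "u k = (if even k then w (k div 2) else w' (k div 2))" for k
    have u: "u (2 * l) = w l" "u (Suc (2 * l)) = w' l" for l by (simp_all add: u_def)
    show ?R
    proof (intro exI[of _ u] ballI)
      fix k assume "k \<in> bE \<beta> 0"
      then show "v k - (\<Sum>l\<in>bE \<beta> 1. DE (f c) D (S c) 0 k l * u l) \<in> Jk T0 f c"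
      proof (cases rule: bE_cases)
        case (1 b')
        then show ?thesis using w[rule_format, of b']
          by (simp add: sum_bE[OF C(1)] DE_simps sum_delta_mult C(1) u; simp add: algebra_simps)
      qed (simp add: m1)
    qed
  next
    assume ?R
    then obtain w where w: "\<forall>k\<in>bE \<beta> 0. v k - (\<Sum>l\<in>bE \<beta> 1. DE (f c) D (S c) 0 k l * w l) \<in> Jk T0 f c" by blast
    show "\<exists>w w'. \<forall>k\<in>\<beta> 0. v (2 * k) - (\<Sum>l\<in>\<beta> 1. D 0 k l * w l) - f c * w' k \<in> Jk T0 f c"
    proof (intro exI ballI)
      fix k assume k: "k \<in> \<beta> 0"
      show "v (2 * k) - (\<Sum>l\<in>\<beta> 1. D 0 k l * w (2 * l)) - f c * w (Suc (2 * k)) \<in> Jk T0 f c"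
        using w[rule_format, of "2 * k"] k
        by (simp add: bE_iff sum_bE[OF C(1)] DE_simps sum_delta_mult C(1); simp add: algebra_simps)
    qed
  qed
  finally show "(\<lambda>b. v (2 * \<rho> b)) \<in> \<K> \<longleftrightarrow> (\<exists>w. \<forall>k\<in>bE \<beta> 0. v k - (\<Sum>l\<in>bE \<beta> 1. DE (f c) D (S c) 0 k l * w l) \<in> Jk T0 f c)" .
qed

subsection \<open>Cohomology with coefficients\<close>

text \<open>Coordinates outside the basis are left free. Tuples that differ only there agree modulo
  every \<open>Cb \<beta> W\<close> with \<open>0\<close> in \<open>W\<close>, so no support
  condition has to be carried along.\<close>

definition Cb :: "nat set \<Rightarrow> 'p set \<Rightarrow> (nat \<Rightarrow> 'p) set" where
  "Cb \<beta> W = {x. \<forall>b\<in>\<beta>. x b \<in> W}"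

lemma CbI: "(\<And>b. b \<in> \<beta> \<Longrightarrow> x b \<in> W) \<Longrightarrow> x \<in> Cb \<beta> W"
  and CbD: "x \<in> Cb \<beta> W \<Longrightarrow> b \<in> \<beta> \<Longrightarrow> x b \<in> W"
  by (auto simp: Cb_def)

lemma Cb_mono: "W \<subseteq> W' \<Longrightarrow> Cb \<beta> W \<subseteq> Cb \<beta> W'"
  by (auto simp: Cb_def)

lemma subgrp_cancel: "subgrp W \<Longrightarrow> x - y \<in> W \<Longrightarrow> y \<in> W \<Longrightarrow> x \<in> W"
  using subgrp_add[of W "x - y" y] by simp

lemma subgrp_cancel': "subgrp W \<Longrightarrow> x - y \<in> W \<Longrightarrow> x \<in> W \<Longrightarrow> y \<in> W"
  using subgrp_diff[of W x "x - y"] by simp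

lemma subgrp_Cb: "subgrp W \<Longrightarrow> subgrp (Cb \<beta> W)"
  by (auto simp: subgrp_def Cb_def)

text \<open>A degree is a pair of filtration index and cohomological degree. \<open>sA\<close>
  belongs to elements of the ideal, \<open>sT\<close> to Eisenbud operators. The second component is
  an integer so that \<open>i - 1\<close> and negative degrees fit into the same formulas.\<close>

definition sA :: "nat \<times> int \<Rightarrow> nat \<times> int" where "sA d = (Suc (fst d), snd d)"
definition sT :: "nat \<times> int \<Rightarrow> nat \<times> int" where "sT d = (fst d, snd d + 2)"

lemma sA_simp [simp]: "sA (n, i) = (Suc n, i)" and sT_simp [simp]: "sT (n, i) = (n, i + 2)"
  by (simp_all add: sA_def sT_def)

context scal
begin

definition vsc :: "'t \<Rightarrow> (nat \<Rightarrow> 'p) \<Rightarrow> nat \<Rightarrow> 'p" where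
  "vsc t x = (\<lambda>b. t \<bullet> x b)"

lemma scal_vsc: "scal vsc"
  by unfold_locales (auto simp: vsc_def sc_add sc_plus sc_mult)

interpretation V: scal vsc by (rule scal_vsc)

text \<open>A cochain is the tuple of its values on the basis, so composition with a matrix acts
  through the transpose; hence the reversed order in \<open>act_act\<close>.\<close>

definition act :: "nat set \<Rightarrow> (nat \<Rightarrow> nat \<Rightarrow> 't) \<Rightarrow> (nat \<Rightarrow> 'p) \<Rightarrow> nat \<Rightarrow> 'p" where
  "act \<beta> m x = (\<lambda>k. \<Sum>b\<in>\<beta>. m b k \<bullet> x b)"

lemma act_diff: "act \<beta> m (x - y) = act \<beta> m x - act \<beta> m y"
  by (auto simp: act_def sc_diff sum_subtractf)

lemma act_0 [simp]: "act \<beta> m 0 = 0"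
  by (auto simp: act_def)

lemma act_vsc: "act \<beta> m (vsc t x) = vsc t (act \<beta> m x)"
  by (auto simp: act_def vsc_def sc_sum sc_left_commute[of t])

lemma act_act: "act \<beta>' m' (act \<beta> m x) = act \<beta> (mm \<beta>' m m') x"
proof
  fix k
  have "act \<beta>' m' (act \<beta> m x) k = (\<Sum>l\<in>\<beta>'. \<Sum>b\<in>\<beta>. (m b l * m' l k) \<bullet> x b)"
    by (simp add: act_def sc_sum sc_mult sc_left_commute)
  also have "\<dots> = (\<Sum>b\<in>\<beta>. \<Sum>l\<in>\<beta>'. (m b l * m' l k) \<bullet> x b)" by (rule sum.swap)
  also have "\<dots> = act \<beta> (mm \<beta>' m m') x k" by (simp add: act_def mm_def sc_sum')
  finally show "act \<beta>' m' (act \<beta> m x) k = act \<beta> (mm \<beta>' m m') x k" .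
qed

lemma act_in:
  assumes "subgrp W'" "\<And>t x. t \<in> J \<Longrightarrow> x \<in> W \<Longrightarrow> t \<bullet> x \<in> W'" "x \<in> Cb \<beta> W"
    "\<And>b k. b \<in> \<beta> \<Longrightarrow> k \<in> \<gamma> \<Longrightarrow> m b k \<in> J"
  shows "act \<beta> m x \<in> Cb \<gamma> W'"
  unfolding act_def by (intro CbI subgrp_sum assms(1,2)) (use assms in \<open>auto simp: Cb_def\<close>)

lemma act_subm: "subm W \<Longrightarrow> x \<in> Cb \<beta> W \<Longrightarrow> act \<beta> m x \<in> Cb \<gamma> W"
  by (rule act_in[of W UNIV W]) (auto simp: subm_def)

lemma act_diff_mat: "act \<beta> m x - act \<beta> m' x = act \<beta> (\<lambda>b k. m b k - m' b k) x"
  by (auto simp: act_def sc_diff' sum_subtractf)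

lemma subm_Cb: "subm W \<Longrightarrow> V.subm (Cb \<beta> W)"
  unfolding V.subm_def subm_def by (auto simp: subgrp_Cb) (auto simp: Cb_def vsc_def)

definition \<Theta>A :: "'t set \<Rightarrow> ('d \<Rightarrow> (nat \<Rightarrow> 'p) \<Rightarrow> nat \<Rightarrow> 'p) set" where
  "\<Theta>A a = (\<lambda>t d. vsc t) ` a"

definition \<Theta>T :: "nat \<Rightarrow> (int \<Rightarrow> nat set) \<Rightarrow> (nat \<Rightarrow> int \<Rightarrow> nat \<Rightarrow> nat \<Rightarrow> 't) \<Rightarrow> (nat \<times> int \<Rightarrow> (nat \<Rightarrow> 'p) \<Rightarrow> nat \<Rightarrow> 'p) set" where
  "\<Theta>T c \<beta> S = (\<lambda>j d. act (\<beta> (snd d)) (S j (snd d))) ` {..<c}"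

definition Om :: "'t set \<Rightarrow> nat \<Rightarrow> (int \<Rightarrow> nat set) \<Rightarrow> (nat \<Rightarrow> int \<Rightarrow> nat \<Rightarrow> nat \<Rightarrow> 't) \<Rightarrow> (nat \<times> int, nat \<Rightarrow> 'p) oper set" where
  "Om a c \<beta> S = V.scops \<union> Pair sA ` \<Theta>A a \<union> Pair sT ` \<Theta>T c \<beta> S"

lemma Om_cases:
  assumes "(\<sigma>, \<tau>) \<in> Om a c \<beta> S"
  obtains t where "\<sigma> = (\<lambda>d. d)" "\<tau> = (\<lambda>d. vsc t)"
  | t where "t \<in> a" "\<sigma> = sA" "\<tau> = (\<lambda>d. vsc t)"
  | j where "j < c" "\<sigma> = sT" "\<tau> = (\<lambda>d. act (\<beta> (snd d)) (S j (snd d)))"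
  using assms unfolding Om_def V.scops_def \<Theta>A_def \<Theta>T_def by blast

lemma Om_I:
  "(\<lambda>d. d, \<lambda>d. vsc t) \<in> Om a c \<beta> S"
  "t \<in> a \<Longrightarrow> (sA, \<lambda>d. vsc t) \<in> Om a c \<beta> S"
  "j < c \<Longrightarrow> (sT, \<lambda>d. act (\<beta> (snd d)) (S j (snd d))) \<in> Om a c \<beta> S"
  unfolding Om_def V.scops_def \<Theta>A_def \<Theta>T_def by blast+

lemma Om_additive: "(\<sigma>, \<tau>) \<in> Om a c \<beta> S \<Longrightarrow> \<tau> d (x - y) = \<tau> d x - \<tau> d y"
  by (erule Om_cases) (auto simp: V.sc_diff act_diff)

lemma Om_vsc: "(\<sigma>, \<tau>) \<in> Om a c \<beta> S \<Longrightarrow> \<tau> d (vsc t x) = vsc t (\<tau> d x)"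
  by (erule Om_cases) (simp_all add: V.sc_left_commute[of t] act_vsc)

lemma Om_Suc: "Om a (Suc c) \<beta> S = insert (sT, \<lambda>d. act (\<beta> (snd d)) (S c (snd d))) (Om a c \<beta> S)"
  unfolding Om_def \<Theta>T_def lessThan_Suc by simp

lemma fam_OmI:
  assumes "\<And>d. V.subm (W d)" "\<And>d. B d \<subseteq> W d" "\<And>d. W d \<subseteq> Z d"
    "\<And>n i t x. t \<in> a \<Longrightarrow> x \<in> W (n, i) \<Longrightarrow> vsc t x \<in> W (Suc n, i)"
    "\<And>n i j x. j < c \<Longrightarrow> x \<in> W (n, i) \<Longrightarrow> act (\<beta> i) (S j i) x \<in> W (n, i + 2)"
  shows "fam (Om a c \<beta> S) Z B W"
proof (rule famI)
  fix d show "subgrp (W d)" "B d \<subseteq> W d" "W d \<subseteq> Z d" using assms(1-3) V.submD(1) by auto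
  fix \<sigma> \<tau> x assume "(\<sigma>, \<tau>) \<in> Om a c \<beta> S" and x: "x \<in> W d"
  then show "\<tau> d x \<in> W (\<sigma> d)"
    by (cases rule: Om_cases; cases d) (use assms(4,5) V.submD(2)[OF assms(1)] in \<open>auto\<close>)
qed

lemma fam_OmD:
  assumes "fam (Om a c \<beta> S) Z B W"
  shows "V.subm (W d)" "B d \<subseteq> W d" "W d \<subseteq> Z d"
    "t \<in> a \<Longrightarrow> x \<in> W (n, i) \<Longrightarrow> vsc t x \<in> W (Suc n, i)"
    "j < c \<Longrightarrow> x \<in> W (n, i) \<Longrightarrow> act (\<beta> i) (S j i) x \<in> W (n, i + 2)"
proof -
  show "V.subm (W d)" by (rule V.subm_fam[OF assms]) (auto simp: Om_def)
  show "B d \<subseteq> W d" "W d \<subseteq> Z d" using famD[OF assms] by auto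
  show "vsc t x \<in> W (Suc n, i)" if "t \<in> a" "x \<in> W (n, i)" for n i
    using famD(4)[OF assms Om_I(2)[OF that(1)] that(2)] by simp
  show "act (\<beta> i) (S j i) x \<in> W (n, i + 2)" if "j < c" "x \<in> W (n, i)" for n i
    using famD(4)[OF assms Om_I(3)[OF that(1)] that(2)] by simp
qed

text \<open>Cocycles and coboundaries of $\mathrm{Hom}(F, X_n / X'_n)$ in degree $i$, lifted to tuples of
  elements of $X_n$.\<close>

definition Zc :: "(int \<Rightarrow> nat set) \<Rightarrow> (int \<Rightarrow> nat \<Rightarrow> nat \<Rightarrow> 't) \<Rightarrow> (nat \<Rightarrow> 'p set) \<Rightarrow> (nat \<Rightarrow> 'p set) \<Rightarrow> nat \<times> int \<Rightarrow> (nat \<Rightarrow> 'p) set" where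
  "Zc \<beta> D X X' d = {x \<in> Cb (\<beta> (snd d)) (X (fst d)).
     act (\<beta> (snd d)) (D (snd d)) x \<in> Cb (\<beta> (snd d + 1)) (X' (fst d))}"

definition Bc :: "(int \<Rightarrow> nat set) \<Rightarrow> (int \<Rightarrow> nat \<Rightarrow> nat \<Rightarrow> 't) \<Rightarrow> (nat \<Rightarrow> 'p set) \<Rightarrow> (nat \<Rightarrow> 'p set) \<Rightarrow> nat \<times> int \<Rightarrow> (nat \<Rightarrow> 'p) set" where
  "Bc \<beta> D X X' d = {x. \<exists>y\<in>Cb (\<beta> (snd d - 1)) (X (fst d)).
     x - act (\<beta> (snd d - 1)) (D (snd d - 1)) y \<in> Cb (\<beta> (snd d)) (X' (fst d))}"

lemma Zc_iff: "x \<in> Zc \<beta> D X X' (n, i) \<longleftrightarrow> x \<in> Cb (\<beta> i) (X n) \<and> act (\<beta> i) (D i) x \<in> Cb (\<beta> (i + 1)) (X' n)"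
  and Bc_iff: "x \<in> Bc \<beta> D X X' (n, i) \<longleftrightarrow> (\<exists>y\<in>Cb (\<beta> (i - 1)) (X n). x - act (\<beta> (i - 1)) (D (i - 1)) y \<in> Cb (\<beta> i) (X' n))"
  by (simp_all add: Zc_def Bc_def)

end

text \<open>One interface for the three coefficient modules used later: the Rees module
  \<open>N n / P0\<close>, the graded pieces \<open>N n / N (Suc n)\<close> and the quotients
  \<open>UNIV / N n\<close>.\<close>

locale coefs = scal sc for sc :: "'t::comm_ring_1 \<Rightarrow> 'p::ab_group_add \<Rightarrow> 'p" (infixr "\<bullet>" 75) +
  fixes T0 :: "'t set" and f :: "nat \<Rightarrow> 't" and C :: nat and a :: "'t set" and X X' :: "nat \<Rightarrow> 'p set"
  assumes T0: "idl T0" and reg: "reg T0 f C"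
    and X: "subm (X n)" and X': "subm (X' n)" and X'X: "X' n \<subseteq> X n"
    and kill: "t \<in> Jk T0 f C \<Longrightarrow> x \<in> X n \<Longrightarrow> t \<bullet> x \<in> X' n"
    and aX: "t \<in> a \<Longrightarrow> x \<in> X n \<Longrightarrow> t \<bullet> x \<in> X (Suc n)"
    and aX': "t \<in> a \<Longrightarrow> x \<in> X' n \<Longrightarrow> t \<bullet> x \<in> X' (Suc n)"
begin

interpretation V: scal vsc by (rule scal_vsc)

lemma kill': "c \<le> C \<Longrightarrow> t \<in> Jk T0 f c \<Longrightarrow> x \<in> X n \<Longrightarrow> t \<bullet> x \<in> X' n"
  using kill Jk_mono[OF T0, of c C f] by blast

lemma reg': "c \<le> C \<Longrightarrow> reg T0 f c"
  using reg by (auto simp: reg_def)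

lemma CX: "subgrp (Cb \<gamma> (X n))" "subgrp (Cb \<gamma> (X' n))"
  by (auto intro: subgrp_Cb submD(1) X X')

lemma DD_in:
  assumes cd: "cdata T0 f c \<beta> D S" and c: "c \<le> C" and x: "x \<in> Cb (\<beta> i) (X n)"
  shows "act (\<beta> (i + 1)) (D (i + 1)) (act (\<beta> i) (D i) x) \<in> Cb (\<beta> (i + 2)) (X' n)"
  unfolding act_act
proof (rule act_in[OF submD(1)[OF X'] kill'[OF c] x])
  fix b k assume "b \<in> \<beta> i" "k \<in> \<beta> (i + 2)"
  from cdataD(3)[OF cd this] show "mm (\<beta> (i + 1)) (D i) (D (i + 1)) b k \<in> Jk T0 f c"
    unfolding Jk_iff[OF T0] by (rule exI[of _ "\<lambda>j. S j i b k"])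
qed

lemma DS_in:
  assumes cd: "cdata T0 f c \<beta> D S" and c: "c \<le> C" and j: "j < c" and x: "x \<in> Cb (\<beta> i) (X n)"
  shows "act (\<beta> (i + 1)) (S j (i + 1)) (act (\<beta> i) (D i) x) - act (\<beta> (i + 2)) (D (i + 2)) (act (\<beta> i) (S j i) x)
    \<in> Cb (\<beta> (i + 3)) (X' n)"
  unfolding act_act act_diff_mat
  by (rule act_in[OF submD(1)[OF X'] kill'[OF c] x]) (use commutator[OF T0 reg'[OF c] cd _ _ j] in auto)

lemma subm_Zc: "V.subm (Zc \<beta> D X X' d)"
  unfolding V.subm_def
proof (intro conjI allI ballI)
  have "subgrp (Cb (\<beta> (snd d)) (X (fst d)) \<inter> {x. act (\<beta> (snd d)) (D (snd d)) x \<in> Cb (\<beta> (snd d + 1)) (X' (fst d))})"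
    by (intro subgrp_Int subgrp_vimage CX act_diff)
  then show "subgrp (Zc \<beta> D X X' d)" by (simp add: Zc_def Int_def)
  show "vsc t x \<in> Zc \<beta> D X X' d" if "x \<in> Zc \<beta> D X X' d" for t x
    using that V.submD(2)[OF subm_Cb[OF X]] V.submD(2)[OF subm_Cb[OF X']] by (auto simp: Zc_def act_vsc)
qed

lemma subm_Bc: "V.subm (Bc \<beta> D X X' d)"
  unfolding V.subm_def
proof (intro conjI allI ballI)
  let ?act = "act (\<beta> (snd d - 1)) (D (snd d - 1))"
  have "Bc \<beta> D X X' d = ssum (?act ` Cb (\<beta> (snd d - 1)) (X (fst d))) (Cb (\<beta> (snd d)) (X' (fst d)))"
    unfolding Bc_def ssum_def by (auto simp: image_iff) (metis add_diff_cancel_left' diff_add_cancel add.commute)+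
  then show "subgrp (Bc \<beta> D X X' d)" by (simp add: subgrp_ssum subgrp_image CX act_diff)
  fix t x assume "x \<in> Bc \<beta> D X X' d"
  then obtain y where "y \<in> Cb (\<beta> (snd d - 1)) (X (fst d))" "x - ?act y \<in> Cb (\<beta> (snd d)) (X' (fst d))"
    by (auto simp: Bc_def)
  then have "vsc t y \<in> Cb (\<beta> (snd d - 1)) (X (fst d))" "vsc t x - ?act (vsc t y) \<in> Cb (\<beta> (snd d)) (X' (fst d))"
    using V.submD(2)[OF subm_Cb[OF X]] V.submD(2)[OF subm_Cb[OF X'], of "x - ?act y"] by (auto simp: act_vsc V.sc_diff)
  then show "vsc t x \<in> Bc \<beta> D X X' d" unfolding Bc_def by blast
qed

lemma X'_Bc: "Cb (\<beta> i) (X' n) \<subseteq> Bc \<beta> D X X' (n, i)"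
  unfolding Bc_iff subset_iff using subgrp_0[OF CX(1)] by (auto intro!: bexI[of _ 0])

lemma act_Bc: "y \<in> Cb (\<beta> (i - 1)) (X n) \<Longrightarrow> act (\<beta> (i - 1)) (D (i - 1)) y \<in> Bc \<beta> D X X' (n, i)"
  unfolding Bc_iff using subgrp_0[OF CX(2)] by (auto intro!: bexI[of _ y])

text \<open>The identities between the lifted matrices hold only modulo the ideal
  \<open>Jk T0 f c\<close>, but that ideal maps \<open>X n\<close> into \<open>X' n\<close>, so they
  are exact on cochains with coefficients in \<open>X n / X' n\<close>.\<close>

lemma sys_cohomology:
  assumes cd: "cdata T0 f c \<beta> D S" and c: "c \<le> C"
  shows "sys (Om a c \<beta> S) (Zc \<beta> D X X') (Bc \<beta> D X X')"
proof -
  note Cadd = subgrp_cancel[OF CX(2)]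
  have BZ: "Bc \<beta> D X X' d \<subseteq> Zc \<beta> D X X' d" for d
  proof (cases d, clarify)
    fix n i x assume "x \<in> Bc \<beta> D X X' (n, i)"
    then obtain y where y: "y \<in> Cb (\<beta> (i - 1)) (X n)" "x - act (\<beta> (i - 1)) (D (i - 1)) y \<in> Cb (\<beta> i) (X' n)"
      by (auto simp: Bc_iff)
    have "x - act (\<beta> (i - 1)) (D (i - 1)) y \<in> Cb (\<beta> i) (X n)" using y(2) Cb_mono[OF X'X] by blast
    then have "x \<in> Cb (\<beta> i) (X n)"
      by (rule subgrp_cancel[OF CX(1) _ act_subm[OF X y(1)]])
    moreover have "act (\<beta> i) (D i) x \<in> Cb (\<beta> (i + 1)) (X' n)"
    proof (rule Cadd)
      show "act (\<beta> i) (D i) x - act (\<beta> i) (D i) (act (\<beta> (i - 1)) (D (i - 1)) y) \<in> Cb (\<beta> (i + 1)) (X' n)"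
        unfolding act_diff[symmetric] by (rule act_subm[OF X' y(2)])
      show "act (\<beta> i) (D i) (act (\<beta> (i - 1)) (D (i - 1)) y) \<in> Cb (\<beta> (i + 1)) (X' n)"
        using DD_in[OF cd c y(1)] by (simp add: add.commute)
    qed
    ultimately show "x \<in> Zc \<beta> D X X' (n, i)" by (simp add: Zc_iff)
  qed
  show ?thesis unfolding sys_def
  proof (intro conjI)
    show "fam (Om a c \<beta> S) (Zc \<beta> D X X') (Bc \<beta> D X X') (Zc \<beta> D X X')"
    proof (rule fam_OmI)
      fix n i x assume x: "x \<in> Zc \<beta> D X X' (n, i)"
      show "vsc t x \<in> Zc \<beta> D X X' (Suc n, i)" if "t \<in> a" for t
        using x aX[OF that] aX'[OF that] by (auto simp: Zc_iff act_vsc) (auto simp: Cb_def vsc_def)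
      fix j assume j: "j < c"
      have "act (\<beta> i) (S j i) x \<in> Cb (\<beta> (i + 2)) (X n)" using x by (intro act_subm X) (simp add: Zc_iff)
      moreover have "act (\<beta> (i + 2)) (D (i + 2)) (act (\<beta> i) (S j i) x) \<in> Cb (\<beta> (i + 3)) (X' n)"
      proof -
        have x': "x \<in> Cb (\<beta> i) (X n)" "act (\<beta> i) (D i) x \<in> Cb (\<beta> (i + 1)) (X' n)"
          using x by (auto simp: Zc_iff)
        show ?thesis by (rule subgrp_cancel'[OF CX(2) DS_in[OF cd c j x'(1)] act_subm[OF X' x'(2)]])
      qed
      ultimately show "act (\<beta> i) (S j i) x \<in> Zc \<beta> D X X' (n, i + 2)" by (simp add: Zc_iff add.commute)
    qed (use subm_Zc BZ in auto)
    show "fam (Om a c \<beta> S) (Zc \<beta> D X X') (Bc \<beta> D X X') (Bc \<beta> D X X')"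
    proof (rule fam_OmI)
      fix n i x assume "x \<in> Bc \<beta> D X X' (n, i)"
      then obtain y where y: "y \<in> Cb (\<beta> (i - 1)) (X n)" "x - act (\<beta> (i - 1)) (D (i - 1)) y \<in> Cb (\<beta> i) (X' n)"
        by (auto simp: Bc_iff)
      show "vsc t x \<in> Bc \<beta> D X X' (Suc n, i)" if "t \<in> a" for t
      proof -
        have "vsc t y \<in> Cb (\<beta> (i - 1)) (X (Suc n))" using y(1) aX[OF that] by (auto simp: Cb_def vsc_def)
        moreover have "vsc t x - act (\<beta> (i - 1)) (D (i - 1)) (vsc t y) \<in> Cb (\<beta> i) (X' (Suc n))"
          unfolding act_vsc V.sc_diff[symmetric] using y(2) aX'[OF that] by (auto simp: Cb_def vsc_def)
        ultimately show ?thesis by (auto simp: Bc_iff)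
      qed
      fix j assume j: "j < c"
      let ?Sy = "act (\<beta> (i - 1)) (S j (i - 1)) y"
      have "?Sy \<in> Cb (\<beta> (i + 1)) (X n)" by (rule act_subm[OF X y(1)])
      moreover have "act (\<beta> i) (S j i) x - act (\<beta> (i + 1)) (D (i + 1)) ?Sy \<in> Cb (\<beta> (i + 2)) (X' n)"
      proof (rule Cadd)
        have "i - 1 + 1 = i" "i - 1 + 2 = i + 1" "i - 1 + 3 = i + 2" by simp_all
        from DS_in[OF cd c j y(1), unfolded this]
        show "act (\<beta> i) (S j i) (act (\<beta> (i - 1)) (D (i - 1)) y) - act (\<beta> (i + 1)) (D (i + 1)) ?Sy \<in> Cb (\<beta> (i + 2)) (X' n)" .
        have "act (\<beta> i) (S j i) (x - act (\<beta> (i - 1)) (D (i - 1)) y) \<in> Cb (\<beta> (i + 2)) (X' n)"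
          by (rule act_subm[OF X' y(2)])
        then show "act (\<beta> i) (S j i) x - act (\<beta> (i + 1)) (D (i + 1)) ?Sy
          - (act (\<beta> i) (S j i) (act (\<beta> (i - 1)) (D (i - 1)) y) - act (\<beta> (i + 1)) (D (i + 1)) ?Sy) \<in> Cb (\<beta> (i + 2)) (X' n)"
          by (simp add: act_diff)
      qed
      ultimately show "act (\<beta> i) (S j i) x \<in> Bc \<beta> D X X' (n, i + 2)" by (auto simp: Bc_iff add.commute)
    qed (use subm_Bc BZ in auto)
    show "\<forall>(\<sigma>, \<tau>)\<in>Om a c \<beta> S. \<forall>d x y. \<tau> d (x - y) = \<tau> d x - \<tau> d y"
      using Om_additive by blast
  qed
qed

end

section \<open>The cokernel of an Eisenbud operator inside the cohomology of the cone\<close>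

context coefs
begin

interpretation V: scal vsc by (rule scal_vsc)

text \<open>Extends a cochain on F by zero to the shifted copy of F in the cone.\<close>

definition emb :: "(nat \<Rightarrow> 'p) \<Rightarrow> nat \<Rightarrow> 'p" where
  "emb x k = (if even k then x (k div 2) else 0)"

lemma emb_simps: "emb x (2 * k) = x k" "emb x (Suc (2 * k)) = 0"
  by (simp_all add: emb_def)

lemma emb_diff: "emb (x - y) = emb x - emb y"
  by (auto simp: emb_def)

lemma emb_vsc: "emb (vsc t x) = vsc t (emb x)"
  by (auto simp: emb_def vsc_def)

lemma nat_even_odd:
  fixes k :: nat obtains l where "k = 2 * l" | l where "k = Suc (2 * l)"
  by (metis oddE evenE Suc_eq_plus1)

lemma act_emb_SE:
  assumes "\<And>i. finite (\<beta> i)"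
  shows "act (bE \<beta> i) (SE S U j i) (emb x) = emb (act (\<beta> i) (S j i) x)"
proof
  fix k show "act (bE \<beta> i) (SE S U j i) (emb x) k = emb (act (\<beta> i) (S j i) x) k"
    by (rule nat_even_odd[of k]) (simp_all add: act_def sum_bE[OF assms] SE_simps emb_simps)
qed

text \<open>The only new component of the coboundary is \<open>f c\<close> times \<open>x\<close>,
  and \<open>f c\<close> kills the coefficients.\<close>

lemma emb_Zc:
  assumes fin: "\<And>i. finite (\<beta> i)" and c: "c < C" and x: "x \<in> Zc \<beta> D X X' (n, i)"
  shows "emb x \<in> Zc (bE \<beta>) (DE (f c) D (S c)) X X' (n, i)"
proof -
  have x1: "x \<in> Cb (\<beta> i) (X n)" and x2: "act (\<beta> i) (D i) x \<in> Cb (\<beta> (i + 1)) (X' n)"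
    using x by (auto simp: Zc_iff)
  have "emb x \<in> Cb (bE \<beta> i) (X n)"
  proof (rule CbI)
    fix b assume "b \<in> bE \<beta> i"
    then show "emb x b \<in> X n"
      by (cases rule: bE_cases) (use x1 subgrp_0[OF submD(1)[OF X]] in \<open>auto simp: emb_simps Cb_def\<close>)
  qed
  moreover have "act (bE \<beta> i) (DE (f c) D (S c) i) (emb x) \<in> Cb (bE \<beta> (i + 1)) (X' n)"
  proof (rule CbI)
    fix k assume "k \<in> bE \<beta> (i + 1)"
    then show "act (bE \<beta> i) (DE (f c) D (S c) i) (emb x) k \<in> X' n"
    proof (cases rule: bE_cases)
      case (1 k')
      then show ?thesis using CbD[OF x2 1(2)] by (simp add: act_def sum_bE[OF fin] DE_simps emb_simps)
    next
      case (2 k')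
      have "(\<Sum>b\<in>\<beta> i. (if b = k' then f c else 0) \<bullet> x b) = (\<Sum>b\<in>\<beta> i. if b = k' then f c \<bullet> x b else 0)"
        by (intro sum.cong) auto
      also have "\<dots> = f c \<bullet> x k'" using fin 2 by simp
      finally have "act (bE \<beta> i) (DE (f c) D (S c) i) (emb x) k = f c \<bullet> x k'"
        using 2(1) by (simp add: act_def sum_bE[OF fin] DE_simps emb_simps)
      then show ?thesis using kill[OF Jk_gen[OF T0 c]] CbD[OF x1, of k'] 2 by simp
    qed
  qed
  ultimately show ?thesis by (simp add: Zc_iff)
qed

text \<open>Split a cochain of the cone whose coboundary is \<open>emb x\<close> into an even part
  \<open>y\<close> and an odd part \<open>z\<close>. The even coordinates say that \<open>x\<close>
  is the coboundary of \<open>y\<close> minus \<open>S c\<close> applied to \<open>z\<close>. The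
  odd ones say that the coboundary of \<open>z\<close> is \<open>f c\<close> times \<open>y\<close>,
  hence zero in the coefficients, so \<open>z\<close> is a cocycle.\<close>

lemma emb_Bc:
  assumes fin: "\<And>i. finite (\<beta> i)" and c: "c < C" and x: "x \<in> Zc \<beta> D X X' (n, i)"
    and e: "emb x \<in> Bc (bE \<beta>) (DE (f c) D (S c)) X X' (n, i)"
    and sys: "sys \<Omega> (Zc \<beta> D X X') (Bc \<beta> D X X')"
  shows "x \<in> imgadd sT (\<lambda>d. act (\<beta> (snd d)) (S c (snd d))) (Zc \<beta> D X X') (Bc \<beta> D X X') (n, i)"
proof -
  let ?T = "imgadd sT (\<lambda>d. act (\<beta> (snd d)) (S c (snd d))) (Zc \<beta> D X X') (Bc \<beta> D X X')"
  have BT: "Bc \<beta> D X X' (n, i) \<subseteq> ?T (n, i)" by (rule imgadd_superset(1))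
  from e obtain u where u: "u \<in> Cb (bE \<beta> (i - 1)) (X n)"
    and eu: "emb x - act (bE \<beta> (i - 1)) (DE (f c) D (S c) (i - 1)) u \<in> Cb (bE \<beta> i) (X' n)"
    by (auto simp: Bc_iff)
  define y z where "y b = u (2 * b)" and "z b = u (Suc (2 * b))" for b
  have y: "y \<in> Cb (\<beta> (i - 1)) (X n)" using u by (auto simp: Cb_def y_def bE_iff)
  have z: "z \<in> Cb (\<beta> (i - 2)) (X n)" using u by (auto simp: Cb_def z_def bE_iff)
  have 1: "x - (act (\<beta> (i - 1)) (D (i - 1)) y - act (\<beta> (i - 2)) (S c (i - 2)) z) \<in> Cb (\<beta> i) (X' n)"
  proof (rule CbI)
    fix k assume "k \<in> \<beta> i"
    then have "2 * k \<in> bE \<beta> i" by (simp add: bE_iff)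
    from CbD[OF eu this] show "(x - (act (\<beta> (i - 1)) (D (i - 1)) y - act (\<beta> (i - 2)) (S c (i - 2)) z)) k \<in> X' n"
      by (simp add: act_def sum_bE[OF fin] DE_simps emb_simps y_def z_def sc_minus' sum_negf)
  qed
  have "act (\<beta> (i - 2)) (D (i - 2)) z \<in> Cb (\<beta> (i - 1)) (X' n)"
  proof (rule CbI)
    fix k assume k: "k \<in> \<beta> (i - 1)"
    then have k': "Suc (2 * k) \<in> bE \<beta> i" by (simp add: bE_iff)
    have "(\<Sum>b\<in>\<beta> (i - 1). (if b = k then f c else 0) \<bullet> y b) = (\<Sum>b\<in>\<beta> (i - 1). if b = k then f c \<bullet> y b else 0)"
      by (intro sum.cong) auto
    also have "\<dots> = f c \<bullet> y k" using fin k by simp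
    finally have s: "(\<Sum>b\<in>\<beta> (i - 1). (if b = k then f c else 0) \<bullet> u (2 * b)) = f c \<bullet> y k" by (simp add: y_def)
    have "act (\<beta> (i - 2)) (D (i - 2)) z k - f c \<bullet> y k \<in> X' n"
      using CbD[OF eu k'] s
      by (simp add: act_def sum_bE[OF fin] DE_simps emb_simps z_def sc_minus' sum_negf)
    moreover have "f c \<bullet> y k \<in> X' n" using kill[OF Jk_gen[OF T0 c]] CbD[OF y k] by simp
    ultimately show "act (\<beta> (i - 2)) (D (i - 2)) z k \<in> X' n" by (rule subgrp_cancel[OF submD(1)[OF X']])
  qed
  with z have "z \<in> Zc \<beta> D X X' (n, i - 2)" by (simp add: Zc_iff)
  from imgadd_superset(2)[where Z = "Zc \<beta> D X X'" and e = "(n, i - 2)" and \<sigma> = sT and B = "Bc \<beta> D X X'"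
      and \<tau> = "\<lambda>d. act (\<beta> (snd d)) (S c (snd d))", OF this]
  have "act (\<beta> (i - 2)) (S c (i - 2)) z \<in> ?T (n, i)" by simp
  moreover have "act (\<beta> (i - 1)) (D (i - 1)) y \<in> ?T (n, i)"
    by (rule subsetD[OF BT act_Bc[of y \<beta> i n D, OF y]])
  ultimately have "act (\<beta> (i - 1)) (D (i - 1)) y - act (\<beta> (i - 2)) (S c (i - 2)) z \<in> ?T (n, i)"
    by (intro subgrp_diff[OF subgrp_imgadd])
  moreover have "x - (act (\<beta> (i - 1)) (D (i - 1)) y - act (\<beta> (i - 2)) (S c (i - 2)) z) \<in> ?T (n, i)"
    by (rule subsetD[OF BT subsetD[OF X'_Bc[of \<beta> i n D] 1]])
  ultimately show ?thesis by (rule subgrp_cancel[OF subgrp_imgadd, rotated])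
qed

text \<open>On cohomology the operators commute: the homotopy is the off-diagonal block of the operator
  on the cone.\<close>

lemma S_commute:
  assumes cd: "cdata T0 f (Suc c) \<beta> D S" and c: "c < C" and cE: "cdata T0 f c (bE \<beta>) (DE (f c) D (S c)) (SE S U)"
    and j: "j < c" and x: "x \<in> Zc \<beta> D X X' (n, i)"
  shows "act (\<beta> (i + 2)) (S c (i + 2)) (act (\<beta> i) (S j i) x) - act (\<beta> (i + 2)) (S j (i + 2)) (act (\<beta> i) (S c i) x)
    \<in> Bc \<beta> D X X' (n, i + 4)"
proof -
  note fin = cdataD(1)[OF cd]
  have x1: "x \<in> Cb (\<beta> i) (X n)" and x2: "act (\<beta> i) (D i) x \<in> Cb (\<beta> (i + 1)) (X' n)"
    using x by (auto simp: Zc_iff)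
  have e: "i + 1 + 1 = i + 2" "i + 1 + 2 = i + 3" "i + 1 + 3 = i + 4" "i + 2 - 1 = i + 1" "i + 3 - 1 = i + 2" "i + 1 - 1 = i"
    by simp_all
  let ?com = "\<lambda>b k. mm (\<beta> (i + 2)) (S j i) (S c (i + 2)) b k - mm (\<beta> (i + 2)) (S c i) (S j (i + 2)) b k
     - (mm (\<beta> (i + 1)) (D i) (U j (i + 2)) b k + mm (\<beta> (i + 3)) (U j (i + 1)) (D (i + 3)) b k)"
  have "?com b k \<in> Jk T0 f c" if b: "b \<in> \<beta> i" and k: "k \<in> \<beta> (i + 4)" for b k
  proof -
    \<comment> \<open>The block of the commutator relation on the cone whose row lies in the shifted
      copy and whose column lies in F itself contains both products of \<open>S j\<close> and
      \<open>S c\<close>; the rest of the block is a homotopy built from \<open>U j\<close>.\<close>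
    have "Suc (2 * b) \<in> bE \<beta> (i + 1)" "2 * k \<in> bE \<beta> (i + 1 + 3)" unfolding bE_iff e using b k by simp_all
    from commutator[OF T0 reg' cE this j] c
    have "mm (bE \<beta> (i + 2)) (DE (f c) D (S c) (i + 1)) (SE S U j (i + 2)) (Suc (2 * b)) (2 * k)
      - mm (bE \<beta> (i + 3)) (SE S U j (i + 1)) (DE (f c) D (S c) (i + 3)) (Suc (2 * b)) (2 * k) \<in> Jk T0 f c"
      unfolding e by simp
    then show ?thesis
      unfolding mm_def sum_bE[OF fin] Suc_eq_plus1[symmetric] DE_simps SE_simps e
      by (simp add: sum_negf algebra_simps)
  qed
  then have 1: "act (\<beta> i) ?com x \<in> Cb (\<beta> (i + 4)) (X' n)"
    using c by (intro act_in[OF submD(1)[OF X'] kill'[of c] x1]) auto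
  have 2: "act (\<beta> i) ?com x = act (\<beta> (i + 2)) (S c (i + 2)) (act (\<beta> i) (S j i) x)
      - act (\<beta> (i + 2)) (S j (i + 2)) (act (\<beta> i) (S c i) x)
      - (act (\<beta> (i + 1)) (U j (i + 2)) (act (\<beta> i) (D i) x) + act (\<beta> (i + 3)) (D (i + 3)) (act (\<beta> i) (U j (i + 1)) x))"
    unfolding act_act by (auto simp: act_def sc_diff' sc_plus sum_subtractf sum.distrib)
  have "act (\<beta> (i + 1)) (U j (i + 2)) (act (\<beta> i) (D i) x) \<in> Cb (\<beta> (i + 4)) (X' n)"
    by (rule act_subm[OF X' x2])
  then have 3: "act (\<beta> (i + 1)) (U j (i + 2)) (act (\<beta> i) (D i) x) \<in> Bc \<beta> D X X' (n, i + 4)"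
    by (rule subsetD[OF X'_Bc])
  have "act (\<beta> i) (U j (i + 1)) x \<in> Cb (\<beta> (i + 4 - 1)) (X n)" by (rule act_subm[OF X x1])
  from act_Bc[of _ \<beta> "i + 4", OF this] have "act (\<beta> (i + 3)) (D (i + 3)) (act (\<beta> i) (U j (i + 1)) x) \<in> Bc \<beta> D X X' (n, i + 4)"
    by (simp add: add.commute)
  from subgrp_add[OF V.submD(1)[OF subm_Bc] 3 this]
  show ?thesis by (rule subgrp_cancel[OF V.submD(1)[OF subm_Bc] subsetD[OF X'_Bc[of \<beta> "i + 4" n D] 1[unfolded 2]]])
qed

text \<open>The vanishing hypothesis is quantified over all complexes because the induction replaces
  the given one by cones. The data \<open>\<K>\<close>, \<open>\<Gamma>\<close> and
  \<open>\<rho>\<close> record that every cone still resolves the same module on the same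
  generators.\<close>

theorem cohomology_noeth:
  assumes NX: "\<And>\<gamma>. finite \<gamma> \<Longrightarrow> noeth (V.scops \<union> Pair Suc ` \<Theta>A a) (\<lambda>n. Cb \<gamma> (X n)) (\<lambda>n. Cb \<gamma> (X' n))"
    and van: "\<And>\<beta> D S \<rho>. cdata T0 f 0 \<beta> D S \<Longrightarrow> exact T0 \<K> \<beta> D \<rho> \<Longrightarrow>
      bij_betw \<rho> \<Gamma> (\<beta> 0) \<Longrightarrow> \<exists>m. \<forall>i>m. \<forall>n. Zc \<beta> D X X' (n, i) \<subseteq> Bc \<beta> D X X' (n, i)"
  shows "c \<le> C \<Longrightarrow> cdata T0 f c \<beta> D S \<Longrightarrow> exact (Jk T0 f c) \<K> \<beta> D \<rho> \<Longrightarrow>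
    bij_betw \<rho> \<Gamma> (\<beta> 0) \<Longrightarrow> noeth (Om a c \<beta> S) (Zc \<beta> D X X') (Bc \<beta> D X X')"
proof (induction c arbitrary: \<beta> D S \<rho>)
  case 0
  let ?Z = "Zc \<beta> D X X'" and ?B = "Bc \<beta> D X X'"
  obtain m where m: "\<And>i n. i > m \<Longrightarrow> ?Z (n, i) \<subseteq> ?B (n, i)" using van[OF 0(2) 0(3)[unfolded Jk.simps(1)] 0(4)] by blast
  show ?case
  \<comment> \<open>With no equations left only the degrees from \<open>0\<close> to
    \<open>m\<close> carry cohomology, and in each of them the cochains alone are Noetherian in the
    direction of \<open>n\<close>.\<close>
  proof (rule noeth_embed_fin[of "{0..m}" "\<lambda>_. V.scops \<union> Pair Suc ` \<Theta>A a" "\<lambda>i n. Cb (\<beta> i) (X n)" "\<lambda>i n. Cb (\<beta> i) (X' n)"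
        _ _ _ "\<lambda>i W n. W (n, i)"])
    show "finite {0..m}" by simp
    show "noeth (V.scops \<union> Pair Suc ` \<Theta>A a) (\<lambda>n. Cb (\<beta> i) (X n)) (\<lambda>n. Cb (\<beta> i) (X' n))" for i
      by (rule NX[OF cdataD(1)[OF 0(2)]])
    show "fam (V.scops \<union> Pair Suc ` \<Theta>A a) (\<lambda>n. Cb (\<beta> i) (X n)) (\<lambda>n. Cb (\<beta> i) (X' n)) (\<lambda>n. W (n, i))"
      if W: "fam (Om a 0 \<beta> S) ?Z ?B W" for i W
    proof (rule famI)
      note Wd = fam_OmD[OF W]
      fix n show "subgrp (W (n, i))" using Wd(1) V.submD(1) by blast
      show "Cb (\<beta> i) (X' n) \<subseteq> W (n, i)" using X'_Bc Wd(2) by blast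
      show "W (n, i) \<subseteq> Cb (\<beta> i) (X n)" using Wd(3)[of "(n, i)"] by (auto simp: Zc_iff)
      fix \<sigma> \<tau> x assume "(\<sigma>, \<tau>) \<in> V.scops \<union> Pair Suc ` \<Theta>A a" and x: "x \<in> W (n, i)"
      then consider t where "\<sigma> = (\<lambda>d. d)" "\<tau> = (\<lambda>d. vsc t)" | t where "t \<in> a" "\<sigma> = Suc" "\<tau> = (\<lambda>d. vsc t)"
        unfolding V.scops_def \<Theta>A_def by blast
      then show "\<tau> n x \<in> W (\<sigma> n, i)"
        by cases (use Wd(4) V.submD(2)[OF Wd(1)] x in auto)
    qed
    show "(\<lambda>n. W (n, i)) \<le> (\<lambda>n. W' (n, i))" if "W \<le> W'" for i and W W' :: "nat \<times> int \<Rightarrow> (nat \<Rightarrow> 'p) set"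
      using that by (auto simp: le_fun_def)
    fix W W' assume W: "fam (Om a 0 \<beta> S) ?Z ?B W" and W': "fam (Om a 0 \<beta> S) ?Z ?B W'"
      and eq: "\<And>i. i \<in> {0..m} \<Longrightarrow> (\<lambda>n. W (n, i)) = (\<lambda>n. W' (n, i))"
    show "W = W'"
    proof (rule ext, clarify)
      fix n i
      show "W (n, i) = W' (n, i)"
      proof (cases "i \<in> {0..m}")
        case True
        then show ?thesis using fun_cong[OF eq[OF True]] by blast
      next
        case False
        then have "?Z (n, i) \<subseteq> ?B (n, i)"
        proof (cases "i < 0")
          case True
          \<comment> \<open>An empty basis imposes no condition on tuples, so in negative degrees
            everything counts as a coboundary.\<close>
          then have "?B (n, i) = UNIV"
            using cdataD(2)[OF 0(2)] subgrp_0[OF CX(1)] by (auto simp: Bc_iff Cb_def)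
          then show ?thesis by simp
        qed (use m in auto)
        then show ?thesis using fam_OmD(2,3)[OF W, of "(n, i)"] fam_OmD(2,3)[OF W', of "(n, i)"] by blast
      qed
    qed
  qed
next
  case (Suc c)
  then have c: "c < C" "c \<le> C" by simp_all
  note cd = Suc.prems(2) and fin = cdataD(1)[OF Suc.prems(2)]
  let ?Z = "Zc \<beta> D X X'" and ?B = "Bc \<beta> D X X'"
  define P where "P i b k u \<longleftrightarrow> mm (\<beta> i) (D (i - 1)) (S c i) b k - mm (\<beta> (i + 1)) (S c (i - 1)) (D (i + 1)) b k
        - (\<Sum>j<c. f j * u j) \<in> T0" for i b k u
  define U' where "U' j i b k = (SOME u. P i b k u) j" for j i b k
  have P: "P i b k (\<lambda>j. U' j i b k)" if b: "b \<in> \<beta> (i - 1)" and k: "k \<in> \<beta> (i + 2)" for i b k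
  proof -
    have e: "i - 1 + 1 = i" "i - 1 + 2 = i + 1" "i - 1 + 3 = i + 2" by simp_all
    \<comment> \<open>\<open>S c\<close> belongs to the last element of the relation, so its
      commutator lies in the ideal of the first \<open>c\<close> elements alone.\<close>
    have "mm (\<beta> i) (D (i - 1)) (S c i) b k - mm (\<beta> (i + 1)) (S c (i - 1)) (D (i + 1)) b k \<in> Jk T0 f c"
      by (rule reg_relation_last[OF T0 reg commutator_sum[OF T0 cd b, unfolded e, OF k] c(1)])
    then have "\<exists>u. P i b k u" unfolding Jk_iff[OF T0] P_def .
    from someI_ex[OF this] show ?thesis by (simp add: U'_def)
  qed
  let ?DE = "DE (f c) D (S c)" and ?SE = "SE S U'"
  have cE: "cdata T0 f c (bE \<beta>) ?DE ?SE"
    by (rule cdata_E[OF T0 cd]) (rule P[unfolded P_def])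
  have IH: "noeth (Om a c (bE \<beta>) ?SE) (Zc (bE \<beta>) ?DE X X') (Bc (bE \<beta>) ?DE X X')"
  proof (rule Suc.IH[OF c(2) cE exact_E[OF T0 reg'[OF Suc.prems(1)] cd Suc.prems(3)]])
    have "bij_betw (\<lambda>b. 2 * b) (\<beta> 0) (bE \<beta> 0)"
      using cdataD(2)[OF cd, of "- 1"] by (auto simp: bij_betw_def inj_on_def bE_def)
    then show "bij_betw (\<lambda>b. 2 * \<rho> b) \<Gamma> (bE \<beta> 0)"
      using bij_betw_trans[OF Suc.prems(4)] by (simp add: comp_def)
  qed
  let ?ZE = "Zc (bE \<beta>) ?DE X X'" and ?BE = "Bc (bE \<beta>) ?DE X X'"
  let ?op = "\<lambda>d. act (\<beta> (snd d)) (S c (snd d))"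
  let ?T = "imgadd sT ?op ?Z ?B"
  have sys: "sys (insert (sT, ?op) (Om a c \<beta> S)) ?Z ?B"
    using sys_cohomology[OF cd Suc.prems(1)] by (simp add: Om_Suc)
  have sysE: "sys (Om a c (bE \<beta>) ?SE) ?ZE ?BE" by (rule sys_cohomology[OF cE c(2)])
  have "noeth (Om a c \<beta> S) ?Z ?T"
  proof (rule noeth_embed[OF IH, where \<Phi> = "\<lambda>W d. ssum (emb ` W d) (?BE d)"])
    fix W assume W: "fam (Om a c \<beta> S) ?Z ?T W"
    note Wd = fam_OmD[OF W]
    have sub: "subgrp (emb ` W d)" for d
      by (intro subgrp_image V.submD(1)[OF Wd(1)] emb_diff)
    show "fam (Om a c (bE \<beta>) ?SE) ?ZE ?BE (\<lambda>d. ssum (emb ` W d) (?BE d))"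
    proof (rule famI)
      fix d
      show "subgrp (ssum (emb ` W d) (?BE d))" by (intro subgrp_ssum sub sysD(4)[OF sysE])
      show "?BE d \<subseteq> ssum (emb ` W d) (?BE d)" by (rule ssum_superset2[OF sub])
      show "ssum (emb ` W d) (?BE d) \<subseteq> ?ZE d"
      proof (rule ssum_least[OF sysD(3)[OF sysE] _ sysD(5)[OF sysE]])
        show "emb ` W d \<subseteq> ?ZE d" using emb_Zc[where \<beta> = \<beta>, OF fin c(1)] Wd(3)[of d] by (cases d) auto
      qed
      fix \<sigma> \<tau> x assume op: "(\<sigma>, \<tau>) \<in> Om a c (bE \<beta>) ?SE" and "x \<in> ssum (emb ` W d) (?BE d)"
      then obtain w b where w: "w \<in> W d" "b \<in> ?BE d" "x = emb w + b" by (auto simp: ssum_def)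
      have "\<tau> d (emb w) \<in> emb ` W (\<sigma> d)"
        using op
      proof (cases rule: Om_cases)
        case (1 t)
        then show ?thesis using V.submD(2)[OF Wd(1) w(1), of t] by (simp add: emb_vsc[symmetric])
      next
        case (2 t)
        then show ?thesis using Wd(4)[of t w "fst d" "snd d"] w(1) by (simp add: emb_vsc[symmetric] sA_def)
      next
        case (3 j)
        then show ?thesis using Wd(5)[of j w "fst d" "snd d"] w(1) by (simp add: act_emb_SE[OF fin] sT_def)
      qed
      then show "\<tau> d x \<in> ssum (emb ` W (\<sigma> d)) (?BE (\<sigma> d))"
        unfolding w(3) oper_add(1)[OF sysE op] by (rule ssumI) (rule sysD(7)[OF sysE op w(2)])
    qed
  next
    show "(\<lambda>d. ssum (emb ` W d) (?BE d)) \<le> (\<lambda>d. ssum (emb ` W' d) (?BE d))" if "W \<le> W'" for W W'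
      using that unfolding le_fun_def ssum_def by blast
  next
    fix W W' assume W: "fam (Om a c \<beta> S) ?Z ?T W" and W': "fam (Om a c \<beta> S) ?Z ?T W'" and le: "W \<le> W'"
      and eq: "(\<lambda>d. ssum (emb ` W d) (?BE d)) = (\<lambda>d. ssum (emb ` W' d) (?BE d))"
    note Wd = famD[OF W] and Wd' = famD[OF W']
    have sub: "x \<in> W d" if x: "x \<in> W' d" for d x
    proof -
      have "emb x \<in> ssum (emb ` W' d) (?BE d)"
        by (rule subsetD[OF ssum_superset1[OF sysD(4)[OF sysE]]]) (use x in blast)
      then have "emb x \<in> ssum (emb ` W d) (?BE d)" using fun_cong[OF eq, of d] by simp
      then obtain w b where w: "w \<in> W d" "b \<in> ?BE d" "emb x = emb w + b" by (auto simp: ssum_def)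
      have "w \<in> W' d" using le_funD[OF le, of d] w(1) by blast
      then have "x - w \<in> ?Z d" using subgrp_diff[OF Wd'(1) x] Wd'(3) by blast
      moreover have "emb (x - w) \<in> ?BE d" using w(2,3) by (simp add: emb_diff)
      \<comment> \<open>The difference is a cocycle that becomes a coboundary in the cone, so by
        \<open>emb_Bc\<close> it lies in the image of \<open>S c\<close> up to coboundaries.\<close>
      ultimately have "x - w \<in> ?T d" using emb_Bc[where \<beta> = \<beta>, OF fin c(1) _ _ sys] by (cases d) auto
      then have "x - w \<in> W d" using Wd(2) by blast
      then show ?thesis using w(1) by (rule subgrp_cancel[OF Wd(1)])
    qed
    show "W = W'" by (rule antisym[OF le le_funI]) (use sub in blast)
  qed
  then have "noeth (insert (sT, ?op) (Om a c \<beta> S)) ?Z ?B"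
  proof (rule noeth_hilbert[OF sys, rotated 4, where h = "\<lambda>d. nat (snd d)"])
    show "inj sT" by (auto simp: inj_def sT_def prod_eq_iff)
    \<comment> \<open>Negative degrees carry no cohomology, so the truncated cohomological degree
      serves as height.\<close>
    show "nat (snd d) < nat (snd (sT d))" if "\<not> ?Z d \<subseteq> ?B d" for d
    proof -
      obtain n i where d: "d = (n, i)" by (cases d)
      have "\<not> i < 0"
      proof
        assume "i < 0"
        then have "?B (n, i) = UNIV"
          using cdataD(2)[OF cd] subgrp_0[OF CX(1)] by (auto simp: Bc_iff Cb_def)
        then show False using that d by simp
      qed
      then show ?thesis using d by simp
    qed
    fix \<sigma> \<tau> d assume op: "(\<sigma>, \<tau>) \<in> Om a c \<beta> S"
    show "\<sigma> (sT d) = sT (\<sigma> d)"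
      using op by (cases rule: Om_cases) (auto simp: sT_def sA_def)
    fix x assume x: "x \<in> ?Z d"
    show "?op (\<sigma> d) (\<tau> d x) - \<tau> (sT d) (?op d x) \<in> ?B (sT (\<sigma> d))"
      using op
    proof (cases rule: Om_cases)
      case (3 j)
      obtain n i where d: "d = (n, i)" by (cases d)
      show ?thesis using S_commute[OF cd c(1) cE 3(1), of x n i] x 3 d by (simp add: add.commute)
    qed (use subgrp_0[OF sysD(4)[OF sys]] in \<open>auto simp: act_vsc sT_def sA_def\<close>)
  qed
  then show ?case by (simp add: Om_Suc)
qed

end

context coefs
begin

interpretation V: scal vsc by (rule scal_vsc)

text \<open>In degree \<open>i\<close> the matrices \<open>s\<close> and \<open>s'\<close> are a
  contracting homotopy. After dualising, a cocycle \<open>x\<close> is up to \<open>X' n\<close> the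
  coboundary of \<open>act (\<beta> i) s' x\<close>, because the other term of the homotopy involves
  only the coboundary of \<open>x\<close>.\<close>

lemma vanishing:
  assumes cd: "cdata T0 f 0 \<beta> D S" and i: "\<And>b k. b \<in> \<beta> i \<Longrightarrow> k \<in> \<beta> i \<Longrightarrow>
    (if b = k then 1 else 0) - mm (\<beta> (i + 1)) (D i) s b k - mm (\<beta> (i - 1)) s' (D (i - 1)) b k \<in> T0"
  shows "Zc \<beta> D X X' (n, i) \<subseteq> Bc \<beta> D X X' (n, i)"
proof
  fix x assume "x \<in> Zc \<beta> D X X' (n, i)"
  then have x1: "x \<in> Cb (\<beta> i) (X n)" and x2: "act (\<beta> i) (D i) x \<in> Cb (\<beta> (i + 1)) (X' n)"
    by (auto simp: Zc_iff)
  let ?m = "\<lambda>b k. (if b = k then 1 else 0) - mm (\<beta> (i + 1)) (D i) s b k - mm (\<beta> (i - 1)) s' (D (i - 1)) b k"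
  have 1: "act (\<beta> i) ?m x \<in> Cb (\<beta> i) (X' n)"
  proof (rule act_in[OF submD(1)[OF X'] kill'[OF le0] x1])
    fix b k assume "b \<in> \<beta> i" "k \<in> \<beta> i"
    from i[OF this] show "?m b k \<in> Jk T0 f 0" by (simp only: Jk.simps)
  qed
  have "act (\<beta> (i + 1)) s (act (\<beta> i) (D i) x) \<in> Cb (\<beta> i) (X' n)" by (rule act_subm[OF X' x2])
  from subgrp_add[OF CX(2) 1 this]
  have 2: "act (\<beta> i) ?m x + act (\<beta> (i + 1)) s (act (\<beta> i) (D i) x) \<in> Cb (\<beta> i) (X' n)" .
  have "x - act (\<beta> (i - 1)) (D (i - 1)) (act (\<beta> i) s' x) \<in> Cb (\<beta> i) (X' n)"
  proof (rule CbI)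
    fix k assume k: "k \<in> \<beta> i"
    have "(\<Sum>b\<in>\<beta> i. (if b = k then 1 else 0) \<bullet> x b) = (\<Sum>b\<in>\<beta> i. if b = k then x b else 0)"
      by (intro sum.cong) auto
    also have "\<dots> = x k" using k cdataD(1)[OF cd] by simp
    finally have "(act (\<beta> i) ?m x + act (\<beta> (i + 1)) s (act (\<beta> i) (D i) x)) k
       = (x - act (\<beta> (i - 1)) (D (i - 1)) (act (\<beta> i) s' x)) k"
      unfolding act_act by (simp add: act_def sc_diff' sum_subtractf)
    then show "(x - act (\<beta> (i - 1)) (D (i - 1)) (act (\<beta> i) s' x)) k \<in> X' n" using CbD[OF 2 k] by simp
  qed
  moreover have "act (\<beta> i) s' x \<in> Cb (\<beta> (i - 1)) (X n)" by (rule act_subm[OF X x1])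
  ultimately show "x \<in> Bc \<beta> D X X' (n, i)" by (auto simp: Bc_iff)
qed

end

section \<open>Finite generation and Noetherian modules of tuples\<close>

context scal
begin

lemma sys_scops:
  assumes "\<And>d. subm (Z d)" "\<And>d. subm (B d)" "\<And>d. B d \<subseteq> Z d"
  shows "sys scops Z B"
  unfolding sys_def fam_def scops_def using assms by (auto simp: subm_def sc_diff)

lemma fam_scopsI:
  "(\<And>d. subm (W d)) \<Longrightarrow> (\<And>d. B d \<subseteq> W d) \<Longrightarrow> (\<And>d. W d \<subseteq> Z d) \<Longrightarrow> fam scops Z B W"
  unfolding fam_def scops_def by (auto simp: subm_def)

definition shull :: "'p set \<Rightarrow> 'p set" where
  "shull A = \<Inter>{W. subm W \<and> A \<subseteq> W}"

lemma subm_shull: "subm (shull A)"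
  unfolding shull_def subm_def by (auto simp: subgrp_def)

lemma shull_superset: "A \<subseteq> shull A" and shull_least: "subm W \<Longrightarrow> A \<subseteq> W \<Longrightarrow> shull A \<subseteq> W"
  by (auto simp: shull_def)

text \<open>A maximal hull of \<open>B\<close> and finitely many elements of \<open>W\<close>
  absorbs every further element of \<open>W\<close>.\<close>

lemma noeth_fg:
  assumes noe: "noeth scops (\<lambda>_::unit. UNIV) (\<lambda>_. B)" and W: "subm W" "B \<subseteq> W"
  obtains G where "finite G" "G \<subseteq> W" "W = shull (B \<union> G)"
proof -
  let ?P = "\<lambda>V::unit \<Rightarrow> 'p set. \<exists>G. finite G \<and> G \<subseteq> W \<and> V = (\<lambda>_. shull (B \<union> G))"
  have fam: "fam scops (\<lambda>_::unit. UNIV) (\<lambda>_. B) (\<lambda>_. shull (B \<union> G))" for G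
    using shull_superset[of "B \<union> G"] by (intro fam_scopsI subm_shull) auto
  have "?P (\<lambda>_. shull (B \<union> {}))" by blast
  then show ?thesis
  proof (rule noeth_max[where P = ?P, OF noe fam])
    fix V assume V: "?P V" and max: "\<And>V'. fam scops (\<lambda>_. UNIV) (\<lambda>_. B) V' \<Longrightarrow> ?P V' \<Longrightarrow> V \<le> V' \<Longrightarrow> V' = V"
    from V obtain G where G: "finite G" "G \<subseteq> W" "V = (\<lambda>_. shull (B \<union> G))" by blast
    have "W \<subseteq> shull (B \<union> G)"
    proof
      fix x assume "x \<in> W"
      then have P: "?P (\<lambda>_. shull (B \<union> insert x G))" using G by (intro exI[of _ "insert x G"]) auto
      have "shull (B \<union> G) \<subseteq> shull (B \<union> insert x G)"
        using shull_superset[of "B \<union> insert x G"] by (intro shull_least subm_shull) blast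
      then have "V \<le> (\<lambda>_. shull (B \<union> insert x G))" by (simp add: G(3) le_fun_def)
      from max[OF fam P this] have "shull (B \<union> insert x G) = shull (B \<union> G)" using G(3) by metis
      then show "x \<in> shull (B \<union> G)" using shull_superset[of "B \<union> insert x G"] by blast
    qed
    moreover have "shull (B \<union> G) \<subseteq> W" using W G(2) by (intro shull_least) auto
    ultimately show thesis using that G by blast
  qed
qed

interpretation V: scal vsc by (rule scal_vsc)

text \<open>Induction on the coordinates: projecting to the coordinate \<open>b\<close> gives a copy
  of \<open>UNIV / P0\<close>, and the kernel is a module of tuples over the remaining
  coordinates.\<close>

lemma noeth_Cb:
  assumes noe: "noeth scops (\<lambda>_::unit. UNIV) (\<lambda>_. P0)" and P0: "subm P0" and "finite \<gamma>"
  shows "noeth V.scops (\<lambda>_::unit. UNIV) (\<lambda>_. Cb \<gamma> P0)"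
  using \<open>finite \<gamma>\<close>
proof induction
  case empty
  have "W = W'" if "fam V.scops (\<lambda>_::unit. UNIV) (\<lambda>_. Cb {} P0) W" "fam V.scops (\<lambda>_::unit. UNIV) (\<lambda>_. Cb {} P0) W'" for W W'
    using famD(2)[OF that(1)] famD(2)[OF that(2)] by (intro ext) (auto simp: Cb_def)
  then show ?case unfolding noeth_def by blast
next
  case (insert b \<gamma>)
  let ?U = "\<lambda>_::unit. UNIV" and ?B = "\<lambda>_::unit. Cb (insert b \<gamma>) P0" and ?Y = "\<lambda>_::unit. Cb {b} P0"
  have YB: "Cb (insert b \<gamma>) P0 \<subseteq> Cb {b} P0" by (auto simp: Cb_def)
  have subU: "V.subm UNIV" by (auto simp: V.subm_def subgrp_def)
  show ?case
  proof (rule noeth_ext[where Y = ?Y])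
    show "fam V.scops ?U ?B ?Y" using YB by (intro V.fam_scopsI subm_Cb P0) auto
    show "sys V.scops ?U ?B" by (intro V.sys_scops subm_Cb P0 subU) auto
    show "noeth V.scops ?U ?Y"
    proof (rule noeth_embed[OF noe, where \<Phi> = "\<lambda>W u. (\<lambda>x. x b) ` W u"])
      fix W assume W: "fam V.scops ?U ?Y W"
      note Wd = famD[OF W] and Ws = V.subm_fam[OF W order_refl]
      show "fam scops ?U (\<lambda>_. P0) (\<lambda>u. (\<lambda>x. x b) ` W u)"
      proof (rule fam_scopsI)
        fix u
        show "subm ((\<lambda>x. x b) ` W u)" unfolding subm_def
        proof (intro conjI allI ballI)
          show "subgrp ((\<lambda>x. x b) ` W u)" using Wd(1) by (rule subgrp_image) simp
          fix t y assume "y \<in> (\<lambda>x. x b) ` W u"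
          then obtain x where "x \<in> W u" "y = x b" by blast
          then show "t \<bullet> y \<in> (\<lambda>x. x b) ` W u"
            using V.submD(2)[OF Ws, of x u t] by (auto simp: vsc_def intro!: image_eqI[of _ _ "vsc t x"])
        qed
        show "P0 \<subseteq> (\<lambda>x. x b) ` W u"
        proof
          fix p assume "p \<in> P0"
          then have "(\<lambda>_. p) \<in> W u" using Wd(2)[of u] by (auto simp: Cb_def)
          then show "p \<in> (\<lambda>x. x b) ` W u" by (auto intro!: image_eqI[of _ _ "\<lambda>_. p"])
        qed
      qed simp
    next
      fix W W' assume W: "fam V.scops ?U ?Y W" and W': "fam V.scops ?U ?Y W'"
        and le: "W \<le> W'" and eq: "(\<lambda>u. (\<lambda>x. x b) ` W u) = (\<lambda>u. (\<lambda>x. x b) ` W' u)"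
      have "x \<in> W u" if "x \<in> W' u" for x u
      proof -
        have "x b \<in> (\<lambda>x. x b) ` W u" using fun_cong[OF eq, of u] that by auto
        then obtain w where w: "w \<in> W u" "x b = w b" by auto
        have "x - w \<in> W u" using famD(2)[OF W, of u] w(2) subgrp_0[OF submD(1)[OF P0]] by (auto simp: Cb_def)
        then show ?thesis using w(1) by (rule subgrp_cancel[OF famD(1)[OF W]])
      qed
      then show "W = W'" by (intro antisym[OF le] le_funI subsetI)
    qed (auto simp: le_fun_def)
    have bd: "(x - y)(b := 0) = x(b := 0) - y(b := 0)" for x y :: "nat \<Rightarrow> 'p" by auto
    show "noeth V.scops ?Y ?B"
    \<comment> \<open>Setting the coordinate \<open>b\<close> to zero changes an element of
      \<open>Cb {b} P0\<close> only by an element of the smaller family, so nothing is lost.\<close>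
    proof (rule noeth_embed[OF insert.IH, where \<Phi> = "\<lambda>W u. {x. x(b := 0) \<in> W u}"])
      fix W assume W: "fam V.scops ?Y ?B W"
      note Wd = famD[OF W] and Ws = V.subm_fam[OF W order_refl]
      show "fam V.scops ?U (\<lambda>_. Cb \<gamma> P0) (\<lambda>u. {x. x(b := 0) \<in> W u})"
      proof (rule V.fam_scopsI)
        fix u
        have "(vsc t x)(b := 0) = vsc t (x(b := 0))" for t x by (auto simp: vsc_def)
        then show "V.subm {x. x(b := 0) \<in> W u}"
          using subgrp_vimage[where h = "\<lambda>x. x(b := 0)", OF Wd(1) bd] V.submD(2)[OF Ws] by (auto simp: V.subm_def)
        show "Cb \<gamma> P0 \<subseteq> {x. x(b := 0) \<in> W u}"
          using Wd(2)[of u] subgrp_0[OF submD(1)[OF P0]] by (auto simp: Cb_def)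
      qed simp
    next
      fix W W' assume W: "fam V.scops ?Y ?B W" and W': "fam V.scops ?Y ?B W'"
        and le: "W \<le> W'" and eq: "(\<lambda>u. {x. x(b := 0) \<in> W u}) = (\<lambda>u. {x. x(b := 0) \<in> W' u})"
      have d: "x - x(b := 0) \<in> Cb (insert b \<gamma>) P0" if "x \<in> Cb {b} P0" for x
        using that subgrp_0[OF submD(1)[OF P0]] by (auto simp: Cb_def)
      have "x \<in> W u" if x: "x \<in> W' u" for x u
      proof -
        have xd: "x - x(b := 0) \<in> Cb (insert b \<gamma>) P0" using famD(3)[OF W', of u] x by (intro d) blast
        have "x(b := 0) \<in> W' u"
          by (rule subgrp_cancel'[OF famD(1)[OF W'] subsetD[OF famD(2)[OF W'] xd] x])
        then have "(x(b := 0))(b := 0) \<in> W' u" by simp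
        then have "(x(b := 0))(b := 0) \<in> W u" using fun_cong[OF eq, of u] by blast
        then have "x(b := 0) \<in> W u" by simp
        with subsetD[OF famD(2)[OF W] xd] show ?thesis by (rule subgrp_cancel[OF famD(1)[OF W]])
      qed
      then show "W = W'" by (intro antisym[OF le] le_funI subsetI)
    qed (auto simp: le_fun_def)
  qed
qed

end

section \<open>Powers of an ideal\<close>

text \<open>The intended \<open>N n\<close> is the preimage of I^nN under a cover of N with kernel
  \<open>P0\<close>. The assumption \<open>Ngen\<close> says that the filtration is adic, so the
  Rees module is generated in degree zero.\<close>

locale rees = scal sc for sc :: "'t::comm_ring_1 \<Rightarrow> 'p::ab_group_add \<Rightarrow> 'p" (infixr "\<bullet>" 75) +
  fixes T0 :: "'t set" and f :: "nat \<Rightarrow> 't" and C :: nat and a :: "'t set" and P0 :: "'p set" and N :: "nat \<Rightarrow> 'p set"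
  assumes T0: "idl T0" and reg: "reg T0 f C" and a: "idl a" and Ja: "Jk T0 f C \<subseteq> a"
    and P0: "subm P0" and N: "subm (N n)" and P0N: "P0 \<subseteq> N n" and N0: "N 0 = UNIV"
    and JP: "t \<in> Jk T0 f C \<Longrightarrow> t \<bullet> x \<in> P0"
    and aN: "t \<in> a \<Longrightarrow> x \<in> N n \<Longrightarrow> t \<bullet> x \<in> N (Suc n)"
    and Ngen: "N (Suc n) \<subseteq> gspan (P0 \<union> {t \<bullet> x | t x. t \<in> a \<and> x \<in> N n})"
    and noeT: "noeth (scal.scops (*)) (\<lambda>_::unit. UNIV) (\<lambda>_. T0)"
    and noeP: "noeth scops (\<lambda>_::unit. UNIV) (\<lambda>_. P0)"
begin

interpretation V: scal vsc by (rule scal_vsc)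

interpretation R: scal "(*) :: 't \<Rightarrow> 't \<Rightarrow> 't" by (rule scal_times)

lemma Ndec: "N (Suc n) \<subseteq> N n"
  by (rule subset_trans[OF Ngen gspan_least[OF submD(1)[OF N]]]) (use P0N submD(2)[OF N] in blast)

lemma Nmono: "m \<le> n \<Longrightarrow> N n \<subseteq> N m"
  using lift_Suc_antimono_le[of N m n] Ndec by blast

text \<open>Finite generation in the form of an induction principle, ready for showing that an ideal
  is contained in a set of good elements.\<close>

lemma ideal_generators:
  assumes "idl I" "T0 \<subseteq> I"
  obtains G where "finite G" "G \<subseteq> I" "\<And>W. idl W \<Longrightarrow> T0 \<subseteq> W \<Longrightarrow> G \<subseteq> W \<Longrightarrow> I \<subseteq> W"
proof -
  have [simp]: "R.subm W \<longleftrightarrow> idl W" for W by (simp add: R.subm_def idl_def)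
  obtain G where "finite G" "G \<subseteq> I" "I = R.shull (T0 \<union> G)"
    using R.noeth_fg[OF noeT, of I] assms by auto
  then show ?thesis using that R.shull_least[of _ "T0 \<union> G"] by auto
qed

lemma T0P: "t \<in> T0 \<Longrightarrow> t \<bullet> x \<in> P0"
  using JP Jk_mono[OF T0, of 0 C f] by auto

text \<open>Hilbert's theorem once for each element of \<open>gs\<close>. At the bottom the images
  of all of them have been divided out and only the scalars act.\<close>

lemma rees_noeth_step:
  assumes gs: "set gs \<subseteq> a" and sys: "sys (V.scops \<union> Pair Suc ` \<Theta>A a) Z B"
    and noe: "noeth V.scops Z (\<lambda>n. gspan (B n \<union> {vsc g z | g z e. g \<in> set gs \<and> n = Suc e \<and> z \<in> Z e}))"
  shows "noeth (V.scops \<union> Pair Suc ` \<Theta>A (set gs)) Z B"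
  using assms
proof (induction gs arbitrary: B)
  case Nil
  have "gspan (B n \<union> {}) \<subseteq> B n" for n using sysD(4)[OF Nil(2)] by (intro gspan_least) auto
  then have "gspan (B n \<union> {}) = B n" for n using gspan_superset[of "B n \<union> {}"] by auto
  then show ?case using Nil(3) by (simp add: \<Theta>A_def)
next
  case (Cons g gs)
  let ?O = "V.scops \<union> Pair Suc ` \<Theta>A a" and ?t = "\<lambda>d::nat. vsc g"
  let ?B1 = "imgadd Suc ?t Z B"
  have g: "(Suc, ?t) \<in> ?O" using Cons.prems(1) by (auto simp: \<Theta>A_def)
  then have ins: "insert (Suc, ?t) ?O = ?O" by blast
  have c1: "\<sigma> (Suc d) = Suc (\<sigma> d)" if "(\<sigma>, \<tau>) \<in> ?O" for \<sigma> \<tau> d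
    using that by (auto simp: V.scops_def \<Theta>A_def)
  have c2: "vsc g (\<tau> d x) - \<tau> (Suc d) (vsc g x) \<in> B (Suc (\<sigma> d))" if "(\<sigma>, \<tau>) \<in> ?O" for \<sigma> \<tau> d x
    using that subgrp_0[OF sysD(4)[OF Cons.prems(2)]] by (auto simp: V.scops_def \<Theta>A_def V.sc_left_commute[of g])
  have "sys ?O Z ?B1"
    by (rule sys_imgadd[of Suc ?t]) (use Cons.prems(2) ins c1 c2 in auto)
  moreover have "noeth V.scops Z (\<lambda>n. gspan (?B1 n \<union> {vsc g z | g z e. g \<in> set gs \<and> n = Suc e \<and> z \<in> Z e}))"
  proof (rule noeth_mono[OF Cons.prems(3)])
    fix n
    have "B n \<union> {vsc h z | h z e. h \<in> set (g # gs) \<and> n = Suc e \<and> z \<in> Z e}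
       \<subseteq> ?B1 n \<union> {vsc g z | g z e. g \<in> set gs \<and> n = Suc e \<and> z \<in> Z e}"
      using imgadd_superset(1)[of B n Suc ?t Z] imgadd_superset(2)[where \<sigma> = Suc and \<tau> = ?t and Z = Z and B = B] by auto
    then show "gspan (B n \<union> {vsc h z | h z e. h \<in> set (g # gs) \<and> n = Suc e \<and> z \<in> Z e})
       \<subseteq> gspan (?B1 n \<union> {vsc g z | g z e. g \<in> set gs \<and> n = Suc e \<and> z \<in> Z e})"
      by (rule gspan_mono)
  qed auto
  ultimately have IH: "noeth (V.scops \<union> Pair Suc ` \<Theta>A (set gs)) Z ?B1"
    using Cons.prems(1) by (intro Cons.IH) auto
  have eq: "V.scops \<union> Pair Suc ` \<Theta>A (set (g # gs)) = insert (Suc, ?t) (V.scops \<union> Pair Suc ` \<Theta>A (set gs))"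
    by (auto simp: \<Theta>A_def)
  have sub: "V.scops \<union> Pair Suc ` \<Theta>A (set gs) \<subseteq> ?O" using Cons.prems(1) by (auto simp: \<Theta>A_def)
  show ?case unfolding eq
  proof (rule noeth_hilbert[where h = "\<lambda>n. n"])
    show "sys (insert (Suc, ?t) (V.scops \<union> Pair Suc ` \<Theta>A (set gs))) Z B"
      using Cons.prems(2) by (rule sys_subset) (use sub g in blast)
    show "noeth (V.scops \<union> Pair Suc ` \<Theta>A (set gs)) Z ?B1" by (rule IH)
    fix \<sigma> \<tau> d x assume op: "(\<sigma>, \<tau>) \<in> V.scops \<union> Pair Suc ` \<Theta>A (set gs)"
    show "\<sigma> (Suc d) = Suc (\<sigma> d)" using c1 sub op by blast
    show "vsc g (\<tau> d x) - \<tau> (Suc d) (vsc g x) \<in> B (Suc (\<sigma> d))" using c2 sub op by blast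
  qed auto
qed

text \<open>By \<open>rees_noeth_step\<close> it suffices to divide out the images of generators of
  \<open>a\<close>, and \<open>Ngen\<close> makes the resulting quotient vanish in positive
  degrees.\<close>

lemma rees_noeth:
  assumes fin: "finite \<gamma>"
  shows "noeth (V.scops \<union> Pair Suc ` \<Theta>A a) (\<lambda>n. Cb \<gamma> (N n)) (\<lambda>n. Cb \<gamma> P0)"
proof -
  let ?Z = "\<lambda>n. Cb \<gamma> (N n)" and ?B = "\<lambda>n::nat. Cb \<gamma> P0"
  have T0a: "T0 \<subseteq> a" using Ja Jk_mono[OF T0, of 0 C f] by auto
  obtain G where G: "finite G" "G \<subseteq> a" "\<And>W. idl W \<Longrightarrow> T0 \<subseteq> W \<Longrightarrow> G \<subseteq> W \<Longrightarrow> a \<subseteq> W"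
    using ideal_generators[OF a T0a] by blast
  obtain gs where gs: "set gs = G" using finite_list[OF G(1)] by blast
  have "sys (V.scops \<union> Pair Suc ` \<Theta>A a) ?Z ?B"
    unfolding sys_def fam_def V.scops_def \<Theta>A_def
    using subm_Cb[OF N] subm_Cb[OF P0] Cb_mono[OF P0N] aN submD(2)[OF P0]
    by (auto simp: V.subm_def V.sc_diff) (auto simp: Cb_def vsc_def)
  moreover have "noeth V.scops ?Z (\<lambda>n. gspan (?B n \<union> {vsc g z | g z e. g \<in> set gs \<and> n = Suc e \<and> z \<in> ?Z e}))"
    (is "noeth _ _ ?B'")
  \<comment> \<open>With only degree zero left, a family is determined by its component
    \<open>W 0\<close>.\<close>
  proof (rule noeth_embed[OF noeth_Cb[OF noeP P0 fin], where \<Phi> = "\<lambda>W _. W 0"])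
    have B'0: "Cb \<gamma> P0 \<subseteq> ?B' n" for n by (rule order_trans[OF Un_upper1 gspan_superset])
    show "fam V.scops (\<lambda>_::unit. UNIV) (\<lambda>_. Cb \<gamma> P0) (\<lambda>_. W 0)" if W: "fam V.scops ?Z ?B' W" for W
      using V.subm_fam[OF W order_refl] famD(2)[OF W, of 0] B'0[of 0] by (intro V.fam_scopsI) auto
    have sp: "?Z (Suc n) \<subseteq> ?B' (Suc n)" for n
    proof
      fix x assume x: "x \<in> ?Z (Suc n)"
      let ?H = "?B' (Suc n)"
      \<comment> \<open>\<open>e b p\<close> is the tuple with the single entry \<open>p\<close>. A
        tuple is treated one coordinate at a time because \<open>Ngen\<close> speaks of elements of
        the module.\<close>
      define e where "e b p = (\<lambda>c. if c = b then p else 0)" for b :: nat and p :: 'p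
      have H: "subgrp ?H" by (rule subgrp_gspan)
      have ediff: "e b (p - q) = e b p - e b q" for b p q by (auto simp: e_def)
      have eP: "e b p \<in> ?H" if "p \<in> P0" for b p
      proof -
        have "e b p \<in> Cb \<gamma> P0" using that subgrp_0[OF submD(1)[OF P0]] by (auto simp: e_def Cb_def)
        then show ?thesis using B'0 by blast
      qed
      have ea: "e b (t \<bullet> y) \<in> ?H" if t: "t \<in> a" and y: "y \<in> N n" for b t y
      proof -
        \<comment> \<open>The quantifier over \<open>s\<close> turns the set of good
          \<open>t\<close> into an ideal, so checking generators of \<open>a\<close> is
          enough.\<close>
        have "a \<subseteq> {t. \<forall>s. e b ((s * t) \<bullet> y) \<in> ?H}"
        proof (rule G(3))
          show "idl {t. \<forall>s. e b ((s * t) \<bullet> y) \<in> ?H}" unfolding idl_def subgrp_def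
          proof (intro conjI ballI allI CollectI)
            show "e b ((s * 0) \<bullet> y) \<in> ?H" for s
              using eP[of 0 b] subgrp_0[OF submD(1)[OF P0]] by simp
            fix t t' s assume "t \<in> {t. \<forall>s. e b ((s * t) \<bullet> y) \<in> ?H}" "t' \<in> {t. \<forall>s. e b ((s * t) \<bullet> y) \<in> ?H}"
            then have "e b ((s * t) \<bullet> y) - e b ((s * t') \<bullet> y) \<in> ?H" by (intro subgrp_diff[OF H]) auto
            then show "e b ((s * (t - t')) \<bullet> y) \<in> ?H" by (simp add: right_diff_distrib sc_diff' ediff)
          next
            fix s t s' assume "t \<in> {t. \<forall>s. e b ((s * t) \<bullet> y) \<in> ?H}"
            then show "e b ((s' * (s * t)) \<bullet> y) \<in> ?H" by (simp add: mult.assoc[symmetric])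
          qed
          show "T0 \<subseteq> {t. \<forall>s. e b ((s * t) \<bullet> y) \<in> ?H}"
            using eP T0P idlD(2)[OF T0] by blast
          show "G \<subseteq> {t. \<forall>s. e b ((s * t) \<bullet> y) \<in> ?H}"
          proof (clarify)
            fix g s assume g: "g \<in> G"
            have "e b (s \<bullet> y) \<in> ?Z n"
              using submD(2)[OF N y] subgrp_0[OF submD(1)[OF N]] by (auto simp: e_def Cb_def)
            then have "vsc g (e b (s \<bullet> y)) \<in> {vsc g z | g z e. g \<in> set gs \<and> Suc n = Suc e \<and> z \<in> ?Z e}"
              using g gs by blast
            then have "vsc g (e b (s \<bullet> y)) \<in> ?H" by (intro subsetD[OF gspan_superset] UnI2)
            moreover have "vsc g (e b (s \<bullet> y)) = e b ((s * g) \<bullet> y)"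
              by (auto simp: e_def vsc_def sc_mult[symmetric] mult.commute)
            ultimately show "e b ((s * g) \<bullet> y) \<in> ?H" by simp
          qed
        qed
        then have "e b ((1 * t) \<bullet> y) \<in> ?H" using t by blast
        then show ?thesis by simp
      qed
      have eN: "e b p \<in> ?H" if "p \<in> N (Suc n)" for b p
      proof -
        have "gspan (P0 \<union> {t \<bullet> x | t x. t \<in> a \<and> x \<in> N n}) \<subseteq> {p. e b p \<in> ?H}"
          using eP ea by (intro gspan_least subgrp_vimage[OF H] ediff) auto
        then show ?thesis using Ngen that by blast
      qed
      have "(\<Sum>b\<in>\<gamma>. e b (x b)) \<in> ?H"
        by (intro subgrp_sum H eN CbD[OF x])
      moreover have "x - (\<Sum>b\<in>\<gamma>. e b (x b)) \<in> ?H"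
      proof -
        have "(\<Sum>b\<in>\<gamma>. e b (x b)) c = x c" if "c \<in> \<gamma>" for c
        proof -
          have "(\<Sum>b\<in>\<gamma>. e b (x b)) c = (\<Sum>b\<in>\<gamma>. e b (x b) c)" using fin by (induction \<gamma> rule: finite_induct) auto
          then show ?thesis using that fin by (simp add: e_def)
        qed
        then have "x - (\<Sum>b\<in>\<gamma>. e b (x b)) \<in> Cb \<gamma> P0" using subgrp_0[OF submD(1)[OF P0]] by (auto simp: Cb_def)
        then show ?thesis using B'0 by blast
      qed
      ultimately show "x \<in> ?H" by (rule subgrp_cancel[OF H, rotated])
    qed
    fix W W' assume W: "fam V.scops ?Z ?B' W" and W': "fam V.scops ?Z ?B' W'"
      and eq: "(\<lambda>_::unit. W 0) = (\<lambda>_. W' 0)"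
    show "W = W'"
    proof
      fix n show "W n = W' n"
      proof (cases n)
        case 0 then show ?thesis using fun_cong[OF eq] by simp
      next
        case (Suc m)
        have "?Z (Suc m) = W (Suc m)"
          using sp[of m] famD(2)[OF W, of "Suc m"] famD(3)[OF W, of "Suc m"] by blast
        moreover have "?Z (Suc m) = W' (Suc m)"
          using sp[of m] famD(2)[OF W', of "Suc m"] famD(3)[OF W', of "Suc m"] by blast
        ultimately show ?thesis using Suc by simp
      qed
    qed
  qed (auto simp: le_fun_def)
  ultimately have "noeth (V.scops \<union> Pair Suc ` \<Theta>A (set gs)) ?Z ?B"
    using gs G(2) by (intro rees_noeth_step) auto
  then show ?thesis by (rule noeth_mono) (use gs G(2) in \<open>auto simp: \<Theta>A_def\<close>)
qed

end

section \<open>Eventual constancy of associated primes in a Noetherian system\<close>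

lemma eventually_constant:
  fixes P :: "nat \<Rightarrow> nat \<Rightarrow> bool"
  assumes 1: "\<And>n k. n \<ge> A \<Longrightarrow> k \<ge> B \<Longrightarrow> \<not> P n k \<Longrightarrow> \<not> P (Suc n) k"
    and 2: "\<And>n k. n \<ge> A \<Longrightarrow> k \<ge> B \<Longrightarrow> \<not> P n k \<Longrightarrow> \<not> P n (Suc k)"
  shows "\<exists>n0 k0. (\<forall>n\<ge>n0. \<forall>k\<ge>k0. P n k) \<or> (\<forall>n\<ge>n0. \<forall>k\<ge>k0. \<not> P n k)"
proof (cases "\<forall>n\<ge>A. \<forall>k\<ge>B. P n k")
  case False
  \<comment> \<open>One failure in the quadrant spreads first along \<open>n\<close> and then, for
    each \<open>n\<close>, along \<open>k\<close>.\<close>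
  then obtain n0 k0 where *: "n0 \<ge> A" "k0 \<ge> B" "\<not> P n0 k0" by blast
  have a: "\<not> P n k0" if "n \<ge> n0" for n
    using that by (induction n rule: dec_induct) (use * 1 in auto)
  have "\<not> P n k" if "n \<ge> n0" "k \<ge> k0" for n k
    using that(2) by (induction k rule: dec_induct) (use * a that(1) 2 in auto)
  then show ?thesis by blast
qed blast

context scal
begin

text \<open>These are the elements that vanish in the localisation at \<open>p\<close> of the
  quotient by \<open>B\<close>.\<close>

lemma subgrp_torsion:
  assumes "subm B" "prime_id p"
  shows "subgrp {x. \<exists>s. s \<notin> p \<and> s \<bullet> x \<in> B}"
  unfolding subgrp_def
proof (intro conjI ballI)
  show "0 \<in> {x. \<exists>s. s \<notin> p \<and> s \<bullet> x \<in> B}"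
    using prime_idD(3)[OF assms(2)] subgrp_0[OF submD(1)[OF assms(1)]] by auto
  fix x y assume "x \<in> {x. \<exists>s. s \<notin> p \<and> s \<bullet> x \<in> B}" "y \<in> {x. \<exists>s. s \<notin> p \<and> s \<bullet> x \<in> B}"
  then obtain s t where st: "s \<notin> p" "s \<bullet> x \<in> B" "t \<notin> p" "t \<bullet> y \<in> B" by blast
  have "s * t \<notin> p" using prime_idD(4)[OF assms(2), of s t] st by blast
  moreover have "(s * t) \<bullet> (x - y) \<in> B"
  proof -
    have "t \<bullet> s \<bullet> x - s \<bullet> t \<bullet> y \<in> B"
      using st submD[OF assms(1)] by (intro subgrp_diff) auto
    then show ?thesis by (simp add: sc_diff sc_mult sc_left_commute[of t s])
  qed
  ultimately show "x - y \<in> {x. \<exists>s. s \<notin> p \<and> s \<bullet> x \<in> B}" by blast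
qed

text \<open>An element has annihilator exactly \<open>p\<close> if \<open>p\<close> kills it and
  nothing outside \<open>p\<close> does. Failure of this for all elements is an inclusion, and
  inclusions can be checked on generators.\<close>

lemma not_assp_iff:
  assumes "prime_id p"
  shows "\<not> assp Z B p \<longleftrightarrow> {x \<in> Z. \<forall>t\<in>p. t \<bullet> x \<in> B} \<subseteq> {x. \<exists>s. s \<notin> p \<and> s \<bullet> x \<in> B}"
  unfolding assp_def using assms by blast

text \<open>Since \<open>\<theta>\<close> commutes with scalars, a multiplier outside
  \<open>p\<close> that kills \<open>x\<close> also kills \<open>\<theta> x\<close>; torsion thus
  passes from \<open>W\<close> to everything generated by it.\<close>

lemma generated_torsion:
  assumes B: "subm B'" and p: "prime_id p"
    and W: "W' \<subseteq> gspan (B' \<union> {\<theta> x | \<theta> x. \<theta> \<in> \<Theta> \<and> x \<in> W})"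
    and tors: "W \<subseteq> {x. \<exists>s. s \<notin> p \<and> s \<bullet> x \<in> B}"
    and th: "\<And>\<theta> x. \<theta> \<in> \<Theta> \<Longrightarrow> x \<in> B \<Longrightarrow> \<theta> x \<in> B''" "\<And>\<theta> s x. \<theta> \<in> \<Theta> \<Longrightarrow> \<theta> (s \<bullet> x) = s \<bullet> \<theta> x"
    and B'': "subm B''" "B' \<subseteq> B''"
  shows "W' \<subseteq> {x. \<exists>s. s \<notin> p \<and> s \<bullet> x \<in> B''}"
proof (rule subset_trans[OF W gspan_least[OF subgrp_torsion[OF B''(1) p]]])
  have "x \<in> {x. \<exists>s. s \<notin> p \<and> s \<bullet> x \<in> B''}" if "x \<in> B'" for x
    using that B''(2) prime_idD(3)[OF p] by (auto intro!: exI[of _ 1])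
  moreover have "\<theta> x \<in> {x. \<exists>s. s \<notin> p \<and> s \<bullet> x \<in> B''}" if t: "\<theta> \<in> \<Theta>" and x: "x \<in> W" for \<theta> x
  proof -
    obtain s where s: "s \<notin> p" "s \<bullet> x \<in> B" using tors x by blast
    show ?thesis using s(1) th(1)[OF t s(2)] th(2)[OF t] by auto
  qed
  ultimately show "B' \<union> {\<theta> x | \<theta> x. \<theta> \<in> \<Theta> \<and> x \<in> W} \<subseteq> {x. \<exists>s. s \<notin> p \<and> s \<bullet> x \<in> B''}" by blast
qed

end

context scal
begin

interpretation V: scal vsc by (rule scal_vsc)

text \<open>Bounded generation with the filtration index as level; the bound is uniform in the
  cohomological degree.\<close>

lemma generated_n:
  assumes noe: "noeth (Om a c \<beta> S) Z B" and sys: "sys (Om a c \<beta> S) Z B" and W: "fam (Om a c \<beta> S) Z B W"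
  shows "\<exists>K. \<forall>n\<ge>K. \<forall>i. W (Suc n, i) \<subseteq> gspan (B (Suc n, i) \<union> {\<theta> x | \<theta> x. \<theta> \<in> vsc ` a \<and> x \<in> W (n, i)})"
proof -
  let ?O = "V.scops \<union> Pair sT ` \<Theta>T c \<beta> S :: (nat \<times> int, nat \<Rightarrow> 'p) oper set"
  have eq: "Om a c \<beta> S = ?O \<union> Pair sA ` \<Theta>A a" by (auto simp: Om_def)
  have ops: "(\<sigma> = (\<lambda>d. d) \<and> (\<exists>t. \<tau> = (\<lambda>d. vsc t))) \<or> (\<sigma> = sT \<and> (\<exists>j<c. \<tau> = (\<lambda>d. act (\<beta> (snd d)) (S j (snd d)))))"
    if "(\<sigma>, \<tau>) \<in> ?O" for \<sigma> \<tau>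
    using that by (auto simp: V.scops_def \<Theta>T_def)
  have zero: "0 \<in> B d" for d using subgrp_0[OF sysD(4)[OF sys]] .
  have "\<exists>K::nat. \<forall>d. int K \<le> int (fst d) \<longrightarrow>
    W (sA d) \<subseteq> gspan (B (sA d) \<union> {\<theta> d x | \<theta> x. \<theta> \<in> \<Theta>A a \<and> x \<in> W d})"
  proof (rule noeth_generated[OF noe[unfolded eq] sys[unfolded eq] W[unfolded eq], where \<pi> = "\<lambda>d. (fst d - 1, snd d)"])
    fix \<sigma> \<tau> and d :: "nat \<times> int" assume op: "(\<sigma>, \<tau>) \<in> ?O"
    show "int (fst (\<sigma> d)) = int (fst d)" "\<sigma> (sA d) = sA (\<sigma> d)" using ops[OF op] by (auto simp: sT_def sA_def)
    fix \<theta> :: "nat \<times> int \<Rightarrow> (nat \<Rightarrow> 'p) \<Rightarrow> nat \<Rightarrow> 'p" and x assume "\<theta> \<in> \<Theta>A a"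
    then obtain t where \<theta>: "\<theta> = (\<lambda>d. vsc t)" by (auto simp: \<Theta>A_def)
    have "\<tau> (sA d) (\<theta> d x) = \<theta> (\<sigma> d) (\<tau> d x)"
      using ops[OF op] by (auto simp: \<theta> V.sc_left_commute[of _ t] act_vsc sA_def)
    then show "\<tau> (sA d) (\<theta> d x) - \<theta> (\<sigma> d) (\<tau> d x) \<in> B (sA (\<sigma> d))" using zero by simp
  qed (auto simp: sA_def)
  then obtain K :: nat where K: "\<And>d. int K \<le> int (fst d) \<Longrightarrow>
    W (sA d) \<subseteq> gspan (B (sA d) \<union> {\<theta> d x | \<theta> x. \<theta> \<in> \<Theta>A a \<and> x \<in> W d})" by blast
  show ?thesis
  proof (intro exI[of _ K] allI impI)
    fix n i assume "K \<le> n"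
    moreover have "{\<theta> (n, i) x | \<theta> x. \<theta> \<in> \<Theta>A a \<and> x \<in> W (n, i)} = {\<theta> x | \<theta> x. \<theta> \<in> vsc ` a \<and> x \<in> W (n, i)}"
      (is "?L = ?R")
    proof -
      have "?L = (\<Union>\<theta>\<in>\<Theta>A a. \<theta> (n, i) ` W (n, i))" by blast
      also have "\<dots> = (\<Union>\<theta>\<in>vsc ` a. \<theta> ` W (n, i))" by (simp add: \<Theta>A_def)
      also have "\<dots> = ?R" by blast
      finally show ?thesis .
    qed
    ultimately show "W (Suc n, i) \<subseteq> gspan (B (Suc n, i) \<union> {\<theta> x | \<theta> x. \<theta> \<in> vsc ` a \<and> x \<in> W (n, i)})"
      using K[of "(n, i)"] by simp
  qed
qed

text \<open>Bounded generation in the cohomological direction, uniform in \<open>n\<close>. The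
  level is \<open>i div 2\<close> because the operators raise the degree by two.\<close>

lemma generated_i:
  assumes noe: "noeth (Om a c \<beta> S) Z B" and sys: "sys (Om a c \<beta> S) Z B" and W: "fam (Om a c \<beta> S) Z B W"
  shows "\<exists>K::nat. \<forall>n i. i div 2 \<ge> int K \<longrightarrow>
    W (n, i + 2) \<subseteq> gspan (B (n, i + 2) \<union> {\<theta> x | \<theta> x. \<theta> \<in> (\<lambda>j. act (\<beta> i) (S j i)) ` {..<c} \<and> x \<in> W (n, i)})"
proof -
  let ?O = "V.scops \<union> Pair sA ` \<Theta>A a :: (nat \<times> int, nat \<Rightarrow> 'p) oper set"
  have eq: "Om a c \<beta> S = ?O \<union> Pair sT ` \<Theta>T c \<beta> S" by (auto simp: Om_def)
  have ops: "(\<exists>t. \<tau> = (\<lambda>d. vsc t)) \<and> (\<sigma> = (\<lambda>d. d) \<or> \<sigma> = sA)"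
    if "(\<sigma>, \<tau>) \<in> ?O" for \<sigma> \<tau>
    using that by (auto simp: V.scops_def \<Theta>A_def)
  have zero: "0 \<in> B d" for d using subgrp_0[OF sysD(4)[OF sys]] .
  have "\<exists>K::nat. \<forall>d. int K \<le> snd d div 2 \<longrightarrow>
    W (sT d) \<subseteq> gspan (B (sT d) \<union> {\<theta> d x | \<theta> x. \<theta> \<in> \<Theta>T c \<beta> S \<and> x \<in> W d})"
  proof (rule noeth_generated[OF noe[unfolded eq] sys[unfolded eq] W[unfolded eq], where \<pi> = "\<lambda>d. (fst d, snd d - 2)"])
    fix \<sigma> \<tau> and d :: "nat \<times> int" assume op: "(\<sigma>, \<tau>) \<in> ?O"
    show "snd (\<sigma> d) div 2 = snd d div 2" "\<sigma> (sT d) = sT (\<sigma> d)" using ops[OF op] by (auto simp: sT_def sA_def)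
    fix \<theta> :: "nat \<times> int \<Rightarrow> (nat \<Rightarrow> 'p) \<Rightarrow> nat \<Rightarrow> 'p" and x assume "\<theta> \<in> \<Theta>T c \<beta> S"
    then obtain j where \<theta>: "\<theta> = (\<lambda>d. act (\<beta> (snd d)) (S j (snd d)))" by (auto simp: \<Theta>T_def)
    have "\<tau> (sT d) (\<theta> d x) = \<theta> (\<sigma> d) (\<tau> d x)"
      using ops[OF op] by (auto simp: \<theta> act_vsc sA_def)
    then show "\<tau> (sT d) (\<theta> d x) - \<theta> (\<sigma> d) (\<tau> d x) \<in> B (sT (\<sigma> d))" using zero by simp
  qed (auto simp: sT_def)
  then obtain K :: nat where K: "\<And>d. int K \<le> snd d div 2 \<Longrightarrow>
    W (sT d) \<subseteq> gspan (B (sT d) \<union> {\<theta> d x | \<theta> x. \<theta> \<in> \<Theta>T c \<beta> S \<and> x \<in> W d})" by blast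
  show ?thesis
  proof (intro exI[of _ K] allI impI)
    fix n i assume "int K \<le> i div 2"
    moreover have "{\<theta> (n, i) x | \<theta> x. \<theta> \<in> \<Theta>T c \<beta> S \<and> x \<in> W (n, i)} = {\<theta> x | \<theta> x. \<theta> \<in> (\<lambda>j. act (\<beta> i) (S j i)) ` {..<c} \<and> x \<in> W (n, i)}"
      (is "?L = ?R")
    proof -
      have "?L = (\<Union>\<theta>\<in>\<Theta>T c \<beta> S. \<theta> (n, i) ` W (n, i))" by blast
      also have "\<dots> = (\<Union>\<theta>\<in>(\<lambda>j. act (\<beta> i) (S j i)) ` {..<c}. \<theta> ` W (n, i))" by (simp add: \<Theta>T_def)
      also have "\<dots> = ?R" by blast
      finally show ?thesis .
    qed
    ultimately show "W (n, i + 2) \<subseteq> gspan (B (n, i + 2) \<union> {\<theta> x | \<theta> x. \<theta> \<in> (\<lambda>j. act (\<beta> i) (S j i)) ` {..<c} \<and> x \<in> W (n, i)})"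
      using K[of "(n, i)"] by simp
  qed
qed

text \<open>The elements killed by \<open>p\<close> form a family, generated in bounded degrees in
  both directions. If they are torsion at \<open>p\<close> in one large bidegree, they are so in the
  next one for \<open>n\<close> and for \<open>k\<close>. The parity \<open>r\<close> stays fixed
  because the operators have degree two.\<close>

lemma assp_dichotomy:
  assumes noe: "noeth (Om a c \<beta> S) Z B" and sys: "sys (Om a c \<beta> S) Z B" and p: "prime_id p" and r: "r \<in> {0, 1}"
  shows "\<exists>n0 k0. (\<forall>n\<ge>n0. \<forall>k\<ge>k0. V.assp (Z (n, 2 * int k + r)) (B (n, 2 * int k + r)) p) \<or>
     (\<forall>n\<ge>n0. \<forall>k\<ge>k0. \<not> V.assp (Z (n, 2 * int k + r)) (B (n, 2 * int k + r)) p)"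
proof -
  define W where "W d = {x \<in> Z d. \<forall>t\<in>p. vsc t x \<in> B d}" for d
  define To where "To d = {x. \<exists>s. s \<notin> p \<and> vsc s x \<in> B d}" for d
  have as: "\<not> V.assp (Z d) (B d) p \<longleftrightarrow> W d \<subseteq> To d" for d
    unfolding W_def To_def by (rule V.not_assp_iff[OF p])
  note ZD = fam_OmD[OF sysD(1)[OF sys]] and BD = fam_OmD[OF sysD(2)[OF sys]]
  have W: "fam (Om a c \<beta> S) Z B W"
  proof (rule famI)
    fix d show "subgrp (W d)" unfolding W_def
      using V.submD(1)[OF ZD(1)[of d]] V.submD(1)[OF BD(1)[of d]] by (auto simp: subgrp_def V.sc_diff)
    show "B d \<subseteq> W d" unfolding W_def using V.submD(2)[OF BD(1)[of d]] sysD(5)[OF sys, of d] by auto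
    show "W d \<subseteq> Z d" by (auto simp: W_def)
    fix \<sigma> \<tau> x assume op: "(\<sigma>, \<tau>) \<in> Om a c \<beta> S" and x: "x \<in> W d"
    have "vsc t (\<tau> d x) \<in> B (\<sigma> d)" if "t \<in> p" for t
      using sysD(7)[OF sys op, of "vsc t x" d] x that by (simp add: W_def Om_vsc[OF op])
    then show "\<tau> d x \<in> W (\<sigma> d)" using sysD(6)[OF sys op] x by (simp add: W_def)
  qed
  obtain K where K: "\<And>n i. n \<ge> K \<Longrightarrow> W (Suc n, i) \<subseteq> gspan (B (Suc n, i) \<union> {\<theta> x | \<theta> x. \<theta> \<in> vsc ` a \<and> x \<in> W (n, i)})"
    using generated_n[OF noe sys W] by blast
  obtain L :: nat where L: "\<And>n i. i div 2 \<ge> int L \<Longrightarrow>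
    W (n, i + 2) \<subseteq> gspan (B (n, i + 2) \<union> {\<theta> x | \<theta> x. \<theta> \<in> (\<lambda>j. act (\<beta> i) (S j i)) ` {..<c} \<and> x \<in> W (n, i)})"
    using generated_i[OF noe sys W] by blast
  show ?thesis
  proof (rule eventually_constant[of K L])
    fix n k assume n: "n \<ge> K" and k: "k \<ge> L"
    let ?i = "2 * int k + r"
    assume "\<not> V.assp (Z (n, ?i)) (B (n, ?i)) p"
    then have h: "W (n, ?i) \<subseteq> {x. \<exists>s. s \<notin> p \<and> vsc s x \<in> B (n, ?i)}" unfolding as To_def .
    show "\<not> V.assp (Z (Suc n, ?i)) (B (Suc n, ?i)) p"
      unfolding as To_def
      by (rule V.generated_torsion[OF BD(1) p K[OF n] h])
         (use BD(4) in \<open>auto simp: V.sc_left_commute intro: BD(1)\<close>)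
    have "?i div 2 \<ge> int L" using k r by auto
    from L[OF this] have "W (n, ?i + 2) \<subseteq> {x. \<exists>s. s \<notin> p \<and> vsc s x \<in> B (n, ?i + 2)}"
      by (rule V.generated_torsion[OF BD(1) p _ h])
         (use BD(5) in \<open>auto simp: act_vsc intro: BD(1)\<close>)
    moreover have "?i + 2 = 2 * int (Suc k) + r" by simp
    ultimately show "\<not> V.assp (Z (n, 2 * int (Suc k) + r)) (B (n, 2 * int (Suc k) + r)) p"
      unfolding as To_def by metis
  qed
qed

end

context rees
begin

lemma JN: "t \<in> Jk T0 f C \<Longrightarrow> t \<bullet> x \<in> N n"
  using JP P0N by blast

lemma coefs_R: "coefs sc T0 f C a N (\<lambda>_. P0)"
  by unfold_locales (use T0 reg N P0 P0N JP aN submD(2)[OF P0] in auto)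

lemma coefs_G: "coefs sc T0 f C a N (\<lambda>n. N (Suc n))"
  by unfold_locales (use T0 reg N JN aN Ndec in auto)

lemma coefs_V: "coefs sc T0 f C a (\<lambda>_. UNIV) N"
  by unfold_locales (use T0 reg N JN aN in \<open>auto simp: subm_def subgrp_def\<close>)

end

section \<open>Cohomology of the quotients by powers and of the graded pieces\<close>

locale powers_cohomology = rees sc T0 f C a P0 N for sc :: "'t::comm_ring_1 \<Rightarrow> 'p::ab_group_add \<Rightarrow> 'p" (infixr "\<bullet>" 75)
    and T0 f C a P0 N +
  fixes \<beta> :: "int \<Rightarrow> nat set" and D :: "int \<Rightarrow> nat \<Rightarrow> nat \<Rightarrow> 't" and S :: "nat \<Rightarrow> int \<Rightarrow> nat \<Rightarrow> nat \<Rightarrow> 't"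
  assumes cd: "cdata T0 f C \<beta> D S"
    and noeR: "noeth (Om a C \<beta> S) (Zc \<beta> D N (\<lambda>_. P0)) (Bc \<beta> D N (\<lambda>_. P0))"
    and noeG: "noeth (Om a C \<beta> S) (Zc \<beta> D N (\<lambda>n. N (Suc n))) (Bc \<beta> D N (\<lambda>n. N (Suc n)))"
begin

interpretation V: scal vsc by (rule scal_vsc)

abbreviation "\<delta> i \<equiv> act (\<beta> i) (D i)"
abbreviation "Zr \<equiv> Zc \<beta> D N (\<lambda>_. P0)"
abbreviation "Br \<equiv> Bc \<beta> D N (\<lambda>_. P0)"
abbreviation "Zg \<equiv> Zc \<beta> D N (\<lambda>n. N (Suc n))"
abbreviation "Bg \<equiv> Bc \<beta> D N (\<lambda>n. N (Suc n))"
abbreviation "Uc \<equiv> Zc \<beta> D (\<lambda>_. UNIV) N"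
abbreviation "Fc \<equiv> Bc \<beta> D (\<lambda>_. UNIV) N"

lemmas sysR = coefs.sys_cohomology[OF coefs_R cd order_refl]
lemmas sysG = coefs.sys_cohomology[OF coefs_G cd order_refl]
lemmas sysV = coefs.sys_cohomology[OF coefs_V cd order_refl]
lemmas famRZ = fam_OmD[OF sysD(1)[OF sysR]] and famRB = fam_OmD[OF sysD(2)[OF sysR]]
lemmas famGZ = fam_OmD[OF sysD(1)[OF sysG]] and famGB = fam_OmD[OF sysD(2)[OF sysG]]
lemmas famU = fam_OmD[OF sysD(1)[OF sysV]] and famF = fam_OmD[OF sysD(2)[OF sysV]]

lemma F_mono: "m \<le> n \<Longrightarrow> Fc (n, i) \<subseteq> Fc (m, i)"
  using Cb_mono[OF Nmono] unfolding Bc_iff subset_iff by blast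

lemma Br_mono: "m \<le> n \<Longrightarrow> Br (n, i) \<subseteq> Br (m, i)"
  using Cb_mono[OF Nmono] unfolding Bc_iff subset_iff by blast

lemma Zr_mono: "m \<le> n \<Longrightarrow> Zr (n, i) \<subseteq> Zr (m, i)"
  using Cb_mono[OF Nmono] unfolding Zc_iff subset_iff by blast

lemma F_0: "Fc (0, i) = UNIV"
  by (auto simp: Bc_iff N0 Cb_def)

lemma C_F: "Cb (\<beta> i) (N n) \<subseteq> Fc (n, i)"
  by (rule coefs.X'_Bc[OF coefs_V])

lemma Br_F: "Br (m, i) \<subseteq> Fc (n, i)"
proof
  fix x assume "x \<in> Br (m, i)"
  then obtain y where "x - \<delta> (i - 1) y \<in> Cb (\<beta> i) P0" by (auto simp: Bc_iff)
  then have "x - \<delta> (i - 1) y \<in> Cb (\<beta> i) (N n)" using Cb_mono[OF P0N] by blast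
  then show "x \<in> Fc (n, i)" by (auto simp: Bc_iff Cb_def intro!: exI[of _ y])
qed

lemma Zr_U: "Zr (0, i) \<subseteq> Uc (n, i)"
proof
  fix x assume "x \<in> Zr (0, i)"
  then have "\<delta> i x \<in> Cb (\<beta> (i + 1)) (N n)" using Cb_mono[OF P0N, of "\<beta> (i + 1)" n] by (auto simp: Zc_iff)
  then show "x \<in> Uc (n, i)" by (simp add: Zc_iff) (simp add: Cb_def)
qed

lemma Zr_0: "x \<in> Zr (0, i) \<longleftrightarrow> \<delta> i x \<in> Cb (\<beta> (i + 1)) P0"
  by (auto simp: Zc_iff N0 Cb_def)

text \<open>The kernel of the map from the cohomology of the graded piece to that of
  \<open>UNIV / N (Suc n)\<close>; hence \<open>Zg / BG\<close> is the image of this map.\<close>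

definition BG :: "nat \<times> int \<Rightarrow> (nat \<Rightarrow> 'p) set" where
  "BG d = Zg d \<inter> Fc (Suc (fst d), snd d)"

lemma sys_BG: "sys (Om a C \<beta> S) Zg BG"
proof -
  have "fam (Om a C \<beta> S) Zg BG BG"
  proof (rule fam_OmI)
    show "V.subm (BG d)" for d
      using famGZ(1)[of d] famF(1)[of "(Suc (fst d), snd d)"]
      by (auto simp: BG_def V.subm_def subgrp_Int)
    show "vsc t x \<in> BG (Suc n, i)" if "t \<in> a" "x \<in> BG (n, i)" for n i t x
      using that famGZ(4)[of t x n i] famF(4)[of t x "Suc n" i] by (simp add: BG_def)
    show "act (\<beta> i) (S j i) x \<in> BG (n, i + 2)" if "j < C" "x \<in> BG (n, i)" for n i j x
      using that famGZ(5)[of j x n i] famF(5)[of j x "Suc n" i] by (simp add: BG_def)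
  qed (auto simp: BG_def)
  moreover have "fam (Om a C \<beta> S) Zg BG Zg"
    using famGZ by (intro fam_OmI) (auto simp: BG_def)
  ultimately show ?thesis using Om_additive unfolding sys_def by blast
qed

lemma noeth_BG: "noeth (Om a C \<beta> S) Zg BG"
proof (rule noeth_mono[OF noeG])
  fix d
  have "Bg (n, i) \<subseteq> Fc (Suc n, i)" for n i
    unfolding Bc_iff subset_iff by (auto simp: Cb_def)
  then show "Bg d \<subseteq> BG d" using sysD(5)[OF sysG, of d] by (cases d) (auto simp: BG_def)
qed auto

text \<open>An associated prime of the $n$-th cohomology already occurs in the image of the cohomology of
  a graded piece: take the last step of the filtration to which a multiple of the element belongs.\<close>

lemma assp_descend:
  assumes p: "prime_id p" and x: "x \<in> Uc (n, i)" "{t. vsc t x \<in> Fc (n, i)} = p"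
    and s: "s \<notin> p" "vsc s x \<in> Fc (m, i)" "m \<le> n"
  obtains j where "m \<le> j" "V.assp (Zg (j, i)) (BG (j, i)) p"
proof -
  define A where "A = {j. j \<le> n \<and> (\<exists>s. s \<notin> p \<and> vsc s x \<in> Fc (j, i))}"
  have A: "finite A" "m \<in> A" using s by (auto simp: A_def)
  \<comment> \<open>At \<open>j\<close> some multiple of \<open>x\<close> by an element outside
    \<open>p\<close> is still a coboundary, at \<open>Suc j\<close> none is. Membership of
    \<open>n\<close> is ruled out by the annihilator of \<open>x\<close>.\<close>
  define j where "j = Max A"
  have j: "j \<in> A" "m \<le> j" and jm: "\<And>l. l \<in> A \<Longrightarrow> l \<le> j" using A by (auto simp: j_def intro: Max_in)
  then obtain u where u: "u \<notin> p" "vsc u x \<in> Fc (j, i)" "j \<le> n" by (auto simp: A_def)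
  have "n \<notin> A" using x(2) by (auto simp: A_def)
  then have jn: "j < n" using u(3) j(1) by (cases "j = n") auto
  have jmax: "s \<in> p" if "vsc s x \<in> Fc (Suc j, i)" for s
    using jm[of "Suc j"] that jn by (auto simp: A_def)
  let ?y = "vsc u x"
  obtain w where w: "?y - \<delta> (i - 1) w \<in> Cb (\<beta> i) (N j)" using u(2) by (auto simp: Bc_iff)
  \<comment> \<open>Subtracting a coboundary gives a representative with entries in
    \<open>N j\<close>. It is a cocycle of the graded piece because its coboundary lies in
    \<open>N n\<close> and \<open>j < n\<close>.\<close>
  let ?z = "?y - \<delta> (i - 1) w"
  have dw: "\<delta> (i - 1) w \<in> Fc (l, i)" for l
    by (rule coefs.act_Bc[OF coefs_V]) (auto simp: Cb_def)
  have "?z \<in> Uc (n, i)"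
    using V.submD(2)[OF famU(1) x(1)] dw[of n] famF(3)[of "(n, i)"]
    by (intro subgrp_diff[OF V.submD(1)[OF famU(1)]]) auto
  then have "\<delta> i ?z \<in> Cb (\<beta> (i + 1)) (N n)" by (simp add: Zc_iff)
  then have "\<delta> i ?z \<in> Cb (\<beta> (i + 1)) (N (Suc j))" using Cb_mono[OF Nmono[of "Suc j" n]] jn by auto
  with w have z: "?z \<in> Zg (j, i)" by (simp add: Zc_iff)
  have "vsc t ?z \<in> BG (j, i) \<longleftrightarrow> t \<in> p" for t
  proof -
    have tz: "vsc t ?z = vsc t ?y - vsc t (\<delta> (i - 1) w)" by (rule V.sc_diff)
    have td: "vsc t (\<delta> (i - 1) w) \<in> Fc (Suc j, i)" by (rule V.submD(2)[OF famF(1) dw])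
    have "vsc t ?z \<in> BG (j, i) \<longleftrightarrow> vsc t ?z \<in> Fc (Suc j, i)"
      using V.submD(2)[OF famGZ(1) z] by (simp add: BG_def)
    also have "\<dots> \<longleftrightarrow> vsc t ?y \<in> Fc (Suc j, i)"
      unfolding tz using td subgrp_diff[OF V.submD(1)[OF famF(1)]] subgrp_cancel[OF V.submD(1)[OF famF(1)]] by blast
    also have "\<dots> \<longleftrightarrow> t \<in> p"
    proof
      assume "vsc t ?y \<in> Fc (Suc j, i)"
      then have "u * t \<in> p" by (intro jmax) (simp add: V.sc_mult V.sc_left_commute[of u])
      then show "t \<in> p" using prime_idD(4)[OF p] u(1) by blast
    next
      assume "t \<in> p"
      then have "u * t \<in> p" by (rule prime_idD(2)[OF p])
      then have "vsc (u * t) x \<in> Fc (n, i)" using x(2) by blast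
      then have "vsc (u * t) x \<in> Fc (Suc j, i)" using F_mono[of "Suc j" n i] jn by auto
      then show "vsc t ?y \<in> Fc (Suc j, i)" by (simp add: V.sc_mult V.sc_left_commute[of u])
    qed
    finally show ?thesis .
  qed
  then have "V.assp (Zg (j, i)) (BG (j, i)) p" using z p unfolding V.assp_def by blast
  with j(2) show ?thesis by (rule that)
qed

text \<open>\<open>Zg / BG\<close> embeds into the cohomology of \<open>UNIV / N (Suc j)\<close>,
  hence the shift of the index by one.\<close>

lemma assp_BG_imp:
  assumes "V.assp (Zg (j, i)) (BG (j, i)) p"
  shows "V.assp (Uc (Suc j, i)) (Fc (Suc j, i)) p"
proof -
  obtain z where z: "z \<in> Zg (j, i)" "{t. vsc t z \<in> BG (j, i)} = p" "prime_id p"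
    using assms by (auto simp: V.assp_def)
  have "z \<in> Uc (Suc j, i)" using z(1) by (auto simp: Zc_iff Cb_def)
  moreover have "{t. vsc t z \<in> Fc (Suc j, i)} = p"
    using z(2) V.submD(2)[OF famGZ(1) z(1)] by (auto simp: BG_def)
  ultimately show ?thesis using z(3) by (auto simp: V.assp_def)
qed

text \<open>Every associated prime of a quotient arises from a graded piece, and these form a
  Noetherian system. The descent starts at filtration index zero, where every tuple is a
  coboundary.\<close>

lemma finite_assp_powers: "finite {p. \<exists>n i. V.assp (Uc (n, i)) (Fc (n, i)) p}"
proof (rule finite_subset)
  have "finite {p. \<exists>d. V.assp (Zg d) (BG d) p}"
  proof (rule V.finite_assp[OF noeth_BG sys_BG _ _ _ noeT[unfolded scal.scops_def[OF scal_times]]])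
    show "V.scops \<subseteq> Om a C \<beta> S" by (auto simp: Om_def)
    show "\<tau> d (vsc t x) = vsc t (\<tau> d x)" if "(\<sigma>, \<tau>) \<in> Om a C \<beta> S" for \<sigma> \<tau> d t x
      by (rule Om_vsc[OF that])
    show "vsc t x \<in> BG d" if "t \<in> T0" "x \<in> Zg d" for t x d
    proof -
      have "vsc t x \<in> Cb (\<beta> (snd d)) (N (Suc (fst d)))"
        using T0P[OF that(1)] P0N by (auto simp: Cb_def vsc_def)
      then show ?thesis using V.submD(2)[OF famGZ(1) that(2)] C_F[of "snd d" "Suc (fst d)"] by (auto simp: BG_def)
    qed
  qed
  then show "finite {p. \<exists>d. V.assp (Zg d) (BG d) p}" .
  show "{p. \<exists>n i. V.assp (Uc (n, i)) (Fc (n, i)) p} \<subseteq> {p. \<exists>d. V.assp (Zg d) (BG d) p}"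
  proof
    fix p assume "p \<in> {p. \<exists>n i. V.assp (Uc (n, i)) (Fc (n, i)) p}"
    then obtain n i where "V.assp (Uc (n, i)) (Fc (n, i)) p" by blast
    then have p: "prime_id p" and "\<exists>x\<in>Uc (n, i). {t. vsc t x \<in> Fc (n, i)} = p"
      by (simp_all only: V.assp_def)
    then obtain x where x: "x \<in> Uc (n, i)" "{t. vsc t x \<in> Fc (n, i)} = p" by blast
    obtain j where "V.assp (Zg (j, i)) (BG (j, i)) p"
      by (rule assp_descend[OF p x prime_idD(3)[OF p], of 0]) (auto simp: F_0)
    then show "p \<in> {p. \<exists>d. V.assp (Zg d) (BG d) p}" by blast
  qed
qed

end

context powers_cohomology
begin

interpretation V: scal vsc by (rule scal_vsc)

subsection \<open>Artin--Rees lemmas\<close>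

lemma Zr_mono': "m \<le> n \<Longrightarrow> x \<in> Zr (n, i) \<Longrightarrow> x \<in> Zr (m, i)"
  using Zr_mono[of m n i] by blast

lemma C_mono': "m \<le> n \<Longrightarrow> x \<in> Cb \<gamma> (N n) \<Longrightarrow> x \<in> Cb \<gamma> (N m)"
  using Cb_mono[OF Nmono[of m n], of \<gamma>] by blast

text \<open>Artin-Rees for coboundaries: \<open>\<delta> i x\<close> bounds and has entries in
  \<open>N n\<close>, so up to \<open>P0\<close> it is the coboundary of some \<open>y\<close> with
  entries in \<open>N (n - l)\<close>. The bound is uniform in \<open>i\<close> because the system
  is Noetherian in both directions at once.\<close>

lemma artin_rees_boundary:
  "\<exists>l. \<forall>n\<ge>l. \<forall>i. \<forall>x\<in>Uc (n, i). \<exists>y\<in>Cb (\<beta> i) (N (n - l)). x - y \<in> Zr (0, i)"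
proof -
  \<comment> \<open>Cocycles with entries in \<open>N n\<close> that bound over the whole
    module.\<close>
  define W where "W d = Zr d \<inter> Br (0, snd d)" for d
  have W: "fam (Om a C \<beta> S) Zr Br W"
  proof (rule fam_OmI)
    fix d show "V.subm (W d)"
      using famRZ(1)[of d] famRB(1)[of "(0, snd d)"] by (auto simp: W_def V.subm_def subgrp_Int)
    show "Br d \<subseteq> W d" using sysD(5)[OF sysR, of d] Br_mono[of 0 "fst d" "snd d"] by (auto simp: W_def)
    show "W d \<subseteq> Zr d" by (auto simp: W_def)
  next
    fix n i t x assume "t \<in> a" "x \<in> W (n, i)"
    then show "vsc t x \<in> W (Suc n, i)"
      using famRZ(4)[of t x n i] V.submD(2)[OF famRB(1)[of "(0, i)"]] by (auto simp: W_def)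
  next
    fix n i j x assume "j < C" "x \<in> W (n, i)"
    then show "act (\<beta> i) (S j i) x \<in> W (n, i + 2)"
      using famRZ(5)[of j x n i] famRB(5)[of j x 0 i] by (auto simp: W_def)
  qed
  obtain l where l: "\<And>n i. n \<ge> l \<Longrightarrow> W (Suc n, i) \<subseteq> gspan (Br (Suc n, i) \<union> {\<theta> x | \<theta> x. \<theta> \<in> vsc ` a \<and> x \<in> W (n, i)})"
    using generated_n[OF noeR sysR W] by blast
  have WB: "W (n, i) \<subseteq> Br (n - l, i)" if "n \<ge> l" for n i
    using that
  proof (induction n rule: dec_induct)
    case base
    then show ?case by (simp add: W_def)
  next
    case (step n)
    have "Br (Suc n, i) \<subseteq> Br (Suc n - l, i)" by (rule Br_mono) simp
    moreover have "vsc t x \<in> Br (Suc n - l, i)" if "t \<in> a" "x \<in> W (n, i)" for t x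
      using famRB(4)[OF that(1), of x "n - l" i] that(2) step by (auto simp: Suc_diff_le)
    ultimately have "gspan (Br (Suc n, i) \<union> {\<theta> x | \<theta> x. \<theta> \<in> vsc ` a \<and> x \<in> W (n, i)}) \<subseteq> Br (Suc n - l, i)"
      by (intro gspan_least V.submD(1)[OF famRB(1)]) blast
    then show ?case using l[of n i] step(1) by blast
  qed
  show ?thesis
  proof (intro exI[of _ l] allI impI ballI)
    fix n i x assume n: "l \<le> n" and x: "x \<in> Uc (n, i)"
    have "\<delta> i x \<in> W (n, i + 1)"
    proof -
      have "x \<in> Cb (\<beta> i) (N 0)" by (simp add: N0 Cb_def)
      then have "\<delta> (i + 1) (\<delta> i x) \<in> Cb (\<beta> (i + 2)) P0"
        using coefs.DD_in[OF coefs_R cd order_refl] by blast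
      moreover have "\<delta> i x \<in> Br (0, i + 1)"
        using coefs.act_Bc[OF coefs_R, of x \<beta> "i + 1" 0 D] by (simp add: N0 Cb_def)
      ultimately show ?thesis using x by (simp add: W_def Zc_iff add.commute)
    qed
    then have "\<delta> i x \<in> Br (n - l, i + 1)" using WB[OF n] by blast
    then obtain y where y: "y \<in> Cb (\<beta> i) (N (n - l))" "\<delta> i x - \<delta> i y \<in> Cb (\<beta> (i + 1)) P0"
      by (auto simp: Bc_iff)
    then show "\<exists>y\<in>Cb (\<beta> i) (N (n - l)). x - y \<in> Zr (0, i)"
      by (intro bexI[of _ y]) (simp_all add: Zr_0 act_diff)
  qed
qed

text \<open>Modulo \<open>Br (0, i)\<close> this is the image of the cohomology of
  \<open>N m / P0\<close> in that of \<open>UNIV / P0\<close>, the filtration to which Artin-Rees is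
  applied.\<close>

definition Em :: "nat \<Rightarrow> int \<Rightarrow> (nat \<Rightarrow> 'p) set" where
  "Em m i = ssum (Zr (m, i)) (Br (0, i))"

lemma Em_iff: "x \<in> Em m i \<longleftrightarrow> (\<exists>w\<in>Zr (m, i). x - w \<in> Br (0, i))"
proof
  assume "x \<in> Em m i"
  then obtain w b where "w \<in> Zr (m, i)" "b \<in> Br (0, i)" "x = w + b" by (auto simp: Em_def ssum_def)
  then show "\<exists>w\<in>Zr (m, i). x - w \<in> Br (0, i)" by (intro bexI[of _ w]) simp_all
next
  assume "\<exists>w\<in>Zr (m, i). x - w \<in> Br (0, i)"
  then obtain w where "w \<in> Zr (m, i)" "x - w \<in> Br (0, i)" by blast
  from ssumI[OF this] show "x \<in> Em m i" by (simp add: Em_def)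
qed

lemma subgrp_Em: "subgrp (Em m i)"
  unfolding Em_def by (intro subgrp_ssum V.submD(1) famRZ famRB)

lemma Zr_Em: "x \<in> Zr (m, i) \<Longrightarrow> x \<in> Em m i"
  using ssum_superset1[OF V.submD(1)[OF famRB(1)]] unfolding Em_def by blast

lemma Br_Em: "x \<in> Br (0, i) \<Longrightarrow> x \<in> Em m i"
  using ssum_superset2[OF V.submD(1)[OF famRZ(1)]] unfolding Em_def by blast

lemma Em_mono: "m \<le> n \<Longrightarrow> x \<in> Em n i \<Longrightarrow> x \<in> Em m i"
  using Zr_mono' unfolding Em_def ssum_def by blast

text \<open>Artin-Rees for the submodule \<open>g K\<close> of the cohomology: if \<open>g k\<close>
  is deep in the filtration, some deep \<open>y\<close> in \<open>K\<close> has the same product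
  with \<open>g\<close>. Stability of \<open>K\<close> under the operators makes \<open>l\<close>
  independent of \<open>i\<close>.\<close>

lemma artin_rees_single:
  assumes K: "\<And>i. V.subm (K i)" "\<And>i. K i \<subseteq> Zr (0, i)" "\<And>i. Br (0, i) \<subseteq> K i"
    "\<And>i j x. j < C \<Longrightarrow> x \<in> K i \<Longrightarrow> act (\<beta> i) (S j i) x \<in> K (i + 2)"
  shows "\<exists>l. \<forall>m\<ge>l. \<forall>i. \<forall>k\<in>K i. vsc g k \<in> Em m i \<longrightarrow>
    (\<exists>y\<in>K i. y \<in> Cb (\<beta> i) (N (m - l)) \<and> vsc g (k - y) \<in> Br (0, i))"
proof -
  define W where "W d = {z \<in> Zr d. \<exists>k\<in>K (snd d). z - vsc g k \<in> Br (0, snd d)}" for d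
  note B0 = V.submD[OF famRB(1)] and Z0 = V.submD[OF famRZ(1)] and K0 = V.submD[OF K(1)]
  have z0: "0 \<in> Br d" "0 \<in> K i" for d i using subgrp_0 B0(1) K0(1) by blast+
  have W: "fam (Om a C \<beta> S) Zr Br W"
  proof (rule fam_OmI)
    fix d show "V.subm (W d)" unfolding V.subm_def subgrp_def
    proof (intro conjI ballI allI)
      show "0 \<in> W d" using z0 subgrp_0[OF Z0(1)] by (auto simp: W_def intro!: bexI[of _ 0])
      fix x assume "x \<in> W d"
      then obtain k where k: "x \<in> Zr d" "k \<in> K (snd d)" "x - vsc g k \<in> Br (0, snd d)" by (auto simp: W_def)
      show "vsc t x \<in> W d" for t
      proof -
        have "vsc t (x - vsc g k) \<in> Br (0, snd d)" by (rule B0(2)[OF k(3)])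
        then have "vsc t x - vsc g (vsc t k) \<in> Br (0, snd d)" by (simp add: V.sc_diff V.sc_left_commute[of t])
        then show ?thesis using Z0(2)[OF k(1)] K0(2)[OF k(2)] by (auto simp: W_def)
      qed
      fix x' assume "x' \<in> W d"
      then obtain k' where k': "x' \<in> Zr d" "k' \<in> K (snd d)" "x' - vsc g k' \<in> Br (0, snd d)" by (auto simp: W_def)
      have "(x - x') - vsc g (k - k') \<in> Br (0, snd d)"
        using subgrp_diff[OF B0(1) k(3) k'(3)] by (simp add: V.sc_diff algebra_simps)
      then show "x - x' \<in> W d" using subgrp_diff[OF Z0(1) k(1) k'(1)] subgrp_diff[OF K0(1) k(2) k'(2)]
        by (auto simp: W_def)
    qed
    show "Br d \<subseteq> W d"
      using sysD(5)[OF sysR, of d] Br_mono[of 0 "fst d" "snd d"] z0(2)[of "snd d"]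
      by (auto simp: W_def intro!: bexI[of _ 0])
    show "W d \<subseteq> Zr d" by (auto simp: W_def)
  next
    fix n i t x assume t: "t \<in> a" and "x \<in> W (n, i)"
    then obtain k where k: "x \<in> Zr (n, i)" "k \<in> K i" "x - vsc g k \<in> Br (0, i)" by (auto simp: W_def)
    have "vsc t (x - vsc g k) \<in> Br (0, i)" by (rule B0(2)[OF k(3)])
    then have "vsc t x - vsc g (vsc t k) \<in> Br (0, i)" by (simp add: V.sc_diff V.sc_left_commute[of t])
    then show "vsc t x \<in> W (Suc n, i)" using famRZ(4)[OF t k(1)] K0(2)[OF k(2)] by (auto simp: W_def)
  next
    fix n i j x assume j: "j < C" and "x \<in> W (n, i)"
    then obtain k where k: "x \<in> Zr (n, i)" "k \<in> K i" "x - vsc g k \<in> Br (0, i)" by (auto simp: W_def)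
    have "act (\<beta> i) (S j i) (x - vsc g k) \<in> Br (0, i + 2)" by (rule famRB(5)[OF j k(3)])
    then have "act (\<beta> i) (S j i) x - vsc g (act (\<beta> i) (S j i) k) \<in> Br (0, i + 2)"
      by (simp add: act_diff act_vsc)
    then show "act (\<beta> i) (S j i) x \<in> W (n, i + 2)"
      using famRZ(5)[OF j k(1)] K(4)[OF j k(2)] by (auto simp: W_def)
  qed
  obtain l where l: "\<And>n i. n \<ge> l \<Longrightarrow> W (Suc n, i) \<subseteq> gspan (Br (Suc n, i) \<union> {\<theta> x | \<theta> x. \<theta> \<in> vsc ` a \<and> x \<in> W (n, i)})"
    using generated_n[OF noeR sysR W] by blast
  \<comment> \<open>The multiples by \<open>g\<close> of elements of \<open>K\<close> with entries
    in \<open>N m\<close>. Multiplication by \<open>a\<close> raises the index, so bounded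
    generation of \<open>W\<close> yields the inclusion \<open>WT\<close> by induction on
    \<open>n\<close>.\<close>
  define T where "T m i = {z. \<exists>y\<in>K i. y \<in> Cb (\<beta> i) (N m) \<and> z - vsc g y \<in> Br (0, i)}" for m i
  have C0: "subgrp (Cb \<gamma> (N m))" for \<gamma> m by (rule subgrp_Cb[OF submD(1)[OF N]])
  have T: "subgrp (T m i)" for m i
    unfolding subgrp_def
  proof (intro conjI ballI)
    show "0 \<in> T m i" using z0 subgrp_0[OF C0] by (auto simp: T_def intro!: bexI[of _ 0])
    fix x x' assume "x \<in> T m i" "x' \<in> T m i"
    then obtain y y' where y: "y \<in> K i" "y \<in> Cb (\<beta> i) (N m)" "x - vsc g y \<in> Br (0, i)"
      "y' \<in> K i" "y' \<in> Cb (\<beta> i) (N m)" "x' - vsc g y' \<in> Br (0, i)" by (auto simp: T_def)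
    have "(x - x') - vsc g (y - y') \<in> Br (0, i)"
      using subgrp_diff[OF B0(1) y(3,6)] by (simp add: V.sc_diff algebra_simps)
    then show "x - x' \<in> T m i" using subgrp_diff[OF K0(1) y(1,4)] subgrp_diff[OF C0 y(2,5)] by (auto simp: T_def)
  qed
  have WT: "W (n, i) \<subseteq> T (n - l) i" if "n \<ge> l" for n i
    using that
  proof (induction n rule: dec_induct)
    case base
    show ?case by (auto simp: W_def T_def N0 Cb_def)
  next
    case (step n)
    have "Br (Suc n, i) \<subseteq> T (Suc n - l) i"
      using Br_mono[of 0 "Suc n" i] z0(2)[of i] subgrp_0[OF C0] by (auto simp: T_def intro!: bexI[of _ 0])
    moreover have "vsc t x \<in> T (Suc n - l) i" if t: "t \<in> a" and x: "x \<in> W (n, i)" for t x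
    proof -
      obtain y where y: "y \<in> K i" "y \<in> Cb (\<beta> i) (N (n - l))" "x - vsc g y \<in> Br (0, i)"
        using step x by (auto simp: T_def)
      have "vsc t (x - vsc g y) \<in> Br (0, i)" by (rule B0(2)[OF y(3)])
      then have "vsc t x - vsc g (vsc t y) \<in> Br (0, i)" by (simp add: V.sc_diff V.sc_left_commute[of t])
      moreover have "vsc t y \<in> Cb (\<beta> i) (N (Suc n - l))"
        using y(2) aN[OF t] step(1) by (auto simp: Cb_def vsc_def Suc_diff_le)
      ultimately show ?thesis using K0(2)[OF y(1)] by (auto simp: T_def)
    qed
    ultimately have "gspan (Br (Suc n, i) \<union> {\<theta> x | \<theta> x. \<theta> \<in> vsc ` a \<and> x \<in> W (n, i)}) \<subseteq> T (Suc n - l) i"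
      by (intro gspan_least T) blast
    then show ?case using l[of n i] step(1) by blast
  qed
  show ?thesis
  proof (intro exI[of _ l] allI impI ballI)
    fix m i k assume m: "l \<le> m" and k: "k \<in> K i" "vsc g k \<in> Em m i"
    from k(2) obtain w where w: "w \<in> Zr (m, i)" "vsc g k - w \<in> Br (0, i)" by (auto simp: Em_iff)
    have "w - vsc g k \<in> Br (0, i)" using subgrp_minus[OF B0(1) w(2)] by simp
    then have "w \<in> W (m, i)" using w(1) k(1) by (auto simp: W_def)
    then obtain y where y: "y \<in> K i" "y \<in> Cb (\<beta> i) (N (m - l))" "w - vsc g y \<in> Br (0, i)"
      using WT[OF m] by (auto simp: T_def)
    have "vsc g (k - y) \<in> Br (0, i)"
      using subgrp_add[OF B0(1) w(2) y(3)] by (simp add: V.sc_diff algebra_simps)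
    then show "\<exists>y\<in>K i. y \<in> Cb (\<beta> i) (N (m - l)) \<and> vsc g (k - y) \<in> Br (0, i)" using y by blast
  qed
qed

text \<open>The elements of \<open>gs\<close> are treated one at a time. The correction for the next
  one is taken inside the common annihilator \<open>K\<close> of those already treated, so earlier
  gains are kept and the losses in depth add up.\<close>

lemma artin_rees_list:
  "\<exists>l. \<forall>m\<ge>l. \<forall>i. \<forall>k\<in>Zr (0, i). (\<forall>g\<in>set gs. vsc g k \<in> Em m i) \<longrightarrow>
    (\<exists>z\<in>Zr (0, i). (\<forall>g\<in>set gs. vsc g z \<in> Br (0, i)) \<and> k - z \<in> Cb (\<beta> i) (N (m - l)))"
proof (induction gs)
  case Nil
  show ?case
  proof (intro exI[of _ 0] allI impI ballI)
    fix m i k assume "k \<in> Zr (0, i)"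
    moreover have "k - k \<in> Cb (\<beta> i) (N (m - 0))" using subgrp_0[OF submD(1)[OF N]] by (simp add: Cb_def)
    ultimately show "\<exists>z\<in>Zr (0, i). (\<forall>g\<in>set []. vsc g z \<in> Br (0, i)) \<and> k - z \<in> Cb (\<beta> i) (N (m - 0))"
      by (intro bexI[of _ k] conjI) simp_all
  qed
next
  case (Cons g gs)
  then obtain l where l: "\<And>m i k. m \<ge> l \<Longrightarrow> k \<in> Zr (0, i) \<Longrightarrow> (\<And>g. g \<in> set gs \<Longrightarrow> vsc g k \<in> Em m i) \<Longrightarrow>
    \<exists>z\<in>Zr (0, i). (\<forall>g\<in>set gs. vsc g z \<in> Br (0, i)) \<and> k - z \<in> Cb (\<beta> i) (N (m - l))"
    by blast
  note B0 = V.submD[OF famRB(1)] and Z0 = V.submD[OF famRZ(1)]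
  define K where "K i = {z \<in> Zr (0, i). \<forall>g\<in>set gs. vsc g z \<in> Br (0, i)}" for i
  have "\<exists>l. \<forall>m\<ge>l. \<forall>i. \<forall>k\<in>K i. vsc g k \<in> Em m i \<longrightarrow>
    (\<exists>y\<in>K i. y \<in> Cb (\<beta> i) (N (m - l)) \<and> vsc g (k - y) \<in> Br (0, i))"
  proof (rule artin_rees_single)
    fix i show "V.subm (K i)"
      using Z0 B0 by (auto simp: K_def V.subm_def subgrp_def V.sc_diff V.sc_left_commute)
    show "K i \<subseteq> Zr (0, i)" by (auto simp: K_def)
    show "Br (0, i) \<subseteq> K i" using sysD(5)[OF sysR, of "(0, i)"] B0(2) by (auto simp: K_def)
    fix j x assume j: "j < C" and x: "x \<in> K i"
    have "vsc g (act (\<beta> i) (S j i) x) \<in> Br (0, i + 2)" if "g \<in> set gs" for g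
      using famRB(5)[OF j, of "vsc g x" 0 i] x that by (simp add: K_def act_vsc)
    then show "act (\<beta> i) (S j i) x \<in> K (i + 2)" using famRZ(5)[OF j, of x 0 i] x by (simp add: K_def)
  qed
  then obtain l' where l': "\<And>m i k. m \<ge> l' \<Longrightarrow> k \<in> K i \<Longrightarrow> vsc g k \<in> Em m i \<Longrightarrow>
    \<exists>y\<in>K i. y \<in> Cb (\<beta> i) (N (m - l')) \<and> vsc g (k - y) \<in> Br (0, i)"
    by blast
  show ?case
  proof (intro exI[of _ "l + l'"] allI impI ballI)
    fix m i k assume m: "l + l' \<le> m" and k: "k \<in> Zr (0, i)" "\<forall>g\<in>set (g # gs). vsc g k \<in> Em m i"
    obtain z0 where z0: "z0 \<in> K i" "k - z0 \<in> Cb (\<beta> i) (N (m - l))"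
      using l[of m k i] m k by (auto simp: K_def)
    \<comment> \<open>The correction \<open>k - z0\<close> is deep itself, so \<open>g z0\<close>
      inherits the depth of \<open>g k\<close> at the weaker index \<open>m - l\<close>.\<close>
    have "k - z0 \<in> Zr (0, i)" using subgrp_diff[OF Z0(1) k(1)] z0(1) by (simp add: K_def)
    then have "k - z0 \<in> Zr (m - l, i)" using z0(2) by (auto simp: Zc_iff)
    then have "vsc g (k - z0) \<in> Em (m - l) i" by (intro Zr_Em Z0(2))
    moreover have "vsc g k \<in> Em (m - l) i" using Em_mono[of "m - l" m] k(2) by simp
    ultimately have "vsc g z0 \<in> Em (m - l) i"
      unfolding V.sc_diff by (rule subgrp_cancel'[OF subgrp_Em])
    moreover have "l' \<le> m - l" using m by simp
    ultimately obtain y where y: "y \<in> K i" "y \<in> Cb (\<beta> i) (N (m - l - l'))" "vsc g (z0 - y) \<in> Br (0, i)"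
      using l'[of "m - l" z0 i] z0(1) by blast
    have 1: "z0 - y \<in> Zr (0, i)" using subgrp_diff[OF Z0(1)] z0(1) y(1) by (simp add: K_def)
    have 2: "vsc h (z0 - y) \<in> Br (0, i)" if "h \<in> set gs" for h
      using subgrp_diff[OF B0(1)] z0(1) y(1) that by (simp add: K_def V.sc_diff)
    have "(k - z0) + y \<in> Cb (\<beta> i) (N (m - l - l'))"
      by (rule subgrp_add[OF subgrp_Cb[OF submD(1)[OF N]] C_mono'[OF _ z0(2)] y(2)]) simp
    then have "k - (z0 - y) \<in> Cb (\<beta> i) (N (m - (l + l')))" by (simp add: algebra_simps)
    with 1 2 y(3) show "\<exists>z\<in>Zr (0, i). (\<forall>g\<in>set (g # gs). vsc g z \<in> Br (0, i)) \<and> k - z \<in> Cb (\<beta> i) (N (m - (l + l')))"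
      by (intro bexI[of _ "z0 - y"]) auto
  qed
qed

subsection \<open>Stability of associated primes\<close>

text \<open>With \<open>m\<close> fixed, the condition concerns classes over the whole module that
  \<open>p\<close> kills. These are generated in bounded cohomological degree, so the propagation of
  torsion applies in steps of two.\<close>

lemma noeR_orthogonal:
  assumes p: "prime_id p" and r: "r \<in> {0, 1}"
  shows "\<exists>k0. (\<forall>k\<ge>k0. \<exists>z\<in>Zr (0, 2 * int k + r). (\<forall>t\<in>p. vsc t z \<in> Br (0, 2 * int k + r)) \<and> (\<forall>s. s \<notin> p \<longrightarrow> vsc s z \<notin> Fc (m, 2 * int k + r)))
     \<or> (\<forall>k\<ge>k0. \<not> (\<exists>z\<in>Zr (0, 2 * int k + r). (\<forall>t\<in>p. vsc t z \<in> Br (0, 2 * int k + r)) \<and> (\<forall>s. s \<notin> p \<longrightarrow> vsc s z \<notin> Fc (m, 2 * int k + r))))"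
    (is "\<exists>k0. (\<forall>k\<ge>k0. ?Q k) \<or> (\<forall>k\<ge>k0. \<not> ?Q k)")
proof -
  note B0 = V.submD[OF famRB(1)] and Z0 = V.submD[OF famRZ(1)]
  define O' where "O' i = {z \<in> Zr (0, i). \<forall>t\<in>p. vsc t z \<in> Br (0, i)}" for i
  \<comment> \<open>The condition is imposed in filtration index zero only; taking all cocycles in
    positive index makes \<open>W\<close> stable under multiplication by \<open>a\<close>.\<close>
  define W where "W d = (if fst d = 0 then O' (snd d) else Zr d)" for d
  have Os: "V.subm (O' i)" for i
    using Z0 B0 by (auto simp: O'_def V.subm_def subgrp_def V.sc_diff V.sc_left_commute)
  have W: "fam (Om a C \<beta> S) Zr Br W"
  proof (rule fam_OmI)
    fix d show "V.subm (W d)" using Os famRZ(1) by (simp add: W_def)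
    show "Br d \<subseteq> W d" using sysD(5)[OF sysR, of d] B0(2) by (cases d) (auto simp: W_def O'_def)
    show "W d \<subseteq> Zr d" by (cases d) (auto simp: W_def O'_def)
  next
    fix n i t x assume t: "t \<in> a" and x: "x \<in> W (n, i)"
    have "x \<in> Zr (n, i)" using x by (auto simp: W_def O'_def split: if_splits)
    then show "vsc t x \<in> W (Suc n, i)" using famRZ(4)[OF t] by (simp add: W_def)
  next
    fix n i j x assume j: "j < C" and x: "x \<in> W (n, i)"
    show "act (\<beta> i) (S j i) x \<in> W (n, i + 2)"
    proof (cases "n = 0")
      case True
      then have x: "x \<in> O' i" using x by (simp add: W_def)
      have "vsc t (act (\<beta> i) (S j i) x) \<in> Br (0, i + 2)" if "t \<in> p" for t
        using famRB(5)[OF j, of "vsc t x" 0 i] x that by (simp add: O'_def act_vsc)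
      then show ?thesis using famRZ(5)[OF j, of x 0 i] x True by (simp add: W_def O'_def)
    qed (use famRZ(5)[OF j, of x n i] x in \<open>auto simp: W_def\<close>)
  qed
  obtain L :: nat where L: "\<And>n i. i div 2 \<ge> int L \<Longrightarrow>
    W (n, i + 2) \<subseteq> gspan (Br (n, i + 2) \<union> {\<theta> x | \<theta> x. \<theta> \<in> (\<lambda>j. act (\<beta> i) (S j i)) ` {..<C} \<and> x \<in> W (n, i)})"
    using generated_i[OF noeR sysR W] by blast
  have Q: "\<not> ?Q k \<longleftrightarrow> O' (2 * int k + r) \<subseteq> {x. \<exists>s. s \<notin> p \<and> vsc s x \<in> Fc (m, 2 * int k + r)}" for k
    unfolding O'_def by blast
  have step: "\<not> ?Q (Suc k)" if "L \<le> k" "\<not> ?Q k" for k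
    using that
  proof -
    assume k: "L \<le> k" and "\<not> ?Q k"
    then have h: "O' (2 * int k + r) \<subseteq> {x. \<exists>s. s \<notin> p \<and> vsc s x \<in> Fc (m, 2 * int k + r)}" using Q by blast
    let ?i = "2 * int k + r"
    have "?i div 2 \<ge> int L" using k r by auto
    from L[OF this, of 0]
    have g: "O' (?i + 2) \<subseteq> gspan (Br (0, ?i + 2) \<union> {\<theta> x | \<theta> x. \<theta> \<in> (\<lambda>j. act (\<beta> ?i) (S j ?i)) ` {..<C} \<and> x \<in> O' ?i})"
      by (simp add: W_def)
    have "O' (?i + 2) \<subseteq> {x. \<exists>s. s \<notin> p \<and> vsc s x \<in> Fc (m, ?i + 2)}"
      by (rule V.generated_torsion[OF famRB(1) p g h])
         (use famF(5) in \<open>auto simp: act_vsc intro: famF(1) subsetD[OF Br_F]\<close>)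
    moreover have "?i + 2 = 2 * int (Suc k) + r" by simp
    ultimately show "\<not> ?Q (Suc k)" unfolding Q by metis
  qed
  show ?thesis
  proof (cases "\<forall>k\<ge>L. ?Q k")
    case False
    then obtain k0 where k0: "k0 \<ge> L" "\<not> ?Q k0" by blast
    have "\<not> ?Q k" if "k \<ge> k0" for k
      using that by (induction k rule: dec_induct) (use k0 step in auto)
    then show ?thesis by blast
  qed blast
qed

text \<open>Either \<open>p\<close> comes from the graded pieces for all large indices, and
  \<open>assp_BG_imp\<close> carries it to the quotients; or no graded piece of large index
  contributes it. In the second case an element with annihilator \<open>p\<close> can be corrected,
  by the two Artin-Rees lemmas, to a class over the whole module killed by \<open>p\<close>, and the
  existence of such a class does not depend on \<open>n\<close>.\<close>

lemma assp_powers_dichotomy: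
  assumes p: "prime_id p" and r: "r \<in> {0, 1}"
  shows "\<exists>n0 k0. (\<forall>n\<ge>n0. \<forall>k\<ge>k0. V.assp (Uc (n, 2 * int k + r)) (Fc (n, 2 * int k + r)) p) \<or>
     (\<forall>n\<ge>n0. \<forall>k\<ge>k0. \<not> V.assp (Uc (n, 2 * int k + r)) (Fc (n, 2 * int k + r)) p)"
proof (cases "T0 \<subseteq> p \<and> a \<subseteq> p")
  case False
  \<comment> \<open>An element \<open>t\<close> of \<open>a\<close> outside \<open>p\<close>
    excludes \<open>p\<close>: its power \<open>t ^ n\<close> kills the quotient by
    \<open>N n\<close> but is not in \<open>p\<close>.\<close>
  have pw: "t ^ n \<bullet> x \<in> N n" if "t \<in> a" for t n x
    by (induction n) (use aN[OF that] in \<open>auto simp: N0 sc_mult\<close>)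
  have "\<not> V.assp (Uc (n, i)) (Fc (n, i)) p" for n i
  proof
    assume "V.assp (Uc (n, i)) (Fc (n, i)) p"
    then obtain x where x: "{t. vsc t x \<in> Fc (n, i)} = p" unfolding V.assp_def by blast
    from False obtain t where t: "t \<in> T0 \<or> t \<in> a" "t \<notin> p" by blast
    have "T0 \<subseteq> a" using Ja Jk_mono[OF T0, of 0 C f] by auto
    then have "t \<in> a" using t(1) by blast
    then have "vsc (t ^ n) x \<in> Cb (\<beta> i) (N n)" using pw by (simp add: Cb_def vsc_def)
    then have "t ^ n \<in> p" using x C_F by blast
    moreover have "t ^ n \<notin> p" by (induction n) (use prime_idD(3,4)[OF p] t(2) in auto)
    ultimately show False by blast
  qed
  then show ?thesis by blast
next
  case True
  note B0 = V.submD[OF famRB(1)] and Z0 = V.submD[OF famRZ(1)] and F0 = V.submD[OF famF(1)]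
  consider (A) n0 k0 where "\<forall>n\<ge>n0. \<forall>k\<ge>k0. V.assp (Zg (n, 2 * int k + r)) (BG (n, 2 * int k + r)) p"
    | (B) n0 k0 where "\<forall>n\<ge>n0. \<forall>k\<ge>k0. \<not> V.assp (Zg (n, 2 * int k + r)) (BG (n, 2 * int k + r)) p"
    using assp_dichotomy[OF noeth_BG sys_BG p r] by blast
  then show ?thesis
  proof cases
    case A
    have "V.assp (Uc (n, 2 * int k + r)) (Fc (n, 2 * int k + r)) p" if "n \<ge> Suc n0" "k \<ge> k0" for n k
      using assp_BG_imp[of "n - 1" "2 * int k + r" p] A that by (cases n) auto
    then show ?thesis by blast
  next
    case B
    have "idl p" using p by (auto simp: prime_id_def idl_def)
    then obtain G where G: "finite G" "G \<subseteq> p" "\<And>W. idl W \<Longrightarrow> T0 \<subseteq> W \<Longrightarrow> G \<subseteq> W \<Longrightarrow> p \<subseteq> W"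
      using ideal_generators True by blast
    obtain gs where gs: "set gs = G" using finite_list[OF G(1)] by blast
    obtain l1 where l1: "\<And>n i x. n \<ge> l1 \<Longrightarrow> x \<in> Uc (n, i) \<Longrightarrow> \<exists>y\<in>Cb (\<beta> i) (N (n - l1)). x - y \<in> Zr (0, i)"
      using artin_rees_boundary by blast
    obtain l2 where l2: "\<And>m i k. m \<ge> l2 \<Longrightarrow> k \<in> Zr (0, i) \<Longrightarrow> (\<And>g. g \<in> G \<Longrightarrow> vsc g k \<in> Em m i) \<Longrightarrow>
      \<exists>z\<in>Zr (0, i). (\<forall>g\<in>G. vsc g z \<in> Br (0, i)) \<and> k - z \<in> Cb (\<beta> i) (N (m - l2))"
      using artin_rees_list[of gs] unfolding gs by blast
    \<comment> \<open>The condition independent of \<open>n\<close>: a class over the whole module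
      killed by \<open>p\<close> that no multiplier outside \<open>p\<close> makes a coboundary
      modulo \<open>N n0\<close>.\<close>
    let ?Q = "\<lambda>i. \<exists>z\<in>Zr (0, i). (\<forall>t\<in>p. vsc t z \<in> Br (0, i)) \<and> (\<forall>s. s \<notin> p \<longrightarrow> vsc s z \<notin> Fc (n0, i))"
    have T0B: "vsc t z \<in> Br (0, i)" if "t \<in> T0" for t z i
      using subsetD[OF coefs.X'_Bc[OF coefs_R, where \<beta> = \<beta> and i = i and n = 0 and D = D]] T0P[OF that] by (auto simp: Cb_def vsc_def)
    \<comment> \<open>From \<open>n0\<close> on the graded pieces contribute nothing;
      \<open>l1\<close> is the depth lost in correcting to a cocycle, \<open>l2\<close> the depth
      lost in making it killed by generators of \<open>p\<close>. With
      \<open>n \<ge> n0 + l1 + l2\<close> all corrections still have entries in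
      \<open>N n0\<close>.\<close>
    have iff: "V.assp (Uc (n, i)) (Fc (n, i)) p \<longleftrightarrow> ?Q i"
      if n: "n \<ge> n0 + l1 + l2" and k: "k \<ge> k0" and i: "i = 2 * int k + r" for n k i
    proof
      assume "V.assp (Uc (n, i)) (Fc (n, i)) p"
      then obtain x where x: "x \<in> Uc (n, i)" "{t. vsc t x \<in> Fc (n, i)} = p" unfolding V.assp_def by blast
      \<comment> \<open>Otherwise \<open>assp_descend\<close> would find \<open>p\<close> in a
        graded piece of index at least \<open>n0\<close>.\<close>
      have xs: "vsc s x \<notin> Fc (n0, i)" if sp: "s \<notin> p" for s
      proof
        assume sx: "vsc s x \<in> Fc (n0, i)"
        have "n0 \<le> n" using n by simp
        then obtain j where "n0 \<le> j" "V.assp (Zg (j, i)) (BG (j, i)) p"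
          by (rule assp_descend[OF p x sp sx])
        then show False using B k i by blast
      qed
      obtain y where y: "y \<in> Cb (\<beta> i) (N (n - l1))" "x - y \<in> Zr (0, i)" using l1[OF _ x(1)] n by auto
      let ?k = "x - y"
      have "vsc g ?k \<in> Em (n - l1) i" if "g \<in> G" for g
      proof -
        have "vsc g x \<in> Fc (n, i)" using x(2) G(2) that by blast
        then have "vsc g x \<in> Fc (n - l1, i)" using F_mono[of "n - l1" n i] by auto
        moreover have "vsc g y \<in> Fc (n - l1, i)" using C_F y(1) F0(2) by blast
        ultimately have "vsc g ?k \<in> Fc (n - l1, i)" unfolding V.sc_diff by (rule subgrp_diff[OF F0(1)])
        then obtain w where w: "vsc g ?k - \<delta> (i - 1) w \<in> Cb (\<beta> i) (N (n - l1))" by (auto simp: Bc_iff)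
        have dw: "\<delta> (i - 1) w \<in> Br (0, i)"
          by (rule coefs.act_Bc[OF coefs_R]) (simp add: N0 Cb_def)
        then have "\<delta> (i - 1) w \<in> Zr (0, i)" using sysD(5)[OF sysR] by blast
        with Z0(2)[OF y(2)] have "vsc g ?k - \<delta> (i - 1) w \<in> Zr (0, i)" by (rule subgrp_diff[OF Z0(1)])
        then have "vsc g ?k - \<delta> (i - 1) w \<in> Zr (n - l1, i)" using w by (simp add: Zc_iff)
        from Zr_Em[OF this] Br_Em[OF dw] show ?thesis by (rule subgrp_cancel[OF subgrp_Em])
      qed
      moreover have "l2 \<le> n - l1" using n by simp
      ultimately obtain z where z: "z \<in> Zr (0, i)" "\<forall>g\<in>G. vsc g z \<in> Br (0, i)" "?k - z \<in> Cb (\<beta> i) (N (n - l1 - l2))"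
        using l2[OF _ y(2), of "n - l1"] by blast
      have "p \<subseteq> {t. vsc t z \<in> Br (0, i)}"
      proof (rule G(3))
        show "idl {t. vsc t z \<in> Br (0, i)}"
          using B0 by (auto simp: idl_def subgrp_def V.sc_diff' V.sc_mult)
        show "T0 \<subseteq> {t. vsc t z \<in> Br (0, i)}" using T0B by blast
        show "G \<subseteq> {t. vsc t z \<in> Br (0, i)}" using z(2) by blast
      qed
      moreover have "vsc s z \<notin> Fc (n0, i)" if "s \<notin> p" for s
      proof
        assume sz: "vsc s z \<in> Fc (n0, i)"
        have "(?k - z) + y \<in> Cb (\<beta> i) (N n0)"
          by (rule subgrp_add[OF subgrp_Cb[OF submD(1)[OF N]] C_mono'[OF _ z(3)] C_mono'[OF _ y(1)]]) (use n in auto)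
        then have "x - z \<in> Fc (n0, i)" using C_F by (auto simp: algebra_simps)
        then have "vsc s (x - z) \<in> Fc (n0, i)" by (rule F0(2))
        then have "vsc s x \<in> Fc (n0, i)" using sz unfolding V.sc_diff by (rule subgrp_cancel[OF F0(1)])
        then show False using xs[OF that] by blast
      qed
      ultimately show "?Q i" using z(1) by blast
    next
      assume "?Q i"
      then obtain z where z: "z \<in> Zr (0, i)" "\<forall>t\<in>p. vsc t z \<in> Br (0, i)" "\<And>s. s \<notin> p \<Longrightarrow> vsc s z \<notin> Fc (n0, i)" by blast
      have "{t. vsc t z \<in> Fc (n, i)} = p"
        using z(2,3) Br_F[of 0 i n] F_mono[of n0 n i] n by auto
      then show "V.assp (Uc (n, i)) (Fc (n, i)) p" unfolding V.assp_def using p z(1) Zr_U[of i n] by blast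
    qed
    obtain k1 where "(\<forall>k\<ge>k1. ?Q (2 * int k + r)) \<or> (\<forall>k\<ge>k1. \<not> ?Q (2 * int k + r))"
      using noeR_orthogonal[OF p r, of n0] True by blast
    then show ?thesis
    proof
      assume "\<forall>k\<ge>k1. ?Q (2 * int k + r)"
      then have "\<forall>n\<ge>n0 + l1 + l2. \<forall>k\<ge>max k0 k1. V.assp (Uc (n, 2 * int k + r)) (Fc (n, 2 * int k + r)) p"
        using iff by simp
      then show ?thesis by blast
    next
      assume "\<forall>k\<ge>k1. \<not> ?Q (2 * int k + r)"
      then have "\<forall>n\<ge>n0 + l1 + l2. \<forall>k\<ge>max k0 k1. \<not> V.assp (Uc (n, 2 * int k + r)) (Fc (n, 2 * int k + r)) p"
        using iff by simp
      then show ?thesis by blast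
    qed
  qed
qed

text \<open>The dichotomy gives a bound for each prime and parity. Only finitely many primes ever
  occur, so these bounds have a maximum; for any other prime both sides are false.\<close>

theorem assp_powers_stable:
  "\<exists>n0 k0. \<forall>n\<ge>n0. \<forall>k\<ge>k0. \<forall>p. \<forall>r\<in>{0, 1}. V.assp (Uc (n, 2 * int k + r)) (Fc (n, 2 * int k + r)) p \<longleftrightarrow>
    V.assp (Uc (n0, 2 * int k0 + r)) (Fc (n0, 2 * int k0 + r)) p"
proof -
  let ?P = "\<lambda>n k r p. V.assp (Uc (n, 2 * int k + r)) (Fc (n, 2 * int k + r)) p"
  define \<P> where "\<P> = {p. \<exists>n i. V.assp (Uc (n, i)) (Fc (n, i)) p} \<times> {0, 1::int}"
  have fin: "finite \<P>" unfolding \<P>_def using finite_assp_powers by simp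
  have "\<exists>m. (\<forall>n\<ge>m. \<forall>k\<ge>m. ?P n k (snd q) (fst q)) \<or> (\<forall>n\<ge>m. \<forall>k\<ge>m. \<not> ?P n k (snd q) (fst q))" if q: "q \<in> \<P>" for q
  proof -
    have "prime_id (fst q)" "snd q \<in> {0, 1}" using q by (auto simp: \<P>_def V.assp_def)
    from assp_powers_dichotomy[OF this] obtain n0 k0 where
      "(\<forall>n\<ge>n0. \<forall>k\<ge>k0. ?P n k (snd q) (fst q)) \<or> (\<forall>n\<ge>n0. \<forall>k\<ge>k0. \<not> ?P n k (snd q) (fst q))" by blast
    then show ?thesis by (intro exI[of _ "max n0 k0"]) auto
  qed
  then obtain m where m: "\<And>q. q \<in> \<P> \<Longrightarrow> (\<forall>n\<ge>m q. \<forall>k\<ge>m q. ?P n k (snd q) (fst q)) \<or> (\<forall>n\<ge>m q. \<forall>k\<ge>m q. \<not> ?P n k (snd q) (fst q))"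
    by metis
  define M where "M = Max (insert 0 (m ` \<P>))"
  have M: "m q \<le> M" if "q \<in> \<P>" for q unfolding M_def using fin that by (intro Max_ge) auto
  have "?P n k r p \<longleftrightarrow> ?P M M r p" if "n \<ge> M" "k \<ge> M" "r \<in> {0, 1}" for n k r p
  proof (cases "(p, r) \<in> \<P>")
    case True
    then show ?thesis using m[OF True] M[OF True] that by (auto dest: order_trans)
  next
    case False
    then have "\<not> V.assp (Uc (n, i)) (Fc (n, i)) p" for n i using that(3) by (auto simp: \<P>_def)
    then show ?thesis by blast
  qed
  then show ?thesis by blast
qed

end

section \<open>Comparison of projective resolutions\<close>

text \<open>\<open>module_hom\<close> without extensionality, so that composites and lambda terms
  are homomorphisms without restricting them.\<close>

definition lin :: "('a, 'b) ring_scheme \<Rightarrow> ('a, 'm, 'c) module_scheme \<Rightarrow> ('a, 'n, 'd) module_scheme \<Rightarrow> ('m \<Rightarrow> 'n) \<Rightarrow> bool" where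
  "lin R M N f \<longleftrightarrow> f \<in> carrier M \<rightarrow> carrier N \<and>
     (\<forall>x\<in>carrier M. \<forall>y\<in>carrier M. f (x \<oplus>\<^bsub>M\<^esub> y) = f x \<oplus>\<^bsub>N\<^esub> f y) \<and>
     (\<forall>a\<in>carrier R. \<forall>x\<in>carrier M. f (a \<odot>\<^bsub>M\<^esub> x) = a \<odot>\<^bsub>N\<^esub> f x)"

lemma linD:
  assumes "lin R M N f"
  shows "x \<in> carrier M \<Longrightarrow> f x \<in> carrier N"
    "x \<in> carrier M \<Longrightarrow> y \<in> carrier M \<Longrightarrow> f (x \<oplus>\<^bsub>M\<^esub> y) = f x \<oplus>\<^bsub>N\<^esub> f y"
    "a \<in> carrier R \<Longrightarrow> x \<in> carrier M \<Longrightarrow> f (a \<odot>\<^bsub>M\<^esub> x) = a \<odot>\<^bsub>N\<^esub> f x"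
  using assms by (auto simp: lin_def)

lemma linI:
  assumes "\<And>x. x \<in> carrier M \<Longrightarrow> f x \<in> carrier N"
    "\<And>x y. x \<in> carrier M \<Longrightarrow> y \<in> carrier M \<Longrightarrow> f (x \<oplus>\<^bsub>M\<^esub> y) = f x \<oplus>\<^bsub>N\<^esub> f y"
    "\<And>a x. a \<in> carrier R \<Longrightarrow> x \<in> carrier M \<Longrightarrow> f (a \<odot>\<^bsub>M\<^esub> x) = a \<odot>\<^bsub>N\<^esub> f x"
  shows "lin R M N f"
  using assms by (auto simp: lin_def)

lemma (in abelian_group) minus_zero_eq: "\<ominus> \<zero> = \<zero>"
  by (rule minus_equality) simp_all

lemma (in abelian_group) eq_if_minus_zero:
  assumes "x \<in> carrier G" "y \<in> carrier G" "x \<ominus> y = \<zero>" shows "x = y"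
  using minus_equality[of x "\<ominus> y"] assms by (simp add: a_minus_def)

lemma lin_comp: "lin R L M f \<Longrightarrow> lin R M N g \<Longrightarrow> lin R L N (\<lambda>x. g (f x))"
  by (rule linI) (simp_all add: linD)

lemma lin_zero:
  assumes "module R M" "module R N" "lin R M N f"
  shows "f \<zero>\<^bsub>M\<^esub> = \<zero>\<^bsub>N\<^esub>"
proof -
  interpret M: module R M by fact
  interpret N: module R N by fact
  have "f (\<zero>\<^bsub>R\<^esub> \<odot>\<^bsub>M\<^esub> \<zero>\<^bsub>M\<^esub>) = \<zero>\<^bsub>R\<^esub> \<odot>\<^bsub>N\<^esub> f \<zero>\<^bsub>M\<^esub>" by (rule linD(3)[OF assms(3)]) simp_all
  then show ?thesis using linD(1)[OF assms(3)] by simp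
qed

lemma lin_minus:
  assumes "module R M" "module R N" "lin R M N f" "x \<in> carrier M" "y \<in> carrier M"
  shows "f (\<ominus>\<^bsub>M\<^esub> x) = \<ominus>\<^bsub>N\<^esub> f x" "f (x \<ominus>\<^bsub>M\<^esub> y) = f x \<ominus>\<^bsub>N\<^esub> f y"
proof -
  interpret M: module R M by fact
  interpret N: module R N by fact
  have *: "f (\<ominus>\<^bsub>M\<^esub> z) = \<ominus>\<^bsub>N\<^esub> f z" if z: "z \<in> carrier M" for z
  proof -
    have "f (\<ominus>\<^bsub>M\<^esub> z) \<oplus>\<^bsub>N\<^esub> f z = f (\<ominus>\<^bsub>M\<^esub> z \<oplus>\<^bsub>M\<^esub> z)" using z by (simp add: linD(2)[OF assms(3)])
    also have "\<dots> = \<zero>\<^bsub>N\<^esub>" using z lin_zero[OF assms(1-3)] by (simp add: M.l_neg)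
    finally show ?thesis using z linD(1)[OF assms(3)] N.minus_equality by simp
  qed
  from *[OF assms(4)] show "f (\<ominus>\<^bsub>M\<^esub> x) = \<ominus>\<^bsub>N\<^esub> f x" .
  show "f (x \<ominus>\<^bsub>M\<^esub> y) = f x \<ominus>\<^bsub>N\<^esub> f y"
    using assms(4,5) by (simp add: a_minus_def linD(2)[OF assms(3)] *)
qed

lemma lin_id: "lin R M M (\<lambda>x. x)"
  by (rule linI) auto

lemma lin_sub:
  assumes "module R M" "module R N" "lin R M N f" "lin R M N g"
  shows "lin R M N (\<lambda>x. f x \<ominus>\<^bsub>N\<^esub> g x)"
proof -
  interpret M: module R M by fact
  interpret N: module R N by fact
  note F = linD[OF assms(3)] and G = linD[OF assms(4)]
  show ?thesis
  proof (rule linI)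
    fix x y assume "x \<in> carrier M" "y \<in> carrier M"
    then show "f (x \<oplus>\<^bsub>M\<^esub> y) \<ominus>\<^bsub>N\<^esub> g (x \<oplus>\<^bsub>M\<^esub> y) = (f x \<ominus>\<^bsub>N\<^esub> g x) \<oplus>\<^bsub>N\<^esub> (f y \<ominus>\<^bsub>N\<^esub> g y)"
      using F(1) G(1) by (simp add: F(2) G(2) a_minus_def N.minus_add N.a_ac)
  next
    fix a x assume "a \<in> carrier R" "x \<in> carrier M"
    then show "f (a \<odot>\<^bsub>M\<^esub> x) \<ominus>\<^bsub>N\<^esub> g (a \<odot>\<^bsub>M\<^esub> x) = a \<odot>\<^bsub>N\<^esub> (f x \<ominus>\<^bsub>N\<^esub> g x)"
      using F(1) G(1) by (simp add: F(3) G(3) a_minus_def N.smult_r_distr N.smult_r_minus)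
  qed (use F(1) G(1) in simp)
qed

lemma lin_smult:
  assumes "module R M" "module R N" "lin R M N f" "a \<in> carrier R"
  shows "lin R M N (\<lambda>x. a \<odot>\<^bsub>N\<^esub> f x)"
proof -
  interpret M: module R M by fact
  interpret N: module R N by fact
  note F = linD[OF assms(3)]
  have "a \<odot>\<^bsub>N\<^esub> (b \<odot>\<^bsub>N\<^esub> f x) = b \<odot>\<^bsub>N\<^esub> (a \<odot>\<^bsub>N\<^esub> f x)" if "b \<in> carrier R" "x \<in> carrier M" for b x
    using that assms(4) F(1) by (metis N.smult_assoc1 M.m_comm)
  then show ?thesis using F assms(4) by (intro linI) (simp_all add: N.smult_r_distr)
qed

text \<open>The free module on \<open>B\<close>. The value outside \<open>B\<close> is fixed to
  zero, so equal elements are equal functions.\<close>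

definition FR :: "('a, 'b) ring_scheme \<Rightarrow> 'i set \<Rightarrow> ('a, 'i \<Rightarrow> 'a) module" where
  "FR R B = \<lparr>carrier = {c. (\<forall>b\<in>B. c b \<in> carrier R) \<and> (\<forall>b. b \<notin> B \<longrightarrow> c b = \<zero>\<^bsub>R\<^esub>) \<and> finite {b. c b \<noteq> \<zero>\<^bsub>R\<^esub>}},
     monoid.mult = undefined, one = undefined, zero = (\<lambda>b. \<zero>\<^bsub>R\<^esub>), add = (\<lambda>c c' b. c b \<oplus>\<^bsub>R\<^esub> c' b),
     smult = (\<lambda>a c b. a \<otimes>\<^bsub>R\<^esub> c b)\<rparr>"

lemma FR_simps:
  "c \<in> carrier (FR R B) \<longleftrightarrow> (\<forall>b\<in>B. c b \<in> carrier R) \<and> (\<forall>b. b \<notin> B \<longrightarrow> c b = \<zero>\<^bsub>R\<^esub>) \<and> finite {b. c b \<noteq> \<zero>\<^bsub>R\<^esub>}"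
  "zero (FR R B) = (\<lambda>b. \<zero>\<^bsub>R\<^esub>)" "c \<oplus>\<^bsub>FR R B\<^esub> c' = (\<lambda>b. c b \<oplus>\<^bsub>R\<^esub> c' b)"
  "a \<odot>\<^bsub>FR R B\<^esub> c = (\<lambda>b. a \<otimes>\<^bsub>R\<^esub> c b)"
  by (simp_all add: FR_def)

lemma FR_in: "cring R \<Longrightarrow> c \<in> carrier (FR R B) \<Longrightarrow> c b \<in> carrier R"
  by (cases "b \<in> B") (auto simp: FR_simps cring_def ring.ring_simprules)

lemma module_FR:
  fixes R (structure)
  assumes "cring R" shows "module R (FR R B)"
proof -
  interpret cring R by fact
  have fin: "finite {b. c b \<oplus> c' b \<noteq> \<zero>}" if "finite {b. c b \<noteq> \<zero>}" "finite {b. c' b \<noteq> \<zero>}" for c c' :: "'c \<Rightarrow> 'a"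
    using that by (rule_tac finite_subset[of _ "{b. c b \<noteq> \<zero>} \<union> {b. c' b \<noteq> \<zero>}"]) auto
  have fin': "finite {b. a \<otimes> c b \<noteq> \<zero>}" if "finite {b. c b \<noteq> \<zero>}" "a \<in> carrier R" for c :: "'c \<Rightarrow> 'a" and a
    using that by (rule_tac finite_subset[of _ "{b. c b \<noteq> \<zero>}"]) auto
  show ?thesis
  proof (rule moduleI)
    show "cring R" by fact
    show "abelian_group (FR R B)"
    proof (rule abelian_groupI)
      fix x y z assume x: "x \<in> carrier (FR R B)" and y: "y \<in> carrier (FR R B)" and z: "z \<in> carrier (FR R B)"
      note in_ = FR_in[OF assms x] FR_in[OF assms y] FR_in[OF assms z]
      show "x \<oplus>\<^bsub>FR R B\<^esub> y \<in> carrier (FR R B)" using x y fin by (simp add: FR_simps)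
      show "x \<oplus>\<^bsub>FR R B\<^esub> y \<oplus>\<^bsub>FR R B\<^esub> z = x \<oplus>\<^bsub>FR R B\<^esub> (y \<oplus>\<^bsub>FR R B\<^esub> z)"
        using in_ by (simp add: FR_simps a_assoc)
      show "x \<oplus>\<^bsub>FR R B\<^esub> y = y \<oplus>\<^bsub>FR R B\<^esub> x" using in_ by (simp add: FR_simps a_comm)
      show "\<zero>\<^bsub>FR R B\<^esub> \<oplus>\<^bsub>FR R B\<^esub> x = x" using in_ by (simp add: FR_simps)
      show "\<exists>y\<in>carrier (FR R B). y \<oplus>\<^bsub>FR R B\<^esub> x = \<zero>\<^bsub>FR R B\<^esub>"
      proof (rule bexI[of _ "\<lambda>b. \<ominus> x b"])
        show "(\<lambda>b. \<ominus> x b) \<oplus>\<^bsub>FR R B\<^esub> x = \<zero>\<^bsub>FR R B\<^esub>" using in_ by (simp add: FR_simps l_neg)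
        have "{b. \<ominus> x b \<noteq> \<zero>} \<subseteq> {b. x b \<noteq> \<zero>}" by auto
        then show "(\<lambda>b. \<ominus> x b) \<in> carrier (FR R B)" using x by (auto simp: FR_simps intro: finite_subset)
      qed
    qed (simp add: FR_simps)
  next
    fix a b x y assume a: "a \<in> carrier R" and b: "b \<in> carrier R" and x: "x \<in> carrier (FR R B)" and y: "y \<in> carrier (FR R B)"
    note in_ = FR_in[OF assms x] FR_in[OF assms y]
    show "a \<odot>\<^bsub>FR R B\<^esub> x \<in> carrier (FR R B)" using a x fin' by (simp add: FR_simps)
    show "(a \<oplus> b) \<odot>\<^bsub>FR R B\<^esub> x = a \<odot>\<^bsub>FR R B\<^esub> x \<oplus>\<^bsub>FR R B\<^esub> b \<odot>\<^bsub>FR R B\<^esub> x"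
      using a b in_ by (simp add: FR_simps l_distr)
    show "a \<odot>\<^bsub>FR R B\<^esub> (x \<oplus>\<^bsub>FR R B\<^esub> y) = a \<odot>\<^bsub>FR R B\<^esub> x \<oplus>\<^bsub>FR R B\<^esub> a \<odot>\<^bsub>FR R B\<^esub> y"
      using a in_ by (simp add: FR_simps r_distr)
    show "a \<otimes> b \<odot>\<^bsub>FR R B\<^esub> x = a \<odot>\<^bsub>FR R B\<^esub> (b \<odot>\<^bsub>FR R B\<^esub> x)"
      using a b in_ by (simp add: FR_simps m_assoc)
  next
    fix x assume "x \<in> carrier (FR R B)"
    from FR_in[OF assms this] show "\<one> \<odot>\<^bsub>FR R B\<^esub> x = x" by (simp add: FR_simps)
  qed
qed

text \<open>The homomorphism from the free module that sends the basis element \<open>b\<close> to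
  \<open>w b\<close>. Summing over the support keeps the sum finite for infinite
  \<open>B\<close>.\<close>

definition evm :: "('a, 'b) ring_scheme \<Rightarrow> ('a, 'm, 'c) module_scheme \<Rightarrow> 'i set \<Rightarrow> ('i \<Rightarrow> 'm) \<Rightarrow> ('i \<Rightarrow> 'a) \<Rightarrow> 'm" where
  "evm R E B w c = (\<Oplus>\<^bsub>E\<^esub>b\<in>{b \<in> B. c b \<noteq> \<zero>\<^bsub>R\<^esub>}. c b \<odot>\<^bsub>E\<^esub> w b)"

lemma evm_eq:
  assumes "module R E" "w \<in> B \<rightarrow> carrier E" "c \<in> carrier (FR R B)" "finite A" "A \<subseteq> B" "{b \<in> B. c b \<noteq> \<zero>\<^bsub>R\<^esub>} \<subseteq> A"
  shows "evm R E B w c = (\<Oplus>\<^bsub>E\<^esub>b\<in>A. c b \<odot>\<^bsub>E\<^esub> w b)"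
proof -
  interpret module R E by fact
  show ?thesis unfolding evm_def
    by (rule M.add.finprod_mono_neutral_cong_left) (use assms in \<open>auto simp: FR_simps Pi_def\<close>)
qed

lemma lin_evm:
  assumes E: "module R E" and w: "w \<in> B \<rightarrow> carrier E"
  shows "lin R (FR R B) E (evm R E B w)"
proof -
  interpret module R E by fact
  interpret F: module R "FR R B" by (rule module_FR) (rule R.is_cring)
  have sm: "c b \<odot>\<^bsub>E\<^esub> w b \<in> carrier E" if "c \<in> carrier (FR R B)" "b \<in> B" for c b
    using that w by (auto simp: FR_simps)
  show ?thesis
  proof (rule linI)
    fix x assume "x \<in> carrier (FR R B)"
    then show "evm R E B w x \<in> carrier E" unfolding evm_def by (intro M.finsum_closed) (auto intro: sm)
  next
    fix x y assume x: "x \<in> carrier (FR R B)" and y: "y \<in> carrier (FR R B)"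
    let ?A = "{b \<in> B. x b \<noteq> \<zero>\<^bsub>R\<^esub>} \<union> {b \<in> B. y b \<noteq> \<zero>\<^bsub>R\<^esub>}"
    have A: "finite ?A" "?A \<subseteq> B" using x y by (auto simp: FR_simps)
    have xy: "x \<oplus>\<^bsub>FR R B\<^esub> y \<in> carrier (FR R B)" using x y by simp
    have "evm R E B w (x \<oplus>\<^bsub>FR R B\<^esub> y) = (\<Oplus>\<^bsub>E\<^esub>b\<in>?A. (x \<oplus>\<^bsub>FR R B\<^esub> y) b \<odot>\<^bsub>E\<^esub> w b)"
      by (rule evm_eq[OF E w xy A]) (auto simp: FR_simps)
    also have "\<dots> = (\<Oplus>\<^bsub>E\<^esub>b\<in>?A. x b \<odot>\<^bsub>E\<^esub> w b \<oplus>\<^bsub>E\<^esub> y b \<odot>\<^bsub>E\<^esub> w b)"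
      using x y w A(2) by (intro M.finsum_cong') (auto simp: FR_simps smult_l_distr Pi_def)
    also have "\<dots> = (\<Oplus>\<^bsub>E\<^esub>b\<in>?A. x b \<odot>\<^bsub>E\<^esub> w b) \<oplus>\<^bsub>E\<^esub> (\<Oplus>\<^bsub>E\<^esub>b\<in>?A. y b \<odot>\<^bsub>E\<^esub> w b)"
      using sm[OF x] sm[OF y] by (intro M.finsum_addf) auto
    also have "(\<Oplus>\<^bsub>E\<^esub>b\<in>?A. x b \<odot>\<^bsub>E\<^esub> w b) = evm R E B w x" by (rule evm_eq[OF E w x A, symmetric]) auto
    also have "(\<Oplus>\<^bsub>E\<^esub>b\<in>?A. y b \<odot>\<^bsub>E\<^esub> w b) = evm R E B w y" by (rule evm_eq[OF E w y A, symmetric]) auto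
    finally show "evm R E B w (x \<oplus>\<^bsub>FR R B\<^esub> y) = evm R E B w x \<oplus>\<^bsub>E\<^esub> evm R E B w y" .
  next
    fix a x assume a: "a \<in> carrier R" and x: "x \<in> carrier (FR R B)"
    let ?A = "{b \<in> B. x b \<noteq> \<zero>\<^bsub>R\<^esub>}"
    have A: "finite ?A" "?A \<subseteq> B" using x by (auto simp: FR_simps)
    have ax: "a \<odot>\<^bsub>FR R B\<^esub> x \<in> carrier (FR R B)" using a x by simp
    have "evm R E B w (a \<odot>\<^bsub>FR R B\<^esub> x) = (\<Oplus>\<^bsub>E\<^esub>b\<in>?A. (a \<odot>\<^bsub>FR R B\<^esub> x) b \<odot>\<^bsub>E\<^esub> w b)"
      by (rule evm_eq[OF E w ax A]) (use a in \<open>auto simp: FR_simps\<close>)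
    also have "\<dots> = (\<Oplus>\<^bsub>E\<^esub>b\<in>?A. a \<odot>\<^bsub>E\<^esub> (x b \<odot>\<^bsub>E\<^esub> w b))"
      using a x w A(2) by (intro M.finsum_cong') (auto simp: FR_simps smult_assoc1 Pi_def)
    also have "\<dots> = a \<odot>\<^bsub>E\<^esub> evm R E B w x"
      unfolding evm_def using a A(1) sm[OF x] by (intro finsum_smult_ldistr[symmetric]) auto
    finally show "evm R E B w (a \<odot>\<^bsub>FR R B\<^esub> x) = a \<odot>\<^bsub>E\<^esub> evm R E B w x" .
  qed
qed

lemma lin_finsum:
  assumes E: "module R E" and Y: "module R Y" and g: "lin R E Y g" and "finite A" "u \<in> A \<rightarrow> carrier E"
  shows "g (\<Oplus>\<^bsub>E\<^esub>b\<in>A. u b) = (\<Oplus>\<^bsub>Y\<^esub>b\<in>A. g (u b))"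
proof -
  interpret E: module R E by fact
  interpret Y: module R Y by fact
  note G = linD[OF g]
  show ?thesis using assms(4,5)
  proof (induction A)
    case empty
    then show ?case using lin_zero[OF E Y g] by simp
  next
    case (insert a A)
    then have "u a \<in> carrier E" "u \<in> A \<rightarrow> carrier E" "(\<lambda>b. g (u b)) \<in> A \<rightarrow> carrier Y" "g (u a) \<in> carrier Y"
      using G(1) by auto
    then show ?case using insert by (simp add: G(2))
  qed
qed

lemma evm_map:
  assumes E: "module R E" and Y: "module R Y" and w: "w \<in> B \<rightarrow> carrier E" and g: "lin R E Y g" and c: "c \<in> carrier (FR R B)"
  shows "g (evm R E B w c) = evm R Y B (\<lambda>b. g (w b)) c"
proof -
  interpret E: module R E by fact
  interpret Y: module R Y by fact
  let ?A = "{b \<in> B. c b \<noteq> \<zero>\<^bsub>R\<^esub>}"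
  have A: "finite ?A" using c by (simp add: FR_simps)
  have "g (evm R E B w c) = (\<Oplus>\<^bsub>Y\<^esub>b\<in>?A. g (c b \<odot>\<^bsub>E\<^esub> w b))"
    unfolding evm_def using c w by (intro lin_finsum[OF E Y g A]) (auto simp: FR_simps)
  also have "\<dots> = evm R Y B (\<lambda>b. g (w b)) c"
    unfolding evm_def using c w linD[OF g] by (intro Y.finsum_cong') (auto simp: FR_simps Pi_def)
  finally show ?thesis .
qed

text \<open>A dual basis: \<open>h\<close> splits the map from the free module given by
  \<open>w\<close>, so \<open>P\<close> is a direct summand of it. Unlike the lifting property in
  \<open>projective_module\<close>, this datum is not tied to particular types of modules.\<close>

definition dualb :: "('a, 'b) ring_scheme \<Rightarrow> ('a, 'p, 'c) module_scheme \<Rightarrow> 'i set \<Rightarrow> ('i \<Rightarrow> 'p) \<Rightarrow> ('p \<Rightarrow> 'i \<Rightarrow> 'a) \<Rightarrow> bool" where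
  "dualb R P B w h \<longleftrightarrow> w \<in> B \<rightarrow> carrier P \<and> lin R P (FR R B) h \<and> (\<forall>x\<in>carrier P. evm R P B w (h x) = x)"

text \<open>Lift the elements \<open>f (w b)\<close> along \<open>g\<close>, extend over the free
  module and precompose with \<open>h\<close>. Only the image of \<open>f\<close> has to lie in that
  of \<open>g\<close>, so exactness of a complex can be used directly.\<close>

lemma dualb_lift:
  assumes P: "module R P" and E: "module R E" and Y: "module R Y" and du: "dualb R P B w h"
    and f: "lin R P Y f" and g: "lin R E Y g" and im: "\<And>x. x \<in> carrier P \<Longrightarrow> f x \<in> g ` carrier E"
  shows "\<exists>k. lin R P E k \<and> (\<forall>x\<in>carrier P. g (k x) = f x)"
proof -
  have w: "w \<in> B \<rightarrow> carrier P" and h: "lin R P (FR R B) h" and hx: "\<And>x. x \<in> carrier P \<Longrightarrow> evm R P B w (h x) = x"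
    using du by (auto simp: dualb_def)
  have "\<forall>b\<in>B. \<exists>v. v \<in> carrier E \<and> g v = f (w b)" using im w by fastforce
  then obtain v where v: "\<And>b. b \<in> B \<Longrightarrow> v b \<in> carrier E \<and> g (v b) = f (w b)" by metis
  then have v': "v \<in> B \<rightarrow> carrier E" by auto
  interpret Y: module R Y by fact
  show ?thesis
  proof (intro exI[of _ "\<lambda>x. evm R E B v (h x)"] conjI ballI)
    show "lin R P E (\<lambda>x. evm R E B v (h x))" by (rule lin_comp[OF h lin_evm[OF E v']])
    fix x assume x: "x \<in> carrier P"
    have hc: "h x \<in> carrier (FR R B)" by (rule linD(1)[OF h x])
    have "g (evm R E B v (h x)) = evm R Y B (\<lambda>b. g (v b)) (h x)" by (rule evm_map[OF E Y v' g hc])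
    also have "\<dots> = evm R Y B (\<lambda>b. f (w b)) (h x)"
      unfolding evm_def using hc v w linD(1)[OF f] by (intro Y.finsum_cong') (auto simp: FR_simps Pi_def)
    also have "\<dots> = f (evm R P B w (h x))" by (rule evm_map[OF P Y w f hc, symmetric])
    finally show "g (evm R E B v (h x)) = f x" using hx[OF x] by simp
  qed
qed

text \<open>Exactness only. Projectivity is supplied separately by \<open>dualb\<close>, so free
  resolutions by matrices and arbitrary projective ones are treated alike.\<close>

locale resolution =
  fixes R :: "('a, 'b) ring_scheme" and M :: "('a, 'm, 'c) module_scheme"
    and P :: "nat \<Rightarrow> ('a, 'p) module" and d :: "nat \<Rightarrow> 'p \<Rightarrow> 'p" and e :: "'p \<Rightarrow> 'm"
  assumes M: "module R M" and P: "module R (P i)" and d: "lin R (P (Suc i)) (P i) (d i)" and e: "lin R (P 0) M e"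
    and e_surj: "e ` carrier (P 0) = carrier M"
    and ex0: "d 0 ` carrier (P (Suc 0)) = {x \<in> carrier (P 0). e x = \<zero>\<^bsub>M\<^esub>}"
    and ex: "d (Suc i) ` carrier (P (Suc (Suc i))) = {x \<in> carrier (P (Suc i)). d i x = \<zero>\<^bsub>P i\<^esub>}"
begin

lemma ed: "x \<in> carrier (P (Suc 0)) \<Longrightarrow> e (d 0 x) = \<zero>\<^bsub>M\<^esub>"
  using ex0 by blast

lemma dd: "x \<in> carrier (P (Suc (Suc i))) \<Longrightarrow> d i (d (Suc i) x) = \<zero>\<^bsub>P i\<^esub>"
  using ex by blast

lemma d_in: "x \<in> carrier (P (Suc i)) \<Longrightarrow> d i x \<in> carrier (P i)"
  using linD(1)[OF d] .

end

lemma chain_map_exists: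
  assumes P: "resolution R M P d e" and E: "resolution R M E d' e'"
    and du: "\<And>i. dualb R (P i) (B i) (w i) (h i)"
  obtains \<alpha> where "\<And>i. lin R (P i) (E i) (\<alpha> i)" "\<And>x. x \<in> carrier (P 0) \<Longrightarrow> e' (\<alpha> 0 x) = e x"
    "\<And>i x. x \<in> carrier (P (Suc i)) \<Longrightarrow> d' i (\<alpha> (Suc i) x) = \<alpha> i (d i x)"
proof -
  interpret P: resolution R M P d e by fact
  interpret E: resolution R M E d' e' by fact
  \<comment> \<open>The invariant contains the condition under which the next lift exists, so no
    choice made at one stage blocks a later one.\<close>
  let ?I = "\<lambda>n f. lin R (P n) (E n) f \<and> (\<forall>x\<in>carrier (P (Suc n)). f (d n x) \<in> d' n ` carrier (E (Suc n)))"
  let ?I' = "\<lambda>n f. ?I n f \<and> (n = 0 \<longrightarrow> (\<forall>x\<in>carrier (P 0). e' (f x) = e x))"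
  have "\<exists>\<alpha>. \<forall>n. ?I' n (\<alpha> n) \<and> (\<forall>x\<in>carrier (P (Suc n)). d' n (\<alpha> (Suc n) x) = \<alpha> n (d n x))"
  proof (rule dependent_nat_choice)
    have "\<exists>k. lin R (P 0) (E 0) k \<and> (\<forall>x\<in>carrier (P 0). e' (k x) = e x)"
      by (rule dualb_lift[OF P.P E.P P.M du P.e E.e]) (use E.e_surj linD(1)[OF P.e] in auto)
    then obtain k where k: "lin R (P 0) (E 0) k" "\<And>x. x \<in> carrier (P 0) \<Longrightarrow> e' (k x) = e x" by blast
    have "k (d 0 x) \<in> d' 0 ` carrier (E (Suc 0))" if "x \<in> carrier (P (Suc 0))" for x
      unfolding E.ex0 using k P.d_in[OF that] P.ed[OF that] linD(1)[OF k(1)] by simp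
    with k show "\<exists>f. ?I' 0 f" by blast
  next
    fix f n assume "?I' n f"
    then have f: "lin R (P n) (E n) f" "\<And>x. x \<in> carrier (P (Suc n)) \<Longrightarrow> f (d n x) \<in> d' n ` carrier (E (Suc n))" by auto
    obtain k where k: "lin R (P (Suc n)) (E (Suc n)) k" "\<And>x. x \<in> carrier (P (Suc n)) \<Longrightarrow> d' n (k x) = f (d n x)"
      using dualb_lift[OF P.P E.P E.P du lin_comp[OF P.d f(1)] E.d f(2)] by blast
    have "k (d (Suc n) x) \<in> d' (Suc n) ` carrier (E (Suc (Suc n)))" if "x \<in> carrier (P (Suc (Suc n)))" for x
    proof -
      have "d' n (k (d (Suc n) x)) = f (d n (d (Suc n) x))" by (rule k(2)[OF P.d_in[OF that]])
      also have "\<dots> = \<zero>\<^bsub>E n\<^esub>" using P.dd[OF that] lin_zero[OF P.P E.P f(1)] by simp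
      finally show ?thesis unfolding E.ex using linD(1)[OF k(1) P.d_in[OF that]] by simp
    qed
    with k show "\<exists>g. ?I' (Suc n) g \<and> (\<forall>x\<in>carrier (P (Suc n)). d' n (g x) = f (d n x))" by blast
  qed
  then obtain \<alpha> where \<alpha>0: "\<forall>n. ?I' n (\<alpha> n) \<and> (\<forall>x\<in>carrier (P (Suc n)). d' n (\<alpha> (Suc n) x) = \<alpha> n (d n x))"
    by (rule exE)
  note \<alpha> = \<alpha>0[THEN spec, THEN conjunct1] \<alpha>0[THEN spec, THEN conjunct2]
  show ?thesis
  proof (rule that)
    show "lin R (P i) (E i) (\<alpha> i)" for i using \<alpha>(1)[of i] by (elim conjE)
    show "e' (\<alpha> 0 x) = e x" if "x \<in> carrier (P 0)" for x using \<alpha>(1)[of 0] that by simp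
    show "d' i (\<alpha> (Suc i) x) = \<alpha> i (d i x)" if "x \<in> carrier (P (Suc i))" for i x using \<alpha>(2)[of i] that by (rule bspec)
  qed
qed

text \<open>Each \<open>s\<close> lifts the difference of the identity, \<open>\<gamma>\<close> and
  the previous \<open>s\<close> after \<open>d\<close> along the next differential; exactness
  applies because this difference is a cycle.\<close>

lemma homotopy_exists:
  assumes P: "resolution R M P d e" and du: "\<And>i. dualb R (P i) (B i) (w i) (h i)"
    and g: "\<And>i. lin R (P i) (P i) (\<gamma> i)" and ge: "\<And>x. x \<in> carrier (P 0) \<Longrightarrow> e (\<gamma> 0 x) = e x"
    and gd: "\<And>i x. x \<in> carrier (P (Suc i)) \<Longrightarrow> d i (\<gamma> (Suc i) x) = \<gamma> i (d i x)"
  obtains s where "\<And>i. lin R (P i) (P (Suc i)) (s i)"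
    "\<And>i x. x \<in> carrier (P (Suc i)) \<Longrightarrow> d (Suc i) (s (Suc i) x) = x \<ominus>\<^bsub>P (Suc i)\<^esub> \<gamma> (Suc i) x \<ominus>\<^bsub>P (Suc i)\<^esub> s i (d i x)"
proof -
  interpret P: resolution R M P d e by fact
  let ?I = "\<lambda>n f. lin R (P n) (P (Suc n)) f \<and>
    (\<forall>x\<in>carrier (P (Suc n)). x \<ominus>\<^bsub>P (Suc n)\<^esub> \<gamma> (Suc n) x \<ominus>\<^bsub>P (Suc n)\<^esub> f (d n x) \<in> d (Suc n) ` carrier (P (Suc (Suc n))))"
  have "\<exists>s. \<forall>n. ?I n (s n) \<and> (\<forall>x\<in>carrier (P (Suc n)). d (Suc n) (s (Suc n) x) = x \<ominus>\<^bsub>P (Suc n)\<^esub> \<gamma> (Suc n) x \<ominus>\<^bsub>P (Suc n)\<^esub> s n (d n x))"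
  proof (rule dependent_nat_choice)
    interpret P0: module R "P 0" by (rule P.P)
    interpret P1: module R "P (Suc 0)" by (rule P.P)
    interpret M: module R M by (rule P.M)
    have "x \<ominus>\<^bsub>P 0\<^esub> \<gamma> 0 x \<in> d 0 ` carrier (P (Suc 0))" if "x \<in> carrier (P 0)" for x
      unfolding P.ex0 using that ge[OF that] linD(1)[OF g that] linD(1)[OF P.e that] lin_minus(2)[OF P.P P.M P.e]
      by (simp; simp add: a_minus_def M.r_neg)
    from dualb_lift[OF P.P P.P P.P du lin_sub[OF P.P P.P lin_id g] P.d this]
    obtain f where f: "lin R (P 0) (P (Suc 0)) f" "\<And>x. x \<in> carrier (P 0) \<Longrightarrow> d 0 (f x) = x \<ominus>\<^bsub>P 0\<^esub> \<gamma> 0 x" by blast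
    have "x \<ominus>\<^bsub>P (Suc 0)\<^esub> \<gamma> (Suc 0) x \<ominus>\<^bsub>P (Suc 0)\<^esub> f (d 0 x) \<in> d (Suc 0) ` carrier (P (Suc (Suc 0)))"
      if x: "x \<in> carrier (P (Suc 0))" for x
    proof -
      have c: "\<gamma> (Suc 0) x \<in> carrier (P (Suc 0))" "f (d 0 x) \<in> carrier (P (Suc 0))" "d 0 x \<in> carrier (P 0)" "\<gamma> 0 (d 0 x) \<in> carrier (P 0)"
        using x linD(1)[OF g] linD(1)[OF f(1)] P.d_in by auto
      then have "d 0 (x \<ominus>\<^bsub>P (Suc 0)\<^esub> \<gamma> (Suc 0) x \<ominus>\<^bsub>P (Suc 0)\<^esub> f (d 0 x)) = \<zero>\<^bsub>P 0\<^esub>"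
        using x by (simp add: lin_minus(2)[OF P.P P.P P.d] gd f(2); simp add: a_minus_def P0.r_neg)
      then show ?thesis unfolding P.ex using x c by simp
    qed
    with f show "\<exists>f. ?I 0 f" by blast
  next
    fix f n assume f: "?I n f"
    interpret P0: module R "P n" by (rule P.P)
    interpret P1: module R "P (Suc n)" by (rule P.P)
    interpret P2: module R "P (Suc (Suc n))" by (rule P.P)
    have l: "lin R (P (Suc n)) (P (Suc n)) (\<lambda>x. x \<ominus>\<^bsub>P (Suc n)\<^esub> \<gamma> (Suc n) x \<ominus>\<^bsub>P (Suc n)\<^esub> f (d n x))"
      using f by (intro lin_sub P.P lin_id g lin_comp[OF P.d]) auto
    from f have "\<And>x. x \<in> carrier (P (Suc n)) \<Longrightarrow> x \<ominus>\<^bsub>P (Suc n)\<^esub> \<gamma> (Suc n) x \<ominus>\<^bsub>P (Suc n)\<^esub> f (d n x) \<in> d (Suc n) ` carrier (P (Suc (Suc n)))" by blast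
    from dualb_lift[OF P.P P.P P.P du l P.d this]
    obtain k where k: "lin R (P (Suc n)) (P (Suc (Suc n))) k"
      "\<And>x. x \<in> carrier (P (Suc n)) \<Longrightarrow> d (Suc n) (k x) = x \<ominus>\<^bsub>P (Suc n)\<^esub> \<gamma> (Suc n) x \<ominus>\<^bsub>P (Suc n)\<^esub> f (d n x)" by blast
    have "x \<ominus>\<^bsub>P (Suc (Suc n))\<^esub> \<gamma> (Suc (Suc n)) x \<ominus>\<^bsub>P (Suc (Suc n))\<^esub> k (d (Suc n) x) \<in> d (Suc (Suc n)) ` carrier (P (Suc (Suc (Suc n))))"
      if x: "x \<in> carrier (P (Suc (Suc n)))" for x
    proof -
      have c: "\<gamma> (Suc (Suc n)) x \<in> carrier (P (Suc (Suc n)))" "d (Suc n) x \<in> carrier (P (Suc n))"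
        "k (d (Suc n) x) \<in> carrier (P (Suc (Suc n)))" "\<gamma> (Suc n) (d (Suc n) x) \<in> carrier (P (Suc n))"
        using x linD(1)[OF g] linD(1)[OF k(1)] P.d_in by auto
      have "f (d n (d (Suc n) x)) = \<zero>\<^bsub>P (Suc n)\<^esub>" using P.dd[OF x] lin_zero[OF P.P P.P] f by simp
      then have "d (Suc n) (x \<ominus>\<^bsub>P (Suc (Suc n))\<^esub> \<gamma> (Suc (Suc n)) x \<ominus>\<^bsub>P (Suc (Suc n))\<^esub> k (d (Suc n) x)) = \<zero>\<^bsub>P (Suc n)\<^esub>"
        using x c by (simp add: lin_minus(2)[OF P.P P.P P.d] gd k(2); simp add: a_minus_def P1.r_neg P1.M.minus_zero_eq)
      then show ?thesis unfolding P.ex using x c by simp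
    qed
    with k show "\<exists>g. ?I (Suc n) g \<and> (\<forall>x\<in>carrier (P (Suc n)). d (Suc n) (g x) = x \<ominus>\<^bsub>P (Suc n)\<^esub> \<gamma> (Suc n) x \<ominus>\<^bsub>P (Suc n)\<^esub> f (d n x))"
      by blast
  qed
  then obtain s where s0: "\<forall>n. ?I n (s n) \<and> (\<forall>x\<in>carrier (P (Suc n)). d (Suc n) (s (Suc n) x) = x \<ominus>\<^bsub>P (Suc n)\<^esub> \<gamma> (Suc n) x \<ominus>\<^bsub>P (Suc n)\<^esub> s n (d n x))"
    by (rule exE)
  note s = s0[THEN spec, THEN conjunct1, THEN conjunct1] s0[THEN spec, THEN conjunct2, THEN bspec]
  show ?thesis by (rule that[of s]) (rule s, rule s)
qed

definition cocyc :: "('a, 'b) ring_scheme \<Rightarrow> (nat \<Rightarrow> ('a, 'p) module) \<Rightarrow> (nat \<Rightarrow> 'p \<Rightarrow> 'p) \<Rightarrow> ('a, 'n, 'd) module_scheme \<Rightarrow> nat \<Rightarrow> ('p \<Rightarrow> 'n) \<Rightarrow> bool" where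
  "cocyc R P d X i \<phi> \<longleftrightarrow> lin R (P i) X \<phi> \<and> (\<forall>x\<in>carrier (P (Suc i)). \<phi> (d i x) = \<zero>\<^bsub>X\<^esub>)"

definition cobnd :: "('a, 'b) ring_scheme \<Rightarrow> (nat \<Rightarrow> ('a, 'p) module) \<Rightarrow> (nat \<Rightarrow> 'p \<Rightarrow> 'p) \<Rightarrow> ('a, 'n, 'd) module_scheme \<Rightarrow> nat \<Rightarrow> ('p \<Rightarrow> 'n) \<Rightarrow> bool" where
  "cobnd R P d X j \<phi> \<longleftrightarrow> (\<exists>\<psi>. lin R (P j) X \<psi> \<and> (\<forall>x\<in>carrier (P (Suc j)). \<phi> x = \<psi> (d j x)))"

text \<open>The annihilator condition for a class in degree \<open>Suc j\<close>, stated without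
  cosets and extensional functions so that it can be moved between resolutions on different
  types.\<close>

definition asc :: "('a, 'b) ring_scheme \<Rightarrow> (nat \<Rightarrow> ('a, 'p) module) \<Rightarrow> (nat \<Rightarrow> 'p \<Rightarrow> 'p) \<Rightarrow> ('a, 'n, 'd) module_scheme \<Rightarrow> nat \<Rightarrow> 'a set \<Rightarrow> bool" where
  "asc R P d X j p \<longleftrightarrow> (\<exists>\<phi>. cocyc R P d X (Suc j) \<phi> \<and> p = {a \<in> carrier R. cobnd R P d X j (\<lambda>x. a \<odot>\<^bsub>X\<^esub> \<phi> x)})"

text \<open>Pulling a cocycle back along a comparison map keeps its annihilator, because the round
  trip on \<open>P\<close> is homotopic to the identity.\<close>

lemma asc_resolution:
  assumes P: "resolution R M P d e" and E: "resolution R M E d' e'"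
    and duP: "\<And>i. dualb R (P i) (B i) (w i) (h i)" and duE: "\<And>i. dualb R (E i) (B' i) (w' i) (h' i)"
    and X: "module R X" and "asc R P d X j p"
  shows "asc R E d' X j p"
proof -
  interpret P: resolution R M P d e by fact
  interpret E: resolution R M E d' e' by fact
  interpret X: module R X by fact
  obtain \<alpha> where \<alpha>: "\<And>i. lin R (P i) (E i) (\<alpha> i)" "\<And>x. x \<in> carrier (P 0) \<Longrightarrow> e' (\<alpha> 0 x) = e x"
    "\<And>i x. x \<in> carrier (P (Suc i)) \<Longrightarrow> d' i (\<alpha> (Suc i) x) = \<alpha> i (d i x)"
    by (rule chain_map_exists[OF P E duP]) blast
  obtain \<beta> where \<beta>: "\<And>i. lin R (E i) (P i) (\<beta> i)" "\<And>x. x \<in> carrier (E 0) \<Longrightarrow> e (\<beta> 0 x) = e' x"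
    "\<And>i x. x \<in> carrier (E (Suc i)) \<Longrightarrow> d i (\<beta> (Suc i) x) = \<beta> i (d' i x)"
    by (rule chain_map_exists[OF E P duE]) blast
  define \<gamma> where "\<gamma> i x = \<beta> i (\<alpha> i x)" for i x
  have g: "lin R (P i) (P i) (\<gamma> i)" for i unfolding \<gamma>_def by (rule lin_comp[OF \<alpha>(1) \<beta>(1)])
  obtain s where s: "\<And>i. lin R (P i) (P (Suc i)) (s i)"
    "\<And>i x. x \<in> carrier (P (Suc i)) \<Longrightarrow> d (Suc i) (s (Suc i) x) = x \<ominus>\<^bsub>P (Suc i)\<^esub> \<gamma> (Suc i) x \<ominus>\<^bsub>P (Suc i)\<^esub> s i (d i x)"
    by (rule homotopy_exists[OF P duP g])
       (auto simp: \<gamma>_def \<alpha> \<beta> linD(1)[OF \<alpha>(1)] P.d_in)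
  obtain \<phi> where \<phi>: "lin R (P (Suc j)) X \<phi>" "\<And>x. x \<in> carrier (P (Suc (Suc j))) \<Longrightarrow> \<phi> (d (Suc j) x) = \<zero>\<^bsub>X\<^esub>"
    and p: "p = {a \<in> carrier R. cobnd R P d X j (\<lambda>x. a \<odot>\<^bsub>X\<^esub> \<phi> x)}"
    using assms(6) by (auto simp: asc_def cocyc_def)
  have "cocyc R E d' X (Suc j) (\<lambda>x. \<phi> (\<beta> (Suc j) x))"
    unfolding cocyc_def
  proof (intro conjI ballI)
    show "lin R (E (Suc j)) X (\<lambda>x. \<phi> (\<beta> (Suc j) x))" by (rule lin_comp[OF \<beta>(1) \<phi>(1)])
    fix x assume x: "x \<in> carrier (E (Suc (Suc j)))"
    show "\<phi> (\<beta> (Suc j) (d' (Suc j) x)) = \<zero>\<^bsub>X\<^esub>"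
      using \<beta>(3)[OF x] \<phi>(2)[OF linD(1)[OF \<beta>(1) x]] by simp
  qed
  moreover have "cobnd R P d X j (\<lambda>x. a \<odot>\<^bsub>X\<^esub> \<phi> x) \<longleftrightarrow> cobnd R E d' X j (\<lambda>x. a \<odot>\<^bsub>X\<^esub> \<phi> (\<beta> (Suc j) x))"
    if a: "a \<in> carrier R" for a
  proof
    assume "cobnd R P d X j (\<lambda>x. a \<odot>\<^bsub>X\<^esub> \<phi> x)"
    then obtain \<psi> where \<psi>: "lin R (P j) X \<psi>" "\<And>x. x \<in> carrier (P (Suc j)) \<Longrightarrow> a \<odot>\<^bsub>X\<^esub> \<phi> x = \<psi> (d j x)"
      by (auto simp: cobnd_def)
    have "\<forall>x\<in>carrier (E (Suc j)). a \<odot>\<^bsub>X\<^esub> \<phi> (\<beta> (Suc j) x) = \<psi> (\<beta> j (d' j x))"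
      using \<psi>(2) linD(1)[OF \<beta>(1)] \<beta>(3) by simp
    then show "cobnd R E d' X j (\<lambda>x. a \<odot>\<^bsub>X\<^esub> \<phi> (\<beta> (Suc j) x))"
      unfolding cobnd_def using lin_comp[OF \<beta>(1) \<psi>(1)] by blast
  next
    assume "cobnd R E d' X j (\<lambda>x. a \<odot>\<^bsub>X\<^esub> \<phi> (\<beta> (Suc j) x))"
    then obtain \<psi> where \<psi>: "lin R (E j) X \<psi>" "\<And>x. x \<in> carrier (E (Suc j)) \<Longrightarrow> a \<odot>\<^bsub>X\<^esub> \<phi> (\<beta> (Suc j) x) = \<psi> (d' j x)"
      by (auto simp: cobnd_def)
    \<comment> \<open>On \<open>d j x\<close> this is \<open>a\<close> times \<open>\<phi>\<close>
      of \<open>\<gamma> (Suc j) x\<close> plus \<open>a\<close> times \<open>\<phi>\<close> of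
      \<open>s j (d j x)\<close>, which is \<open>a\<close> times \<open>\<phi> x\<close> by the
      homotopy. The double sign lets \<open>lin_sub\<close> and \<open>lin_smult\<close>
      apply.\<close>
    let ?\<psi> = "\<lambda>x. \<psi> (\<alpha> j x) \<ominus>\<^bsub>X\<^esub> (\<ominus>\<^bsub>R\<^esub> a) \<odot>\<^bsub>X\<^esub> \<phi> (s j x)"
    have "lin R (P j) X ?\<psi>"
      by (intro lin_sub lin_smult P.P X lin_comp[OF \<alpha>(1) \<psi>(1)] lin_comp[OF s(1) \<phi>(1)]) (use a in simp)
    moreover have "a \<odot>\<^bsub>X\<^esub> \<phi> x = ?\<psi> (d j x)" if x: "x \<in> carrier (P (Suc j))" for x
    proof -
      interpret Pj: module R "P (Suc j)" by (rule P.P)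
      have c: "\<gamma> (Suc j) x \<in> carrier (P (Suc j))" "s j (d j x) \<in> carrier (P (Suc j))"
        "s (Suc j) x \<in> carrier (P (Suc (Suc j)))"
        using x linD(1)[OF g] linD(1)[OF s(1)] P.d_in by auto
      have \<phi>c: "\<phi> x \<in> carrier X" "\<phi> (\<gamma> (Suc j) x) \<in> carrier X" "\<phi> (s j (d j x)) \<in> carrier X"
        using linD(1)[OF \<phi>(1)] x c by auto
      have "\<zero>\<^bsub>X\<^esub> = \<phi> (x \<ominus>\<^bsub>P (Suc j)\<^esub> \<gamma> (Suc j) x \<ominus>\<^bsub>P (Suc j)\<^esub> s j (d j x))"
        using \<phi>(2)[OF c(3)] s(2)[OF x] by simp
      also have "\<dots> = \<phi> x \<ominus>\<^bsub>X\<^esub> \<phi> (\<gamma> (Suc j) x) \<ominus>\<^bsub>X\<^esub> \<phi> (s j (d j x))"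
        using x c by (simp add: lin_minus(2)[OF P.P X \<phi>(1)])
      finally have "\<phi> x \<ominus>\<^bsub>X\<^esub> (\<phi> (\<gamma> (Suc j) x) \<oplus>\<^bsub>X\<^esub> \<phi> (s j (d j x))) = \<zero>\<^bsub>X\<^esub>"
        using \<phi>c by (simp add: a_minus_def X.minus_add X.a_assoc)
      then have "\<phi> x = \<phi> (\<gamma> (Suc j) x) \<oplus>\<^bsub>X\<^esub> \<phi> (s j (d j x))"
        by (rule X.M.eq_if_minus_zero[OF \<phi>c(1) X.M.a_closed[OF \<phi>c(2,3)]])
      then have "a \<odot>\<^bsub>X\<^esub> \<phi> x = a \<odot>\<^bsub>X\<^esub> \<phi> (\<gamma> (Suc j) x) \<oplus>\<^bsub>X\<^esub> a \<odot>\<^bsub>X\<^esub> \<phi> (s j (d j x))"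
        using \<phi>c a by (simp add: X.smult_r_distr)
      also have "a \<odot>\<^bsub>X\<^esub> \<phi> (\<gamma> (Suc j) x) = \<psi> (\<alpha> j (d j x))"
        unfolding \<gamma>_def using \<psi>(2)[OF linD(1)[OF \<alpha>(1) x]] \<alpha>(3)[OF x] by simp
      also have "\<psi> (\<alpha> j (d j x)) \<oplus>\<^bsub>X\<^esub> a \<odot>\<^bsub>X\<^esub> \<phi> (s j (d j x)) = ?\<psi> (d j x)"
        using \<phi>c a by (simp add: a_minus_def X.smult_l_minus X.minus_minus)
      finally show ?thesis .
    qed
    ultimately show "cobnd R P d X j (\<lambda>x. a \<odot>\<^bsub>X\<^esub> \<phi> x)" unfolding cobnd_def by blast
  qed
  ultimately show ?thesis unfolding asc_def p by blast
qed

section \<open>Quotient modules and cohomology of the Hom complex\<close>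

text \<open>The axioms are identities or ask for inverses, and both can be pushed forward along a
  surjection that respects the operations.\<close>

lemma module_image:
  assumes M: "module R M" and im: "q ` carrier M = carrier X" and z: "\<zero>\<^bsub>X\<^esub> = q \<zero>\<^bsub>M\<^esub>"
    and a: "\<And>x y. x \<in> carrier M \<Longrightarrow> y \<in> carrier M \<Longrightarrow> q (x \<oplus>\<^bsub>M\<^esub> y) = q x \<oplus>\<^bsub>X\<^esub> q y"
    and s: "\<And>a x. a \<in> carrier R \<Longrightarrow> x \<in> carrier M \<Longrightarrow> q (a \<odot>\<^bsub>M\<^esub> x) = a \<odot>\<^bsub>X\<^esub> q x"
  shows "module R X"
proof -
  interpret module R M by fact
  have ex: "\<exists>x'\<in>carrier M. x = q x'" if "x \<in> carrier X" for x using im that by blast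
  have qc: "q x \<in> carrier X" if "x \<in> carrier M" for x using im that by blast
  show ?thesis
  proof (rule moduleI)
    show "cring R" by (rule R.is_cring)
    show "abelian_group X"
    proof (rule abelian_groupI)
      show "\<zero>\<^bsub>X\<^esub> \<in> carrier X" using z qc by simp
      fix x y assume "x \<in> carrier X" "y \<in> carrier X"
      then obtain x' y' where *: "x' \<in> carrier M" "y' \<in> carrier M" "x = q x'" "y = q y'" using ex by metis
      show "x \<oplus>\<^bsub>X\<^esub> y \<in> carrier X" using * a[symmetric] qc by simp
      show "x \<oplus>\<^bsub>X\<^esub> y = y \<oplus>\<^bsub>X\<^esub> x" using * a[symmetric] M.a_comm by simp
    next
      fix x y w assume "x \<in> carrier X" "y \<in> carrier X" "w \<in> carrier X"
      then obtain x' y' w' where *: "x' \<in> carrier M" "y' \<in> carrier M" "w' \<in> carrier M" "x = q x'" "y = q y'" "w = q w'"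
        using ex by metis
      show "x \<oplus>\<^bsub>X\<^esub> y \<oplus>\<^bsub>X\<^esub> w = x \<oplus>\<^bsub>X\<^esub> (y \<oplus>\<^bsub>X\<^esub> w)" using * a[symmetric] M.a_assoc by simp
    next
      fix x assume "x \<in> carrier X"
      then obtain x' where *: "x' \<in> carrier M" "x = q x'" using ex by metis
      show "\<zero>\<^bsub>X\<^esub> \<oplus>\<^bsub>X\<^esub> x = x" using * a[symmetric] z by simp
      have "q (\<ominus>\<^bsub>M\<^esub> x') \<oplus>\<^bsub>X\<^esub> x = \<zero>\<^bsub>X\<^esub>" using * a[symmetric] z by (simp add: M.l_neg)
      then show "\<exists>y\<in>carrier X. y \<oplus>\<^bsub>X\<^esub> x = \<zero>\<^bsub>X\<^esub>" using * qc by auto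
    qed
  next
    fix a x assume a': "a \<in> carrier R" and "x \<in> carrier X"
    then obtain x' where *: "x' \<in> carrier M" "x = q x'" using ex by metis
    show "a \<odot>\<^bsub>X\<^esub> x \<in> carrier X" using * a' s[symmetric] qc by simp
    fix b assume b: "b \<in> carrier R"
    show "(a \<oplus>\<^bsub>R\<^esub> b) \<odot>\<^bsub>X\<^esub> x = a \<odot>\<^bsub>X\<^esub> x \<oplus>\<^bsub>X\<^esub> b \<odot>\<^bsub>X\<^esub> x"
      using * a' b s[symmetric] a[symmetric] smult_l_distr by simp
    show "(a \<otimes>\<^bsub>R\<^esub> b) \<odot>\<^bsub>X\<^esub> x = a \<odot>\<^bsub>X\<^esub> (b \<odot>\<^bsub>X\<^esub> x)"
      using * a' b s[symmetric] smult_assoc1 by simp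
  next
    fix a x y assume a': "a \<in> carrier R" and "x \<in> carrier X" "y \<in> carrier X"
    then obtain x' y' where *: "x' \<in> carrier M" "y' \<in> carrier M" "x = q x'" "y = q y'" using ex by metis
    show "a \<odot>\<^bsub>X\<^esub> (x \<oplus>\<^bsub>X\<^esub> y) = a \<odot>\<^bsub>X\<^esub> x \<oplus>\<^bsub>X\<^esub> a \<odot>\<^bsub>X\<^esub> y"
      using * a' s[symmetric] a[symmetric] smult_r_distr by simp
  next
    fix x assume "x \<in> carrier X"
    then obtain x' where *: "x' \<in> carrier M" "x = q x'" using ex by metis
    show "\<one>\<^bsub>R\<^esub> \<odot>\<^bsub>X\<^esub> x = x" using * s[OF R.one_closed, symmetric] by simp
  qed
qed

lemma quot_module_facts:
  assumes M: "module R M" and K: "submodule K R M"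
  shows "carrier (quot_module M K) = (\<lambda>x. K +>\<^bsub>M\<^esub> x) ` carrier M"
    "\<zero>\<^bsub>quot_module M K\<^esub> = K"
    "x \<in> carrier M \<Longrightarrow> K +>\<^bsub>M\<^esub> x = K \<longleftrightarrow> x \<in> K"
    "a \<in> carrier R \<Longrightarrow> x \<in> carrier M \<Longrightarrow> a \<odot>\<^bsub>quot_module M K\<^esub> (K +>\<^bsub>M\<^esub> x) = K +>\<^bsub>M\<^esub> (a \<odot>\<^bsub>M\<^esub> x)"
    "module R (quot_module M K)" "lin R M (quot_module M K) (\<lambda>x. K +>\<^bsub>M\<^esub> x)"
proof -
  interpret module R M by fact
  have sg: "subgroup K (add_monoid M)" using K by (simp add: submodule_def)
  then have "additive_subgroup K M" by (rule additive_subgroupI)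
  then interpret K: abelian_subgroup K M
    by (intro abelian_subgroupI3) (auto intro: M.abelian_group_axioms)
  show car: "carrier (quot_module M K) = (\<lambda>x. K +>\<^bsub>M\<^esub> x) ` carrier M"
    by (auto simp: quot_module_def A_RCOSETS_defs a_r_coset_def)
  show z: "\<zero>\<^bsub>quot_module M K\<^esub> = K" by (simp add: quot_module_def)
  show iff: "K +>\<^bsub>M\<^esub> x = K \<longleftrightarrow> x \<in> K" if "x \<in> carrier M" for x
    using K.a_rcos_const[of x] M.a_coset_join1[of K x] that sg by auto
  have add: "(K +>\<^bsub>M\<^esub> x) \<oplus>\<^bsub>quot_module M K\<^esub> (K +>\<^bsub>M\<^esub> y) = K +>\<^bsub>M\<^esub> (x \<oplus>\<^bsub>M\<^esub> y)" if "x \<in> carrier M" "y \<in> carrier M" for x y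
    using K.a_rcos_sum[OF that] by (simp add: quot_module_def)
  show sm: "a \<odot>\<^bsub>quot_module M K\<^esub> (K +>\<^bsub>M\<^esub> x) = K +>\<^bsub>M\<^esub> (a \<odot>\<^bsub>M\<^esub> x)" if a: "a \<in> carrier R" and x: "x \<in> carrier M" for a x
  proof -
    \<comment> \<open>All representatives of a coset give the same product coset, so the union in
      the definition of \<open>quot_module\<close> has constant terms.\<close>
    have eq: "K +>\<^bsub>M\<^esub> (a \<odot>\<^bsub>M\<^esub> y) = K +>\<^bsub>M\<^esub> (a \<odot>\<^bsub>M\<^esub> x)" if y: "y \<in> K +>\<^bsub>M\<^esub> x" for y
    proof -
      obtain k where k: "k \<in> K" "y = k \<oplus>\<^bsub>M\<^esub> x" using y by (auto simp: a_r_coset_def')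
      then have kc: "k \<in> carrier M" using K.a_Hcarr by blast
      have ak: "a \<odot>\<^bsub>M\<^esub> k \<in> K" using submodule.smult_closed[OF K a k(1)] .
      have "a \<odot>\<^bsub>M\<^esub> y = a \<odot>\<^bsub>M\<^esub> k \<oplus>\<^bsub>M\<^esub> a \<odot>\<^bsub>M\<^esub> x" using k(2) kc a x by (simp add: smult_r_distr)
      also have "\<dots> \<in> K +>\<^bsub>M\<^esub> (a \<odot>\<^bsub>M\<^esub> x)" using ak by (auto simp: a_r_coset_def')
      finally show ?thesis using K.a_repr_independence'[of "a \<odot>\<^bsub>M\<^esub> y" "a \<odot>\<^bsub>M\<^esub> x"] a x by simp
    qed
    have "x \<in> K +>\<^bsub>M\<^esub> x" by (rule K.a_rcos_self[OF x])
    then have "(\<Union>y\<in>K +>\<^bsub>M\<^esub> x. K +>\<^bsub>M\<^esub> (a \<odot>\<^bsub>M\<^esub> x)) = K +>\<^bsub>M\<^esub> (a \<odot>\<^bsub>M\<^esub> x)" by (rule UN_constant_eq) simp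
    moreover have "(\<Union>y\<in>K +>\<^bsub>M\<^esub> x. K +>\<^bsub>M\<^esub> (a \<odot>\<^bsub>M\<^esub> y)) = (\<Union>y\<in>K +>\<^bsub>M\<^esub> x. K +>\<^bsub>M\<^esub> (a \<odot>\<^bsub>M\<^esub> x))"
      by (rule SUP_cong[OF refl eq])
    ultimately show ?thesis by (simp add: quot_module_def)
  qed
  show "module R (quot_module M K)"
  proof (rule module_image[OF M car[symmetric]])
    show "\<zero>\<^bsub>quot_module M K\<^esub> = K +>\<^bsub>M\<^esub> \<zero>\<^bsub>M\<^esub>" using iff[of "\<zero>\<^bsub>M\<^esub>"] z by simp
  qed (simp_all add: add sm)
  show "lin R M (quot_module M K) (\<lambda>x. K +>\<^bsub>M\<^esub> x)"
    by (rule linI) (use car add sm in auto)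
qed

lemma associated_primes_quot:
  assumes M: "module R M" and K: "submodule K R M"
  shows "associated_primes R (quot_module M K) = {p. primeideal p R \<and> (\<exists>x\<in>carrier M. p = {a \<in> carrier R. a \<odot>\<^bsub>M\<^esub> x \<in> K})}"
proof -
  interpret module R M by fact
  note q = quot_module_facts[OF M K]
  have "{a \<in> carrier R. a \<odot>\<^bsub>quot_module M K\<^esub> (K +>\<^bsub>M\<^esub> x) = \<zero>\<^bsub>quot_module M K\<^esub>} = {a \<in> carrier R. a \<odot>\<^bsub>M\<^esub> x \<in> K}"
    if x: "x \<in> carrier M" for x
  proof (intro Collect_cong conj_cong refl)
    fix a assume a: "a \<in> carrier R"
    show "a \<odot>\<^bsub>quot_module M K\<^esub> (K +>\<^bsub>M\<^esub> x) = \<zero>\<^bsub>quot_module M K\<^esub> \<longleftrightarrow> a \<odot>\<^bsub>M\<^esub> x \<in> K"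
      unfolding q(2) q(4)[OF a x] by (rule q(3)[OF smult_closed[OF a x]])
  qed
  then show ?thesis unfolding associated_primes_def q(1) by (simp add: bex_simps)
qed

lemma submodule_carrier_update:
  assumes M: "module R M" and H: "submodule H R M" and K: "submodule K R M" "K \<subseteq> H"
  shows "submodule K R (M\<lparr>carrier := H\<rparr>)"
proof -
  interpret M: module R M by fact
  interpret H: module R "M\<lparr>carrier := H\<rparr>" by (rule submodule.submodule_is_module[OF H M])
  have mk: "module R (M\<lparr>carrier := K\<rparr>)" by (rule submodule.submodule_is_module[OF K(1) M])
  show ?thesis by (rule H.module_incl_imp_submodule) (use K(2) mk in auto)
qed

lemma module_hom_iff:
  "f \<in> module_hom R M N \<longleftrightarrow> lin R M N f \<and> f \<in> extensional (carrier M)"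
  by (auto simp: module_hom_def lin_def PiE_def)

lemma lin_restrict: "module R M \<Longrightarrow> lin R M N (restrict f (carrier M)) \<longleftrightarrow> lin R M N f"
proof -
  assume "module R M"
  then interpret module R M .
  show ?thesis by (auto simp: lin_def Pi_def)
qed

lemma module_Hom:
  assumes M: "module R M" and N: "module R N"
  shows "module R (Hom_module R M N)"
proof -
  interpret M: module R M by fact
  interpret N: module R N by fact
  let ?H = "Hom_module R M N"
  have car: "f \<in> carrier ?H \<longleftrightarrow> lin R M N f \<and> f \<in> extensional (carrier M)" for f
    by (simp add: Hom_module_def module_hom_iff)
  have ops: "\<zero>\<^bsub>?H\<^esub> = (\<lambda>x\<in>carrier M. \<zero>\<^bsub>N\<^esub>)" "f \<oplus>\<^bsub>?H\<^esub> g = (\<lambda>x\<in>carrier M. f x \<oplus>\<^bsub>N\<^esub> g x)"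
    "a \<odot>\<^bsub>?H\<^esub> f = (\<lambda>x\<in>carrier M. a \<odot>\<^bsub>N\<^esub> f x)" for f g a
    by (simp_all add: Hom_module_def)
  have val: "f x \<in> carrier N" if "f \<in> carrier ?H" "x \<in> carrier M" for f x
    using that linD(1) by (auto simp: car)
  have ext: "f = g" if "f \<in> carrier ?H" "g \<in> carrier ?H" "\<And>x. x \<in> carrier M \<Longrightarrow> f x = g x" for f g
    using that by (auto simp: car intro: extensionalityI)
  have ladd: "f \<oplus>\<^bsub>?H\<^esub> g \<in> carrier ?H" if "f \<in> carrier ?H" "g \<in> carrier ?H" for f g
  proof -
    have "lin R M N (\<lambda>x. f x \<oplus>\<^bsub>N\<^esub> g x)"
      by (rule linI) (use that in \<open>auto simp: car linD N.a_ac N.smult_r_distr\<close>)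
    then show ?thesis by (simp add: car ops lin_restrict[OF M])
  qed
  have lsm: "a \<odot>\<^bsub>?H\<^esub> f \<in> carrier ?H" if "f \<in> carrier ?H" "a \<in> carrier R" for f a
    using that lin_smult[OF M N] by (simp add: car ops lin_restrict[OF M])
  have l0: "\<zero>\<^bsub>?H\<^esub> \<in> carrier ?H"
    by (simp add: car ops lin_restrict[OF M]) (rule linI, auto)
  show ?thesis
  proof (rule moduleI)
    show "cring R" by (rule M.R.is_cring)
    show "abelian_group ?H"
    proof (rule abelian_groupI)
      fix f g h assume f: "f \<in> carrier ?H" and g: "g \<in> carrier ?H" and h: "h \<in> carrier ?H"
      show "f \<oplus>\<^bsub>?H\<^esub> g \<oplus>\<^bsub>?H\<^esub> h = f \<oplus>\<^bsub>?H\<^esub> (g \<oplus>\<^bsub>?H\<^esub> h)"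
        by (rule ext[OF ladd[OF ladd[OF f g] h] ladd[OF f ladd[OF g h]]]) (use f g h val in \<open>auto simp: ops N.a_assoc\<close>)
    next
      fix f g assume f: "f \<in> carrier ?H" and g: "g \<in> carrier ?H"
      show "f \<oplus>\<^bsub>?H\<^esub> g = g \<oplus>\<^bsub>?H\<^esub> f"
        by (rule ext[OF ladd[OF f g] ladd[OF g f]]) (use f g val in \<open>auto simp: ops N.a_comm\<close>)
    next
      fix f assume f: "f \<in> carrier ?H"
      show "\<zero>\<^bsub>?H\<^esub> \<oplus>\<^bsub>?H\<^esub> f = f"
        by (rule ext[OF ladd[OF l0 f] f]) (use f val in \<open>auto simp: ops\<close>)
      show "\<exists>g\<in>carrier ?H. g \<oplus>\<^bsub>?H\<^esub> f = \<zero>\<^bsub>?H\<^esub>"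
      proof (rule bexI)
        show m: "(\<ominus>\<^bsub>R\<^esub> \<one>\<^bsub>R\<^esub>) \<odot>\<^bsub>?H\<^esub> f \<in> carrier ?H" by (rule lsm[OF f]) simp
        show "(\<ominus>\<^bsub>R\<^esub> \<one>\<^bsub>R\<^esub>) \<odot>\<^bsub>?H\<^esub> f \<oplus>\<^bsub>?H\<^esub> f = \<zero>\<^bsub>?H\<^esub>"
          by (rule ext[OF ladd[OF m f] l0]) (use f val in \<open>auto simp: ops N.smult_l_minus N.l_neg\<close>)
      qed
    qed (use ladd l0 in auto)
  next
    fix a f assume a: "a \<in> carrier R" and f: "f \<in> carrier ?H"
    show "a \<odot>\<^bsub>?H\<^esub> f \<in> carrier ?H" by (rule lsm[OF f a])
    fix b assume b: "b \<in> carrier R"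
    show "(a \<oplus>\<^bsub>R\<^esub> b) \<odot>\<^bsub>?H\<^esub> f = a \<odot>\<^bsub>?H\<^esub> f \<oplus>\<^bsub>?H\<^esub> b \<odot>\<^bsub>?H\<^esub> f"
      by (rule ext[OF lsm[OF f M.R.a_closed[OF a b]] ladd[OF lsm[OF f a] lsm[OF f b]]]) (use a b f val in \<open>auto simp: ops N.smult_l_distr\<close>)
    show "(a \<otimes>\<^bsub>R\<^esub> b) \<odot>\<^bsub>?H\<^esub> f = a \<odot>\<^bsub>?H\<^esub> (b \<odot>\<^bsub>?H\<^esub> f)"
      by (rule ext[OF lsm[OF f M.R.m_closed[OF a b]] lsm[OF lsm[OF f b] a]]) (use a b f val in \<open>auto simp: ops N.smult_assoc1\<close>)
  next
    fix a f g assume a: "a \<in> carrier R" and f: "f \<in> carrier ?H" and g: "g \<in> carrier ?H"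
    show "a \<odot>\<^bsub>?H\<^esub> (f \<oplus>\<^bsub>?H\<^esub> g) = a \<odot>\<^bsub>?H\<^esub> f \<oplus>\<^bsub>?H\<^esub> a \<odot>\<^bsub>?H\<^esub> g"
      by (rule ext[OF lsm[OF ladd[OF f g] a] ladd[OF lsm[OF f a] lsm[OF g a]]]) (use a f g val in \<open>auto simp: ops N.smult_r_distr\<close>)
  next
    fix f assume f: "f \<in> carrier ?H"
    show "\<one>\<^bsub>R\<^esub> \<odot>\<^bsub>?H\<^esub> f = f"
      by (rule ext[OF lsm[OF f M.R.one_closed] f]) (use f val in \<open>auto simp: ops\<close>)
  qed
qed

text \<open>Translates cosets of extensional homomorphisms into \<open>asc\<close>. In degree
  \<open>Suc j\<close> the coboundaries are composites with \<open>d j\<close>.\<close>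

lemma associated_primes_Hom_cohomology:
  assumes P: "\<And>i. module R (P i)" and d: "\<And>i. lin R (P (Suc i)) (P i) (d i)"
    and dd: "\<And>x. x \<in> carrier (P (Suc (Suc j))) \<Longrightarrow> d j (d (Suc j) x) = \<zero>\<^bsub>P j\<^esub>" and X: "module R X"
  shows "associated_primes R (Hom_cohomology R P d X (Suc j)) = {p. primeideal p R \<and> asc R P d X j p}"
proof -
  let ?i = "Suc j"
  let ?H = "Hom_module R (P ?i) X" and ?Z = "Hom_cocycles R P d X ?i" and ?B = "Hom_coboundaries R P d X ?i"
  interpret Pi: module R "P ?i" by (rule P)
  interpret Pj: module R "P j" by (rule P)
  interpret Ps: module R "P (Suc ?i)" by (rule P)
  interpret X: module R X by (rule X)
  interpret H: module R ?H by (rule module_Hom[OF P X])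
  interpret Hj: module R "Hom_module R (P j) X" by (rule module_Hom[OF P X])
  have ops: "\<zero>\<^bsub>?H\<^esub> = (\<lambda>x\<in>carrier (P ?i). \<zero>\<^bsub>X\<^esub>)" "f \<oplus>\<^bsub>?H\<^esub> g = (\<lambda>x\<in>carrier (P ?i). f x \<oplus>\<^bsub>X\<^esub> g x)"
    "a \<odot>\<^bsub>?H\<^esub> f = (\<lambda>x\<in>carrier (P ?i). a \<odot>\<^bsub>X\<^esub> f x)" "carrier ?H = module_hom R (P ?i) X" for f g a
    by (simp_all add: Hom_module_def)
  have dc: "d ?i x \<in> carrier (P ?i)" if "x \<in> carrier (P (Suc ?i))" for x using linD(1)[OF d that] .
  have djc: "d j x \<in> carrier (P j)" if "x \<in> carrier (P ?i)" for x using linD(1)[OF d that] .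
  have Ziff: "f \<in> ?Z \<longleftrightarrow> f \<in> module_hom R (P ?i) X \<and> (\<forall>x\<in>carrier (P (Suc ?i)). f (d ?i x) = \<zero>\<^bsub>X\<^esub>)" for f
    unfolding Hom_cocycles_def compose_def by (auto simp: fun_eq_iff restrict_def)
  have Zsub: "submodule ?Z R ?H"
  proof (rule H.module_incl_imp_submodule)
    show "?Z \<subseteq> carrier ?H" by (auto simp: Ziff ops)
    show "module R (?H\<lparr>carrier := ?Z\<rparr>)"
    proof (rule submodule.submodule_is_module[OF H.submoduleI])
      show "?Z \<subseteq> carrier ?H" by (auto simp: Ziff ops)
      show "\<zero>\<^bsub>?H\<^esub> \<in> ?Z" using H.zero_closed dc by (auto simp: Ziff ops)
      show add: "f \<oplus>\<^bsub>?H\<^esub> g \<in> ?Z" if "f \<in> ?Z" "g \<in> ?Z" for f g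
      proof -
        have "f \<oplus>\<^bsub>?H\<^esub> g \<in> carrier ?H" using that by (intro H.a_closed) (auto simp: Ziff ops)
        then show ?thesis using that dc by (auto simp: Ziff ops)
      qed
      show sm: "a \<odot>\<^bsub>?H\<^esub> f \<in> ?Z" if "a \<in> carrier R" "f \<in> ?Z" for a f
      proof -
        have "a \<odot>\<^bsub>?H\<^esub> f \<in> carrier ?H" using that by (intro H.smult_closed) (auto simp: Ziff ops)
        then show ?thesis using that dc by (auto simp: Ziff ops)
      qed
      show "\<ominus>\<^bsub>?H\<^esub> f \<in> ?Z" if f: "f \<in> ?Z" for f
      proof -
        have fc: "f \<in> carrier ?H" using f by (auto simp: Ziff ops)
        have "\<ominus>\<^bsub>?H\<^esub> f = (\<ominus>\<^bsub>R\<^esub> \<one>\<^bsub>R\<^esub>) \<odot>\<^bsub>?H\<^esub> f"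
          using H.smult_l_minus[OF Pi.R.one_closed fc] fc by simp
        then show ?thesis using sm[OF _ f] by simp
      qed
    qed (rule module_Hom[OF P X])
  qed
  have comp: "compose (carrier (P ?i)) f (d j) = (\<lambda>x\<in>carrier (P ?i). f (d j x))" for f by (simp add: compose_def)
  have Bdef: "?B = (\<lambda>f. \<lambda>x\<in>carrier (P ?i). f (d j x)) ` module_hom R (P j) X" by (simp add: comp)
  note [simp del] = Hom_coboundaries.simps
  have BZ: "?B \<subseteq> ?Z"
  proof
    fix f assume "f \<in> ?B"
    then obtain g where g: "lin R (P j) X g" "f = (\<lambda>x\<in>carrier (P ?i). g (d j x))" by (auto simp: Bdef module_hom_iff)
    have "lin R (P ?i) X f" unfolding g(2) lin_restrict[OF P] by (rule lin_comp[OF d g(1)])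
    moreover have "f (d ?i x) = \<zero>\<^bsub>X\<^esub>" if "x \<in> carrier (P (Suc ?i))" for x
      using that dc dd lin_zero[OF P X g(1)] by (simp add: g(2))
    ultimately show "f \<in> ?Z" by (simp add: Ziff module_hom_iff g(2))
  qed
  have Bsub: "submodule ?B R ?H"
  proof (rule H.submoduleI)
    show "?B \<subseteq> carrier ?H" using BZ by (auto simp: Ziff ops)
    have opsj: "\<zero>\<^bsub>Hom_module R (P j) X\<^esub> = (\<lambda>x\<in>carrier (P j). \<zero>\<^bsub>X\<^esub>)" "f \<oplus>\<^bsub>Hom_module R (P j) X\<^esub> g = (\<lambda>x\<in>carrier (P j). f x \<oplus>\<^bsub>X\<^esub> g x)"
      "a \<odot>\<^bsub>Hom_module R (P j) X\<^esub> f = (\<lambda>x\<in>carrier (P j). a \<odot>\<^bsub>X\<^esub> f x)" "carrier (Hom_module R (P j) X) = module_hom R (P j) X" for f g a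
      by (simp_all add: Hom_module_def)
    show "\<zero>\<^bsub>?H\<^esub> \<in> ?B"
    proof -
      have "\<zero>\<^bsub>?H\<^esub> = (\<lambda>x\<in>carrier (P ?i). \<zero>\<^bsub>Hom_module R (P j) X\<^esub> (d j x))" using djc by (auto simp: ops opsj)
      moreover have "\<zero>\<^bsub>Hom_module R (P j) X\<^esub> \<in> module_hom R (P j) X" using Hj.zero_closed by (simp only: opsj(4))
      ultimately show ?thesis unfolding Bdef by (rule image_eqI)
    qed
    show "f \<oplus>\<^bsub>?H\<^esub> g \<in> ?B" if fg: "f \<in> ?B" "g \<in> ?B" for f g
    proof -
      obtain f' g' where *: "f' \<in> module_hom R (P j) X" "g' \<in> module_hom R (P j) X"
        "f = (\<lambda>x\<in>carrier (P ?i). f' (d j x))" "g = (\<lambda>x\<in>carrier (P ?i). g' (d j x))" using fg unfolding Bdef by blast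
      have "f \<oplus>\<^bsub>?H\<^esub> g = (\<lambda>x\<in>carrier (P ?i). (f' \<oplus>\<^bsub>Hom_module R (P j) X\<^esub> g') (d j x))"
        using djc * by (auto simp: ops opsj)
      moreover have "f' \<oplus>\<^bsub>Hom_module R (P j) X\<^esub> g' \<in> module_hom R (P j) X" using Hj.a_closed[of f' g'] * by (simp only: opsj(4))
      ultimately show ?thesis unfolding Bdef by (rule image_eqI)
    qed
    show sm: "a \<odot>\<^bsub>?H\<^esub> f \<in> ?B" if af: "a \<in> carrier R" "f \<in> ?B" for a f
    proof -
      obtain f' where *: "f' \<in> module_hom R (P j) X" "f = (\<lambda>x\<in>carrier (P ?i). f' (d j x))" using af unfolding Bdef by blast
      have "a \<odot>\<^bsub>?H\<^esub> f = (\<lambda>x\<in>carrier (P ?i). (a \<odot>\<^bsub>Hom_module R (P j) X\<^esub> f') (d j x))"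
        using djc * by (auto simp: ops opsj)
      moreover have "a \<odot>\<^bsub>Hom_module R (P j) X\<^esub> f' \<in> module_hom R (P j) X" using Hj.smult_closed[of a f'] * af by (simp only: opsj(4))
      ultimately show ?thesis unfolding Bdef by (rule image_eqI)
    qed
    show "\<ominus>\<^bsub>?H\<^esub> f \<in> ?B" if f: "f \<in> ?B" for f
    proof -
      have fc: "f \<in> carrier ?H" using f BZ by (auto simp: Ziff ops)
      have "\<ominus>\<^bsub>?H\<^esub> f = (\<ominus>\<^bsub>R\<^esub> \<one>\<^bsub>R\<^esub>) \<odot>\<^bsub>?H\<^esub> f"
        using H.smult_l_minus[OF Pi.R.one_closed fc] fc by simp
      then show ?thesis using sm[OF _ f] by simp
    qed
  qed
  have Zmod: "module R (?H\<lparr>carrier := ?Z\<rparr>)" by (rule submodule.submodule_is_module[OF Zsub module_Hom[OF P X]])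
  have Bsub': "submodule ?B R (?H\<lparr>carrier := ?Z\<rparr>)"
    by (rule submodule_carrier_update[OF module_Hom[OF P X] Zsub Bsub BZ])
  have ann: "a \<odot>\<^bsub>?H\<^esub> f \<in> ?B \<longleftrightarrow> cobnd R P d X j (\<lambda>x. a \<odot>\<^bsub>X\<^esub> f x)" for a f
  proof
    assume "a \<odot>\<^bsub>?H\<^esub> f \<in> ?B"
    then obtain g where g: "lin R (P j) X g" "a \<odot>\<^bsub>?H\<^esub> f = (\<lambda>x\<in>carrier (P ?i). g (d j x))" by (auto simp: Bdef module_hom_iff)
    have "a \<odot>\<^bsub>X\<^esub> f x = g (d j x)" if "x \<in> carrier (P ?i)" for x
      using fun_cong[OF g(2), of x] that by (simp add: ops)
    then show "cobnd R P d X j (\<lambda>x. a \<odot>\<^bsub>X\<^esub> f x)" unfolding cobnd_def using g(1) by blast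
  next
    assume "cobnd R P d X j (\<lambda>x. a \<odot>\<^bsub>X\<^esub> f x)"
    then obtain g where g: "lin R (P j) X g" "\<And>x. x \<in> carrier (P ?i) \<Longrightarrow> a \<odot>\<^bsub>X\<^esub> f x = g (d j x)" by (auto simp: cobnd_def)
    have "restrict g (carrier (P j)) \<in> module_hom R (P j) X" using g(1) by (simp add: module_hom_iff lin_restrict[OF P])
    moreover have "a \<odot>\<^bsub>?H\<^esub> f = (\<lambda>x\<in>carrier (P ?i). restrict g (carrier (P j)) (d j x))"
      using g(2) djc by (auto simp: ops)
    ultimately show "a \<odot>\<^bsub>?H\<^esub> f \<in> ?B" unfolding Bdef by blast
  qed
  have "associated_primes R (Hom_cohomology R P d X ?i)
     = {p. primeideal p R \<and> (\<exists>f\<in>?Z. p = {a \<in> carrier R. cobnd R P d X j (\<lambda>x. a \<odot>\<^bsub>X\<^esub> f x)})}"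
    unfolding Hom_cohomology_def associated_primes_quot[OF Zmod Bsub'] by (simp add: ann)
  also have "\<dots> = {p. primeideal p R \<and> asc R P d X j p}"
  proof -
    have "(\<exists>f\<in>?Z. p = {a \<in> carrier R. cobnd R P d X j (\<lambda>x. a \<odot>\<^bsub>X\<^esub> f x)}) \<longleftrightarrow> asc R P d X j p" for p
    proof
      assume "\<exists>f\<in>?Z. p = {a \<in> carrier R. cobnd R P d X j (\<lambda>x. a \<odot>\<^bsub>X\<^esub> f x)}"
      then show "asc R P d X j p" by (auto simp: asc_def cocyc_def Ziff module_hom_iff)
    next
      assume "asc R P d X j p"
      then obtain f where f: "cocyc R P d X ?i f" "p = {a \<in> carrier R. cobnd R P d X j (\<lambda>x. a \<odot>\<^bsub>X\<^esub> f x)}" by (auto simp: asc_def)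
      let ?f = "restrict f (carrier (P ?i))"
      have "?f \<in> ?Z" using f(1) dc by (simp add: cocyc_def Ziff module_hom_iff lin_restrict[OF P])
      moreover have "cobnd R P d X j (\<lambda>x. a \<odot>\<^bsub>X\<^esub> ?f x) \<longleftrightarrow> cobnd R P d X j (\<lambda>x. a \<odot>\<^bsub>X\<^esub> f x)" for a
        by (simp add: cobnd_def)
      ultimately show "\<exists>f\<in>?Z. p = {a \<in> carrier R. cobnd R P d X j (\<lambda>x. a \<odot>\<^bsub>X\<^esub> f x)}" using f(2) by (intro bexI[of _ ?f]) (simp_all only:)
    qed
    then show ?thesis by simp
  qed
  finally show ?thesis .
qed

section \<open>Dual bases and the lifting property\<close>

lemma dualb_projective:
  assumes P: "module R (P :: ('a, 'p) module)" and du: "dualb R P B w h"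
  shows "projective_module R P"
  unfolding projective_module_def
proof (intro conjI allI impI)
  show "module R P" by fact
  fix E :: "('a, 'p \<Rightarrow> 'a) module" and F :: "('a, 'p) module" and g f
  assume *: "module R E \<and> module R F \<and> g \<in> module_hom R E F \<and> g ` carrier E = carrier F \<and> f \<in> module_hom R P F"
  then have f: "lin R P F f" "f \<in> extensional (carrier P)" and g: "lin R E F g" by (auto simp: module_hom_iff)
  have "f x \<in> g ` carrier E" if "x \<in> carrier P" for x using * linD(1)[OF f(1) that] by simp
  from dualb_lift[OF P _ _ du f(1) g this] * obtain k where k: "lin R P E k" "\<And>x. x \<in> carrier P \<Longrightarrow> g (k x) = f x" by blast
  have "restrict k (carrier P) \<in> module_hom R P E" using k(1) by (simp add: module_hom_iff lin_restrict[OF P])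
  moreover have "compose (carrier P) g (restrict k (carrier P)) = f"
    using f(2) k(2) by (auto simp: compose_def intro!: extensionalityI[of _ "carrier P"])
  ultimately show "\<exists>h\<in>module_hom R P E. compose (carrier P) g h = f" by blast
qed

lemma FR_unit:
  assumes R: "cring R" and "b \<in> B"
  shows "(\<lambda>c. if c = b then \<one>\<^bsub>R\<^esub> else \<zero>\<^bsub>R\<^esub>) \<in> carrier (FR R B)"
proof -
  interpret cring R by fact
  have "{c. (if c = b then \<one>\<^bsub>R\<^esub> else \<zero>\<^bsub>R\<^esub>) \<noteq> \<zero>\<^bsub>R\<^esub>} \<subseteq> {b}" by auto
  then show ?thesis using assms(2) by (auto simp: FR_simps intro: finite_subset)
qed

lemma evm_unit:
  assumes E: "module R E" and w: "w \<in> B \<rightarrow> carrier E" and b: "b \<in> B"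
  shows "evm R E B w (\<lambda>c. if c = b then \<one>\<^bsub>R\<^esub> else \<zero>\<^bsub>R\<^esub>) = w b"
proof -
  interpret module R E by fact
  have "evm R E B w (\<lambda>c. if c = b then \<one>\<^bsub>R\<^esub> else \<zero>\<^bsub>R\<^esub>) = (\<Oplus>\<^bsub>E\<^esub>c\<in>{b}. (if c = b then \<one>\<^bsub>R\<^esub> else \<zero>\<^bsub>R\<^esub>) \<odot>\<^bsub>E\<^esub> w c)"
    by (rule evm_eq[OF E w FR_unit[OF R.is_cring b]]) (use b in auto)
  then show ?thesis using w b by (auto simp: Pi_def)
qed

text \<open>The two types in the definition of \<open>projective_module\<close> are those of the
  free module on the carrier and of \<open>P\<close> itself, so the identity of \<open>P\<close>
  lifts along the canonical surjection.\<close>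

lemma projective_dualb:
  assumes "projective_module R (P :: ('a, 'p) module)"
  obtains h where "dualb R P (carrier P) (\<lambda>x. x) h"
proof -
  have P: "module R P" using assms by (simp add: projective_module_def)
  interpret module R P by fact
  let ?E = "FR R (carrier P)" and ?w = "\<lambda>x. x"
  have w: "?w \<in> carrier P \<rightarrow> carrier P" by simp
  have E: "module R ?E" by (rule module_FR[OF R.is_cring])
  let ?g = "restrict (evm R P (carrier P) ?w) (carrier ?E)"
  let ?f = "restrict (\<lambda>x. x) (carrier P)"
  have g: "?g \<in> module_hom R ?E P"
    using lin_evm[OF P w] by (simp add: module_hom_iff lin_restrict[OF E])
  moreover have "?g ` carrier ?E = carrier P"
  proof
    show "?g ` carrier ?E \<subseteq> carrier P" using g linD(1) by (fastforce simp: module_hom_iff)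
    show "carrier P \<subseteq> ?g ` carrier ?E"
    proof
      fix b assume b: "b \<in> carrier P"
      have "b = ?g (\<lambda>c. if c = b then \<one>\<^bsub>R\<^esub> else \<zero>\<^bsub>R\<^esub>)"
        using evm_unit[OF P w b] FR_unit[OF R.is_cring b] by simp
      then show "b \<in> ?g ` carrier ?E" using FR_unit[OF R.is_cring b] by blast
    qed
  qed
  moreover have "?f \<in> module_hom R P P" using lin_id by (simp add: module_hom_iff lin_restrict[OF P])
  ultimately obtain h where h: "h \<in> module_hom R P ?E" "compose (carrier P) ?g h = ?f"
    using assms P E unfolding projective_module_def by blast
  have "evm R P (carrier P) ?w (h x) = x" if "x \<in> carrier P" for x
    using fun_cong[OF h(2), of x] that linD(1)[of R P ?E h x] h(1) by (simp add: compose_def module_hom_iff)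
  then have "dualb R P (carrier P) ?w h" using h(1) by (simp add: dualb_def module_hom_iff)
  then show ?thesis by (rule that)
qed

lemma projective_resolution_resolution:
  assumes M: "module R M" and P: "projective_resolution R M P d e"
  shows "resolution R M P d e"
  unfolding resolution_def
proof (intro conjI allI)
  have "module R (P i)" for i using P by (auto simp: projective_resolution_def projective_module_def)
  then show "module R (P i)" for i .
qed (use M P in \<open>auto simp: projective_resolution_def module_hom_iff a_kernel_def'\<close>)

lemma resolution_projective_resolution:
  assumes P: "resolution R M P d e" and du: "\<And>i. dualb R (P i) (B i) (w i) (h i)"
  shows "projective_resolution R M P (\<lambda>i. restrict (d i) (carrier (P (Suc i)))) (restrict e (carrier (P 0)))"
proof -
  interpret resolution R M P d e by fact
  interpret P0: module R "P i" for i by (rule P)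
  have "d (Suc i) ` carrier (P (Suc (Suc i))) = {x \<in> carrier (P (Suc i)). restrict (d i) (carrier (P (Suc i))) x = \<zero>\<^bsub>P i\<^esub>}" for i
    unfolding ex by auto
  moreover have "d 0 ` carrier (P (Suc 0)) = {x \<in> carrier (P 0). restrict e (carrier (P 0)) x = \<zero>\<^bsub>M\<^esub>}"
    unfolding ex0 by auto
  ultimately show ?thesis
    unfolding projective_resolution_def a_kernel_def'
    using dualb_projective[OF P du] d e e_surj by (simp add: module_hom_iff lin_restrict[OF P])
qed

section \<open>Resolutions given by matrices over a covering ring\<close>

text \<open>A surjection from a type-class ring. Equality in \<open>R\<close> becomes a difference
  in \<open>ker\<close>, so the matrix algebra developed for type classes applies to rings with
  carriers.\<close>

locale ring_cover = cring R for R :: "('a, 'b) ring_scheme" (structure) +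
  fixes \<pi> :: "'t::comm_ring_1 \<Rightarrow> 'a"
  assumes pi_range: "range \<pi> = carrier R" and pi_add: "\<pi> (s + t) = \<pi> s \<oplus> \<pi> t"
    and pi_mult: "\<pi> (s * t) = \<pi> s \<otimes> \<pi> t" and pi_one: "\<pi> 1 = \<one>"
begin

lemma pi_in [simp]: "\<pi> t \<in> carrier R" using pi_range by blast

lemma pi_zero: "\<pi> 0 = \<zero>"
  using pi_add[of 0 0] add.l_cancel_one[of "\<pi> 0" "\<pi> 0"] by simp

lemma pi_minus: "\<pi> (- t) = \<ominus> \<pi> t"
  using pi_add[of "- t" t] minus_equality[of "\<pi> (- t)" "\<pi> t"] by (simp add: pi_zero)

lemma pi_diff: "\<pi> (s - t) = \<pi> s \<ominus> \<pi> t"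
  using pi_add[of s "- t"] by (simp add: pi_minus a_minus_def)

definition ker :: "'t set" where "ker = {t. \<pi> t = \<zero>}"

lemma pi_eq_iff: "\<pi> s = \<pi> t \<longleftrightarrow> s - t \<in> ker"
  using eq_if_minus_zero[of "\<pi> s" "\<pi> t"] by (auto simp: ker_def pi_diff a_minus_def r_neg)

lemma idl_ker: "idl ker"
  by (auto simp: idl_def subgrp_def ker_def pi_zero pi_diff pi_mult a_minus_def minus_zero_eq)

definition lft :: "'a \<Rightarrow> 't" where "lft a = (SOME t. \<pi> t = a)"

lemma pi_lft: "a \<in> carrier R \<Longrightarrow> \<pi> (lft a) = a"
  unfolding lft_def by (rule someI_ex) (use pi_range in \<open>metis imageE\<close>)

definition vec :: "nat set \<Rightarrow> (nat \<Rightarrow> 't) \<Rightarrow> nat \<Rightarrow> 'a" where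
  "vec \<beta> u = (\<lambda>b. if b \<in> \<beta> then \<pi> (u b) else \<zero>)"

abbreviation "unit k \<equiv> (\<lambda>c::nat. if c = k then \<one> else \<zero>)"

lemma vec_in: "finite \<beta> \<Longrightarrow> vec \<beta> u \<in> carrier (FR R \<beta>)"
  by (auto simp: FR_simps vec_def intro: finite_subset[of _ \<beta>])

lemma vec_eq_iff: "vec \<beta> u = vec \<beta> u' \<longleftrightarrow> (\<forall>b\<in>\<beta>. u b - u' b \<in> ker)"
  by (auto simp: vec_def fun_eq_iff pi_eq_iff)

lemma vec_zero_iff: "vec \<beta> u = \<zero>\<^bsub>FR R \<beta>\<^esub> \<longleftrightarrow> (\<forall>b\<in>\<beta>. u b \<in> ker)"
  by (auto simp: vec_def fun_eq_iff FR_simps ker_def)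

lemma vec_add: "vec \<beta> u \<oplus>\<^bsub>FR R \<beta>\<^esub> vec \<beta> u' = vec \<beta> (\<lambda>b. u b + u' b)"
  and vec_smult: "\<pi> t \<odot>\<^bsub>FR R \<beta>\<^esub> vec \<beta> u = vec \<beta> (\<lambda>b. t * u b)"
  by (auto simp: vec_def FR_simps pi_add pi_mult fun_eq_iff)

lemma vec_lft: "v \<in> carrier (FR R \<beta>) \<Longrightarrow> vec \<beta> (\<lambda>b. lft (v b)) = v"
  by (auto simp: vec_def FR_simps fun_eq_iff pi_lft)

lemma vec_cases: "v \<in> carrier (FR R \<beta>) \<Longrightarrow> (\<And>u. v = vec \<beta> u \<Longrightarrow> thesis) \<Longrightarrow> thesis"
  using vec_lft by metis

lemma unit_vec: "k \<in> \<beta> \<Longrightarrow> unit k = vec \<beta> (\<lambda>c. if c = k then 1 else 0)"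
  by (auto simp: vec_def fun_eq_iff pi_zero pi_one)

lemma vec_sum:
  assumes "finite \<beta>"
  shows "(\<Oplus>\<^bsub>FR R \<beta>\<^esub>k\<in>A. vec \<beta> (x k)) = vec \<beta> (\<lambda>b. \<Sum>k\<in>A. x k b)"
proof -
  interpret F: module R "FR R \<beta>" by (rule module_FR[OF is_cring])
  have z: "vec \<beta> (\<lambda>b. 0) = \<zero>\<^bsub>FR R \<beta>\<^esub>" by (auto simp: vec_def FR_simps pi_zero)
  show ?thesis
    by (induction A rule: infinite_finite_induct) (simp_all add: z vec_add vec_in assms)
qed

lemma lin_FR_I:
  assumes "\<And>u. f (vec \<beta> u) \<in> carrier E" "\<And>u u'. f (vec \<beta> (\<lambda>b. u b + u' b)) = f (vec \<beta> u) \<oplus>\<^bsub>E\<^esub> f (vec \<beta> u')"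
    "\<And>t u. f (vec \<beta> (\<lambda>b. t * u b)) = \<pi> t \<odot>\<^bsub>E\<^esub> f (vec \<beta> u)"
  shows "lin R (FR R \<beta>) E f"
proof (rule linI)
  fix x y assume "x \<in> carrier (FR R \<beta>)" "y \<in> carrier (FR R \<beta>)"
  then show "f (x \<oplus>\<^bsub>FR R \<beta>\<^esub> y) = f x \<oplus>\<^bsub>E\<^esub> f y"
    by (elim vec_cases) (simp add: vec_add assms)
next
  fix a x assume "a \<in> carrier R" "x \<in> carrier (FR R \<beta>)"
  then show "f (a \<odot>\<^bsub>FR R \<beta>\<^esub> x) = a \<odot>\<^bsub>E\<^esub> f x"
    by (elim vec_cases) (metis pi_range imageE vec_smult assms(3))
qed (use assms(1) in \<open>auto elim: vec_cases\<close>)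

lemma evm_vec:
  assumes "module R E" "w \<in> \<beta> \<rightarrow> carrier E" "finite \<beta>"
  shows "evm R E \<beta> w (vec \<beta> u) = (\<Oplus>\<^bsub>E\<^esub>b\<in>\<beta>. \<pi> (u b) \<odot>\<^bsub>E\<^esub> w b)"
proof -
  interpret E: module R E by fact
  have "evm R E \<beta> w (vec \<beta> u) = (\<Oplus>\<^bsub>E\<^esub>b\<in>\<beta>. vec \<beta> u b \<odot>\<^bsub>E\<^esub> w b)"
    by (rule evm_eq[OF assms(1,2) vec_in]) (use assms in auto)
  also have "\<dots> = (\<Oplus>\<^bsub>E\<^esub>b\<in>\<beta>. \<pi> (u b) \<odot>\<^bsub>E\<^esub> w b)"
    by (rule E.M.finsum_cong') (use assms in \<open>auto simp: vec_def\<close>)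
  finally show ?thesis .
qed

lemma unit_in: "unit \<in> \<beta> \<rightarrow> carrier (FR R \<beta>)"
  by (rule Pi_I) (rule FR_unit[OF is_cring])

lemma evm_unit_vec:
  assumes "finite \<beta>"
  shows "evm R (FR R \<beta>) \<beta> unit (vec \<beta> u) = vec \<beta> u"
proof -
  interpret F: module R "FR R \<beta>" by (rule module_FR[OF is_cring])
  have "evm R (FR R \<beta>) \<beta> unit (vec \<beta> u) = (\<Oplus>\<^bsub>FR R \<beta>\<^esub>k\<in>\<beta>. \<pi> (u k) \<odot>\<^bsub>FR R \<beta>\<^esub> unit k)"
    by (rule evm_vec[OF F.module_axioms unit_in assms])
  also have "\<dots> = (\<Oplus>\<^bsub>FR R \<beta>\<^esub>k\<in>\<beta>. vec \<beta> (\<lambda>b. u k * (if b = k then 1 else 0)))"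
    by (rule F.M.finsum_cong') (auto simp: unit_vec vec_smult vec_in[OF assms])
  also have "\<dots> = vec \<beta> (\<lambda>b. \<Sum>k\<in>\<beta>. u k * (if b = k then 1 else 0))" by (rule vec_sum[OF assms])
  also have "\<dots> = vec \<beta> u" using assms by (simp add: vec_eq_iff idl_ker[THEN idlD(1), THEN subgrp_0] if_distrib[of "\<lambda>x. _ * x"] cong: if_cong)
  finally show ?thesis .
qed

lemma dualb_FR: "finite \<beta> \<Longrightarrow> dualb R (FR R \<beta>) \<beta> unit (\<lambda>x. x)"
  unfolding dualb_def by (intro conjI ballI unit_in lin_id) (auto elim!: vec_cases simp: evm_unit_vec)

lemma lin_FR_eval:
  assumes E: "module R E" and f: "lin R (FR R \<beta>) E f" and \<beta>: "finite \<beta>"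
  shows "f (vec \<beta> u) = (\<Oplus>\<^bsub>E\<^esub>k\<in>\<beta>. \<pi> (u k) \<odot>\<^bsub>E\<^esub> f (unit k))"
proof -
  have "f (vec \<beta> u) = f (evm R (FR R \<beta>) \<beta> unit (vec \<beta> u))" by (simp add: evm_unit_vec[OF \<beta>])
  also have "\<dots> = evm R E \<beta> (\<lambda>k. f (unit k)) (vec \<beta> u)"
    by (rule evm_map[OF module_FR[OF is_cring] E unit_in f vec_in[OF \<beta>]])
  also have "\<dots> = (\<Oplus>\<^bsub>E\<^esub>k\<in>\<beta>. \<pi> (u k) \<odot>\<^bsub>E\<^esub> f (unit k))"
    using unit_in linD(1)[OF f] by (intro evm_vec[OF E _ \<beta>]) auto
  finally show ?thesis .
qed

text \<open>The choice in \<open>lft\<close> is harmless: two lifts differ by an element of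
  \<open>ker\<close>, see \<open>mapm_vec\<close>.\<close>

definition mapm :: "nat set \<Rightarrow> nat set \<Rightarrow> (nat \<Rightarrow> nat \<Rightarrow> 't) \<Rightarrow> (nat \<Rightarrow> 'a) \<Rightarrow> nat \<Rightarrow> 'a" where
  "mapm \<gamma> \<beta> m v = vec \<gamma> (\<lambda>b. \<Sum>k\<in>\<beta>. m b k * lft (v k))"

lemma sum_ker: "(\<And>k. k \<in> A \<Longrightarrow> u k \<in> ker) \<Longrightarrow> (\<Sum>k\<in>A. u k) \<in> ker"
  using subgrp_sum[OF idlD(1)[OF idl_ker]] by blast

lemma mapm_vec: "mapm \<gamma> \<beta> m (vec \<beta> u) = vec \<gamma> (\<lambda>b. \<Sum>k\<in>\<beta>. m b k * u k)"
proof -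
  have "lft (vec \<beta> u k) - u k \<in> ker" if "k \<in> \<beta>" for k
    using that by (simp add: pi_eq_iff[symmetric] pi_lft vec_def)
  then show ?thesis unfolding mapm_def vec_eq_iff
    by (auto simp: sum_subtractf[symmetric] right_diff_distrib[symmetric] intro!: sum_ker idlD(2)[OF idl_ker])
qed

lemma lin_mapm:
  assumes "finite \<gamma>"
  shows "lin R (FR R \<beta>) (FR R \<gamma>) (mapm \<gamma> \<beta> m)"
  by (rule lin_FR_I)
     (simp_all add: mapm_vec vec_in assms vec_add vec_smult distrib_left sum.distrib sum_distrib_left mult.left_commute)

lemma lin_matrix:
  assumes f: "lin R (FR R \<beta>) (FR R \<gamma>) f" and \<beta>: "finite \<beta>" and \<gamma>: "finite \<gamma>"
  obtains m where "\<And>u. f (vec \<beta> u) = vec \<gamma> (\<lambda>b. \<Sum>k\<in>\<beta>. m b k * u k)"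
proof -
  interpret F: module R "FR R \<gamma>" by (rule module_FR[OF is_cring])
  define m where "m b k = lft (f (unit k) b)" for b k
  have m: "f (unit k) = vec \<gamma> (\<lambda>b. m b k)" if "k \<in> \<beta>" for k
    unfolding m_def using vec_lft[OF linD(1)[OF f]] unit_in that by (simp add: Pi_iff)
  have "f (vec \<beta> u) = vec \<gamma> (\<lambda>b. \<Sum>k\<in>\<beta>. m b k * u k)" for u
  proof -
    have "f (vec \<beta> u) = (\<Oplus>\<^bsub>FR R \<gamma>\<^esub>k\<in>\<beta>. \<pi> (u k) \<odot>\<^bsub>FR R \<gamma>\<^esub> f (unit k))"
      by (rule lin_FR_eval[OF F.module_axioms f \<beta>])
    also have "\<dots> = (\<Oplus>\<^bsub>FR R \<gamma>\<^esub>k\<in>\<beta>. vec \<gamma> (\<lambda>b. u k * m b k))"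
      by (rule F.M.finsum_cong') (auto simp: m vec_smult vec_in[OF \<gamma>])
    also have "\<dots> = vec \<gamma> (\<lambda>b. \<Sum>k\<in>\<beta>. u k * m b k)" by (rule vec_sum[OF \<gamma>])
    finally show ?thesis by (simp add: mult.commute)
  qed
  then show ?thesis by (rule that)
qed

definition Fs :: "(int \<Rightarrow> nat set) \<Rightarrow> nat \<Rightarrow> ('a, nat \<Rightarrow> 'a) module" where
  "Fs \<beta> i = FR R (\<beta> (int i))"

definition ds :: "(int \<Rightarrow> nat set) \<Rightarrow> (int \<Rightarrow> nat \<Rightarrow> nat \<Rightarrow> 't) \<Rightarrow> nat \<Rightarrow> (nat \<Rightarrow> 'a) \<Rightarrow> nat \<Rightarrow> 'a" where
  "ds \<beta> D i = mapm (\<beta> (int i)) (\<beta> (int i + 1)) (D (int i))"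

lemma int_Suc': "int (Suc i) = int i + 1" by simp

lemma ds_vec: "ds \<beta> D i (vec (\<beta> (int i + 1)) u) = vec (\<beta> (int i)) (\<lambda>b. \<Sum>k\<in>\<beta> (int i + 1). D (int i) b k * u k)"
  by (simp add: ds_def mapm_vec)

text \<open>The maps \<open>\<rho>\<close> and \<open>\<rho>'\<close> translate between the original
  generators of the module and their numbers in \<open>\<beta> 0\<close>, which every cone
  changes.\<close>

lemma matrix_resolution:
  assumes fin: "\<And>i. finite (\<beta> i)" and M: "module R M" and g: "g \<in> \<beta> 0 \<rightarrow> carrier M"
    and span: "\<And>x. x \<in> carrier M \<Longrightarrow> \<exists>u. x = evm R M (\<beta> 0) g (vec (\<beta> 0) u)"
    and DD: "\<And>i b k. b \<in> \<beta> i \<Longrightarrow> k \<in> \<beta> (i + 2) \<Longrightarrow> mm (\<beta> (i + 1)) (D i) (D (i + 1)) b k \<in> ker"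
    and ex: "exact ker {v. evm R M (\<beta> 0) g (vec (\<beta> 0) (\<lambda>b. v (\<rho>' b))) = \<zero>\<^bsub>M\<^esub>} \<beta> D \<rho>"
    and inv: "\<And>b. b \<in> \<beta> 0 \<Longrightarrow> \<rho> (\<rho>' b) = b"
  shows "resolution R M (Fs \<beta>) (ds \<beta> D) (evm R M (\<beta> 0) g)"
proof (rule resolution.intro)
  note z = subgrp_0[OF idlD(1)[OF idl_ker]]
  show "module R M" by fact
  show "module R (Fs \<beta> i)" for i unfolding Fs_def by (rule module_FR[OF is_cring])
  show "lin R (Fs \<beta> (Suc i)) (Fs \<beta> i) (ds \<beta> D i)" for i
    unfolding Fs_def ds_def int_Suc' by (rule lin_mapm[OF fin])
  show l: "lin R (Fs \<beta> 0) M (evm R M (\<beta> 0) g)" using lin_evm[OF M g] by (simp add: Fs_def)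
  show "evm R M (\<beta> 0) g ` carrier (Fs \<beta> 0) = carrier M"
  proof
    show "evm R M (\<beta> 0) g ` carrier (Fs \<beta> 0) \<subseteq> carrier M" using linD(1)[OF l] by blast
    show "carrier M \<subseteq> evm R M (\<beta> 0) g ` carrier (Fs \<beta> 0)"
      using span vec_in[OF fin] by (fastforce simp: Fs_def)
  qed
  have aug: "evm R M (\<beta> 0) g (vec (\<beta> 0) v) = \<zero>\<^bsub>M\<^esub> \<longleftrightarrow> (\<exists>w. \<forall>k\<in>\<beta> 0. v k - (\<Sum>l\<in>\<beta> 1. D 0 k l * w l) \<in> ker)" for v
  proof -
    have "vec (\<beta> 0) (\<lambda>b. v (\<rho> (\<rho>' b))) = vec (\<beta> 0) v" by (auto simp: vec_def inv)
    then show ?thesis using ex[unfolded exact_def mem_Collect_eq, THEN conjunct2, THEN spec, of v] by simp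
  qed
  show "ds \<beta> D 0 ` carrier (Fs \<beta> (Suc 0)) = {x \<in> carrier (Fs \<beta> 0). evm R M (\<beta> 0) g x = \<zero>\<^bsub>M\<^esub>}"
  proof (intro equalityI subsetI)
    fix x assume "x \<in> ds \<beta> D 0 ` carrier (Fs \<beta> (Suc 0))"
    then obtain w where x: "x = vec (\<beta> 0) (\<lambda>b. \<Sum>k\<in>\<beta> 1. D 0 b k * w k)"
      using ds_vec[of \<beta> D 0] by (auto simp: Fs_def elim!: vec_cases)
    then show "x \<in> {x \<in> carrier (Fs \<beta> 0). evm R M (\<beta> 0) g x = \<zero>\<^bsub>M\<^esub>}"
      using z vec_in[OF fin, of 0] by (auto simp: Fs_def aug intro!: exI[of _ w])
  next
    fix x assume "x \<in> {x \<in> carrier (Fs \<beta> 0). evm R M (\<beta> 0) g x = \<zero>\<^bsub>M\<^esub>}"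
    then obtain v where v: "x = vec (\<beta> 0) v" "evm R M (\<beta> 0) g (vec (\<beta> 0) v) = \<zero>\<^bsub>M\<^esub>"
      by (auto simp: Fs_def elim!: vec_cases)
    from v(2) obtain w where "\<forall>k\<in>\<beta> 0. v k - (\<Sum>l\<in>\<beta> 1. D 0 k l * w l) \<in> ker" unfolding aug by blast
    then have "x = ds \<beta> D 0 (vec (\<beta> 1) w)" using ds_vec[of \<beta> D 0] v(1) by (simp add: vec_eq_iff)
    then show "x \<in> ds \<beta> D 0 ` carrier (Fs \<beta> (Suc 0))" using vec_in[OF fin, of 1] by (simp add: Fs_def)
  qed
  show "ds \<beta> D (Suc i) ` carrier (Fs \<beta> (Suc (Suc i))) = {x \<in> carrier (Fs \<beta> (Suc i)). ds \<beta> D i x = \<zero>\<^bsub>Fs \<beta> i\<^esub>}" for i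
  proof -
    define j where "j = int i"
    have F: "Fs \<beta> i = FR R (\<beta> j)" "Fs \<beta> (Suc i) = FR R (\<beta> (j + 1))" "Fs \<beta> (Suc (Suc i)) = FR R (\<beta> (j + 2))"
      by (simp_all add: Fs_def j_def add.commute)
    have d: "ds \<beta> D i (vec (\<beta> (j + 1)) u) = vec (\<beta> j) (\<lambda>b. \<Sum>k\<in>\<beta> (j + 1). D j b k * u k)"
      "ds \<beta> D (Suc i) (vec (\<beta> (j + 2)) u) = vec (\<beta> (j + 1)) (\<lambda>b. \<Sum>k\<in>\<beta> (j + 2). D (j + 1) b k * u k)" for u
      using ds_vec[of \<beta> D i u] ds_vec[of \<beta> D "Suc i" u] by (simp_all add: j_def add.commute)
    show ?thesis unfolding F
    proof (intro equalityI subsetI)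
      fix x assume "x \<in> ds \<beta> D (Suc i) ` carrier (FR R (\<beta> (j + 2)))"
      then obtain w where x: "x = vec (\<beta> (j + 1)) (\<lambda>b. \<Sum>k\<in>\<beta> (j + 2). D (j + 1) b k * w k)"
        by (auto simp: d elim!: vec_cases)
      have "(\<Sum>l\<in>\<beta> (j + 2). mm (\<beta> (j + 1)) (D j) (D (j + 1)) b l * w l) \<in> ker" if "b \<in> \<beta> j" for b
        using that DD by (intro sum_ker idlD(3)[OF idl_ker])
      moreover have "(\<Sum>l\<in>\<beta> (j + 2). mm (\<beta> (j + 1)) (D j) (D (j + 1)) b l * w l)
        = (\<Sum>k\<in>\<beta> (j + 1). D j b k * (\<Sum>l\<in>\<beta> (j + 2). D (j + 1) k l * w l))" for b
        unfolding mm_def sum_distrib_left sum_distrib_right mult.assoc by (rule sum.swap)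
      ultimately show "x \<in> {x \<in> carrier (FR R (\<beta> (j + 1))). ds \<beta> D i x = \<zero>\<^bsub>FR R (\<beta> j)\<^esub>}"
        unfolding x using vec_in[OF fin] by (simp add: d vec_zero_iff)
    next
      fix x assume "x \<in> {x \<in> carrier (FR R (\<beta> (j + 1))). ds \<beta> D i x = \<zero>\<^bsub>FR R (\<beta> j)\<^esub>}"
      then obtain v where v: "x = vec (\<beta> (j + 1)) v" "\<forall>b\<in>\<beta> j. (\<Sum>k\<in>\<beta> (j + 1). D j b k * v k) \<in> ker"
        by (auto simp: d vec_zero_iff elim!: vec_cases)
      have "\<exists>w. \<forall>k\<in>\<beta> (j + 1). v k - (\<Sum>l\<in>\<beta> (j + 1 + 1). D (j + 1) k l * w l) \<in> ker"
        using ex[unfolded exact_def, THEN conjunct1, rule_format, of "j + 1" v] v(2) by (simp add: j_def)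
      then obtain w where "\<forall>k\<in>\<beta> (j + 1). v k - (\<Sum>l\<in>\<beta> (j + 2). D (j + 1) k l * w l) \<in> ker" by (auto simp: add.assoc)
      then have "x = ds \<beta> D (Suc i) (vec (\<beta> (j + 2)) w)" by (simp add: v(1) d vec_eq_iff)
      then show "x \<in> ds \<beta> D (Suc i) ` carrier (FR R (\<beta> (j + 2)))" using vec_in[OF fin] by blast
    qed
  qed
qed

text \<open>The identity of the matrix resolution is homotopic to a map through \<open>P\<close>,
  which is zero beyond \<open>n\<close>; there the homotopy is a contraction. On free modules of
  finite rank it is given by matrices.\<close>

lemma matrix_contraction:
  assumes fin: "\<And>i. finite (\<beta> i)" and F: "resolution R M (Fs \<beta>) (ds \<beta> D) e"
    and P: "resolution R M P d' e'" and du: "\<And>i. dualb R (P i) (B i) (w i) (h i)"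
    and van: "\<And>i. i > n \<Longrightarrow> carrier (P i) = {\<zero>\<^bsub>P i\<^esub>}" and i: "i > int n"
  obtains s s' where "\<And>b k. b \<in> \<beta> i \<Longrightarrow> k \<in> \<beta> i \<Longrightarrow>
    (if b = k then 1 else 0) - mm (\<beta> (i + 1)) (D i) s b k - mm (\<beta> (i - 1)) s' (D (i - 1)) b k \<in> ker"
proof -
  interpret F: resolution R M "Fs \<beta>" "ds \<beta> D" e by fact
  interpret P: resolution R M P d' e' by fact
  have duF: "dualb R (Fs \<beta> i) (\<beta> (int i)) unit (\<lambda>x. x)" for i unfolding Fs_def by (rule dualb_FR[OF fin])
  obtain \<alpha> where \<alpha>: "\<And>i. lin R (Fs \<beta> i) (P i) (\<alpha> i)" "\<And>x. x \<in> carrier (Fs \<beta> 0) \<Longrightarrow> e' (\<alpha> 0 x) = e x"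
    "\<And>i x. x \<in> carrier (Fs \<beta> (Suc i)) \<Longrightarrow> d' i (\<alpha> (Suc i) x) = \<alpha> i (ds \<beta> D i x)"
    by (rule chain_map_exists[OF F P duF]) blast
  obtain \<gamma> where \<gamma>: "\<And>i. lin R (P i) (Fs \<beta> i) (\<gamma> i)" "\<And>x. x \<in> carrier (P 0) \<Longrightarrow> e (\<gamma> 0 x) = e' x"
    "\<And>i x. x \<in> carrier (P (Suc i)) \<Longrightarrow> ds \<beta> D i (\<gamma> (Suc i) x) = \<gamma> i (d' i x)"
    by (rule chain_map_exists[OF P F du]) blast
  obtain s where s: "\<And>i. lin R (Fs \<beta> i) (Fs \<beta> (Suc i)) (s i)"
    "\<And>i x. x \<in> carrier (Fs \<beta> (Suc i)) \<Longrightarrow> ds \<beta> D (Suc i) (s (Suc i) x)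
       = x \<ominus>\<^bsub>Fs \<beta> (Suc i)\<^esub> \<gamma> (Suc i) (\<alpha> (Suc i) x) \<ominus>\<^bsub>Fs \<beta> (Suc i)\<^esub> s i (ds \<beta> D i x)"
    by (rule homotopy_exists[OF F duF lin_comp[OF \<alpha>(1) \<gamma>(1)]])
       (auto simp: \<alpha> \<gamma> linD(1)[OF \<alpha>(1)] F.d_in)
  define j where "j = nat (i - 1)"
  have j: "i = int j + 1" "Suc j > n" using i by (auto simp: j_def)
  have Fj: "Fs \<beta> j = FR R (\<beta> (i - 1))" "Fs \<beta> (Suc j) = FR R (\<beta> i)" "Fs \<beta> (Suc (Suc j)) = FR R (\<beta> (i + 1))"
    by (simp_all add: Fs_def j add.commute)
  have d: "ds \<beta> D j (vec (\<beta> i) u) = vec (\<beta> (i - 1)) (\<lambda>b. \<Sum>k\<in>\<beta> i. D (i - 1) b k * u k)"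
    "ds \<beta> D (Suc j) (vec (\<beta> (i + 1)) u) = vec (\<beta> i) (\<lambda>b. \<Sum>k\<in>\<beta> (i + 1). D i b k * u k)" for u
    using ds_vec[of \<beta> D j u] ds_vec[of \<beta> D "Suc j" u] by (simp_all add: j add.commute)
  obtain m where m: "\<And>u. s (Suc j) (vec (\<beta> i) u) = vec (\<beta> (i + 1)) (\<lambda>b. \<Sum>k\<in>\<beta> i. m b k * u k)"
    by (rule lin_matrix[OF s(1)[of "Suc j", unfolded Fj] fin fin]) blast
  obtain m' where m': "\<And>u. s j (vec (\<beta> (i - 1)) u) = vec (\<beta> i) (\<lambda>b. \<Sum>k\<in>\<beta> (i - 1). m' b k * u k)"
    by (rule lin_matrix[OF s(1)[of j, unfolded Fj] fin fin]) blast
  interpret FR: module R "FR R (\<beta> i)" by (rule module_FR[OF is_cring])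
  show thesis
  proof (rule that[of m m'])
    fix b k assume b: "b \<in> \<beta> i" and k: "k \<in> \<beta> i"
    let ?u = "\<lambda>c. if c = k then 1 else 0 :: 't" and ?x = "vec (\<beta> i) (\<lambda>c. if c = k then 1 else 0)"
    have x: "?x \<in> carrier (Fs \<beta> (Suc j))" unfolding Fj by (rule vec_in[OF fin])
    have s1: "(\<Sum>c\<in>\<beta> i. q c * ?u c) = q k" for q :: "nat \<Rightarrow> 't"
      using k fin by (simp add: if_distrib[of "\<lambda>x. _ * x"] cong: if_cong)
    have "\<alpha> (Suc j) ?x = \<zero>\<^bsub>P (Suc j)\<^esub>" using linD(1)[OF \<alpha>(1) x] van[OF j(2)] by simp
    then have g: "\<gamma> (Suc j) (\<alpha> (Suc j) ?x) = \<zero>\<^bsub>FR R (\<beta> i)\<^esub>" using lin_zero[OF P.P F.P \<gamma>(1)] Fj(2) by metis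
    have "vec (\<beta> i) (\<lambda>b. mm (\<beta> (i + 1)) (D i) m b k) = ?x \<ominus>\<^bsub>FR R (\<beta> i)\<^esub> vec (\<beta> i) (\<lambda>b. mm (\<beta> (i - 1)) m' (D (i - 1)) b k)"
      using s(2)[OF x] x unfolding g Fj m d m' s1 mm_def
      by (simp add: a_minus_def FR.M.minus_zero_eq)
    then have "vec (\<beta> i) (\<lambda>b. mm (\<beta> (i + 1)) (D i) m b k + mm (\<beta> (i - 1)) m' (D (i - 1)) b k) = ?x"
      using vec_in[OF fin, of i] by (simp add: vec_add[symmetric] a_minus_def FR.M.a_assoc FR.M.l_neg)
    then show "(if b = k then 1 else 0) - mm (\<beta> (i + 1)) (D i) m b k - mm (\<beta> (i - 1)) m' (D (i - 1)) b k \<in> ker"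
      using b by (simp add: eq_commute[of _ ?x] vec_eq_iff diff_diff_eq)
  qed
qed

lemma prime_id_pi:
  assumes "primeideal p R"
  shows "prime_id {t. \<pi> t \<in> p}"
proof -
  interpret p: primeideal p R by fact
  have "\<pi> 1 \<notin> p" using p.I_notcarr p.one_imp_carrier by (auto simp: pi_one)
  then show ?thesis
    by (auto simp: prime_id_def subgrp_def pi_zero pi_diff pi_mult a_minus_def p.I_l_closed dest: p.I_prime[OF pi_in pi_in])
qed

end

text \<open>A module with carrier as a semilinear image of a type-class module; submodules become
  their preimages, which contain the kernel \<open>kq\<close>.\<close>

locale module_cover = ring_cover R \<pi> + scal sc + X: module R X
  for R :: "('a, 'b) ring_scheme" (structure) and \<pi> :: "'t::comm_ring_1 \<Rightarrow> 'a"
    and sc :: "'t \<Rightarrow> 'p::ab_group_add \<Rightarrow> 'p" (infixr "\<bullet>" 75) and X :: "('a, 'x, 'c) module_scheme" +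
  fixes q :: "'p \<Rightarrow> 'x"
  assumes q_range: "range q = carrier X" and q_add: "q (x + y) = q x \<oplus>\<^bsub>X\<^esub> q y" and q_sc: "q (t \<bullet> x) = \<pi> t \<odot>\<^bsub>X\<^esub> q x"
begin

interpretation V: scal vsc by (rule scal_vsc)

lemma q_in [simp]: "q x \<in> carrier X" using q_range by blast

lemma q_zero: "q 0 = \<zero>\<^bsub>X\<^esub>"
  using q_sc[of 0 0] X.smult_l_null[of "q 0"] by (simp add: pi_zero)

lemma q_diff: "q (x - y) = q x \<ominus>\<^bsub>X\<^esub> q y"
  using q_add[of x "(- 1) \<bullet> y"] q_sc[of "- 1" y] X.smult_l_minus[of \<one> "q y"] by (simp add: pi_minus pi_one a_minus_def sc_minus')

lemma q_sum: "q (\<Sum>k\<in>A. u k) = (\<Oplus>\<^bsub>X\<^esub>k\<in>A. q (u k))"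
  by (induction A rule: infinite_finite_induct) (simp_all add: q_zero q_add)

definition kq :: "'p set" where "kq = {x. q x = \<zero>\<^bsub>X\<^esub>}"

lemma subm_kq: "subm kq"
  by (auto simp: subm_def subgrp_def kq_def q_zero q_diff q_sc a_minus_def X.M.minus_zero_eq)

lemma q_eq_iff: "q x = q y \<longleftrightarrow> x - y \<in> kq"
  using X.M.eq_if_minus_zero[of "q x" "q y"] by (auto simp: kq_def q_diff a_minus_def X.M.r_neg)

text \<open>The homomorphism on the free module with value \<open>q (x b)\<close> on the basis
  element \<open>b\<close>; this is how a tuple becomes a cochain.\<close>

definition \<Phi> :: "nat set \<Rightarrow> (nat \<Rightarrow> 'p) \<Rightarrow> (nat \<Rightarrow> 'a) \<Rightarrow> 'x" where
  "\<Phi> \<beta> x v = q (\<Sum>b\<in>\<beta>. lft (v b) \<bullet> x b)"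

lemma \<Phi>_vec: "\<Phi> \<beta> x (vec \<beta> u) = q (\<Sum>b\<in>\<beta>. u b \<bullet> x b)"
proof -
  have "lft (vec \<beta> u b) - u b \<in> ker" if "b \<in> \<beta>" for b
    using that by (simp add: pi_eq_iff[symmetric] pi_lft vec_def)
  then have "(lft (vec \<beta> u b) - u b) \<bullet> x b \<in> kq" if "b \<in> \<beta>" for b
    using that by (auto simp: ker_def kq_def q_sc)
  then show ?thesis unfolding \<Phi>_def q_eq_iff
    by (simp add: sum_subtractf[symmetric] sc_diff'[symmetric] subgrp_sum[OF submD(1)[OF subm_kq]])
qed

lemma lin_\<Phi>: "lin R (FR R \<beta>) X (\<Phi> \<beta> x)"
  by (rule lin_FR_I)
     (simp_all add: \<Phi>_vec sc_plus sum.distrib q_add sc_mult sc_sum[symmetric] q_sc)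

lemma lin_\<Phi>_cases:
  assumes \<phi>: "lin R (FR R \<beta>) X \<phi>" and \<beta>: "finite \<beta>"
  obtains x where "\<And>v. v \<in> carrier (FR R \<beta>) \<Longrightarrow> \<phi> v = \<Phi> \<beta> x v"
proof -
  define x where "x k = (SOME y. q y = \<phi> (unit k))" for k
  have x: "q (x k) = \<phi> (unit k)" if k: "k \<in> \<beta>" for k
  proof -
    have "\<phi> (unit k) \<in> range q" unfolding q_range
      by (rule linD(1)[OF \<phi>]) (use unit_in k in blast)
    then have "\<exists>y. q y = \<phi> (unit k)" by auto
    then show ?thesis unfolding x_def by (rule someI_ex)
  qed
  have "\<phi> (vec \<beta> u) = \<Phi> \<beta> x (vec \<beta> u)" for u
  proof -
    have "\<phi> (vec \<beta> u) = (\<Oplus>\<^bsub>X\<^esub>k\<in>\<beta>. \<pi> (u k) \<odot>\<^bsub>X\<^esub> \<phi> (unit k))"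
      by (rule lin_FR_eval[OF X.module_axioms \<phi> \<beta>])
    also have "\<dots> = (\<Oplus>\<^bsub>X\<^esub>k\<in>\<beta>. q (u k \<bullet> x k))"
      by (rule X.M.finsum_cong') (auto simp: q_sc x[symmetric])
    finally show ?thesis by (simp add: \<Phi>_vec q_sum)
  qed
  then show ?thesis using that[of x] by (metis vec_cases)
qed

lemma \<Phi>_zero_iff:
  assumes \<beta>: "finite \<beta>"
  shows "(\<forall>v\<in>carrier (FR R \<beta>). \<Phi> \<beta> x v = \<zero>\<^bsub>X\<^esub>) \<longleftrightarrow> x \<in> Cb \<beta> kq"
proof
  assume *: "\<forall>v\<in>carrier (FR R \<beta>). \<Phi> \<beta> x v = \<zero>\<^bsub>X\<^esub>"
  show "x \<in> Cb \<beta> kq"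
  proof (rule CbI)
    fix b assume b: "b \<in> \<beta>"
    have "\<Phi> \<beta> x (vec \<beta> (\<lambda>c. if c = b then 1 else 0)) = q (x b)"
      using \<beta> b by (simp add: \<Phi>_vec if_distrib[of "\<lambda>t. t \<bullet> _"] cong: if_cong)
    then show "x b \<in> kq" using * vec_in[OF \<beta>] by (simp add: kq_def)
  qed
next
  assume x: "x \<in> Cb \<beta> kq"
  have "(\<Sum>b\<in>\<beta>. u b \<bullet> x b) \<in> kq" for u
    by (rule subgrp_sum[OF submD(1)[OF subm_kq]]) (use CbD[OF x] submD(2)[OF subm_kq] in blast)
  then show "\<forall>v\<in>carrier (FR R \<beta>). \<Phi> \<beta> x v = \<zero>\<^bsub>X\<^esub>"
    by (auto simp: \<Phi>_vec kq_def elim!: vec_cases)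
qed

lemma \<Phi>_mapm:
  assumes \<beta>: "finite \<beta>" and v: "v \<in> carrier (FR R \<beta>)"
  shows "\<Phi> \<gamma> x (mapm \<gamma> \<beta> m v) = \<Phi> \<beta> (act \<gamma> m x) v"
proof -
  from v obtain u where u: "v = vec \<beta> u" by (rule vec_cases)
  have "(\<Sum>b\<in>\<gamma>. (\<Sum>k\<in>\<beta>. m b k * u k) \<bullet> x b) = (\<Sum>b\<in>\<gamma>. \<Sum>k\<in>\<beta>. u k \<bullet> m b k \<bullet> x b)"
    by (simp add: sc_sum' sc_mult[symmetric] mult.commute)
  also have "\<dots> = (\<Sum>k\<in>\<beta>. u k \<bullet> act \<gamma> m x k)"
    unfolding act_def by (subst sum.swap) (simp add: sc_sum)
  finally show ?thesis by (simp add: u mapm_vec \<Phi>_vec)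
qed

lemma \<Phi>_eq_iff:
  assumes "finite \<beta>"
  shows "(\<forall>v\<in>carrier (FR R \<beta>). \<Phi> \<beta> x v = \<Phi> \<beta> y v) \<longleftrightarrow> x - y \<in> Cb \<beta> kq"
proof -
  have "\<Phi> \<beta> x v = \<Phi> \<beta> y v \<longleftrightarrow> \<Phi> \<beta> (x - y) v = \<zero>\<^bsub>X\<^esub>" for v
    by (simp add: \<Phi>_def q_eq_iff kq_def[unfolded set_eq_iff, simplified] sum_subtractf sc_diff)
  then show ?thesis using \<Phi>_zero_iff[OF assms] by simp
qed

lemma \<Phi>_vsc: "\<Phi> \<beta> (vsc t x) v = \<pi> t \<odot>\<^bsub>X\<^esub> \<Phi> \<beta> x v"
proof -
  have "(\<Sum>b\<in>\<beta>. lft (v b) \<bullet> vsc t x b) = t \<bullet> (\<Sum>b\<in>\<beta>. lft (v b) \<bullet> x b)"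
    by (simp add: vsc_def sc_sum sc_mult[symmetric] mult.commute)
  then show ?thesis by (simp add: \<Phi>_def q_sc)
qed

text \<open>Through \<open>\<Phi>\<close> the tuples modulo \<open>Cb (\<beta> i) kq\<close> are the
  homomorphisms on the free module, and \<open>act\<close> is composition with the differential.
  Cocycles and coboundaries therefore correspond to \<open>Zc\<close> and \<open>Bc\<close> with
  coefficients \<open>UNIV / kq\<close>.\<close>

lemma asc_matrix:
  assumes fin: "\<And>i. finite (\<beta> i)" and p: "primeideal p R" and N: "N n = kq" and j: "i = int j + 1"
  shows "asc R (Fs \<beta>) (ds \<beta> D) X j p \<longleftrightarrow>
    V.assp (Zc \<beta> D (\<lambda>_. UNIV) N (n, i)) (Bc \<beta> D (\<lambda>_. UNIV) N (n, i)) {t. \<pi> t \<in> p}"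
proof -
  let ?Z = "Zc \<beta> D (\<lambda>_. UNIV) N (n, i)" and ?B = "Bc \<beta> D (\<lambda>_. UNIV) N (n, i)"
  have Fj: "Fs \<beta> j = FR R (\<beta> (i - 1))" "Fs \<beta> (Suc j) = FR R (\<beta> i)" "Fs \<beta> (Suc (Suc j)) = FR R (\<beta> (i + 1))"
    by (simp_all add: Fs_def j add.commute)
  have dj: "ds \<beta> D j = mapm (\<beta> (i - 1)) (\<beta> i) (D (i - 1))" "ds \<beta> D (Suc j) = mapm (\<beta> i) (\<beta> (i + 1)) (D i)"
    by (simp_all add: ds_def j add.commute)
  have mi: "mapm (\<beta> (i - 1)) (\<beta> i) (D (i - 1)) v \<in> carrier (FR R (\<beta> (i - 1)))" if "v \<in> carrier (FR R (\<beta> i))" for v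
    by (rule linD(1)[OF lin_mapm[OF fin] that])
  have mi': "mapm (\<beta> i) (\<beta> (i + 1)) (D i) v \<in> carrier (FR R (\<beta> i))" if "v \<in> carrier (FR R (\<beta> (i + 1)))" for v
    by (rule linD(1)[OF lin_mapm[OF fin] that])
  have cocyc: "cocyc R (Fs \<beta>) (ds \<beta> D) X (Suc j) (\<Phi> (\<beta> i) x) \<longleftrightarrow> x \<in> ?Z" for x
    using lin_\<Phi> \<Phi>_zero_iff[OF fin] by (simp add: cocyc_def Fj dj \<Phi>_mapm[OF fin] Zc_iff Cb_def N)
  have cobnd: "cobnd R (Fs \<beta>) (ds \<beta> D) X j (\<Phi> (\<beta> i) y) \<longleftrightarrow> y \<in> ?B" for y
  proof
    assume "cobnd R (Fs \<beta>) (ds \<beta> D) X j (\<Phi> (\<beta> i) y)"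
    then obtain \<psi> where \<psi>: "lin R (FR R (\<beta> (i - 1))) X \<psi>"
      "\<And>v. v \<in> carrier (FR R (\<beta> i)) \<Longrightarrow> \<Phi> (\<beta> i) y v = \<psi> (mapm (\<beta> (i - 1)) (\<beta> i) (D (i - 1)) v)"
      by (auto simp: cobnd_def Fj dj)
    obtain z where z: "\<And>v. v \<in> carrier (FR R (\<beta> (i - 1))) \<Longrightarrow> \<psi> v = \<Phi> (\<beta> (i - 1)) z v"
      using lin_\<Phi>_cases[OF \<psi>(1) fin] by metis
    have "\<forall>v\<in>carrier (FR R (\<beta> i)). \<Phi> (\<beta> i) y v = \<Phi> (\<beta> i) (act (\<beta> (i - 1)) (D (i - 1)) z) v"
      using \<psi>(2) z[OF mi] by (simp add: \<Phi>_mapm[OF fin])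
    then have "y - act (\<beta> (i - 1)) (D (i - 1)) z \<in> Cb (\<beta> i) kq" by (simp only: \<Phi>_eq_iff[OF fin])
    then show "y \<in> ?B" by (auto simp: Bc_iff N Cb_def)
  next
    assume "y \<in> ?B"
    then obtain z where "y - act (\<beta> (i - 1)) (D (i - 1)) z \<in> Cb (\<beta> i) kq" by (auto simp: Bc_iff N)
    then have "\<forall>v\<in>carrier (FR R (\<beta> i)). \<Phi> (\<beta> i) y v = \<Phi> (\<beta> (i - 1)) z (mapm (\<beta> (i - 1)) (\<beta> i) (D (i - 1)) v)"
      by (simp add: \<Phi>_mapm[OF fin] \<Phi>_eq_iff[OF fin])
    then show "cobnd R (Fs \<beta>) (ds \<beta> D) X j (\<Phi> (\<beta> i) y)"
      unfolding cobnd_def Fj dj using lin_\<Phi> by blast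
  qed
  have cocyc_cong: "cocyc R (Fs \<beta>) (ds \<beta> D) X (Suc j) \<phi> \<longleftrightarrow> cocyc R (Fs \<beta>) (ds \<beta> D) X (Suc j) (\<Phi> (\<beta> i) x)"
    if "lin R (FR R (\<beta> i)) X \<phi>" "\<And>v. v \<in> carrier (FR R (\<beta> i)) \<Longrightarrow> \<phi> v = \<Phi> (\<beta> i) x v" for \<phi> x
    using that lin_\<Phi> mi' by (simp add: cocyc_def Fj dj)
  have set: "p = {a \<in> carrier R. P a} \<longleftrightarrow> (\<forall>t. \<pi> t \<in> p \<longleftrightarrow> P (\<pi> t))" for P
  proof -
    have "p \<subseteq> carrier R" using p additive_subgroup.a_subset ideal.axioms(1) primeideal.axioms(1) by metis
    then show ?thesis unfolding pi_range[symmetric] by blast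
  qed
  have "asc R (Fs \<beta>) (ds \<beta> D) X j p \<longleftrightarrow> (\<exists>x\<in>?Z. \<forall>t. \<pi> t \<in> p \<longleftrightarrow> vsc t x \<in> ?B)"
  proof
    assume "asc R (Fs \<beta>) (ds \<beta> D) X j p"
    then obtain \<phi> where \<phi>: "cocyc R (Fs \<beta>) (ds \<beta> D) X (Suc j) \<phi>"
      "\<And>t. \<pi> t \<in> p \<longleftrightarrow> cobnd R (Fs \<beta>) (ds \<beta> D) X j (\<lambda>v. \<pi> t \<odot>\<^bsub>X\<^esub> \<phi> v)"
      unfolding asc_def set by blast
    then have l: "lin R (FR R (\<beta> i)) X \<phi>" by (simp add: cocyc_def Fj)
    obtain x where x: "\<And>v. v \<in> carrier (FR R (\<beta> i)) \<Longrightarrow> \<phi> v = \<Phi> (\<beta> i) x v"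
      using lin_\<Phi>_cases[OF l fin] by metis
    have "cobnd R (Fs \<beta>) (ds \<beta> D) X j (\<lambda>v. \<pi> t \<odot>\<^bsub>X\<^esub> \<phi> v) \<longleftrightarrow> vsc t x \<in> ?B" for t
      unfolding cobnd[symmetric] cobnd_def Fj using x by (simp add: \<Phi>_vsc)
    moreover have "x \<in> ?Z" using \<phi>(1) cocyc_cong[OF l x] cocyc by blast
    ultimately show "\<exists>x\<in>?Z. \<forall>t. \<pi> t \<in> p \<longleftrightarrow> vsc t x \<in> ?B" using \<phi>(2) by blast
  next
    assume "\<exists>x\<in>?Z. \<forall>t. \<pi> t \<in> p \<longleftrightarrow> vsc t x \<in> ?B"
    then obtain x where x: "x \<in> ?Z" "\<And>t. \<pi> t \<in> p \<longleftrightarrow> vsc t x \<in> ?B" by blast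
    then show "asc R (Fs \<beta>) (ds \<beta> D) X j p" unfolding asc_def set
      by (intro exI[of _ "\<Phi> (\<beta> i) x"]) (simp add: cocyc \<Phi>_vsc[symmetric] cobnd)
  qed
  then show ?thesis using prime_id_pi[OF p] by (auto simp: V.assp_def set_eq_iff)
qed

end

section \<open>Existence of matrix resolutions\<close>

definition submv :: "(nat \<Rightarrow> 't::comm_ring_1) set \<Rightarrow> bool" where
  "submv W \<longleftrightarrow> subgrp W \<and> (\<forall>t. \<forall>x\<in>W. (\<lambda>b. t * x b) \<in> W)"

text \<open>The columns of \<open>m\<close> are finitely many generators of \<open>W\<close> over
  \<open>Cb {..<r} J\<close>.\<close>

lemma generating_matrix:
  fixes J :: "'t::comm_ring_1 set"
  assumes noe: "noeth (scal.scops (*)) (\<lambda>_::unit. UNIV) (\<lambda>_. J)" and J: "idl J"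
    and W: "submv W" "Cb {..<r} J \<subseteq> W"
  obtains m and r' :: nat where "\<And>v. v \<in> W \<longleftrightarrow> (\<exists>w. \<forall>k<r. v k - (\<Sum>l<r'. m k l * w l) \<in> J)"
proof -
  interpret R: scal "(*) :: 't \<Rightarrow> 't \<Rightarrow> 't" by (rule scal_times)
  interpret V: scal R.vsc by (rule R.scal_vsc)
  have Jm: "R.subm J" using J by (simp add: R.subm_def idl_def)
  have Vm: "V.subm U \<longleftrightarrow> submv U" for U by (simp add: V.subm_def submv_def R.vsc_def)
  have nC: "noeth V.scops (\<lambda>_::unit. UNIV) (\<lambda>_. Cb {..<r} J)" by (rule R.noeth_Cb[OF noe Jm]) simp
  have subW: "V.subm W" using W(1) by (simp add: Vm)
  obtain G where G: "finite G" "G \<subseteq> W" "W = V.shull (Cb {..<r} J \<union> G)" by (rule V.noeth_fg[OF nC subW W(2)])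
  obtain gs where gs: "G = set gs" using finite_list[OF G(1)] by blast
  let ?n = "length gs"
  let ?m = "\<lambda>k l. (gs ! l) k"
  let ?U = "{v. \<exists>w. \<forall>k<r. v k - (\<Sum>l<?n. ?m k l * w l) \<in> J}"
  have "submv ?U" unfolding submv_def subgrp_def
  proof (intro conjI ballI allI)
    show "0 \<in> ?U" using subgrp_0[OF idlD(1)[OF J]] by (auto intro!: exI[of _ "\<lambda>_. 0"])
    fix x assume "x \<in> ?U"
    then obtain w where w: "\<And>k. k < r \<Longrightarrow> x k - (\<Sum>l<?n. ?m k l * w l) \<in> J" by blast
    show "(\<lambda>b. t * x b) \<in> ?U" for t
      using idlD(2)[OF J w, of _ t]
      by (auto intro!: exI[of _ "\<lambda>l. t * w l"] simp: right_diff_distrib sum_distrib_left mult.left_commute)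
    fix y assume "y \<in> ?U"
    then obtain w' where w': "\<And>k. k < r \<Longrightarrow> y k - (\<Sum>l<?n. ?m k l * w' l) \<in> J" by blast
    show "x - y \<in> ?U"
      using subgrp_diff[OF idlD(1)[OF J] w w']
      by (auto intro!: exI[of _ "\<lambda>l. w l - w' l"] simp: right_diff_distrib sum_subtractf algebra_simps)
  qed
  moreover have "Cb {..<r} J \<union> G \<subseteq> ?U"
  proof
    fix x assume "x \<in> Cb {..<r} J \<union> G"
    then consider "x \<in> Cb {..<r} J" | i where "i < ?n" "x = gs ! i" by (auto simp: gs in_set_conv_nth)
    then show "x \<in> ?U"
    proof cases
      case 1
      then show ?thesis by (auto intro!: exI[of _ "\<lambda>_. 0"] simp: Cb_def)
    next
      case 2
      then show ?thesis using subgrp_0[OF idlD(1)[OF J]]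
        by (auto intro!: exI[of _ "\<lambda>l. if l = i then 1 else 0"] simp: if_distrib[of "\<lambda>t. _ * t"] cong: if_cong)
    qed
  qed
  ultimately have "W \<subseteq> ?U" unfolding G(3) by (intro V.shull_least) (simp_all only: Vm)
  moreover have "v \<in> W" if v: "\<And>k. k < r \<Longrightarrow> v k - (\<Sum>l<?n. ?m k l * w l) \<in> J" for v w
  proof -
    have sa: "(\<Sum>l\<in>A. R.vsc (w l) (gs ! l)) k = (\<Sum>l\<in>A. w l * (gs ! l) k)" for A k
      by (induction A rule: infinite_finite_induct) (auto simp: R.vsc_def)
    have "(\<Sum>l<?n. R.vsc (w l) (gs ! l)) \<in> W"
      by (rule subgrp_sum[OF V.submD(1)[OF subW]], rule V.submD(2)[OF subW]) (use G(2) gs in force)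
    moreover have "v - (\<Sum>l<?n. R.vsc (w l) (gs ! l)) \<in> Cb {..<r} J"
      using v by (auto simp: Cb_def mult.commute sa)
    ultimately show ?thesis using subgrp_cancel[OF V.submD(1)[OF subW]] W(2) by blast
  qed
  ultimately show thesis using that[of ?m ?n] by blast
qed

lemma submv_kernel:
  assumes J: "idl J"
  shows "submv {v. \<forall>b<r. (\<Sum>k<r'. m b k * v k) \<in> J}" "Cb {..<r'} J \<subseteq> {v. \<forall>b<r. (\<Sum>k<r'. m b k * v k) \<in> J}"
proof -
  have 1: "(\<Sum>k<r'. m b k * (t * v k)) = t * (\<Sum>k<r'. m b k * v k)" for b t v
    by (simp add: sum_distrib_left mult.left_commute)
  show "submv {v. \<forall>b<r. (\<Sum>k<r'. m b k * v k) \<in> J}"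
    using idlD[OF J] by (auto simp: submv_def subgrp_def 1 right_diff_distrib sum_subtractf)
  show "Cb {..<r'} J \<subseteq> {v. \<forall>b<r. (\<Sum>k<r'. m b k * v k) \<in> J}"
    by (auto simp: Cb_def intro!: subgrp_sum[OF idlD(1)[OF J]] idlD(2)[OF J])
qed

text \<open>The columns of each matrix generate the kernel of the preceding one modulo
  \<open>Jk T0 f c\<close>. Products of consecutive matrices then have entries in this ideal, and
  \<open>S\<close> collects the coefficients of the \<open>f j\<close>.\<close>

lemma matrix_resolution_exists:
  fixes T0 :: "'t::comm_ring_1 set"
  assumes noe: "noeth (scal.scops (*)) (\<lambda>_::unit. UNIV) (\<lambda>_. T0)" and T0: "idl T0"
    and K: "submv \<K>" "Cb {..<r0} (Jk T0 f c) \<subseteq> \<K>"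
  obtains \<beta> D S where "cdata T0 f c \<beta> D S" "exact (Jk T0 f c) \<K> \<beta> D (\<lambda>b. b)" "\<beta> 0 = {..<r0}"
proof -
  let ?J = "Jk T0 f c"
  have J: "idl ?J" by (rule idl_Jk[OF T0])
  have nJ: "noeth (scal.scops (*)) (\<lambda>_::unit. UNIV) (\<lambda>_. ?J)"
    by (rule noeth_mono[OF noe order_refl]) (use Jk_mono[OF T0, of 0 c f] in auto)
  let ?ex = "\<lambda>W (r::nat, r'::nat, m). \<forall>v. v \<in> W \<longleftrightarrow> (\<exists>w. \<forall>k<r. v k - (\<Sum>l<r'. m k l * w l) \<in> ?J)"
  let ?K = "\<lambda>(r::nat, r'::nat, m). {v. \<forall>b<r. (\<Sum>k<r'. m b k * v k) \<in> ?J}"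
  \<comment> \<open>The state is a matrix with its numbers of rows and columns; the column space of
    the next matrix is the kernel of the present one.\<close>
  have "\<exists>x :: nat \<Rightarrow> nat \<times> nat \<times> (nat \<Rightarrow> nat \<Rightarrow> 't). \<forall>n. (n = 0 \<longrightarrow> fst (x n) = r0 \<and> ?ex \<K> (x n)) \<and>
      (fst (x (Suc n)) = fst (snd (x n)) \<and> ?ex (?K (x n)) (x (Suc n)))"
  proof (rule dependent_nat_choice)
    obtain m and r' :: nat where "\<And>v. v \<in> \<K> \<longleftrightarrow> (\<exists>w. \<forall>k<r0. v k - (\<Sum>l<r'. m k l * w l) \<in> ?J)"
      by (rule generating_matrix[OF nJ J K]) blast
    then show "\<exists>x. 0 = (0::nat) \<longrightarrow> fst x = r0 \<and> ?ex \<K> x" by (intro exI[of _ "(r0, r', m)"]) auto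
  next
    fix x :: "nat \<times> nat \<times> (nat \<Rightarrow> nat \<Rightarrow> 't)" and n
    obtain r r' m where x: "x = (r, r', m)" by (cases x)
    obtain m' and r'' :: nat where "\<And>v. v \<in> ?K x \<longleftrightarrow> (\<exists>w. \<forall>k<r'. v k - (\<Sum>l<r''. m' k l * w l) \<in> ?J)"
      unfolding x prod.case by (rule generating_matrix[OF nJ J submv_kernel(1)[where r = r and r' = r' and m = m, OF J] submv_kernel(2)[OF J]]) blast
    then show "\<exists>y. (Suc n = 0 \<longrightarrow> fst y = r0 \<and> ?ex \<K> y) \<and> (fst y = fst (snd x) \<and> ?ex (?K x) y)"
      by (intro exI[of _ "(r', r'', m')"]) (simp add: x)
  qed
  then obtain x :: "nat \<Rightarrow> nat \<times> nat \<times> (nat \<Rightarrow> nat \<Rightarrow> 't)" where "\<forall>n. (n = 0 \<longrightarrow> fst (x n) = r0 \<and> ?ex \<K> (x n)) \<and>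
      (fst (x (Suc n)) = fst (snd (x n)) \<and> ?ex (?K (x n)) (x (Suc n)))" by (rule exE)
  note x' = this[THEN spec]
  have x0: "fst (x 0) = r0" "?ex \<K> (x 0)"
    using x'[THEN conjunct1, THEN mp, OF refl] by (rule conjunct1, rule conjunct2)
  note xS = x'[THEN conjunct2, THEN conjunct1] x'[THEN conjunct2, THEN conjunct2]
  define r where "r n = fst (x n)" for n
  define m where "m n = snd (snd (x n))" for n
  have x: "x n = (r n, r (Suc n), m n)" for n by (simp add: r_def m_def xS(1))
  have e0: "v \<in> \<K> \<longleftrightarrow> (\<exists>w. \<forall>k<r0. v k - (\<Sum>l<r 1. m 0 k l * w l) \<in> ?J)" for v
    using x0 by (simp add: x)
  have eS: "(\<forall>b<r n. (\<Sum>k<r (Suc n). m n b k * v k) \<in> ?J)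
      \<longleftrightarrow> (\<exists>w. \<forall>k<r (Suc n). v k - (\<Sum>l<r (Suc (Suc n)). m (Suc n) k l * w l) \<in> ?J)" for n v
    using xS(2)[of n] by (simp add: x)
  define \<beta> where "\<beta> i = (if i < 0 then {} else {..<r (nat i)})" for i :: int
  define D where "D i = m (nat i)" for i
  have DD: "mm (\<beta> (i + 1)) (D i) (D (i + 1)) b k \<in> ?J" if b: "b \<in> \<beta> i" and k: "k \<in> \<beta> (i + 2)" for i b k
  proof -
    define n where "n = nat i"
    have i: "i = int n" using b by (auto simp: \<beta>_def n_def split: if_splits)
    have n: "nat (i + 1) = Suc n" "nat (i + 2) = Suc (Suc n)" "nat i = n" by (auto simp: i)
    \<comment> \<open>Column \<open>k\<close> of the next matrix lies in the kernel: use
      \<open>eS\<close> from right to left with a unit vector as \<open>w\<close>.\<close>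
    have "\<forall>b<r n. (\<Sum>l<r (Suc n). m n b l * m (Suc n) l k) \<in> ?J" unfolding eS
      using k subgrp_0[OF idlD(1)[OF J]]
      by (intro exI[of _ "\<lambda>l. if l = k then 1 else 0"])
         (auto simp: \<beta>_def n if_distrib[of "\<lambda>t. _ * t"] cong: if_cong split: if_splits)
    then show ?thesis using b by (auto simp: \<beta>_def mm_def D_def n split: if_splits)
  qed
  define S where "S j i b k = (SOME s. mm (\<beta> (i + 1)) (D i) (D (i + 1)) b k - (\<Sum>j<c. f j * s j) \<in> T0) j" for j i b k
  show thesis
  proof (rule that[of \<beta> D S])
    have "mm (\<beta> (i + 1)) (D i) (D (i + 1)) b k - (\<Sum>j<c. f j * S j i b k) \<in> T0"
      if "b \<in> \<beta> i" "k \<in> \<beta> (i + 2)" for i b k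
      unfolding S_def by (rule someI_ex[OF DD[OF that, unfolded Jk_iff[OF T0]]])
    then show "cdata T0 f c \<beta> D S" by (auto simp: cdata_def \<beta>_def)
    show "\<beta> 0 = {..<r0}" using x0(1) by (simp add: \<beta>_def x)
    then show "exact ?J \<K> \<beta> D (\<lambda>b. b)" unfolding exact_def
    proof (intro conjI allI impI)
      fix i :: int and v assume i: "0 < i" and v: "\<forall>b\<in>\<beta> (i - 1). (\<Sum>k\<in>\<beta> i. D (i - 1) b k * v k) \<in> ?J"
      define n where "n = nat (i - 1)"
      have n: "nat i = Suc n" "nat (i + 1) = Suc (Suc n)" "nat (i - 1) = n" using i by (auto simp: n_def)
      show "\<exists>w. \<forall>k\<in>\<beta> i. v k - (\<Sum>l\<in>\<beta> (i + 1). D i k l * w l) \<in> ?J"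
        using eS[of n v] v i by (auto simp: \<beta>_def D_def n)
    next
      fix v
      have "r 0 = r0" using x0(1) by (simp add: x)
      then show "((\<lambda>b. v b) \<in> \<K>) = (\<exists>w. \<forall>k\<in>\<beta> 0. v k - (\<Sum>l\<in>\<beta> 1. D 0 k l * w l) \<in> ?J)"
        using e0[of v] by (simp add: \<beta>_def D_def Ball_def)
    qed
  qed
qed

section \<open>Ideals and submodules through a cover\<close>

context ring_cover
begin

lemma ideal_image: "idl U \<Longrightarrow> ideal (\<pi> ` U) R"
proof (rule idealI)
  assume U: "idl U"
  show "ring R" by (rule ring_axioms)
  show "subgroup (\<pi> ` U) (add_monoid R)"
  proof (rule add.subgroupI)
    fix a assume "a \<in> \<pi> ` U"
    then obtain u where u: "u \<in> U" "a = \<pi> u" by blast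
    then show "\<ominus> a \<in> \<pi> ` U" using subgrp_minus[OF idlD(1)[OF U]] by (metis image_eqI pi_minus)
    fix b assume "b \<in> \<pi> ` U"
    then obtain v where v: "v \<in> U" "b = \<pi> v" by blast
    then show "a \<oplus> b \<in> \<pi> ` U" using u subgrp_add[OF idlD(1)[OF U]] by (metis image_eqI pi_add)
  qed (use subgrp_0[OF idlD(1)[OF U]] in auto)
  fix a x assume "a \<in> \<pi> ` U" "x \<in> carrier R"
  then obtain u t where u: "u \<in> U" "a = \<pi> u" "x = \<pi> t" using pi_range by blast
  show "x \<otimes> a \<in> \<pi> ` U" "a \<otimes> x \<in> \<pi> ` U"
    unfolding u(2,3) pi_mult[symmetric] using idlD(2,3)[OF U u(1)] by blast+
qed

lemma idl_preimage:
  assumes "ideal I R" shows "idl {t. \<pi> t \<in> I}"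
proof -
  interpret ideal I R by fact
  show ?thesis by (auto simp: idl_def subgrp_def pi_zero pi_diff pi_mult a_minus_def I_l_closed)
qed

lemma
  assumes I: "ideal I R"
  shows quotient_cover: "ring_cover (R Quot I) (\<lambda>t. I +> \<pi> t)"
    and quotient_ker: "ring_cover.ker (R Quot I) (\<lambda>t. I +> \<pi> t) = {t. \<pi> t \<in> I}"
proof -
  interpret I: ideal I R by fact
  have "range (\<lambda>t. I +> \<pi> t) = (\<lambda>a. I +> a) ` range \<pi>" by auto
  also have "\<dots> = carrier (R Quot I)" unfolding pi_range by (auto simp: FactRing_def A_RCOSETS_def')
  finally show c: "ring_cover (R Quot I) (\<lambda>t. I +> \<pi> t)"
    using ring_hom_add[OF I.rcos_ring_hom] ring_hom_mult[OF I.rcos_ring_hom] ring_hom_one[OF I.rcos_ring_hom]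
    by (intro ring_cover.intro ring_cover_axioms.intro I.quotient_is_cring is_cring) (simp_all add: pi_add pi_mult pi_one)
  have "I +> \<pi> t = I \<longleftrightarrow> \<pi> t \<in> I" for t
    using I.a_rcos_self[of "\<pi> t"] I.a_rcos_const[of "\<pi> t"] by auto
  then show "ring_cover.ker (R Quot I) (\<lambda>t. I +> \<pi> t) = {t. \<pi> t \<in> I}"
    unfolding ring_cover.ker_def[OF c] by (simp add: FactRing_def)
qed

text \<open>One inclusion evaluates the sum in \<open>Jk_iff\<close>. For the other, the image of
  \<open>Jk\<close> is an ideal containing the generators, and passing back to the preimage costs
  only elements of \<open>ker\<close>.\<close>

lemma Jk_ker:
  assumes fs: "set fs \<subseteq> carrier R" and k: "k \<le> length fs"
  shows "Jk ker (\<lambda>j. lft (fs ! j)) k = {t. \<pi> t \<in> genideal R (set (take k fs))}" (is "Jk ker ?f k = ?R")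
proof
  have S: "set (take k fs) \<subseteq> carrier R" using fs set_take_subset[of k fs] by blast
  interpret G: ideal "genideal R (set (take k fs))" R by (rule genideal_ideal[OF S])
  have f: "\<pi> (?f j) = fs ! j" if "j < k" for j using fs k that by (intro pi_lft) auto
  have fG: "\<pi> (?f j) \<in> genideal R (set (take k fs))" if "j < k" for j
  proof -
    have "fs ! j \<in> set (take k fs)" using that k by (auto simp: in_set_conv_nth)
    then show ?thesis using genideal_self[OF S] f[OF that] by auto
  qed
  show "Jk ker ?f k \<subseteq> ?R"
  proof
    fix t assume "t \<in> Jk ker ?f k"
    then obtain s where s: "t - (\<Sum>j<k. ?f j * s j) \<in> ker" unfolding Jk_iff[OF idl_ker] by blast
    have "(\<Sum>j<k. ?f j * s j) \<in> ?R"
      using fG by (intro subgrp_sum[OF idlD(1)[OF idl_preimage[OF G.is_ideal]]] idlD(3)[OF idl_preimage[OF G.is_ideal]]) auto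
    then show "t \<in> ?R" using s by (simp add: pi_eq_iff[symmetric])
  qed
  have "genideal R (set (take k fs)) \<subseteq> \<pi> ` Jk ker ?f k"
  proof (rule genideal_minimal[OF ideal_image[OF idl_Jk[OF idl_ker]]])
    show "set (take k fs) \<subseteq> \<pi> ` Jk ker ?f k"
    proof
      fix a assume "a \<in> set (take k fs)"
      then obtain j where j: "j < k" "a = fs ! j" using k by (auto simp: in_set_conv_nth)
      have "?f j \<in> Jk ker ?f k" unfolding Jk_iff[OF idl_ker]
        using j(1) subgrp_0[OF idlD(1)[OF idl_ker]]
        by (intro exI[of _ "\<lambda>i. if i = j then 1 else 0"]) (simp add: if_distrib[of "\<lambda>t. _ * t"] cong: if_cong)
      then show "a \<in> \<pi> ` Jk ker ?f k" using f[OF j(1)] j(2) by (metis image_eqI)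
    qed
  qed
  then show "?R \<subseteq> Jk ker ?f k"
  proof (intro subsetI)
    fix t assume "t \<in> ?R" "genideal R (set (take k fs)) \<subseteq> \<pi> ` Jk ker ?f k"
    then obtain u where u: "u \<in> Jk ker ?f k" "\<pi> t = \<pi> u" by blast
    have "t - u \<in> Jk ker ?f k" using u(2) Jk_mono[OF idl_ker, of 0 k ?f] by (auto simp: pi_eq_iff)
    then show "t \<in> Jk ker ?f k" using u(1) by (rule subgrp_cancel[OF idlD(1)[OF idl_Jk[OF idl_ker]]])
  qed
qed

lemma reg_ker:
  assumes rs: "regular_sequence R fs"
  shows "reg ker (\<lambda>j. lft (fs ! j)) (length fs)"
  unfolding reg_def
proof (intro allI impI)
  fix k x assume k: "k < length fs" and x: "lft (fs ! k) * x \<in> Jk ker (\<lambda>j. lft (fs ! j)) k"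
  have fs: "set fs \<subseteq> carrier R" using rs by (simp add: regular_sequence_def)
  let ?G = "genideal R (set (take k fs))"
  have S: "set (take k fs) \<subseteq> carrier R" using fs set_take_subset[of k fs] by blast
  note G = genideal_ideal[OF S]
  let ?R = "R Quot ?G" and ?p = "\<lambda>t. ?G +> \<pi> t"
  interpret c: ring_cover ?R ?p by (rule quotient_cover[OF G])
  have ker: "?p t = \<zero>\<^bsub>?R\<^esub> \<longleftrightarrow> t \<in> Jk ker (\<lambda>j. lft (fs ! j)) k" for t
    using quotient_ker[OF G] Jk_ker[OF fs, of k] k by (auto simp: c.ker_def)
  have "\<pi> (lft (fs ! k)) = fs ! k" using fs k by (intro pi_lft) auto
  then have "(?G +> fs ! k) \<otimes>\<^bsub>?R\<^esub> ?p x = \<zero>\<^bsub>?R\<^esub>" using x ker[of "lft (fs ! k) * x"] c.pi_mult[of "lft (fs ! k)" x] by simp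
  moreover have "\<forall>x\<in>carrier ?R. (?G +> fs ! k) \<otimes>\<^bsub>?R\<^esub> x = \<zero>\<^bsub>?R\<^esub> \<longrightarrow> x = \<zero>\<^bsub>?R\<^esub>"
    using rs k by (simp add: regular_sequence_def Let_def)
  ultimately show "x \<in> Jk ker (\<lambda>j. lft (fs ! j)) k" using ker[of x] c.pi_in[of x] by blast
qed

text \<open>An ideal containing \<open>ker\<close> is recovered from its image in \<open>R\<close>,
  so a chain stops as soon as its chain of images does.\<close>

lemma noeth_ker:
  assumes "noetherian_ring R"
  shows "noeth (scal.scops (*)) (\<lambda>_::unit. UNIV) (\<lambda>_. ker)"
  unfolding noeth_def
proof (intro allI impI)
  interpret noetherian_ring R by fact
  interpret S: scal "(*) :: 't \<Rightarrow> 't \<Rightarrow> 't" by (rule scal_times)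
  fix c :: "nat \<Rightarrow> unit \<Rightarrow> 't set" assume c: "mono c" "\<forall>k. fam S.scops (\<lambda>_. UNIV) (\<lambda>_. ker) (c k)"
  have idl: "idl (c k ())" for k using S.subm_fam[OF c(2)[rule_format, of k] order_refl, of "()"] by (simp add: S.subm_def idl_def)
  have kc: "ker \<subseteq> c k ()" for k using famD(2)[OF c(2)[rule_format, of k]] by blast
  have mono: "c k () \<subseteq> c l ()" if "k \<le> l" for k l using monoD[OF c(1) that] by (auto simp: le_fun_def)
  let ?C = "range (\<lambda>k. \<pi> ` c k ())"
  have "\<Union> ?C \<in> ?C"
  proof (rule ideal_chain_is_trivial)
    show "subset.chain {I. ideal I R} ?C"
      unfolding subset.chain_def
    proof (intro conjI ballI)
      fix A B assume "A \<in> ?C" "B \<in> ?C"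
      then obtain k l where "A = \<pi> ` c k ()" "B = \<pi> ` c l ()" by blast
      then show "(\<subset>)\<^sup>=\<^sup>= A B \<or> (\<subset>)\<^sup>=\<^sup>= B A"
        using image_mono[OF mono[of k l], of \<pi>] image_mono[OF mono[of l k], of \<pi>] by (cases "k \<le> l") auto
    qed (use ideal_image[OF idl] in auto)
  qed simp
  then obtain K where K: "\<Union> ?C = \<pi> ` c K ()" by blast
  have "c k = c K" if k: "k \<ge> K" for k
  proof -
    have "c k () \<subseteq> c K ()"
    proof
      fix t assume "t \<in> c k ()"
      then have "\<pi> t \<in> \<pi> ` c K ()" unfolding K[symmetric] by blast
      then obtain u where u: "u \<in> c K ()" "t - u \<in> ker" by (auto simp: pi_eq_iff)
      then show "t \<in> c K ()" using kc[of K] subgrp_cancel[OF idlD(1)[OF idl[of K]]] by (meson subsetD)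
    qed
    then show ?thesis using mono[OF k] by auto
  qed
  then show "\<exists>K. \<forall>k\<ge>K. c k = c K" by blast
qed

end

context module_cover
begin

interpretation V: scal vsc by (rule scal_vsc)

lemma submodule_image: "subm U \<Longrightarrow> submodule (q ` U) R X"
proof (rule X.submoduleI)
  assume U: "subm U"
  note Us = submD(1)[OF U]
  show "q ` U \<subseteq> carrier X" by auto
  show "\<zero>\<^bsub>X\<^esub> \<in> q ` U" using subgrp_0[OF Us] by (auto simp: q_zero[symmetric])
  fix a assume "a \<in> q ` U"
  then obtain u where u: "u \<in> U" "a = q u" by blast
  have "q (- u) = \<ominus>\<^bsub>X\<^esub> q u" using q_diff[of 0 u] by (simp add: q_zero a_minus_def)
  then show "\<ominus>\<^bsub>X\<^esub> a \<in> q ` U" unfolding u(2) using imageI[OF subgrp_minus[OF Us u(1)], of q] by simp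
  show "x \<odot>\<^bsub>X\<^esub> a \<in> q ` U" if x: "x \<in> carrier R" for x
  proof -
    obtain t where "x = \<pi> t" using x pi_range by blast
    then show ?thesis unfolding u(2) using submD(2)[OF U u(1), of t] by (auto simp: q_sc[symmetric])
  qed
  fix b assume "b \<in> q ` U"
  then obtain v where v: "v \<in> U" "b = q v" by blast
  show "a \<oplus>\<^bsub>X\<^esub> b \<in> q ` U" unfolding u(2) v(2) q_add[symmetric] by (rule imageI[OF subgrp_add[OF Us u(1) v(1)]])
qed

lemma subm_preimage:
  assumes K: "submodule K R X" shows "subm {x. q x \<in> K}"
proof -
  have K': "subgroup K (add_monoid X)" using K by (simp add: submodule_def)
  then interpret K: additive_subgroup K X by (rule additive_subgroupI)
  show ?thesis
    using submodule.smult_closed[OF K pi_in] K.a_inv_closed[OF _]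
    by (auto simp: subm_def subgrp_def q_zero q_diff q_sc a_minus_def)
qed

lemma span_module_least: "submodule K R X \<Longrightarrow> S \<subseteq> K \<Longrightarrow> span_module R X S \<subseteq> K"
  by (auto simp: span_module_def)

text \<open>The Noetherian hypothesis concerns \<open>R'\<close>, in the application
  \<open>Q\<close>, whereas \<open>X\<close> is a module over its quotient. Pulling families back
  along the map \<open>?e\<close> from tuples of scalars to \<open>'p\<close> reduces the claim to
  \<open>noeth_Cb\<close> over the cover of \<open>R'\<close>.\<close>

lemma noeth_kq:
  assumes "noetherian_ring R'" "ring_cover R' \<pi>'" and sub: "ring_cover.ker R' \<pi>' \<subseteq> ker" and fg: "fin_gen_module R X"
  shows "noeth scops (\<lambda>_::unit. UNIV) (\<lambda>_. kq)"
proof -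
  interpret R': ring_cover R' \<pi>' by fact
  interpret S: scal "(*) :: 't \<Rightarrow> 't \<Rightarrow> 't" by (rule scal_times)
  interpret SV: scal S.vsc by (rule S.scal_vsc)
  obtain G where G: "finite G" "G \<subseteq> carrier X" "span_module R X G = carrier X" using fg by (auto simp: fin_gen_module_def)
  obtain gs where gs: "G = set gs" using finite_list[OF G(1)] by blast
  let ?n = "length gs"
  define g where "g l = (SOME y. q y = gs ! l)" for l
  have g: "q (g l) = gs ! l" if "l < ?n" for l unfolding g_def
  proof (rule someI_ex)
    have "gs ! l \<in> range q" unfolding q_range using G(2) gs that by auto
    then show "\<exists>y. q y = gs ! l" by auto
  qed
  let ?e = "\<lambda>u. \<Sum>l<?n. u l \<bullet> g l"
  have e_diff: "?e (u - v) = ?e u - ?e v" and e_sc: "?e (S.vsc t u) = t \<bullet> ?e u" for u v t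
    by (simp_all add: sc_diff' sum_subtractf S.vsc_def sc_mult sc_sum)
  have e_0: "?e 0 = 0" by simp
  have "subm (range ?e)" unfolding subm_def subgrp_def
  proof (intro conjI ballI allI)
    show "0 \<in> range ?e" by (rule range_eqI[of _ _ 0]) (simp only: e_0)
    fix x t assume "x \<in> range ?e"
    then obtain u where u: "x = ?e u" by (rule rangeE)
    show "t \<bullet> x \<in> range ?e" unfolding u e_sc[symmetric] by (rule rangeI)
    fix y assume "y \<in> range ?e"
    then obtain v where v: "y = ?e v" by (rule rangeE)
    show "x - y \<in> range ?e" unfolding u v e_diff[symmetric] by (rule rangeI)
  qed
  then have cov: "span_module R X G \<subseteq> q ` range ?e"
  proof (rule span_module_least[OF submodule_image])
    show "G \<subseteq> q ` range ?e"
    proof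
      fix a assume "a \<in> G"
      then obtain l where l: "l < ?n" "a = gs ! l" by (auto simp: gs in_set_conv_nth)
      have "?e (\<lambda>j. if j = l then 1 else 0) = g l" using l(1) by (simp add: if_distrib[of "\<lambda>t. t \<bullet> _"] cong: if_cong)
      then have "g l \<in> range ?e" by (intro range_eqI[of _ ?e "\<lambda>j. if j = l then 1 else 0"]) (rule sym)
      then have "q (g l) \<in> q ` range ?e" by (rule imageI)
      then show "a \<in> q ` range ?e" by (simp only: g[OF l(1)] l(2))
    qed
  qed
  have e_surj: "\<exists>u. x - ?e u \<in> kq" for x
  proof -
    have "q x \<in> q ` range ?e" using q_in[of x] cov unfolding G(3) by (rule rev_subsetD)
    then obtain y where y: "q x = q y" "y \<in> range ?e" by (rule imageE)
    from y(2) obtain u where "y = ?e u" by (rule rangeE)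
    then have "q x = q (?e u)" using y(1) by (simp only:)
    then show ?thesis unfolding q_eq_iff by (intro exI[of _ u])
  qed
  have "S.subm R'.ker" using R'.idl_ker by (simp add: S.subm_def idl_def)
  note nC = S.noeth_Cb[OF R'.noeth_ker[OF assms(1)] this finite_lessThan[of ?n]]
  have ek: "?e u \<in> kq" if "u \<in> Cb {..<?n} R'.ker" for u
    using that sub by (intro subgrp_sum[OF submD(1)[OF subm_kq]]) (auto simp: Cb_def kq_def q_sc ker_def subset_iff)
  show ?thesis
  proof (rule noeth_embed[OF nC, where \<Phi> = "\<lambda>W d. {u. ?e u \<in> W d}"])
    fix W assume W: "fam scops (\<lambda>_::unit. UNIV) (\<lambda>_. kq) W"
    note Wd = famD[OF W] and Ws = subm_fam[OF W order_refl]
    show "fam SV.scops (\<lambda>_. UNIV) (\<lambda>_. Cb {..<?n} R'.ker) (\<lambda>d. {u. ?e u \<in> W d})"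
    proof (rule SV.fam_scopsI)
      show "SV.subm {u. ?e u \<in> W d}" for d
        unfolding SV.subm_def subgrp_def using subgrp_0[OF Wd(1)] subgrp_diff[OF Wd(1)] submD(2)[OF Ws]
        by (simp only: mem_Collect_eq e_diff e_sc e_0) blast
      show "Cb {..<?n} R'.ker \<subseteq> {u. ?e u \<in> W d}" for d using ek Wd(2) by blast
    qed simp
  next
    show "(\<lambda>d. {u. ?e u \<in> W d}) \<le> (\<lambda>d. {u. ?e u \<in> W' d})" if "W \<le> W'" for W W' :: "unit \<Rightarrow> 'p set"
      using that by (auto simp: le_fun_def)
  next
    fix W W' assume W: "fam scops (\<lambda>_::unit. UNIV) (\<lambda>_. kq) W" and W': "fam scops (\<lambda>_::unit. UNIV) (\<lambda>_. kq) W'"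
      and eq: "(\<lambda>d. {u. ?e u \<in> W d}) = (\<lambda>d. {u. ?e u \<in> W' d})"
    note Wd = famD[OF W] and Wd' = famD[OF W']
    have "x \<in> W d \<longleftrightarrow> x \<in> W' d" for x d
    proof -
      obtain u where u: "x - ?e u \<in> kq" using e_surj by blast
      have "x \<in> U \<longleftrightarrow> ?e u \<in> U" if U: "subgrp U" "kq \<subseteq> U" for U
        using subgrp_diff[OF U(1), of x "x - ?e u"] subgrp_cancel[OF U(1), of x "?e u"] u U(2) by auto
      moreover have "?e u \<in> W d \<longleftrightarrow> ?e u \<in> W' d" using fun_cong[OF eq, of d] by blast
      ultimately show ?thesis using Wd(1,2) Wd'(1,2) by blast
    qed
    then show "W = W'" by auto
  qed
qed

end

section \<open>The filtration by powers of an ideal\<close>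

lemma ideals_set_pow:
  "I [^]\<^bsub>ideals_set R\<^esub> (0::nat) = carrier R"
  "I [^]\<^bsub>ideals_set R\<^esub> Suc n = ideal_prod R (I [^]\<^bsub>ideals_set R\<^esub> n) I"
  by (simp_all add: nat_pow_def ideals_set_def)

lemma (in cring) ideal_pow: "ideal I R \<Longrightarrow> ideal (I [^]\<^bsub>ideals_set R\<^esub> (n::nat)) R"
  by (induction n) (simp_all only: ideals_set_pow oneideal ideal_prod_is_ideal)

lemma (in module) submodule_span: "S \<subseteq> carrier M \<Longrightarrow> submodule (span_module R M S) R M"
proof (rule submoduleI)
  assume S: "S \<subseteq> carrier M"
  have c: "submodule (carrier M) R M" by (rule submoduleI) auto
  note mem = span_module_def[of R M S]
  show "span_module R M S \<subseteq> carrier M" using c S by (auto simp: mem)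
  show "\<zero>\<^bsub>M\<^esub> \<in> span_module R M S" by (auto simp: mem submodule_def subgroup_def)
  show "\<ominus>\<^bsub>M\<^esub> x \<in> span_module R M S" if "x \<in> span_module R M S" for x
    using that subgroup.m_inv_closed[of _ "add_monoid M"] by (auto simp: mem submodule_def a_inv_def)
  show "x \<oplus>\<^bsub>M\<^esub> y \<in> span_module R M S" if "x \<in> span_module R M S" "y \<in> span_module R M S" for x y
    using that subgroup.m_closed[of _ "add_monoid M"] by (auto simp: mem submodule_def)
  show "a \<odot>\<^bsub>M\<^esub> x \<in> span_module R M S" if "a \<in> carrier R" "x \<in> span_module R M S" for a x
    using that by (auto simp: mem submodule.smult_closed)
qed

lemma span_module_superset: "S \<subseteq> span_module R M S"
  by (auto simp: span_module_def)

lemma submoduleD: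
  assumes "submodule K R M"
  shows "K \<subseteq> carrier M" "\<zero>\<^bsub>M\<^esub> \<in> K" "x \<in> K \<Longrightarrow> y \<in> K \<Longrightarrow> x \<oplus>\<^bsub>M\<^esub> y \<in> K" "x \<in> K \<Longrightarrow> \<ominus>\<^bsub>M\<^esub> x \<in> K"
    "a \<in> carrier R \<Longrightarrow> x \<in> K \<Longrightarrow> a \<odot>\<^bsub>M\<^esub> x \<in> K"
proof -
  have s: "subgroup K (add_monoid M)" using assms by (simp add: submodule_def)
  show "K \<subseteq> carrier M" "\<zero>\<^bsub>M\<^esub> \<in> K" "x \<in> K \<Longrightarrow> y \<in> K \<Longrightarrow> x \<oplus>\<^bsub>M\<^esub> y \<in> K" "x \<in> K \<Longrightarrow> \<ominus>\<^bsub>M\<^esub> x \<in> K"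
    using subgroup.subset[OF s] subgroup.one_closed[OF s] subgroup.m_closed[OF s] subgroup.m_inv_closed[OF s]
    by (auto simp: a_inv_def)
  show "a \<in> carrier R \<Longrightarrow> x \<in> K \<Longrightarrow> a \<odot>\<^bsub>M\<^esub> x \<in> K" by (rule submodule.smult_closed[OF assms])
qed

context module_cover
begin

abbreviation "pw I n \<equiv> ideal_times_module R (I [^]\<^bsub>ideals_set R\<^esub> (n::nat)) X"

lemma submodule_pw:
  assumes "ideal I R" shows "submodule (pw I n) R X"
proof -
  interpret ideal "I [^]\<^bsub>ideals_set R\<^esub> n" R by (rule ideal_pow[OF assms])
  show ?thesis unfolding ideal_times_module_def by (rule X.submodule_span) auto
qed

lemma pw_gen: "c \<in> I [^]\<^bsub>ideals_set R\<^esub> n \<Longrightarrow> y \<in> carrier X \<Longrightarrow> c \<odot>\<^bsub>X\<^esub> y \<in> pw I n"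
  unfolding ideal_times_module_def by (rule subsetD[OF span_module_superset]) blast

lemma pw_least:
  assumes "submodule K R X" "\<And>c y. c \<in> I [^]\<^bsub>ideals_set R\<^esub> n \<Longrightarrow> y \<in> carrier X \<Longrightarrow> c \<odot>\<^bsub>X\<^esub> y \<in> K"
  shows "pw I n \<subseteq> K"
  unfolding ideal_times_module_def by (rule span_module_least[OF assms(1)]) (use assms(2) in blast)

lemma pw_0: "ideal I R \<Longrightarrow> pw I 0 = carrier X"
proof
  assume I: "ideal I R"
  show "pw I 0 \<subseteq> carrier X" by (rule submoduleD(1)[OF submodule_pw[OF I]])
  show "carrier X \<subseteq> pw I 0" using pw_gen[of \<one> I 0] X.smult_one unfolding ideals_set_pow by fastforce
qed

text \<open>The elements that \<open>a\<close> sends into the next power form a submodule, so it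
  suffices to test the generators of \<open>pw I n\<close>.\<close>

lemma pw_step:
  assumes I: "ideal I R" and a: "a \<in> I" and y: "y \<in> pw I n"
  shows "a \<odot>\<^bsub>X\<^esub> y \<in> pw I (Suc n)"
proof -
  interpret I: ideal I R by fact
  interpret In: ideal "I [^]\<^bsub>ideals_set R\<^esub> n" R by (rule ideal_pow[OF I])
  have ac: "a \<in> carrier R" using a by simp
  note S = submoduleD[OF submodule_pw[OF I, of "Suc n"]]
  let ?K = "{y \<in> carrier X. a \<odot>\<^bsub>X\<^esub> y \<in> pw I (Suc n)}"
  have "pw I n \<subseteq> ?K"
  proof (rule pw_least)
    show "submodule ?K R X"
    proof (rule X.submoduleI)
      fix b x assume b: "b \<in> carrier R" and x: "x \<in> ?K"
      have "a \<odot>\<^bsub>X\<^esub> (b \<odot>\<^bsub>X\<^esub> x) = b \<odot>\<^bsub>X\<^esub> (a \<odot>\<^bsub>X\<^esub> x)"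
        using ac b x by (simp add: X.smult_assoc1[symmetric] m_comm)
      then show "b \<odot>\<^bsub>X\<^esub> x \<in> ?K" using b x S(5) by simp
    qed (use ac S in \<open>auto simp: X.smult_r_distr X.smult_r_minus\<close>)
    fix c y assume c: "c \<in> I [^]\<^bsub>ideals_set R\<^esub> n" and y: "y \<in> carrier X"
    have "c \<otimes> a \<in> I [^]\<^bsub>ideals_set R\<^esub> Suc n" unfolding ideals_set_pow by (rule ideal_prod.prod[OF c a])
    then have "(c \<otimes> a) \<odot>\<^bsub>X\<^esub> y \<in> pw I (Suc n)" using y by (rule pw_gen)
    moreover have "(c \<otimes> a) \<odot>\<^bsub>X\<^esub> y = a \<odot>\<^bsub>X\<^esub> (c \<odot>\<^bsub>X\<^esub> y)"
      using ac c y by (simp add: X.smult_assoc1[symmetric] m_comm)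
    ultimately show "c \<odot>\<^bsub>X\<^esub> y \<in> ?K" using c y by simp
  qed
  then show ?thesis using y by blast
qed

definition Nf :: "'a set \<Rightarrow> nat \<Rightarrow> 'p set" where
  "Nf I n = {x. q x \<in> pw I n}"

lemma subm_Nf: "ideal I R \<Longrightarrow> subm (Nf I n)"
  unfolding Nf_def by (rule subm_preimage[OF submodule_pw])

text \<open>This is the adic property \<open>Ngen\<close> of the locale \<open>rees\<close>: the
  next power is reached by one multiplication with elements of the ideal, up to the kernel of the
  cover.\<close>

lemma Nf_generated:
  assumes I: "ideal I R"
  shows "Nf I (Suc n) \<subseteq> gspan (kq \<union> {t \<bullet> x | t x. t \<in> {t. \<pi> t \<in> I} \<and> x \<in> Nf I n})" (is "_ \<subseteq> gspan ?S")
proof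
  fix x assume "x \<in> Nf I (Suc n)"
  interpret I: ideal I R by fact
  interpret In: ideal "I [^]\<^bsub>ideals_set R\<^esub> n" R by (rule ideal_pow[OF I])
  \<comment> \<open>The generating set is closed under scalars, which makes its additive span a
    submodule.\<close>
  have S: "s \<bullet> z \<in> ?S" if "z \<in> ?S" for s z
  proof -
    from that consider "z \<in> kq" | t x where "\<pi> t \<in> I" "x \<in> Nf I n" "z = t \<bullet> x" by blast
    then show ?thesis
    proof cases
      case 1
      then show ?thesis using submD(2)[OF subm_kq] by blast
    next
      case (2 t x)
      have "s \<bullet> z = t \<bullet> (s \<bullet> x)" unfolding 2(3) by (rule sc_left_commute)
      moreover have "s \<bullet> x \<in> Nf I n" by (rule submD(2)[OF subm_Nf[OF I] 2(2)])
      ultimately show ?thesis using 2(1) by blast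
    qed
  qed
  have "gspan ?S \<subseteq> {z. s \<bullet> z \<in> gspan ?S}" for s
  proof (rule gspan_least)
    show "subgrp {z. s \<bullet> z \<in> gspan ?S}"
      using subgrp_gspan[of ?S] by (simp add: subgrp_def sc_diff)
    show "?S \<subseteq> {z. s \<bullet> z \<in> gspan ?S}" by (rule subsetI, rule CollectI, rule subsetD[OF gspan_superset S])
  qed
  then have sub: "subm (gspan ?S)" using subgrp_gspan by (auto simp: subm_def)
  have "pw I (Suc n) \<subseteq> q ` gspan ?S"
  proof (rule pw_least[OF submodule_image[OF sub]])
    fix c y assume c: "c \<in> I [^]\<^bsub>ideals_set R\<^esub> Suc n" and y: "y \<in> carrier X"
    have "c \<in> carrier R \<and> c \<odot>\<^bsub>X\<^esub> y \<in> q ` gspan ?S"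
      using c unfolding ideals_set_pow
    \<comment> \<open>A product \<open>b a\<close> sends \<open>y\<close> to \<open>a\<close> times
      the element \<open>b y\<close>, and \<open>b y\<close> already lies in
      \<open>pw I n\<close>.\<close>
    proof (induction c rule: ideal_prod.induct)
      case (prod b a)
      obtain x where x: "y = q x" using y q_range by blast
      have "b \<in> range \<pi>" "a \<in> range \<pi>" unfolding pi_range using prod by simp_all
      then obtain s t where st: "b = \<pi> s" "a = \<pi> t" by (elim rangeE)
      have "q (s \<bullet> x) \<in> pw I n" unfolding q_sc st(1)[symmetric] by (rule pw_gen[OF prod(1) q_in])
      then have "t \<bullet> s \<bullet> x \<in> ?S" using prod(2) unfolding st(2) Nf_def by blast
      then have "q (t \<bullet> s \<bullet> x) \<in> q ` gspan ?S" by (intro imageI subsetD[OF gspan_superset])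
      moreover have "q (t \<bullet> s \<bullet> x) = (b \<otimes> a) \<odot>\<^bsub>X\<^esub> y"
        unfolding sc_left_commute[of t] by (simp add: q_sc st x X.smult_assoc1)
      ultimately show ?case by (simp add: st)
    next
      case (sum c c')
      then show ?case using y submoduleD(3)[OF submodule_image[OF sub]] by (simp add: X.smult_l_distr)
    qed
    then show "c \<odot>\<^bsub>X\<^esub> y \<in> q ` gspan ?S" by blast
  qed
  then obtain z where z: "z \<in> gspan ?S" "q x = q z" using \<open>x \<in> Nf I (Suc n)\<close> by (auto simp: Nf_def)
  have "x - z \<in> gspan ?S" using z(2) unfolding q_eq_iff by (rule subsetD[OF gspan_superset, OF UnI1])
  then show "x \<in> gspan ?S" using z(1) by (rule subgrp_cancel[OF subgrp_gspan])
qed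

lemma quotient_cover_module:
  assumes K: "submodule K R X"
  shows "module_cover R \<pi> (\<bullet>) (quot_module X K) (\<lambda>x. K +>\<^bsub>X\<^esub> q x)"
    "module_cover.kq (quot_module X K) (\<lambda>x. K +>\<^bsub>X\<^esub> q x) = {x. q x \<in> K}"
proof -
  note Q = quot_module_facts[OF X.module_axioms K]
  note l = linD[OF Q(6)]
  have "range (\<lambda>x. K +>\<^bsub>X\<^esub> q x) = (\<lambda>y. K +>\<^bsub>X\<^esub> y) ` range q" by auto
  then have r: "range (\<lambda>x. K +>\<^bsub>X\<^esub> q x) = carrier (quot_module X K)" by (simp only: Q(1) q_range)
  show c: "module_cover R \<pi> (\<bullet>) (quot_module X K) (\<lambda>x. K +>\<^bsub>X\<^esub> q x)"
    by (intro module_cover.intro ring_cover_axioms scal_axioms Q(5) module_cover_axioms.intro r)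
       (simp_all add: q_add q_sc l)
  show "module_cover.kq (quot_module X K) (\<lambda>x. K +>\<^bsub>X\<^esub> q x) = {x. q x \<in> K}"
    unfolding module_cover.kq_def[OF c] by (simp add: Q(2,3))
qed

lemma rees_cover:
  assumes I: "ideal I R" and T0: "idl T0" and reg: "reg T0 f C" and J: "Jk T0 f C = ker"
    and noeT: "noeth (scal.scops (*)) (\<lambda>_::unit. UNIV) (\<lambda>_. T0)" and noeP: "noeth scops (\<lambda>_::unit. UNIV) (\<lambda>_. kq)"
  shows "rees (\<bullet>) T0 f C {t. \<pi> t \<in> I} kq (Nf I)"
proof (unfold_locales)
  interpret I: ideal I R by fact
  show "idl {t. \<pi> t \<in> I}" by (rule idl_preimage[OF I])
  show "Jk T0 f C \<subseteq> {t. \<pi> t \<in> I}" unfolding J by (auto simp: ker_def)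
  show "subm (Nf I n)" for n by (rule subm_Nf[OF I])
  show "kq \<subseteq> Nf I n" for n using submoduleD(2)[OF submodule_pw[OF I]] by (auto simp: kq_def Nf_def)
  show "Nf I 0 = UNIV" unfolding Nf_def pw_0[OF I] by simp
  show "t \<bullet> x \<in> kq" if "t \<in> Jk T0 f C" for t x using that by (simp add: J ker_def kq_def q_sc)
  show "t \<bullet> x \<in> Nf I (Suc n)" if "t \<in> {t. \<pi> t \<in> I}" "x \<in> Nf I n" for t x n
    using that pw_step[OF I] by (simp add: Nf_def q_sc)
  show "Nf I (Suc n) \<subseteq> gspan (kq \<union> {t \<bullet> x | t x. t \<in> {t. \<pi> t \<in> I} \<and> x \<in> Nf I n})" for n by (rule Nf_generated[OF I])
qed (rule assms subm_kq)+

end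

section \<open>Stability of associated primes of Ext over a covered ring\<close>

lemma module_restrict_scalars:
  assumes Q: "cring Q" and M: "module A M" and hom: "h \<in> ring_hom Q A"
  shows "module Q (restrict_scalars h M)"
proof -
  interpret M: module A M by fact
  have simps: "carrier (restrict_scalars h M) = carrier M" "\<zero>\<^bsub>restrict_scalars h M\<^esub> = \<zero>\<^bsub>M\<^esub>"
    "x \<oplus>\<^bsub>restrict_scalars h M\<^esub> y = x \<oplus>\<^bsub>M\<^esub> y" "a \<odot>\<^bsub>restrict_scalars h M\<^esub> x = h a \<odot>\<^bsub>M\<^esub> x" for x y a
    by (simp_all add: restrict_scalars_def)
  show ?thesis
  proof (rule moduleI)
    show "cring Q" by (rule Q)
    show "abelian_group (restrict_scalars h M)"
    proof (rule abelian_groupI)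
      fix x assume "x \<in> carrier (restrict_scalars h M)"
      then show "\<exists>y\<in>carrier (restrict_scalars h M). y \<oplus>\<^bsub>restrict_scalars h M\<^esub> x = \<zero>\<^bsub>restrict_scalars h M\<^esub>"
        by (intro bexI[of _ "\<ominus>\<^bsub>M\<^esub> x"]) (simp_all add: simps M.M.l_neg)
    qed (auto simp: simps M.M.a_ac)
  qed (use ring_hom_closed[OF hom] in \<open>auto simp: simps ring_hom_add[OF hom] ring_hom_mult[OF hom] ring_hom_one[OF hom]
        M.smult_l_distr M.smult_r_distr M.smult_assoc1\<close>)
qed

lemma proj_dim_finite:
  fixes R :: "('a, 'b) ring_scheme"
  assumes "proj_dim R M < \<infinity>"
  obtains n and P :: "nat \<Rightarrow> ('a, nat \<Rightarrow> 'a) module" and d e where "projective_resolution R M P d e"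
    "\<And>i. i > n \<Longrightarrow> carrier (P i) = {\<zero>\<^bsub>P i\<^esub>}"
proof -
  let ?S = "{enat n | n. \<exists>(P :: nat \<Rightarrow> ('a, nat \<Rightarrow> 'a) module) d \<epsilon>. projective_resolution R M P d \<epsilon> \<and>
       (\<forall>i>n. carrier (P i) = {\<zero>\<^bsub>P i\<^esub>})}"
  have "?S \<noteq> {}"
  proof
    assume "?S = {}"
    then have "proj_dim R M = Inf {}" unfolding proj_dim_def by (rule arg_cong)
    then show False using assms by (simp add: Inf_enat_def)
  qed
  then show thesis using that by blast
qed

text \<open>With no equations the matrices resolve \<open>M\<close> over \<open>R\<close> itself,
  and comparison with a finite projective resolution contracts them in high degrees. The map
  \<open>\<rho>'\<close> undoes the renumbering of the generators.\<close>

lemma (in ring_cover) matrix_vanishing: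
  assumes M: "module R M" and g: "g \<in> {..<r0} \<rightarrow> carrier M"
    and span: "\<And>x. x \<in> carrier M \<Longrightarrow> \<exists>u. x = evm R M {..<r0} g (vec {..<r0} u)"
    and pd: "proj_dim R M < \<infinity>" and cd: "cdata ker f 0 \<beta> D S"
    and ex: "exact ker {v. evm R M {..<r0} g (vec {..<r0} v) = \<zero>\<^bsub>M\<^esub>} \<beta> D \<rho>" and bij: "bij_betw \<rho> {..<r0} (\<beta> 0)"
  shows "\<exists>n. \<forall>i>int n. \<exists>s s'. \<forall>b\<in>\<beta> i. \<forall>k\<in>\<beta> i.
    (if b = k then 1 else 0) - mm (\<beta> (i + 1)) (D i) s b k - mm (\<beta> (i - 1)) s' (D (i - 1)) b k \<in> ker"
proof -
  interpret M: module R M by fact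
  obtain n and P :: "nat \<Rightarrow> ('a, nat \<Rightarrow> 'a) module" and d e where P: "projective_resolution R M P d e"
    and van: "\<And>i. i > n \<Longrightarrow> carrier (P i) = {\<zero>\<^bsub>P i\<^esub>}" by (rule proj_dim_finite[OF pd]) blast
  have "\<exists>h. dualb R (P i) (carrier (P i)) (\<lambda>x. x) h" for i
  proof -
    have "projective_module R (P i)" using P by (simp add: projective_resolution_def)
    then show ?thesis by (rule projective_dualb) blast
  qed
  then obtain h where du: "\<And>i. dualb R (P i) (carrier (P i)) (\<lambda>x. x) (h i)" by metis
  define \<rho>' where "\<rho>' = inv_into {..<r0} \<rho>"
  have inj: "inj_on \<rho>' (\<beta> 0)" and im: "\<rho>' ` \<beta> 0 = {..<r0}"
    using bij_betw_inv_into[OF bij] by (auto simp: bij_betw_def \<rho>'_def)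
  have inv: "\<rho> (\<rho>' b) = b" if "b \<in> \<beta> 0" for b
    unfolding \<rho>'_def using bij that by (intro f_inv_into_f) (simp add: bij_betw_def)
  have r0: "\<rho>' b < r0" if "b \<in> \<beta> 0" for b using im that by auto
  have g': "(\<lambda>b. g (\<rho>' b)) \<in> \<beta> 0 \<rightarrow> carrier M" using g r0 by auto
  note fin = cdataD(1)[OF cd]
  have ev: "evm R M (\<beta> 0) (\<lambda>b. g (\<rho>' b)) (vec (\<beta> 0) (\<lambda>b. v (\<rho>' b))) = evm R M {..<r0} g (vec {..<r0} v)" for v
  proof -
    have "(\<Oplus>\<^bsub>M\<^esub>c\<in>\<rho>' ` \<beta> 0. \<pi> (v c) \<odot>\<^bsub>M\<^esub> g c) = (\<Oplus>\<^bsub>M\<^esub>b\<in>\<beta> 0. \<pi> (v (\<rho>' b)) \<odot>\<^bsub>M\<^esub> g (\<rho>' b))"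
      by (rule M.M.finsum_reindex[OF _ inj]) (use g' in auto)
    then show ?thesis by (simp add: evm_vec[OF M g'] evm_vec[OF M g] fin im)
  qed
  have F: "resolution R M (Fs \<beta>) (ds \<beta> D) (evm R M (\<beta> 0) (\<lambda>b. g (\<rho>' b)))"
  proof (rule matrix_resolution[where \<beta> = \<beta> and \<rho> = \<rho> and \<rho>' = \<rho>', OF fin M g' _ _ _ inv])
    fix x assume "x \<in> carrier M"
    then obtain u where u: "x = evm R M {..<r0} g (vec {..<r0} u)" using span by blast
    show "\<exists>u. x = evm R M (\<beta> 0) (\<lambda>b. g (\<rho>' b)) (vec (\<beta> 0) u)" unfolding u ev[symmetric] by blast
  next
    show "mm (\<beta> (i + 1)) (D i) (D (i + 1)) b k \<in> ker" if "b \<in> \<beta> i" "k \<in> \<beta> (i + 2)" for i b k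
      using cdataD(3)[OF cd that] by simp
    show "exact ker {v. evm R M (\<beta> 0) (\<lambda>b. g (\<rho>' b)) (vec (\<beta> 0) (\<lambda>b. v (\<rho>' b))) = \<zero>\<^bsub>M\<^esub>} \<beta> D \<rho>"
      unfolding ev by (rule ex)
  qed
  show ?thesis
  proof (intro exI[of _ n] allI impI)
    fix i assume i: "i > int n"
    show "\<exists>s s'. \<forall>b\<in>\<beta> i. \<forall>k\<in>\<beta> i.
      (if b = k then 1 else 0) - mm (\<beta> (i + 1)) (D i) s b k - mm (\<beta> (i - 1)) s' (D (i - 1)) b k \<in> ker"
      by (rule matrix_contraction[OF fin F projective_resolution_resolution[OF M P] du van i]) blast+
  qed
qed

text \<open>\<open>Ext\<close> rests on a chosen resolution; \<open>asc_resolution\<close> in both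
  directions replaces it by the matrix resolution, where cochains are tuples.\<close>

lemma (in module_cover) associated_primes_Ext:
  assumes fin: "\<And>i. finite (\<beta> i)" and F: "resolution R M (Fs \<beta>) (ds \<beta> D) e" and N: "N n = kq" and j: "i = int j + 1"
  shows "associated_primes R (Ext R (Suc j) M X) = {p. primeideal p R \<and>
    scal.assp vsc (Zc \<beta> D (\<lambda>_. UNIV) N (n, i)) (Bc \<beta> D (\<lambda>_. UNIV) N (n, i)) {t. \<pi> t \<in> p}}"
proof -
  interpret F: resolution R M "Fs \<beta>" "ds \<beta> D" e by fact
  let ?S = "\<lambda>(P :: nat \<Rightarrow> ('a, nat \<Rightarrow> 'a) module, d). \<exists>\<epsilon>. projective_resolution R M P d \<epsilon>"
  have duF: "dualb R (Fs \<beta> i) (\<beta> (int i)) unit (\<lambda>x. x)" for i unfolding Fs_def by (rule dualb_FR[OF fin])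
  obtain P d where Pd: "(SOME x. ?S x) = (P, d)" by (cases "SOME x. ?S x") blast
  \<comment> \<open>The matrix resolution itself witnesses that the choice made in
    \<open>Ext\<close> is not vacuous.\<close>
  have "\<exists>x. ?S x" using resolution_projective_resolution[OF F duF] by (auto intro!: exI)
  from someI_ex[OF this] obtain e' where P: "projective_resolution R M P d e'" by (auto simp: Pd)
  then have R: "resolution R M P d e'" by (rule projective_resolution_resolution[OF F.M])
  interpret P: resolution R M P d e' by (rule R)
  have "\<exists>h. dualb R (P i) (carrier (P i)) (\<lambda>x. x) h" for i
  proof -
    have "projective_module R (P i)" using P by (simp add: projective_resolution_def)
    then show ?thesis by (rule projective_dualb) blast
  qed
  then obtain h where du: "\<And>i. dualb R (P i) (carrier (P i)) (\<lambda>x. x) (h i)" by metis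
  have "Ext R (Suc j) M X = Hom_cohomology R P d X (Suc j)" by (simp add: Ext_def Pd)
  moreover have "asc R P d X j p \<longleftrightarrow> asc R (Fs \<beta>) (ds \<beta> D) X j p" for p
    using asc_resolution[OF R F du duF X.module_axioms] asc_resolution[OF F R duF du X.module_axioms] by blast
  ultimately show ?thesis
    using associated_primes_Hom_cohomology[where P = P and d = d and j = j, OF P.P P.d P.dd X.module_axioms] asc_matrix[where \<beta> = \<beta> and N = N and n = n and j = j, OF fin _ N j]
    by auto
qed

text \<open>The covers of \<open>Q\<close> and \<open>N\<close> are hypotheses here, so that the
  argument runs in type classes; suitable covers are constructed afterwards. The parameter
  \<open>r\<close> treats both parities at once.\<close>

theorem associated_primes_Ext_stable:
  fixes Q :: "('q, 'b) ring_scheme" and fs :: "'q list" and M :: "('q set, 'm, 'c) module_scheme"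
    and N :: "('q set, 'n, 'd) module_scheme" and \<pi> :: "'t::comm_ring_1 \<Rightarrow> 'q" and sc :: "'t \<Rightarrow> 'p::ab_group_add \<Rightarrow> 'p"
  defines "G \<equiv> genideal Q (set fs)"
  defines "A \<equiv> Q Quot G"
  assumes noe: "noetherian_ring Q" and rs: "regular_sequence Q fs"
    and M: "module A M" and fgM: "fin_gen_module A M" and fgN: "fin_gen_module A N"
    and pd: "proj_dim Q (restrict_scalars (\<lambda>x. G +>\<^bsub>Q\<^esub> x) M) < \<infinity>" and I: "ideal I A"
    and covQ: "ring_cover Q \<pi>" and covN: "module_cover A (\<lambda>t. G +>\<^bsub>Q\<^esub> \<pi> t) sc N q"
  shows "\<exists>(n0 :: nat) (i0 :: nat). \<forall>n\<ge>n0. \<forall>i\<ge>i0. \<forall>r\<in>{0, 1}.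
    associated_primes A (Ext A (2 * i + r) M (quot_module N (ideal_times_module A (I [^]\<^bsub>ideals_set A\<^esub> n) N))) =
    associated_primes A (Ext A (2 * i0 + r) M (quot_module N (ideal_times_module A (I [^]\<^bsub>ideals_set A\<^esub> n0) N)))"
proof -
  let ?p = "\<lambda>t. G +>\<^bsub>Q\<^esub> \<pi> t"
  interpret c: ring_cover Q \<pi> by fact
  interpret m: module_cover A ?p sc N q by fact
  interpret M: module A M by fact
  have fs: "set fs \<subseteq> carrier Q" using rs by (simp add: regular_sequence_def)
  have Gi: "ideal G Q" unfolding G_def by (rule c.genideal_ideal[OF fs])
  define f where "f = (\<lambda>j. c.lft (fs ! j))"
  let ?C = "length fs"
  have J: "Jk c.ker f ?C = m.ker"
    using c.Jk_ker[OF fs order_refl] c.quotient_ker[OF Gi] by (simp add: f_def G_def A_def)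
  have reg: "reg c.ker f ?C" unfolding f_def by (rule c.reg_ker[OF rs])
  note noeT = c.noeth_ker[OF noe]
  have "c.ker \<subseteq> m.ker" using Jk_mono[OF c.idl_ker, of 0 ?C f] J by simp
  note noeP = m.noeth_kq[OF noe covQ this fgN]
  interpret R: rees sc c.ker f ?C "{t. ?p t \<in> I}" m.kq "m.Nf I" by (rule m.rees_cover[OF I c.idl_ker reg J noeT noeP])
  obtain Gs where Gs: "finite Gs" "Gs \<subseteq> carrier M" "span_module A M Gs = carrier M" using fgM by (auto simp: fin_gen_module_def)
  obtain gs where gs: "Gs = set gs" using finite_list[OF Gs(1)] by blast
  define g where "g l = gs ! l" for l
  let ?r = "length gs"
  have g: "g \<in> {..<?r} \<rightarrow> carrier M" using Gs(2) by (auto simp: gs g_def)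
  have lin: "lin A (FR A {..<?r}) M (evm A M {..<?r} g)" by (rule lin_evm[OF M g])
  have span: "\<exists>u. x = evm A M {..<?r} g (m.vec {..<?r} u)" if "x \<in> carrier M" for x
  proof -
    let ?K = "evm A M {..<?r} g ` carrier (FR A {..<?r})"
    interpret F: module A "FR A {..<?r}" by (rule module_FR[OF m.is_cring])
    have "submodule ?K A M"
    proof (rule M.submoduleI)
      show "?K \<subseteq> carrier M" using linD(1)[OF lin] by blast
      show "\<zero>\<^bsub>M\<^esub> \<in> ?K" using lin_zero[OF F.module_axioms M lin] by (metis F.zero_closed image_eqI)
      fix x assume "x \<in> ?K"
      then obtain u where u: "u \<in> carrier (FR A {..<?r})" "x = evm A M {..<?r} g u" by blast
      show "\<ominus>\<^bsub>M\<^esub> x \<in> ?K" using lin_minus(1)[OF F.module_axioms M lin u(1) u(1)] u F.a_inv_closed[OF u(1)] by (metis image_eqI)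
      show "a \<odot>\<^bsub>M\<^esub> x \<in> ?K" if "a \<in> carrier A" for a
        using linD(3)[OF lin that u(1)] u(2) F.smult_closed[OF that u(1)] by (metis image_eqI)
      fix y assume "y \<in> ?K"
      then obtain v where v: "v \<in> carrier (FR A {..<?r})" "y = evm A M {..<?r} g v" by blast
      show "x \<oplus>\<^bsub>M\<^esub> y \<in> ?K" using linD(2)[OF lin u(1) v(1)] u(2) v(2) F.a_closed[OF u(1) v(1)] by (metis image_eqI)
    qed
    moreover have "Gs \<subseteq> ?K"
    proof
      fix y assume "y \<in> Gs"
      then obtain l where l: "l \<in> {..<?r}" "y = g l" by (auto simp: gs g_def in_set_conv_nth)
      then show "y \<in> ?K" using evm_unit[OF M g l(1)] FR_unit[OF m.is_cring l(1)] by (metis image_eqI)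
    qed
    ultimately have "carrier M \<subseteq> ?K" using Gs(3) m.span_module_least unfolding span_module_def by blast
    then have "x \<in> ?K" using that by (rule subsetD)
    then show ?thesis by (auto elim!: m.vec_cases)
  qed
  define \<K> where "\<K> = {v. evm A M {..<?r} g (m.vec {..<?r} v) = \<zero>\<^bsub>M\<^esub>}"
  have vd: "m.vec {..<?r} (x - y) = m.vec {..<?r} x \<ominus>\<^bsub>FR A {..<?r}\<^esub> m.vec {..<?r} y" for x y
  proof -
    interpret F: module A "FR A {..<?r}" by (rule module_FR[OF m.is_cring])
    have "m.vec {..<?r} (x - y) \<oplus>\<^bsub>FR A {..<?r}\<^esub> m.vec {..<?r} y = m.vec {..<?r} x" by (simp add: m.vec_add)
    then show ?thesis
      using m.vec_in[of "{..<?r}"] by (metis F.M.a_assoc F.M.a_closed F.M.a_inv_closed F.M.minus_eq F.M.r_neg F.M.r_zero finite_lessThan)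
  qed
  have K: "submv \<K>" "Cb {..<?r} (Jk c.ker f ?C) \<subseteq> \<K>"
  proof -
    have in_: "m.vec {..<?r} u \<in> carrier (FR A {..<?r})" for u by (rule m.vec_in) simp
    interpret F: module A "FR A {..<?r}" by (rule module_FR[OF m.is_cring])
    have z: "m.vec {..<?r} 0 = \<zero>\<^bsub>FR A {..<?r}\<^esub>" by (simp add: m.vec_zero_iff m.idl_ker[THEN idlD(1), THEN subgrp_0])
    show "submv \<K>" unfolding submv_def subgrp_def
    proof (intro conjI ballI allI)
      show "0 \<in> \<K>" by (simp add: \<K>_def z lin_zero[OF F.module_axioms M lin])
      fix x t assume x: "x \<in> \<K>"
      have "evm A M {..<?r} g (?p t \<odot>\<^bsub>FR A {..<?r}\<^esub> m.vec {..<?r} x) = \<zero>\<^bsub>M\<^esub>"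
        using x by (simp add: \<K>_def linD(3)[OF lin m.pi_in in_])
      then show "(\<lambda>b. t * x b) \<in> \<K>" by (simp add: \<K>_def m.vec_smult)
      fix y assume y: "y \<in> \<K>"
      then show "x - y \<in> \<K>" using x
        by (simp add: \<K>_def vd lin_minus(2)[OF F.module_axioms M lin in_ in_]; simp add: a_minus_def M.M.minus_zero_eq)
    qed
    show "Cb {..<?r} (Jk c.ker f ?C) \<subseteq> \<K>"
    proof
      fix v assume "v \<in> Cb {..<?r} (Jk c.ker f ?C)"
      then have "m.vec {..<?r} v = \<zero>\<^bsub>FR A {..<?r}\<^esub>" unfolding m.vec_zero_iff J by (simp add: Cb_def)
      then show "v \<in> \<K>" by (simp add: \<K>_def lin_zero[OF F.module_axioms M lin])
    qed
  qed
  obtain \<beta> D S where cd: "cdata c.ker f ?C \<beta> D S" and ex: "exact (Jk c.ker f ?C) \<K> \<beta> D (\<lambda>b. b)" and \<beta>0: "\<beta> 0 = {..<?r}"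
    by (rule matrix_resolution_exists[OF noeT c.idl_ker K])
  note fin = cdataD(1)[OF cd]
  have F: "resolution A M (m.Fs \<beta>) (m.ds \<beta> D) (evm A M (\<beta> 0) g)"
  proof (rule m.matrix_resolution[OF fin M, where \<rho> = "\<lambda>b. b" and \<rho>' = "\<lambda>b. b"])
    show "mm (\<beta> (i + 1)) (D i) (D (i + 1)) b k \<in> m.ker" if "b \<in> \<beta> i" "k \<in> \<beta> (i + 2)" for i b k
      using cdataD(3)[OF cd that] unfolding J[symmetric] Jk_iff[OF c.idl_ker] by (intro exI[of _ "\<lambda>j. S j i b k"])
  qed (use g span ex in \<open>simp_all add: \<beta>0 J \<K>_def\<close>)
  let ?MQ = "restrict_scalars (\<lambda>x. G +>\<^bsub>Q\<^esub> x) M"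
  have MQ_simps: "carrier ?MQ = carrier M" "\<zero>\<^bsub>?MQ\<^esub> = \<zero>\<^bsub>M\<^esub>" "x \<oplus>\<^bsub>?MQ\<^esub> y = x \<oplus>\<^bsub>M\<^esub> y" "a \<odot>\<^bsub>?MQ\<^esub> x = (G +>\<^bsub>Q\<^esub> a) \<odot>\<^bsub>M\<^esub> x" for x y a
    by (simp_all add: restrict_scalars_def)
  have hom: "(\<lambda>x. G +>\<^bsub>Q\<^esub> x) \<in> ring_hom Q A" unfolding A_def by (rule ideal.rcos_ring_hom[OF Gi])
  have MQ: "module Q ?MQ" by (rule module_restrict_scalars[OF c.is_cring M hom])
  have gQ: "g \<in> {..<?r} \<rightarrow> carrier ?MQ" using g by (simp add: MQ_simps)
  have evQ: "evm Q ?MQ {..<?r} g (c.vec {..<?r} v) = evm A M {..<?r} g (m.vec {..<?r} v)" for v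
  proof -
    \<comment> \<open>\<open>finsum\<close> depends only on the additive structure, which
      restriction of scalars leaves unchanged.\<close>
    have "finsum ?MQ = (finsum M :: (nat \<Rightarrow> 'm) \<Rightarrow> _)" by (simp add: finsum_def finprod_def restrict_scalars_def fun_eq_iff)
    then show ?thesis by (simp add: c.evm_vec[OF MQ gQ] m.evm_vec[OF M g] MQ_simps)
  qed
  \<comment> \<open>Once all equations are removed the complex resolves \<open>M\<close> as a module
    over \<open>Q\<close>; here the finite projective dimension enters.\<close>
  have van: "\<exists>m. \<forall>i>m. \<forall>n. Zc' \<beta>' D' X X' (n, i) \<subseteq> Bc' \<beta>' D' X X' (n, i)"
    if co: "coefs sc c.ker f ?C {t. ?p t \<in> I} X X'" and cd': "cdata c.ker f 0 \<beta>' D' S'" and ex': "exact c.ker \<K> \<beta>' D' \<rho>"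
      and bij: "bij_betw \<rho> {..<?r} (\<beta>' 0)" and Z: "Zc' = m.Zc" "Bc' = m.Bc" for X X' \<beta>' D' S' \<rho> Zc' Bc'
  proof -
    have spanQ: "\<exists>u. x = evm Q ?MQ {..<?r} g (c.vec {..<?r} u)" if "x \<in> carrier ?MQ" for x
      using that unfolding evQ MQ_simps by (rule span)
    have exQ: "exact c.ker {v. evm Q ?MQ {..<?r} g (c.vec {..<?r} v) = \<zero>\<^bsub>?MQ\<^esub>} \<beta>' D' \<rho>"
      using ex' unfolding evQ MQ_simps \<K>_def .
    obtain n where n: "\<forall>i>int n. \<exists>s s'. \<forall>b\<in>\<beta>' i. \<forall>k\<in>\<beta>' i. (if b = k then 1 else 0)
        - mm (\<beta>' (i + 1)) (D' i) s b k - mm (\<beta>' (i - 1)) s' (D' (i - 1)) b k \<in> c.ker"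
      using c.matrix_vanishing[OF MQ gQ spanQ pd cd' exQ bij] by (rule exE)
    have "m.Zc \<beta>' D' X X' (n', i) \<subseteq> m.Bc \<beta>' D' X X' (n', i)" if i: "i > int n" for i n'
    proof -
      obtain s s' where "\<And>b k. b \<in> \<beta>' i \<Longrightarrow> k \<in> \<beta>' i \<Longrightarrow> (if b = k then 1 else 0)
        - mm (\<beta>' (i + 1)) (D' i) s b k - mm (\<beta>' (i - 1)) s' (D' (i - 1)) b k \<in> c.ker" using n[rule_format, OF i] by blast
      then show ?thesis by (rule coefs.vanishing[OF co cd'])
    qed
    then show ?thesis unfolding Z by blast
  qed
  have bij: "bij_betw (\<lambda>b. b) {..<?r} (\<beta> 0)" by (simp add: \<beta>0 bij_betw_def)
  \<comment> \<open>The graded coefficients are a quotient of the Rees coefficients, since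
    \<open>m.kq\<close> lies in every \<open>m.Nf I (Suc n)\<close>.\<close>
  have noethG: "noeth (scal.scops m.vsc \<union> Pair Suc ` m.\<Theta>A {t. ?p t \<in> I}) (\<lambda>n. Cb \<gamma> (m.Nf I n)) (\<lambda>n. Cb \<gamma> (m.Nf I (Suc n)))"
    if "finite \<gamma>" for \<gamma>
    by (rule noeth_mono[OF R.rees_noeth[OF that] order_refl Cb_mono[OF R.P0N] order_refl])
  interpret P: powers_cohomology sc c.ker f ?C "{t. ?p t \<in> I}" m.kq "m.Nf I" \<beta> D S
  proof
    show "cdata c.ker f ?C \<beta> D S" by (rule cd)
    show "noeth (m.Om {t. ?p t \<in> I} ?C \<beta> S) (m.Zc \<beta> D (m.Nf I) (\<lambda>_. m.kq)) (m.Bc \<beta> D (m.Nf I) (\<lambda>_. m.kq))"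
      by (rule coefs.cohomology_noeth[OF R.coefs_R R.rees_noeth van[OF R.coefs_R _ _ _ refl refl] order_refl cd ex bij])
    show "noeth (m.Om {t. ?p t \<in> I} ?C \<beta> S) (m.Zc \<beta> D (m.Nf I) (\<lambda>n. m.Nf I (Suc n))) (m.Bc \<beta> D (m.Nf I) (\<lambda>n. m.Nf I (Suc n)))"
      by (rule coefs.cohomology_noeth[OF R.coefs_G noethG van[OF R.coefs_G _ _ _ refl refl] order_refl cd ex bij])
  qed
  obtain n0 k0 where stable: "\<And>n k p r. n \<ge> n0 \<Longrightarrow> k \<ge> k0 \<Longrightarrow> r \<in> {0, 1} \<Longrightarrow>
    scal.assp m.vsc (P.Uc (n, 2 * int k + r)) (P.Fc (n, 2 * int k + r)) p \<longleftrightarrow>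
    scal.assp m.vsc (P.Uc (n0, 2 * int k0 + r)) (P.Fc (n0, 2 * int k0 + r)) p"
    using P.assp_powers_stable by blast
  let ?X = "\<lambda>n. quot_module N (ideal_times_module A (I [^]\<^bsub>ideals_set A\<^esub> n) N)"
  have main: "associated_primes A (Ext A (2 * i + r) M (?X n)) = {p. primeideal p A \<and>
      scal.assp m.vsc (P.Uc (n0, 2 * int k0 + int r)) (P.Fc (n0, 2 * int k0 + int r)) {t. ?p t \<in> p}}"
    if n: "n \<ge> n0" and i: "i \<ge> Suc k0" and r: "r \<in> {0, 1}" for n i r
  proof -
    note Xc = m.quotient_cover_module[OF m.submodule_pw[OF I, of n]]
    \<comment> \<open>\<open>associated_primes_Ext\<close> treats degrees of the form
      \<open>Suc j\<close>; the bound \<open>Suc k0\<close> on \<open>i\<close> makes the degree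
      positive.\<close>
    have e: "2 * i + r = Suc (2 * i + r - 1)" "2 * int i + int r = int (2 * i + r - 1) + 1" using i by auto
    have kq: "m.Nf I n = module_cover.kq (?X n) (\<lambda>x. ideal_times_module A (I [^]\<^bsub>ideals_set A\<^esub> n) N +>\<^bsub>N\<^esub> q x)"
      unfolding m.Nf_def Xc(2) ..
    have "associated_primes A (Ext A (Suc (2 * i + r - 1)) M (?X n)) = {p. primeideal p A \<and>
      scal.assp m.vsc (P.Uc (n, 2 * int i + int r)) (P.Fc (n, 2 * int i + int r)) {t. ?p t \<in> p}}"
      by (rule module_cover.associated_primes_Ext[where \<beta> = \<beta> and N = "m.Nf I" and n = n, OF Xc(1) fin F kq e(2)])
    then show ?thesis unfolding e(1)[symmetric] using stable[of n i "int r"] n i r by auto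
  qed
  show ?thesis
  proof (rule exI[of _ n0], rule exI[of _ "Suc k0"], intro allI impI ballI)
    fix n i and r :: nat assume h: "n0 \<le> n" "Suc k0 \<le> i" "r \<in> {0, 1}"
    show "associated_primes A (Ext A (2 * i + r) M (?X n)) = associated_primes A (Ext A (2 * Suc k0 + r) M (?X n0))"
      unfolding main[OF h] main[OF order_refl order_refl h(3)] by (rule refl)
  qed
qed

section \<open>Products over all module structures\<close>

text \<open>Every ring and module on given types is a quotient of these two types, so the type-class algebra
  above applies to rings and modules with carriers. The integer component makes $0 \neq 1$.\<close>

type_synonym ('q, 'n) structure_pair = "'q ring \<times> ('q, 'n) module"

abbreviation modp :: "('q, 'n) structure_pair \<Rightarrow> bool" where
  "modp k \<equiv> module (fst k) (snd k)"

text \<open>A type cannot depend on the given ring, hence a product over all structures at once. It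
  runs over pairs of a ring and a module over it, so that \<open>ring_prod\<close> acts on
  \<open>module_prod\<close> factor by factor.\<close>

typedef ('q, 'n) ring_prod = "{zf :: int \<times> (('q, 'n) structure_pair \<Rightarrow> 'q).
    \<forall>k. (modp k \<longrightarrow> snd zf k \<in> carrier (fst k)) \<and> (\<not> modp k \<longrightarrow> snd zf k = undefined)}"
  by (rule exI[of _ "(0, \<lambda>k. if modp k then zero (fst k) else undefined)"])
     (auto simp: module_def cring_def ring.ring_simprules)

typedef ('q, 'n) module_prod = "{g :: ('q, 'n) structure_pair \<Rightarrow> 'n.
    \<forall>k. (modp k \<longrightarrow> g k \<in> carrier (snd k)) \<and> (\<not> modp k \<longrightarrow> g k = undefined)}"
  by (rule exI[of _ "\<lambda>k. if modp k then zero (snd k) else undefined"])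
     (auto simp: module_def abelian_group_def abelian_monoid.zero_closed)

setup_lifting type_definition_ring_prod
setup_lifting type_definition_module_prod

declare split_paired_All [simp del]

lemma modp_cring: "modp k \<Longrightarrow> cring (fst k)"
  and modp_abelian: "modp k \<Longrightarrow> abelian_group (snd k)"
  and modp_abelian_monoid: "modp k \<Longrightarrow> abelian_monoid (snd k)"
  by (auto simp: module_def abelian_group_def)

lemmas modp_simps = cring.cring_simprules[OF modp_cring]

lemmas modp_module_simps = abelian_monoid.a_assoc[OF modp_abelian_monoid] abelian_monoid.a_closed[OF modp_abelian_monoid]
  abelian_monoid.a_comm[OF modp_abelian_monoid] abelian_monoid.a_lcomm[OF modp_abelian_monoid] abelian_monoid.l_zero[OF modp_abelian_monoid] abelian_monoid.r_zero[OF modp_abelian_monoid]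
  abelian_monoid.zero_closed[OF modp_abelian_monoid] abelian_group.l_neg[OF modp_abelian] abelian_group.r_neg[OF modp_abelian]
  abelian_group.a_inv_closed[OF modp_abelian]
  module.smult_closed module.smult_r_distr module.smult_l_distr module.smult_assoc1 module.smult_one

instantiation ring_prod :: (type, type) comm_ring_1
begin

lift_definition zero_ring_prod :: "('a, 'b) ring_prod" is
  "(0, \<lambda>k. if modp k then zero (fst k) else undefined)"
  by (simp add: modp_simps)

lift_definition one_ring_prod :: "('a, 'b) ring_prod" is
  "(1, \<lambda>k. if modp k then one (fst k) else undefined)"
  by (simp add: modp_simps)

lift_definition plus_ring_prod :: "('a, 'b) ring_prod \<Rightarrow> ('a, 'b) ring_prod \<Rightarrow> ('a, 'b) ring_prod" is
  "\<lambda>s t. (fst s + fst t, \<lambda>k. if modp k then snd s k \<oplus>\<^bsub>fst k\<^esub> snd t k else undefined)"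
  by (simp add: modp_simps)

lift_definition times_ring_prod :: "('a, 'b) ring_prod \<Rightarrow> ('a, 'b) ring_prod \<Rightarrow> ('a, 'b) ring_prod" is
  "\<lambda>s t. (fst s * fst t, \<lambda>k. if modp k then snd s k \<otimes>\<^bsub>fst k\<^esub> snd t k else undefined)"
  by (simp add: modp_simps)

lift_definition uminus_ring_prod :: "('a, 'b) ring_prod \<Rightarrow> ('a, 'b) ring_prod" is
  "\<lambda>s. (- fst s, \<lambda>k. if modp k then \<ominus>\<^bsub>fst k\<^esub> snd s k else undefined)"
  by (simp add: modp_simps)

definition minus_ring_prod :: "('a, 'b) ring_prod \<Rightarrow> ('a, 'b) ring_prod \<Rightarrow> ('a, 'b) ring_prod" where
  "minus_ring_prod s t = s + - t"

instance
proof
  fix s t u :: "('a, 'b) ring_prod"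
  show "s * t * u = s * (t * u)" by transfer (simp add: fun_eq_iff prod_eq_iff modp_simps distrib_right)
  show "s * t = t * s" by transfer (simp add: fun_eq_iff prod_eq_iff modp_simps distrib_right)
  show "1 * s = s" by transfer (simp add: fun_eq_iff prod_eq_iff modp_simps distrib_right)
  show "s + t + u = s + (t + u)" by transfer (simp add: fun_eq_iff prod_eq_iff modp_simps distrib_right)
  show "s + t = t + s" by transfer (simp add: fun_eq_iff prod_eq_iff modp_simps distrib_right)
  show "0 + s = s" by transfer (simp add: fun_eq_iff prod_eq_iff modp_simps distrib_right)
  show "- s + s = 0" by transfer (simp add: fun_eq_iff prod_eq_iff modp_simps distrib_right)
  show "s - t = s + - t" by (rule minus_ring_prod_def)
  show "(s + t) * u = s * u + t * u" by transfer (simp add: fun_eq_iff prod_eq_iff modp_simps distrib_right)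
  show "(0 :: ('a, 'b) ring_prod) \<noteq> 1" by transfer simp
qed

end

instantiation module_prod :: (type, type) ab_group_add
begin

lift_definition zero_module_prod :: "('a, 'b) module_prod" is
  "\<lambda>k. if modp k then zero (snd k) else undefined"
  by (simp add: modp_module_simps)

lift_definition plus_module_prod :: "('a, 'b) module_prod \<Rightarrow> ('a, 'b) module_prod \<Rightarrow> ('a, 'b) module_prod" is
  "\<lambda>s t k. if modp k then s k \<oplus>\<^bsub>snd k\<^esub> t k else undefined"
  by (simp add: modp_module_simps)

lift_definition uminus_module_prod :: "('a, 'b) module_prod \<Rightarrow> ('a, 'b) module_prod" is
  "\<lambda>s k. if modp k then \<ominus>\<^bsub>snd k\<^esub> s k else undefined"
  by (simp add: modp_module_simps)

definition minus_module_prod :: "('a, 'b) module_prod \<Rightarrow> ('a, 'b) module_prod \<Rightarrow> ('a, 'b) module_prod" where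
  "minus_module_prod s t = s + - t"

instance
proof
  fix s t u :: "('a, 'b) module_prod"
  show "s + t + u = s + (t + u)"
    by transfer (simp add: fun_eq_iff modp_module_simps)
  show "s + t = t + s" by transfer (simp add: fun_eq_iff modp_module_simps)
  show "0 + s = s"
    by transfer (simp add: fun_eq_iff modp_module_simps)
  show "- s + s = 0"
    by transfer (simp add: fun_eq_iff modp_module_simps)
  show "s - t = s + - t" by (rule minus_module_prod_def)
qed

end

lift_definition scale_prod :: "('q, 'n) ring_prod \<Rightarrow> ('q, 'n) module_prod \<Rightarrow> ('q, 'n) module_prod" is
  "\<lambda>t x k. if modp k then snd t k \<odot>\<^bsub>snd k\<^esub> x k else undefined"
  by (simp add: modp_module_simps)

lemma scal_prod: "scal (scale_prod :: ('q, 'n) ring_prod \<Rightarrow> _)"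
proof
  fix s t :: "('q, 'n) ring_prod" and x y :: "('q, 'n) module_prod"
  show "scale_prod t (x + y) = scale_prod t x + scale_prod t y"
    by transfer (simp add: fun_eq_iff modp_module_simps)
  show "scale_prod (s + t) x = scale_prod s x + scale_prod t x"
    by transfer (simp add: fun_eq_iff modp_module_simps)
  show "scale_prod (s * t) x = scale_prod s (scale_prod t x)"
    by transfer (simp add: fun_eq_iff modp_module_simps)
  show "scale_prod 1 x = x"
    by transfer (simp add: fun_eq_iff modp_module_simps)
qed

lift_definition ev_ring :: "('q, 'n) structure_pair \<Rightarrow> ('q, 'n) ring_prod \<Rightarrow> 'q" is "\<lambda>k t. snd t k" .

lift_definition ev_module :: "('q, 'n) structure_pair \<Rightarrow> ('q, 'n) module_prod \<Rightarrow> 'n" is "\<lambda>k x. x k" .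

lemma
  assumes k: "modp k"
  shows ev_ring_range: "range (ev_ring k) = carrier (fst k)"
    and ev_ring_add: "ev_ring k (s + t) = ev_ring k s \<oplus>\<^bsub>fst k\<^esub> ev_ring k t"
    and ev_ring_mult: "ev_ring k (s * t) = ev_ring k s \<otimes>\<^bsub>fst k\<^esub> ev_ring k t"
    and ev_ring_one: "ev_ring k 1 = \<one>\<^bsub>fst k\<^esub>"
    and ev_module_range: "range (ev_module k) = carrier (snd k)"
    and ev_module_add: "ev_module k (x + y) = ev_module k x \<oplus>\<^bsub>snd k\<^esub> ev_module k y"
    and ev_module_scale: "ev_module k (scale_prod t x) = ev_ring k t \<odot>\<^bsub>snd k\<^esub> ev_module k x"
proof -
  show "ev_ring k (s + t) = ev_ring k s \<oplus>\<^bsub>fst k\<^esub> ev_ring k t" using k by transfer simp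
  show "ev_ring k (s * t) = ev_ring k s \<otimes>\<^bsub>fst k\<^esub> ev_ring k t" using k by transfer simp
  show "ev_ring k 1 = \<one>\<^bsub>fst k\<^esub>" using k by transfer simp
  show "ev_module k (x + y) = ev_module k x \<oplus>\<^bsub>snd k\<^esub> ev_module k y" using k by transfer simp
  show "ev_module k (scale_prod t x) = ev_ring k t \<odot>\<^bsub>snd k\<^esub> ev_module k x" using k by transfer simp
  have in_: "ev_ring k t \<in> carrier (fst k)" for t using k by transfer (metis (mono_tags))
  have in_m: "ev_module k x \<in> carrier (snd k)" for x using k by transfer (metis (mono_tags))
  have "a \<in> range (ev_ring k)" if "a \<in> carrier (fst k)" for a
  proof (rule range_eqI)
    have "(0 :: int, \<lambda>l. if l = k then a else if modp l then zero (fst l) else undefined) \<in> {zf. \<forall>k. (modp k \<longrightarrow> snd zf k \<in> carrier (fst k)) \<and> (\<not> modp k \<longrightarrow> snd zf k = undefined)}"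
      using that k by (simp add: modp_simps)
    then show "a = ev_ring k (Abs_ring_prod (0, \<lambda>l. if l = k then a else if modp l then zero (fst l) else undefined))"
      by (simp add: ev_ring.rep_eq Abs_ring_prod_inverse)
  qed
  then show "range (ev_ring k) = carrier (fst k)" using in_ by blast
  have "a \<in> range (ev_module k)" if "a \<in> carrier (snd k)" for a
  proof (rule range_eqI)
    have "(\<lambda>l. if l = k then a else if modp l then zero (snd l) else undefined) \<in> {g. \<forall>k. (modp k \<longrightarrow> g k \<in> carrier (snd k)) \<and> (\<not> modp k \<longrightarrow> g k = undefined)}"
      using that k by (simp add: modp_module_simps)
    then show "a = ev_module k (Abs_module_prod (\<lambda>l. if l = k then a else if modp l then zero (snd l) else undefined))"
      by (simp add: ev_module.rep_eq Abs_module_prod_inverse)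
  qed
  then show "range (ev_module k) = carrier (snd k)" using in_m by blast
qed

text \<open>The index pairs hold plain ring records, so the extra fields of \<open>Q\<close> are
  dropped before it can serve as an index.\<close>

lemma truncate_ring:
  "carrier (ring.truncate Q) = carrier Q" "\<zero>\<^bsub>ring.truncate Q\<^esub> = \<zero>\<^bsub>Q\<^esub>" "\<one>\<^bsub>ring.truncate Q\<^esub> = \<one>\<^bsub>Q\<^esub>"
  "x \<oplus>\<^bsub>ring.truncate Q\<^esub> y = x \<oplus>\<^bsub>Q\<^esub> y" "x \<otimes>\<^bsub>ring.truncate Q\<^esub> y = x \<otimes>\<^bsub>Q\<^esub> y"
  by (simp_all add: ring.truncate_def)

lemma cring_truncate:
  assumes "cring Q" shows "cring (ring.truncate Q)"
proof -
  interpret cring Q by fact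
  show ?thesis
  proof (rule cringI)
    show "abelian_group (ring.truncate Q)"
    proof (rule abelian_groupI)
      fix x assume "x \<in> carrier (ring.truncate Q)"
      then show "\<exists>y\<in>carrier (ring.truncate Q). y \<oplus>\<^bsub>ring.truncate Q\<^esub> x = \<zero>\<^bsub>ring.truncate Q\<^esub>"
        by (intro bexI[of _ "\<ominus>\<^bsub>Q\<^esub> x"]) (simp_all add: truncate_ring l_neg)
    qed (auto simp: truncate_ring a_ac)
    show "comm_monoid (ring.truncate Q)"
      by (rule comm_monoidI) (auto simp: truncate_ring m_ac)
  qed (auto simp: truncate_ring l_distr)
qed

theorem theorem3p3p1:
  fixes Q :: "('q, 'b) ring_scheme" and fs :: "'q list" and A :: "'q set ring"
    and M :: "('q set, 'm, 'c) module_scheme" and N :: "('q set, 'n, 'd) module_scheme"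
    and I :: "'q set set"
  defines "A \<equiv> Q Quot (genideal Q (set fs))"
  assumes "cring Q" and "noetherian_ring Q" and "krull_dim Q < \<infinity>"
    and "regular_sequence Q fs"
    and "module A M" and "fin_gen_module A M"
    and "module A N" and "fin_gen_module A N"
    and "proj_dim Q (restrict_scalars (\<lambda>q. genideal Q (set fs) +>\<^bsub>Q\<^esub> q) M) < \<infinity>"
    and "ideal I A"
  shows "\<exists>(n0 :: nat) (i0 :: nat). \<forall>n\<ge>n0. \<forall>i\<ge>i0.
    associated_primes A (Ext A (2 * i) M
        (quot_module N (ideal_times_module A (I [^]\<^bsub>ideals_set A\<^esub> n) N))) =
    associated_primes A (Ext A (2 * i0) M
        (quot_module N (ideal_times_module A (I [^]\<^bsub>ideals_set A\<^esub> n0) N))) \<and>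
    associated_primes A (Ext A (2 * i + 1) M
        (quot_module N (ideal_times_module A (I [^]\<^bsub>ideals_set A\<^esub> n) N))) =
    associated_primes A (Ext A (2 * i0 + 1) M
        (quot_module N (ideal_times_module A (I [^]\<^bsub>ideals_set A\<^esub> n0) N)))"
proof -
  interpret Q: cring Q by fact
  let ?G = "genideal Q (set fs)"
  let ?h = "\<lambda>x. ?G +>\<^bsub>Q\<^esub> x"
  have "set fs \<subseteq> carrier Q" using assms(5) by (simp add: regular_sequence_def)
  then have G: "ideal ?G Q" by (rule Q.genideal_ideal)
  have "?h \<in> ring_hom Q A" unfolding A_def by (rule ideal.rcos_ring_hom[OF G])
  then have hom: "?h \<in> ring_hom (ring.truncate Q) A" by (simp add: ring_hom_def truncate_ring)
  \<comment> \<open>The factor to project to: the truncated \<open>Q\<close> together with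
    \<open>N\<close>, seen as a module over it through the quotient map.\<close>
  define k where "k = (ring.truncate Q, restrict_scalars ?h N)"
  have k: "modp k"
    using module_restrict_scalars[OF cring_truncate[OF assms(2)] assms(8) hom] by (simp add: k_def)
  have covQ: "ring_cover Q (ev_ring k)"
    by (intro ring_cover.intro ring_cover_axioms.intro assms(2))
       (simp_all add: ev_ring_range[OF k] ev_ring_add[OF k] ev_ring_mult[OF k] ev_ring_one[OF k], simp_all add: k_def truncate_ring)
  have covN: "module_cover A (\<lambda>t. ?h (ev_ring k t)) scale_prod N (ev_module k)"
  proof (rule module_cover.intro)
    show "ring_cover A (\<lambda>t. ?h (ev_ring k t))" unfolding A_def by (rule ring_cover.quotient_cover[OF covQ G])
    show "scal (scale_prod :: ('q, 'n) ring_prod \<Rightarrow> _)" by (rule scal_prod)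
    show "module A N" by (rule assms(8))
    have N: "carrier (snd k) = carrier N" "x \<oplus>\<^bsub>snd k\<^esub> y = x \<oplus>\<^bsub>N\<^esub> y" "c \<odot>\<^bsub>snd k\<^esub> x = ?h c \<odot>\<^bsub>N\<^esub> x" for x y c
      by (simp_all add: k_def restrict_scalars_def)
    show "module_cover_axioms (\<lambda>t. ?h (ev_ring k t)) scale_prod N (ev_module k)"
      by (rule module_cover_axioms.intro) (simp_all only: N ev_module_range[OF k] ev_module_add[OF k] ev_module_scale[OF k])
  qed
  define E where "E n i = associated_primes A (Ext A i M (quot_module N (ideal_times_module A (I [^]\<^bsub>ideals_set A\<^esub> n) N)))"
    for n i :: nat
  have "\<exists>n0 i0. \<forall>n\<ge>n0. \<forall>i\<ge>i0. \<forall>r\<in>{0, 1}. E n (2 * i + r) = E n0 (2 * i0 + r)"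
    unfolding E_def A_def
    by (rule associated_primes_Ext_stable[OF assms(3,5) assms(6)[unfolded A_def] assms(7)[unfolded A_def] assms(9)[unfolded A_def]
      assms(10) assms(11)[unfolded A_def] covQ covN[unfolded A_def]])
  then have "\<exists>n0 i0. \<forall>n\<ge>n0. \<forall>i\<ge>i0. E n (2 * i) = E n0 (2 * i0) \<and> E n (2 * i + 1) = E n0 (2 * i0 + 1)"
    by simp
  then show ?thesis unfolding E_def .
qed

end
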